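(* There exist constants $c,C>0$, independent of $R$, such that for all sufficiently large $R$: (1) for any real-valued radial function $h\in\mathcal E$, $$\langle h,L^+h\rangle\ge c(\ln R)^{-\frac43}\int_{\mathbb R^6}|\nabla h|^2dx-C\big(\langle\phi_RW,h\rangle^2+\langle\mathcal Y^{(2)},h\rangle^2\big),$$ $$\langle h,L^-h\rangle\ge c(\ln R)^{-\frac43}\int_{\mathbb R^6}|\nabla h|^2dx-C\langle\phi_R\Lambda W,h\rangle^2;$$ (2) if $r_1\ge c^{-1}R(\ln R)^{\frac43}$, then for any real-valued radial function $h\in\mathcal E$, $$(1-2c(\ln R)^{-\frac43})\int_{|x|\le r_1}|\nabla h|^2dx+c(\ln R)^{-\frac43}\int_{|x|\ge r_1}|\nabla h|^2dx+\int_{\mathbb R^6}V^+|h|^2dx\ge-C\big(\langle\phi_RW,h\rangle^2+\langle\mathcal Y^{(2)},h\rangle^2\big),$$ $$(1-2c(\ln R)^{-\frac43})\int_{|x|\le r_1}|\nabla h|^2dx+c(\ln R)^{-\frac43}\int_{|x|\ge r_1}|\nabla h|^2dx+\int_{\mathbb R^6}V^-|h|^2dx\ge-C\langle\phi_R\Lambda W,h\rangle^2;$$ (3) if $0<r_2\le c(\ln R)^{-\frac43}$, then for any real-valued radial function $h\in\mathcal E$, $$(1-2c(\ln R)^{-\frac43})\int_{|x|\ge r_2}|\nabla h|^2dx+c(\ln R)^{-\frac43}\int_{|x|\le r_2}|\nabla h|^2dx+\int_{\mathbb R^6}V^+|h|^2dx\ge-C\big(\langle\phi_RW,h\rangle^2+\langle\mathcal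 Y^{(2)},h\rangle^2\big),$$ $$(1-2c(\ln R)^{-\frac43})\int_{|x|\ge r_2}|\nabla h|^2dx+c(\ln R)^{-\frac43}\int_{|x|\le r_2}|\nabla h|^2dx+\int_{\mathbb R^6}V^-|h|^2dx\ge-C\langle\phi_R\Lambda W,h\rangle^2.$$
   Context: $\mathcal E$ is the space of radially symmetric functions in $\dot H^1(\mathbb R^6;\mathbb C)$. $\langle v,w\rangle:=\mathrm{Re}\int_{\mathbb R^6}\overline v\,w\,dx$. $W(x)=(1+|x|^2/24)^{-2}$, $\Lambda v:=(2+x\cdot\nabla)v$. $V^+:=-2W$, $V^-:=-W$, $L^\pm:=-\Delta+V^\pm$; for $h\in\mathcal E$, $\langle h,L^\pm h\rangle$ denotes the quadratic form $\int|\nabla h|^2+\int V^\pm|h|^2$. $\phi$ is a fixed smooth radial function with $\phi(x)=1$ for $|x|\le1$, $\phi(x)=0$ for $|x|\ge2$, and $\phi_R(x):=\phi(x/R)$. $\mathcal Y^{(1)},\mathcal Y^{(2)}$ are real radial Schwartz functions and $\nu>0$ a real number (known to exist) with $L^+\mathcal Y^{(1)}=-\nu\mathcal Y^{(2)}$, $L^-\mathcal Y^{(2)}=\nu\mathcal Y^{(1)}$, normalized by $\|\mathcal Y^{(1)}\|_{L^2}=\|\mathcal Y^{(2)}\|_{L^2}=1$. *)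

theory Defs
  imports "HOL-Analysis.Analysis"
begin

definition partial_deriv :: "'n \<Rightarrow> (real^'n \<Rightarrow> 'b) \<Rightarrow> real^'n \<Rightarrow> 'b::real_normed_vector"
  where "partial_deriv i f x = frechet_derivative f (at x) (axis i 1)"

text \<open>Every iterated partial derivative is required to be Frechet differentiable everywhere, hence
  all of them are continuous; this is \<open>C\<^sup>\<infinity>\<close>.\<close>

definition smooth :: "(real^'n \<Rightarrow> 'b::real_normed_vector) \<Rightarrow> bool"
  where "smooth f \<longleftrightarrow> (\<forall>is. foldr partial_deriv is f differentiable_on UNIV)"

definition test_function :: "(real^'n \<Rightarrow> real) \<Rightarrow> bool"
  where "test_function \<psi> \<longleftrightarrow> smooth \<psi> \<and> (\<exists>B. \<forall>x. norm x > B \<longrightarrow> \<psi> x = 0)"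

definition schwartz :: "(real^'n \<Rightarrow> 'b::real_normed_vector) \<Rightarrow> bool"
  where "schwartz f \<longleftrightarrow>
    smooth f \<and> (\<forall>k is. bounded (range (\<lambda>x. norm x ^ k *\<^sub>R foldr partial_deriv is f x)))"

definition laplacian :: "(real^'n \<Rightarrow> 'b) \<Rightarrow> real^'n \<Rightarrow> 'b::real_normed_vector"
  where "laplacian f x = (\<Sum>i\<in>UNIV. partial_deriv i (partial_deriv i f) x)"

definition radial :: "(real^'n \<Rightarrow> 'b) \<Rightarrow> bool"
  where "radial f \<longleftrightarrow> (\<exists>g. \<forall>x. f x = g (norm x))"

definition radial_ae :: "(real^'n \<Rightarrow> 'b) \<Rightarrow> bool"
  where "radial_ae f \<longleftrightarrow> (\<exists>g. AE x in lebesgue. f x = g (norm x))"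

definition in_Lp :: "nat \<Rightarrow> (real^'n \<Rightarrow> 'b::euclidean_space) \<Rightarrow> bool"
  where "in_Lp p f \<longleftrightarrow> f \<in> borel_measurable lebesgue \<and> integrable lebesgue (\<lambda>x. norm (f x) ^ p)"

definition L2norm :: "(real^'n \<Rightarrow> 'b::euclidean_space) \<Rightarrow> real"
  where "L2norm f = sqrt (LINT x|lebesgue. (norm (f x))\<^sup>2)"

definition locally_integrable :: "(real^'n \<Rightarrow> 'b::euclidean_space) \<Rightarrow> bool"
  where "locally_integrable f \<longleftrightarrow> (\<forall>K. compact K \<longrightarrow> set_integrable lebesgue K f)"

definition has_weak_gradient :: "(real^'n \<Rightarrow> complex) \<Rightarrow> (real^'n \<Rightarrow> complex^'n) \<Rightarrow> bool"
  where "has_weak_gradient h g \<longleftrightarrow>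
    locally_integrable h \<and> locally_integrable g \<and>
    (\<forall>i \<psi>. test_function \<psi> \<longrightarrow>
      (LINT x|lebesgue. h x * of_real (partial_deriv i \<psi> x)) =
      - (LINT x|lebesgue. g x $ i * of_real (\<psi> x)))"

text \<open>The weak gradient is unique up to a null set, so integrals of it do not depend on the choice.\<close>

definition weak_gradient :: "(real^'n \<Rightarrow> complex) \<Rightarrow> real^'n \<Rightarrow> complex^'n"
  where "weak_gradient h = (SOME g. has_weak_gradient h g)"

text \<open>In dimension 6 the Sobolev exponent is \<open>2\<^sup>* = 2 \<cdot> 6 / (6 - 2) = 3\<close>, and the homogeneous space
  (the completion of the test functions in the norm \<open>\<parallel>\<nabla>h\<parallel>\<close> of \<open>L\<^sup>2\<close>) is realised as the space of
  \<open>L\<^sup>3\<close> functions whose weak gradient is in \<open>L\<^sup>2\<close>. The \<open>L\<^sup>3\<close> condition excludes nonzero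
  constants. Elements are representatives of classes modulo null sets.\<close>

definition Hdot1 :: "(real^6 \<Rightarrow> complex) set"
  where "Hdot1 = {h. in_Lp 3 h \<and> has_weak_gradient h (weak_gradient h) \<and> in_Lp 2 (weak_gradient h)}"

definition energy_space :: "(real^6 \<Rightarrow> complex) set"
  where "energy_space = {h \<in> Hdot1. radial_ae h}"

definition real_valued_ae :: "(real^6 \<Rightarrow> complex) \<Rightarrow> bool"
  where "real_valued_ae h \<longleftrightarrow> (AE x in lebesgue. h x \<in> \<real>)"

definition pairing :: "(real^6 \<Rightarrow> complex) \<Rightarrow> (real^6 \<Rightarrow> complex) \<Rightarrow> real"
  where "pairing v w = Re (LINT x|lebesgue. cnj (v x) * w x)"

definition W :: "real^6 \<Rightarrow> real"
  where "W x = 1 / (1 + (norm x)\<^sup>2 / 24)\<^sup>2"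

definition Lam :: "(real^6 \<Rightarrow> real) \<Rightarrow> real^6 \<Rightarrow> real"
  where "Lam v x = 2 * v x + (\<Sum>i\<in>UNIV. x $ i * partial_deriv i v x)"

definition Vplus :: "real^6 \<Rightarrow> real"
  where "Vplus x = - 2 * W x"

definition Vminus :: "real^6 \<Rightarrow> real"
  where "Vminus x = - W x"

definition schroedinger :: "(real^6 \<Rightarrow> real) \<Rightarrow> (real^6 \<Rightarrow> real) \<Rightarrow> real^6 \<Rightarrow> real"
  where "schroedinger V v x = - laplacian v x + V x * v x"

definition grad_energy :: "(real^6) set \<Rightarrow> (real^6 \<Rightarrow> complex) \<Rightarrow> real"
  where "grad_energy A h = (LINT x:A|lebesgue. (norm (weak_gradient h x))\<^sup>2)"

definition potential_energy :: "(real^6 \<Rightarrow> real) \<Rightarrow> (real^6 \<Rightarrow> complex) \<Rightarrow> real"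
  where "potential_energy V h = (LINT x|lebesgue. V x * (norm (h x))\<^sup>2)"

text \<open>The quadratic form \<open>\<langle>h, (-\<Delta> + V) h\<rangle>\<close>.\<close>

definition schroedinger_form :: "(real^6 \<Rightarrow> real) \<Rightarrow> (real^6 \<Rightarrow> complex) \<Rightarrow> real"
  where "schroedinger_form V h = grad_energy UNIV h + potential_energy V h"

definition rescale :: "real \<Rightarrow> (real^6 \<Rightarrow> real) \<Rightarrow> real^6 \<Rightarrow> real"
  where "rescale R \<phi> x = \<phi> (x /\<^sub>R R)"

end

theory Submission
  imports Defs "HOL-Real_Asymp.Real_Asymp"
begin

text \<open>
  Only the radial derivative \<open>f\<close> of \<open>h\<close> matters: \<open>h(r) = -\<integral>\<^sub>r\<^sup>\<infinity> f\<close> and \<open>\<bar>f\<bar> \<le> \<bar>\<nabla>h\<bar>\<close>, so every claim reduces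
  to one about \<open>f \<in> L\<^sup>2\<close>. The forms \<open>E = \<integral>f\<^sup>2\<close> and \<open>P = \<integral>W h\<^sup>2\<close> are simultaneously diagonal on \<open>W\<close>
  (eigenvalue 1), \<open>\<Lambda>W\<close> (eigenvalue 2) and their complement, where \<open>E \<ge> 7/3 P\<close> by Picone's identity on the
  three zones cut out by two nodes. Write \<open>h = a W + b \<Lambda>W + z\<close>. The form of \<open>L\<^sup>-\<close> controls \<open>b\<close> and \<open>z\<close>,
  and \<open>\<langle>\<phi>\<^sub>R \<Lambda>W, h\<rangle>\<close> recovers \<open>a\<close>, at the price of a factor \<open>ln R\<close> because \<open>\<langle>\<phi>\<^sub>R \<Lambda>W, z\<rangle>\<^sup>2\<close> is only bounded
  by \<open>ln R E(z)\<close>. For \<open>L\<^sup>+\<close>, subtract from \<open>h\<close> the multiple of \<open>Y1\<close> that makes it orthogonal to \<open>Y2\<close>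
  (possible since \<open>\<langle>Y1, Y2\<rangle> > 0\<close>); a reversed Cauchy-Schwarz inequality against \<open>Y1\<close> then shows that the form
  controls \<open>a\<close> and \<open>z\<close>, and \<open>\<langle>\<phi>\<^sub>R W, h\<rangle>\<close> recovers \<open>b\<close>. The resulting coercivity constant \<open>c / ln R\<close> exceeds
  \<open>c (ln R) powr (-4/3)\<close>, and the room between the two absorbs the part of \<open>f\<close> outside \<open>r1\<close> or inside \<open>r2\<close>,
  whose influence on \<open>P\<close> and on the pairings is small.
\<close>

section \<open>Integration in polar coordinates\<close>

text \<open>Under stereographic projection the problem -\<Delta>h = \<lambda> W h on radial
  functions becomes that of zonal harmonics on the six-sphere, with eigenvalues (k+2)(k+3)/6, that
  is 1, 2, 10/3 and so on; 7/3 is a convenient value between the second and the third. It has to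
  exceed 2 strictly, which is what keeps the form of L+ positive on the complement of the two modes.
  The logarithm comes from borderline decay: a function of finite energy is only of size |x|^-2, W
  is of size |x|^-4, and their product against r^5 dr gives dr/r. That W detects \<Lambda>W and
  conversely is a consequence of scaling, \<langle>W, \<Lambda>W\<rangle> = -||W||^2. The technical
  obstacle is that h is known only almost everywhere and has only a weak gradient. No absolutely
  continuous representative is ever differentiated: primitives are integrals over annuli, their
  products are handled by Fubini in the order of |x|, and the weak derivative is tested only on
  compactly supported fields x \<eta>(|x|^2), which identifies h with the integral of its radial
  derivative.\<close>

definition sphere_area :: real where "sphere_area = 6 * unit_ball_vol 6"

lemma sphere_area_pos [simp]: "sphere_area > 0"
  by (simp add: sphere_area_def)

lemma sphere_area_nz [simp]: "sphere_area \<noteq> 0"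
  using sphere_area_pos by linarith

lemma sphere_area_nonneg [simp]: "sphere_area \<ge> 0"
  using sphere_area_pos by linarith

text \<open>Both measures assign the volume of the ball to each half-line, and half-lines generate
  the Borel sets and are closed under intersection; the finite values on \<open>{..real i}\<close>
  complete the uniqueness argument.\<close>

lemma distr_norm_lborel:
  "distr lborel borel (norm :: real^6 \<Rightarrow> real) =
   density lborel (\<lambda>r. ennreal (indicator {0<..} r * (sphere_area * r^5)))" (is "?M = ?N")
proof (rule measure_eqI_generator_eq[where E = "range (\<lambda>a. {..a})" and \<Omega> = UNIV and A = "\<lambda>i. {..real i}"])
  show "Int_stable (range (\<lambda>a::real. {..a}))"
    by (auto simp: Int_stable_def)
  have *: "emeasure ?M {..a} = ennreal (unit_ball_vol 6 * (max 0 a)^6)" for a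
  proof (cases "a \<ge> 0")
    case True
    have "norm -` {..a} = cball (0::real^6) a" by (auto simp: dist_norm)
    then show ?thesis using True
      by (subst emeasure_distr) (auto simp: emeasure_cball max_def)
  next
    case False
    then have "norm -` {..a} = ({}::(real^6) set)"
      by (auto simp: not_le) (metis norm_ge_zero order_less_le_trans not_less)
    then show ?thesis using False
      by (subst emeasure_distr) (auto simp: max_def)
  qed
  have **: "emeasure ?N {..a} = ennreal (unit_ball_vol 6 * (max 0 a)^6)" for a
  proof -
    have "emeasure ?N {..a} = (\<integral>\<^sup>+r. ennreal (indicator {0<..} r * (sphere_area * r^5)) * indicator {..a} r \<partial>lborel)"
      by (subst emeasure_density) auto
    also have "\<dots> = (\<integral>\<^sup>+r. ennreal (sphere_area * r^5) * indicator {0..max 0 a} r \<partial>lborel)"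
      by (intro nn_integral_cong) (auto simp: indicator_def max_def split: if_splits)
    also have "\<dots> = ennreal (unit_ball_vol 6 * (max 0 a)^6 - unit_ball_vol 6 * 0^6)"
      by (rule nn_integral_FTC_Icc)
         (auto intro!: derivative_eq_intros simp: sphere_area_def)
    finally show ?thesis by simp
  qed
  show "\<And>X. X \<in> range (\<lambda>a. {..a}) \<Longrightarrow> emeasure ?M X = emeasure ?N X"
    using * ** by auto
  show "emeasure ?M {..real i} \<noteq> \<infinity>" for i
    using * by simp
  show "sets ?M = sigma_sets UNIV (range (\<lambda>a. {..a}))"
    by (simp add: borel_eq_atMost)
  show "sets ?N = sigma_sets UNIV (range (\<lambda>a. {..a}))"
    by (simp add: borel_eq_atMost)
  show "(\<Union>i. {..real i}) = UNIV"
    using real_arch_simple by auto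
qed auto

lemma borel_measurable_lebesgueI:
  "f \<in> borel_measurable borel \<Longrightarrow> f \<in> borel_measurable (lebesgue :: 'a::euclidean_space measure)"
  by (rule measurable_completion) simp

lemma measurable_norm_lebesgue [measurable]: "norm \<in> lebesgue \<rightarrow>\<^sub>M (borel :: real measure)"
  by (rule borel_measurable_lebesgueI) simp

lemma measurable_radial_lebesgue [measurable (raw)]:
  fixes k :: "real \<Rightarrow> 'b::topological_space"
  assumes "k \<in> borel_measurable borel"
  shows "(\<lambda>x::'a::euclidean_space. k (norm x)) \<in> borel_measurable lebesgue"
  by (rule measurable_compose[OF measurable_norm_lebesgue assms])

lemma polar_nn_integral:
  fixes k :: "real \<Rightarrow> ennreal"
  assumes [measurable]: "k \<in> borel_measurable borel"
  shows "(\<integral>\<^sup>+x. k (norm x) \<partial>(lebesgue :: (real^6) measure))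
    = (\<integral>\<^sup>+r. ennreal (indicator {0<..} r * (sphere_area * r^5)) * k r \<partial>lborel)"
proof -
  have "(\<integral>\<^sup>+x. k (norm x) \<partial>(lebesgue :: (real^6) measure)) = (\<integral>\<^sup>+x. k (norm x) \<partial>(lborel :: (real^6) measure))"
    by (simp add: nn_integral_completion)
  also have "\<dots> = (\<integral>\<^sup>+r. k r \<partial>distr lborel borel (norm :: real^6 \<Rightarrow> real))"
    by (subst nn_integral_distr) auto
  also have "\<dots> = (\<integral>\<^sup>+r. ennreal (indicator {0<..} r * (sphere_area * r^5)) * k r \<partial>lborel)"
    by (simp add: distr_norm_lborel nn_integral_density)
  finally show ?thesis .
qed

text \<open>The law of |x| is absolutely continuous on the positive axis, so a null set of radii
  pulls back to a null set. The origin is discarded separately, because the hypothesis says nothing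
  about radius 0.\<close>

lemma AE_radial:
  assumes "AE r in lborel. r > 0 \<longrightarrow> P r"
  shows "AE x in (lebesgue :: (real^6) measure). P (norm x)"
proof -
  obtain N where N: "{r. \<not> (r > 0 \<longrightarrow> P r)} \<subseteq> N" "N \<in> sets lborel" "emeasure lborel N = 0"
    using assms by (auto elim!: AE_E)
  have [measurable]: "N \<in> sets borel" using N by simp
  have "(\<integral>\<^sup>+x. indicator N (norm x) \<partial>(lebesgue :: (real^6) measure))
     = (\<integral>\<^sup>+r. ennreal (indicator {0<..} r * (sphere_area * r^5)) * indicator N r \<partial>lborel)"
    by (rule polar_nn_integral) simp
  also have "\<dots> = (\<integral>\<^sup>+(r::real). 0 \<partial>lborel)"
  proof (rule nn_integral_cong_AE)
    have "AE r in lborel. r \<notin> N" using N by (simp add: AE_iff_null null_setsI AE_not_in)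
    then show "AE r in lborel. ennreal (indicator {0<..} r * (sphere_area * r^5)) * indicator N r = 0"
      by eventually_elim auto
  qed
  finally have "(\<integral>\<^sup>+x. indicator N (norm x) \<partial>(lebesgue :: (real^6) measure)) = 0" by simp
  then have 1: "AE x in (lebesgue::(real^6) measure). (indicator N (norm x) :: ennreal) = 0"
    by (subst (asm) nn_integral_0_iff_AE) auto
  have 2: "AE x in (lebesgue::(real^6) measure). x \<noteq> 0"
    by (intro AE_completion AE_lborel_singleton)
  from 1 2 show ?thesis
  proof eventually_elim
    case (elim x)
    then have "norm x > 0" "norm x \<notin> N" by (auto simp: indicator_def split: if_splits)
    with N(1) show ?case by blast
  qed
qed

lemma AE_norm_neq: "AE x in (lebesgue :: (real^6) measure). norm x \<noteq> c"
proof (rule AE_radial)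
  have "AE r in lborel. r \<noteq> c" by (rule AE_lborel_singleton)
  then show "AE r in lborel. r > 0 \<longrightarrow> r \<noteq> c" by eventually_elim auto
qed

lemma polar_integrable_iff:
  fixes k :: "real \<Rightarrow> real"
  assumes [measurable]: "k \<in> borel_measurable borel"
  shows "integrable (lebesgue :: (real^6) measure) (\<lambda>x. k (norm x))
    \<longleftrightarrow> integrable lborel (\<lambda>r. indicator {0<..} r * (sphere_area * r^5) * k r)"
proof -
  have "integrable (lebesgue :: (real^6) measure) (\<lambda>x. k (norm x))
     \<longleftrightarrow> integrable (lborel :: (real^6) measure) (\<lambda>x. k (norm x))"
    by (rule integrable_completion) simp
  also have "\<dots> \<longleftrightarrow> integrable (distr lborel borel (norm :: real^6 \<Rightarrow> real)) k"
    by (rule integrable_distr_eq[symmetric]) auto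
  also have "\<dots> \<longleftrightarrow> integrable lborel (\<lambda>r. (indicator {0<..} r * (sphere_area * r^5)) *\<^sub>R k r)"
    unfolding distr_norm_lborel
    by (rule integrable_density) (auto simp: indicator_def)
  finally show ?thesis by simp
qed

lemma polar_integral:
  fixes k :: "real \<Rightarrow> real"
  assumes [measurable]: "k \<in> borel_measurable borel"
  shows "(LINT x|(lebesgue :: (real^6) measure). k (norm x))
    = (LINT r|lborel. indicator {0<..} r * (sphere_area * r^5) * k r)"
proof -
  have "(LINT x|(lebesgue :: (real^6) measure). k (norm x)) = (LINT x|(lborel :: (real^6) measure). k (norm x))"
    by (rule integral_completion) simp
  also have "\<dots> = (LINT r|distr lborel borel (norm :: real^6 \<Rightarrow> real). k r)"
    by (rule integral_distr[symmetric]) auto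
  also have "\<dots> = (LINT r|lborel. (indicator {0<..} r * (sphere_area * r^5)) *\<^sub>R k r)"
    unfolding distr_norm_lborel
    by (rule integral_density) (auto simp: indicator_def)
  finally show ?thesis by simp
qed

text \<open>Dividing by the fifth power cancels the polar density, so annular integrals are one-dimensional.\<close>

lemma annulus_FTC:
  fixes p p' :: "real \<Rightarrow> real"
  assumes "0 < a" "a \<le> b"
    and d: "\<And>r. a \<le> r \<Longrightarrow> r \<le> b \<Longrightarrow> (p has_real_derivative p' r) (at r)"
    and c: "continuous_on {a..b} p'"
  shows "integrable (lebesgue :: (real^6) measure) (\<lambda>x. indicator {a<..b} (norm x) * (p' (norm x) / norm x ^ 5))"
    and "(LINT x|(lebesgue :: (real^6) measure). indicator {a<..b} (norm x) * (p' (norm x) / norm x ^ 5))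
      = sphere_area * (p b - p a)"
proof -
  \<comment> \<open>The function p' is controlled only on [a, b], so measurability is obtained for
    its restriction.\<close>
  let ?q = "\<lambda>r. indicator {a..b} r * p' r"
  have q: "?q \<in> borel_measurable borel"
    using borel_measurable_continuous_on_indicator[OF _ c] by simp
  let ?k = "\<lambda>r. indicator {a<..b} r * (p' r / r^5)"
  have eqk: "?k = (\<lambda>r. indicator {a<..b} r * (?q r / r^5))"
    by (auto simp: indicator_def fun_eq_iff)
  have k [measurable]: "?k \<in> borel_measurable borel"
    unfolding eqk by (intro borel_measurable_times borel_measurable_divide q) auto
  have ae: "AE r in lborel. indicator {0<..} r * (sphere_area * r^5) * ?k r = sphere_area * (p' r * indicator {a..b} r)"
  proof -
    have "AE r in lborel. r \<noteq> a" by (rule AE_lborel_singleton)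
    then show ?thesis by eventually_elim (use \<open>0 < a\<close> in \<open>auto simp: indicator_def\<close>)
  qed
  have I: "has_bochner_integral lborel (\<lambda>x. indicator {a..b} x *\<^sub>R p' x) (p b - p a)"
    using assms by (intro has_bochner_integral_FTC_Icc c)
      (auto simp: has_real_derivative_iff_has_vector_derivative[symmetric] intro: DERIV_subset)
  have I': "has_bochner_integral lborel (\<lambda>r. sphere_area * (p' r * indicator {a..b} r)) (sphere_area * (p b - p a))"
    using has_bochner_integral_mult_right[OF I, of sphere_area] by (simp add: mult_ac)
  have I'': "has_bochner_integral lborel (\<lambda>r. indicator {0<..} r * (sphere_area * r^5) * ?k r) (sphere_area * (p b - p a))"
  proof (rule has_bochner_integralI_AE[OF I'])
    show "(\<lambda>r. indicator {0<..} r * (sphere_area * r^5) * ?k r) \<in> borel_measurable lborel"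
      by (rule borel_measurable_times) (use k in simp_all)
    show "AE r in lborel. sphere_area * (p' r * indicator {a..b} r) = indicator {0<..} r * (sphere_area * r^5) * ?k r"
      using ae by (rule eventually_mono) (rule sym)
  qed
  show "integrable (lebesgue :: (real^6) measure) (\<lambda>x. indicator {a<..b} (norm x) * (p' (norm x) / norm x ^ 5))"
    using polar_integrable_iff[OF k] I'' by (auto simp: has_bochner_integral_iff)
  show "(LINT x|(lebesgue :: (real^6) measure). indicator {a<..b} (norm x) * (p' (norm x) / norm x ^ 5))
      = sphere_area * (p b - p a)"
    using polar_integral[OF k] I'' by (auto simp: has_bochner_integral_iff)
qed

lemma polar_nonneg:
  fixes k :: "real \<Rightarrow> real"
  assumes [measurable]: "k \<in> borel_measurable borel" and "\<And>r. r > 0 \<Longrightarrow> k r \<ge> 0"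
    and "(\<integral>\<^sup>+r. ennreal (indicator {0<..} r * (sphere_area * r^5) * k r) \<partial>lborel) = ennreal v" "v \<ge> 0"
  shows "integrable (lebesgue :: (real^6) measure) (\<lambda>x. k (norm x))"
    and "(LINT x|(lebesgue :: (real^6) measure). k (norm x)) = v"
proof -
  have "has_bochner_integral lborel (\<lambda>r. indicator {0<..} r * (sphere_area * r^5) * k r) v"
    using assms by (intro has_bochner_integral_nn_integral) (auto simp: indicator_def)
  then show "integrable (lebesgue :: (real^6) measure) (\<lambda>x. k (norm x))"
    "(LINT x|(lebesgue :: (real^6) measure). k (norm x)) = v"
    by (simp_all add: polar_integrable_iff polar_integral has_bochner_integral_iff)
qed

text \<open>In polar coordinates the integrand is r^(5-j), so \<open>j \<le> 5\<close> is
  integrability at the origin for integer powers.\<close>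

lemma ball_power:
  assumes "j \<le> 5" "a \<ge> 0"
  shows "integrable (lebesgue :: (real^6) measure) (\<lambda>x. indicator {..a} (norm x) * (1 / norm x ^ j))"
    and "(LINT x|(lebesgue :: (real^6) measure). indicator {..a} (norm x) * (1 / norm x ^ j))
      = sphere_area * a^(6-j) / real (6-j)"
proof -
  have "(\<integral>\<^sup>+r. ennreal (indicator {0<..} r * (sphere_area * r^5) * (indicator {..a} r * (1 / r^j))) \<partial>lborel)
     = (\<integral>\<^sup>+r. ennreal (sphere_area * r^(5-j)) * indicator {0..a} r \<partial>lborel)"
  proof (rule nn_integral_cong_AE)
    have "AE r in lborel. r \<noteq> (0::real)" by (rule AE_lborel_singleton)
    then show "AE r in lborel. ennreal (indicator {0<..} r * (sphere_area * r^5) * (indicator {..a} r * (1 / r^j)))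
        = ennreal (sphere_area * r^(5-j)) * indicator {0..a} r"
      by eventually_elim (use assms in \<open>auto simp: indicator_def power_diff\<close>)
  qed
  also have "\<dots> = ennreal (sphere_area * a^(6-j) / real (6-j) - sphere_area * 0^(6-j) / real (6-j))"
  proof (rule nn_integral_FTC_Icc)
    fix x assume "x \<in> {0..a}"
    have e: "6 - j = Suc (5 - j)" using assms by simp
    then show "DERIV (\<lambda>r. sphere_area * r^(6-j) / real (6-j)) x :> sphere_area * x^(5-j)"
      unfolding e by (auto intro!: derivative_eq_intros simp del: of_nat_Suc power_Suc)
  qed (use assms in auto)
  also have "\<dots> = ennreal (sphere_area * a^(6-j) / real (6-j))" using assms by (simp add: power_0_left)
  finally have *: "(\<integral>\<^sup>+r. ennreal (indicator {0<..} r * (sphere_area * r^5) * (indicator {..a} r * (1 / r^j))) \<partial>lborel)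
     = ennreal (sphere_area * a^(6-j) / real (6-j))" .
  show "integrable (lebesgue :: (real^6) measure) (\<lambda>x. indicator {..a} (norm x) * (1 / norm x ^ j))"
    and "(LINT x|(lebesgue :: (real^6) measure). indicator {..a} (norm x) * (1 / norm x ^ j))
      = sphere_area * a^(6-j) / real (6-j)"
    using polar_nonneg[OF _ _ *] assms by auto
qed

text \<open>The exponent is written \<open>m + 7\<close> because 7 is the first integer power that
  is integrable at infinity in dimension 6.\<close>

lemma tail_power:
  assumes "a > 0"
  shows "integrable (lebesgue :: (real^6) measure) (\<lambda>x. indicator {a<..} (norm x) * (1 / norm x ^ (m + 7)))"
    and "(LINT x|(lebesgue :: (real^6) measure). indicator {a<..} (norm x) * (1 / norm x ^ (m + 7)))
      = sphere_area / (real (Suc m) * a ^ Suc m)"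
proof -
  have "(\<integral>\<^sup>+r. ennreal (indicator {0<..} r * (sphere_area * r^5) * (indicator {a<..} r * (1 / r^(m+7)))) \<partial>lborel)
     = (\<integral>\<^sup>+r. ennreal (sphere_area / r^(m+2) * (if r = 0 then 0 else 1)) * indicator {a..} r \<partial>lborel)"
  proof (rule nn_integral_cong_AE)
    have "AE r in lborel. r \<noteq> a" by (rule AE_lborel_singleton)
    then show "AE r in lborel. ennreal (indicator {0<..} r * (sphere_area * r^5) * (indicator {a<..} r * (1 / r^(m+7))))
        = ennreal (sphere_area / r^(m+2) * (if r = 0 then 0 else 1)) * indicator {a..} r"
      by eventually_elim (use assms in \<open>auto simp: indicator_def field_simps power_add power2_eq_square eval_nat_numeral\<close>)
  qed
  also have "\<dots> = (\<integral>\<^sup>+r. ennreal (sphere_area / r^(m+2)) * indicator {a..} r \<partial>lborel)"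
    by (intro nn_integral_cong) (use assms in \<open>auto simp: indicator_def\<close>)
  also have "\<dots> = ennreal (0 - (- (sphere_area / (real (Suc m) * a ^ Suc m))))"
  proof (rule nn_integral_FTC_atLeast)
    fix x assume "a \<le> x"
    then show "DERIV (\<lambda>r. - (sphere_area / (real (Suc m) * r ^ Suc m))) x :> sphere_area / x^(m+2)"
      using assms by (auto intro!: derivative_eq_intros simp: field_simps power2_eq_square simp del: power_Suc of_nat_Suc)
         (simp add: field_simps)
  next
    have "LIM r at_top. real (Suc m) * r ^ Suc m :> at_top"
      by (intro filterlim_tendsto_pos_mult_at_top[OF tendsto_const] filterlim_pow_at_top filterlim_ident) auto
    then have "((\<lambda>r. sphere_area / (real (Suc m) * r ^ Suc m)) \<longlongrightarrow> 0) at_top"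
      by (intro tendsto_divide_0[OF tendsto_const] filterlim_at_top_imp_at_infinity)
    then show "((\<lambda>r. - (sphere_area / (real (Suc m) * r ^ Suc m))) \<longlongrightarrow> 0) at_top"
      using tendsto_minus by fastforce
  qed (use assms in auto)
  finally have *: "(\<integral>\<^sup>+r. ennreal (indicator {0<..} r * (sphere_area * r^5) * (indicator {a<..} r * (1 / r^(m+7)))) \<partial>lborel)
     = ennreal (sphere_area / (real (Suc m) * a ^ Suc m))" by simp
  show "integrable (lebesgue :: (real^6) measure) (\<lambda>x. indicator {a<..} (norm x) * (1 / norm x ^ (m + 7)))"
    and "(LINT x|(lebesgue :: (real^6) measure). indicator {a<..} (norm x) * (1 / norm x ^ (m + 7)))
      = sphere_area / (real (Suc m) * a ^ Suc m)"
    using polar_nonneg[OF _ _ *] assms by auto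
qed

text \<open>The exponents 5 and 7 are the integers on either side of the critical exponent 6; many
  integrability claims below reduce to this pair.\<close>

lemma integrable_two_powers:
  fixes F :: "real^6 \<Rightarrow> real"
  assumes [measurable]: "F \<in> borel_measurable lebesgue"
    and near: "\<And>x. x \<noteq> 0 \<Longrightarrow> norm x \<le> 1 \<Longrightarrow> \<bar>F x\<bar> \<le> C / norm x ^ 5"
    and far: "\<And>x. norm x > 1 \<Longrightarrow> \<bar>F x\<bar> \<le> C / norm x ^ 7"
  shows "integrable lebesgue F"
proof (rule Bochner_Integration.integrable_bound)
  let ?m = "\<lambda>x::real^6. C * (indicator {..1} (norm x) * (1 / norm x ^ 5)) + C * (indicator {1<..} (norm x) * (1 / norm x ^ 7))"
  show "integrable lebesgue ?m"
    using ball_power(1)[of 5 1] tail_power(1)[of 1 0] by (intro Bochner_Integration.integrable_add integrable_mult_right) auto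
  have "AE x in (lebesgue::(real^6) measure). x \<noteq> 0"
    by (intro AE_completion AE_lborel_singleton)
  then show "AE x in lebesgue. norm (F x) \<le> norm (?m x)"
  proof eventually_elim
    case (elim x)
    show ?case
    proof (cases "norm x \<le> 1")
      case True
      have "C / norm x ^ 5 \<le> \<bar>C\<bar> / norm x ^ 5" by (intro divide_right_mono) auto
      with True near[OF elim] show ?thesis by (auto simp: indicator_def)
    next
      case False
      have "C / norm x ^ 7 \<le> \<bar>C\<bar> / norm x ^ 7" by (intro divide_right_mono) auto
      with False far[of x] show ?thesis by (auto simp: indicator_def)
    qed
  qed
qed simp

section \<open>Fubini in the order given by a real function\<close>

lemma sigma_finite_lebesgue: "sigma_finite_measure (lebesgue :: 'a::euclidean_space measure)"
proof
  obtain A :: "'a set set" where A: "countable A" "A \<subseteq> sets lborel" "\<Union>A = space lborel" "\<forall>a\<in>A. emeasure lborel a \<noteq> \<infinity>"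
    using sigma_finite_measure.sigma_finite_countable[OF sigma_finite_lborel] by blast
  then show "\<exists>A::'a set set. countable A \<and> A \<subseteq> sets lebesgue \<and> \<Union>A = space lebesgue \<and> (\<forall>a\<in>A. emeasure lebesgue a \<noteq> \<infinity>)"
    by (intro exI[of _ A]) auto
qed

text \<open>The product square is cut along the diagonal of the order induced by \<tau>: the pairs
  with \<open>\<tau> y \<le> \<tau> x\<close> give the first term, those with
  \<open>\<tau> x < \<tau> y\<close> the second. The absence of atoms lets the strict inequality be
  replaced by the weak one. With the norm as \<tau> this is the product rule for radial primitives,
  obtained without differentiating anything.\<close>

lemma ordered_product_rule:
  fixes F K \<tau> :: "'a \<Rightarrow> real"
  assumes "sigma_finite_measure M" and F: "integrable M F" and K: "integrable M K"
    and \<tau> [measurable]: "\<tau> \<in> borel_measurable M" and noatom: "\<And>t. AE x in M. \<tau> x \<noteq> t"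
  shows "integrable M (\<lambda>x. F x * (LINT y|M. indicator {..\<tau> x} (\<tau> y) * K y))" (is ?I1)
    and "integrable M (\<lambda>y. K y * (LINT x|M. indicator {..\<tau> y} (\<tau> x) * F x))" (is ?I2)
    and "(LINT x|M. F x) * (LINT y|M. K y) =
      (LINT x|M. F x * (LINT y|M. indicator {..\<tau> x} (\<tau> y) * K y)) +
      (LINT y|M. K y * (LINT x|M. indicator {..\<tau> y} (\<tau> x) * F x))" (is ?E)
proof -
  interpret sigma_finite_measure M by fact
  interpret pair_sigma_finite M M by unfold_locales
  note [measurable] = borel_measurable_integrable[OF F] borel_measurable_integrable[OF K]
  let ?P = "M \<Otimes>\<^sub>M M"
  let ?G = "\<lambda>(x,y). F x * K y"
  let ?G1 = "\<lambda>(x,y). indicator {..\<tau> x} (\<tau> y) * (F x * K y)"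
  let ?G2 = "\<lambda>(x,y). indicator {..<\<tau> y} (\<tau> x) * (F x * K y)"
  have G: "integrable ?P ?G"
  proof (rule Fubini_integrable)
    show "integrable M (\<lambda>x. LINT y|M. norm (case (x, y) of (x, y) \<Rightarrow> F x * K y))"
      using F by (simp add: abs_mult)
    show "AE x in M. integrable M (\<lambda>y. case (x, y) of (x, y) \<Rightarrow> F x * K y)"
      using K by simp
  qed simp
  have m1: "?G1 \<in> borel_measurable ?P"
    by (simp add: indicator_def) measurable
  have m2: "?G2 \<in> borel_measurable ?P"
    by (simp add: indicator_def) measurable
  have G1: "integrable ?P ?G1"
    by (rule Bochner_Integration.integrable_bound[OF G m1]) (auto simp: indicator_def)
  have G2: "integrable ?P ?G2"
    by (rule Bochner_Integration.integrable_bound[OF G m2]) (auto simp: indicator_def)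
  have i1: "(LINT y|M. ?G1 (x, y)) = F x * (LINT y|M. indicator {..\<tau> x} (\<tau> y) * K y)" for x
    by (simp add: mult.left_commute)
  have i2: "(LINT x|M. ?G2 (x, y)) = K y * (LINT x|M. indicator {..\<tau> y} (\<tau> x) * F x)" for y
  proof -
    have "(LINT x|M. ?G2 (x, y)) = (LINT x|M. K y * (indicator {..\<tau> y} (\<tau> x) * F x))"
    proof (rule integral_cong_AE)
      show "AE x in M. ?G2 (x, y) = K y * (indicator {..\<tau> y} (\<tau> x) * F x)"
        using noatom[of "\<tau> y"] by eventually_elim (auto simp: indicator_def)
    qed auto
    then show ?thesis by simp
  qed
  show ?I1 using integrable_fst'[OF G1] unfolding i1 .
  have "integrable M (\<lambda>y. LINT x|M. (\<lambda>x y. ?G2 (x,y)) x y)"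
    by (rule integrable_snd) (use G2 in simp)
  then show ?I2 by (simp only: i2)
  have "(LINT x|M. F x) * (LINT y|M. K y) = (LINT x|M. (LINT y|M. ?G (x,y)))"
    by (simp add: mult.commute)
  also have "\<dots> = integral\<^sup>L ?P ?G" by (rule integral_fst'[OF G])
  also have "\<dots> = integral\<^sup>L ?P (\<lambda>z. ?G1 z + ?G2 z)"
    by (intro Bochner_Integration.integral_cong) (auto simp: indicator_def)
  also have "\<dots> = integral\<^sup>L ?P ?G1 + integral\<^sup>L ?P ?G2"
    by (rule Bochner_Integration.integral_add[OF G1 G2])
  also have "integral\<^sup>L ?P ?G1 = (LINT x|M. LINT y|M. ?G1 (x,y))"
    by (rule integral_fst'[OF G1, symmetric])
  also have "integral\<^sup>L ?P ?G2 = (LINT y|M. LINT x|M. (\<lambda>x y. ?G2 (x,y)) x y)"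
    by (subst integral_snd) (use G2 in simp_all)
  finally show ?E by (simp only: i1 i2)
qed

section \<open>Real square integrable functions\<close>

definition sq_int :: "(real^6 \<Rightarrow> real) \<Rightarrow> bool"
  where "sq_int f \<longleftrightarrow> f \<in> borel_measurable lebesgue \<and> integrable lebesgue (\<lambda>x. (f x)\<^sup>2)"

lemma sq_int_meas [measurable_dest]: "sq_int f \<Longrightarrow> f \<in> borel_measurable lebesgue"
  by (simp add: sq_int_def)

lemma abs_mult_le_squares: "\<bar>a * b\<bar> \<le> a\<^sup>2 + b\<^sup>2" for a b :: real
proof -
  have "0 \<le> (\<bar>a\<bar> - \<bar>b\<bar>)\<^sup>2" by simp
  then have "2 * (\<bar>a\<bar> * \<bar>b\<bar>) \<le> a\<^sup>2 + b\<^sup>2" by (simp add: power2_diff)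
  moreover have "0 \<le> \<bar>a\<bar> * \<bar>b\<bar>" by simp
  ultimately show ?thesis by (simp only: abs_mult)
qed

lemma sq_int_mult:
  assumes "sq_int f" "sq_int g" shows "integrable lebesgue (\<lambda>x. f x * g x)"
proof (rule Bochner_Integration.integrable_bound)
  note [measurable] = sq_int_meas[OF assms(1)] sq_int_meas[OF assms(2)]
  show "integrable lebesgue (\<lambda>x. (f x)\<^sup>2 + (g x)\<^sup>2)" using assms by (auto simp: sq_int_def)
  show "(\<lambda>x. f x * g x) \<in> borel_measurable lebesgue" by measurable
  show "AE x in lebesgue. norm (f x * g x) \<le> norm ((f x)\<^sup>2 + (g x)\<^sup>2)"
    using abs_mult_le_squares by simp
qed

lemma sq_int_add:
  assumes "sq_int f" "sq_int g" shows "sq_int (\<lambda>x. f x + g x)"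
proof -
  note [measurable] = sq_int_meas[OF assms(1)] sq_int_meas[OF assms(2)]
  have "integrable lebesgue (\<lambda>x. (f x)\<^sup>2 + 2 * (f x * g x) + (g x)\<^sup>2)"
    using assms sq_int_mult[OF assms] by (auto simp: sq_int_def)
  then show ?thesis by (simp add: sq_int_def power2_sum algebra_simps)
qed

lemma sq_int_scale: "sq_int f \<Longrightarrow> sq_int (\<lambda>x. c * f x)"
  by (auto simp: sq_int_def power_mult_distrib)

lemma sq_int_restrict:
  assumes "sq_int f" "A \<in> sets borel" shows "sq_int (\<lambda>x. indicator A (norm x) * f x)"
proof -
  have [measurable]: "A \<in> sets borel" by fact
  note [measurable] = sq_int_meas[OF assms(1)]
  have m: "(\<lambda>x. indicator A (norm x) * f x) \<in> borel_measurable lebesgue" by measurable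
  have "integrable lebesgue (\<lambda>x. (indicator A (norm x) * f x)\<^sup>2)"
  proof (rule Bochner_Integration.integrable_bound)
    show "integrable lebesgue (\<lambda>x. (f x)\<^sup>2)" using assms by (simp add: sq_int_def)
    show "(\<lambda>x. (indicator A (norm x) * f x)\<^sup>2) \<in> borel_measurable lebesgue" by (intro borel_measurable_power m)
  qed (auto simp: indicator_def)
  with m show ?thesis by (simp add: sq_int_def)
qed

lemma cauchy_schwarz_integral:
  fixes f g :: "'a \<Rightarrow> real"
  assumes [measurable]: "f \<in> borel_measurable M" "g \<in> borel_measurable M"
    and f: "integrable M (\<lambda>x. (f x)\<^sup>2)" and g: "integrable M (\<lambda>x. (g x)\<^sup>2)"
  shows "(LINT x|M. f x * g x)\<^sup>2 \<le> (LINT x|M. (f x)\<^sup>2) * (LINT x|M. (g x)\<^sup>2)"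
    and "integrable M (\<lambda>x. f x * g x)"
proof -
  show fg: "integrable M (\<lambda>x. f x * g x)"
    by (rule Bochner_Integration.integrable_bound[OF Bochner_Integration.integrable_add[OF f g]]) (use abs_mult_le_squares in auto)
  let ?A = "LINT x|M. (f x)\<^sup>2" and ?B = "LINT x|M. (g x)\<^sup>2" and ?C = "LINT x|M. f x * g x"
  \<comment> \<open>A quadratic in t that is never negative has nonpositive discriminant. If its
    leading coefficient vanishes, the value of t chosen below would make it equal to -1.\<close>
  have q: "0 \<le> ?A - 2 * t * ?C + t\<^sup>2 * ?B" for t
  proof -
    have "0 \<le> (LINT x|M. (f x - t * g x)\<^sup>2)" by simp
    also have "\<dots> = (LINT x|M. (f x)\<^sup>2 - 2 * t * (f x * g x) + t\<^sup>2 * (g x)\<^sup>2)"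
      by (intro Bochner_Integration.integral_cong refl) (simp add: power2_eq_square algebra_simps)
    also have "\<dots> = ?A - 2 * t * ?C + t\<^sup>2 * ?B" using f g fg by simp
    finally show ?thesis .
  qed
  have B0: "?B \<ge> 0" by simp
  show "?C\<^sup>2 \<le> ?A * ?B"
  proof (cases "?B = 0")
    case True
    have "?C = 0"
    proof (rule ccontr)
      assume "?C \<noteq> 0"
      with q[of "(?A + 1) / (2 * ?C)"] True show False by simp
    qed
    then show ?thesis using True by simp
  next
    case False
    then have "?B > 0" using B0 by (metis less_eq_real_def)
    with q[of "?C / ?B"] show ?thesis by (simp add: power2_eq_square field_simps)
  qed
qed

text \<open>The decaying radial function with radial derivative \<open>f\<close>, averaged over spheres if \<open>f\<close> is not radial.\<close>

definition radial_prim :: "(real^6 \<Rightarrow> real) \<Rightarrow> real \<Rightarrow> real"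
  where "radial_prim f r = - (LINT x|lebesgue. indicator {r<..} (norm x) * (f x / norm x ^ 5)) / sphere_area"

text \<open>The squared weight is |x|^-10, and 10 = 3 + 7; its tail integral is the origin of the
  factor 4 r^4 in the pointwise bounds for primitives.\<close>

lemma tail_weight:
  assumes "r > 0"
  shows "integrable (lebesgue :: (real^6) measure) (\<lambda>x. (indicator {r<..} (norm x) / norm x ^ 5)\<^sup>2)"
    and "(LINT x|(lebesgue :: (real^6) measure). (indicator {r<..} (norm x) / norm x ^ 5)\<^sup>2) = sphere_area / (4 * r^4)"
proof -
  have *: "(\<lambda>x::real^6. (indicator {r<..} (norm x) / norm x ^ 5)\<^sup>2) = (\<lambda>x. indicator {r<..} (norm x) * (1 / norm x ^ (3 + 7)))"
    by (auto simp: fun_eq_iff indicator_def power_divide simp flip: power_mult)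
  show "integrable (lebesgue :: (real^6) measure) (\<lambda>x. (indicator {r<..} (norm x) / norm x ^ 5)\<^sup>2)"
    and "(LINT x|(lebesgue :: (real^6) measure). (indicator {r<..} (norm x) / norm x ^ 5)\<^sup>2) = sphere_area / (4 * r^4)"
    unfolding * using tail_power[OF assms, of 3] by simp_all
qed

lemma radial_prim_integrable:
  assumes "sq_int f" "r > 0" "A \<subseteq> {r<..}" and [measurable]: "A \<in> sets borel"
  shows "integrable lebesgue (\<lambda>x. indicator A (norm x) * (f x / norm x ^ 5))"
proof -
  note [measurable] = sq_int_meas[OF assms(1)]
  have "integrable lebesgue (\<lambda>x. f x * (indicator {r<..} (norm x) / norm x ^ 5))"
    by (rule cauchy_schwarz_integral) (use assms tail_weight in \<open>auto simp: sq_int_def\<close>)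
  then show ?thesis
    by (rule Bochner_Integration.integrable_bound) (use assms(3) in \<open>auto simp: indicator_def\<close>)
qed

text \<open>Cauchy-Schwarz against the weight of \<open>tail_weight\<close>. Only the energy outside
  radius r is kept on the right, which is what makes \<open>radial_prim_decay\<close>
  possible.\<close>

lemma radial_prim_bound:
  assumes "sq_int f" "r > 0"
  shows "(radial_prim f r)\<^sup>2 \<le> (LINT x|lebesgue. (indicator {r<..} (norm x) * f x)\<^sup>2) / (4 * sphere_area * r^4)"
proof -
  note [measurable] = sq_int_meas[OF assms(1)]
  have g: "sq_int (\<lambda>x. indicator {r<..} (norm x) * f x)" by (rule sq_int_restrict) (use assms in auto)
  have "(LINT x|lebesgue. indicator {r<..} (norm x) * (f x / norm x ^ 5))
    = (LINT x|lebesgue. (indicator {r<..} (norm x) * f x) * (indicator {r<..} (norm x) / norm x ^ 5))"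
    by (intro Bochner_Integration.integral_cong) (auto simp: indicator_def)
  moreover have "(\<dots>)\<^sup>2 \<le> (LINT x|lebesgue. (indicator {r<..} (norm x) * f x)\<^sup>2) * (LINT x|(lebesgue :: (real^6) measure). (indicator {r<..} (norm x) / norm x ^ 5)\<^sup>2)"
    by (rule cauchy_schwarz_integral) (use g tail_weight assms in \<open>auto simp: sq_int_def\<close>)
  ultimately show ?thesis
    using assms tail_weight(2)[of r]
    by (simp add: radial_prim_def power_divide) (simp add: field_simps power2_eq_square)
qed

lemma radial_prim_bound':
  assumes "sq_int f" "r > 0"
  shows "(radial_prim f r)\<^sup>2 \<le> (LINT x|lebesgue. (f x)\<^sup>2) / (4 * sphere_area * r^4)"
proof -
  have "(LINT x|lebesgue. (indicator {r<..} (norm x) * f x)\<^sup>2) \<le> (LINT x|lebesgue. (f x)\<^sup>2)"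
    using assms sq_int_restrict[of f "{r<..}"]
    by (intro integral_mono) (auto simp: sq_int_def indicator_def)
  then show ?thesis
    using assms radial_prim_bound[OF assms] by (smt (verit) divide_right_mono mult_nonneg_nonneg sphere_area_nonneg zero_le_power_eq_numeral zero_le_power)
qed

lemma radial_prim_diff:
  assumes "sq_int f" "0 < a" "a \<le> b"
  shows "radial_prim f b = radial_prim f a + (LINT x|lebesgue. indicator {a<..b} (norm x) * (f x / norm x ^ 5)) / sphere_area"
proof -
  have "(LINT x|lebesgue. indicator {a<..} (norm x) * (f x / norm x ^ 5))
    = (LINT x|lebesgue. indicator {a<..b} (norm x) * (f x / norm x ^ 5) + indicator {b<..} (norm x) * (f x / norm x ^ 5))"
    by (intro Bochner_Integration.integral_cong) (use assms in \<open>auto simp: indicator_def\<close>)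
  also have "\<dots> = (LINT x|lebesgue. indicator {a<..b} (norm x) * (f x / norm x ^ 5)) + (LINT x|lebesgue. indicator {b<..} (norm x) * (f x / norm x ^ 5))"
    by (intro Bochner_Integration.integral_add radial_prim_integrable[OF assms(1,2)]) (use assms in auto)
  finally show ?thesis by (simp add: radial_prim_def field_simps)
qed

section \<open>Primitives on annuli and integration by parts\<close>

abbreviation leb :: "(real^6) measure" where "leb \<equiv> lebesgue"

text \<open>The interface shared by C1 functions and by \<open>radial_prim\<close>, whose derivative
  is only square integrable. It is stable under products, and that is all integration by parts
  needs. The density F lives on R^6 and need not be radial.\<close>

definition prim_on :: "real \<Rightarrow> real \<Rightarrow> (real \<Rightarrow> real) \<Rightarrow> (real^6 \<Rightarrow> real) \<Rightarrow> bool"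
  where "prim_on a b A F \<longleftrightarrow> integrable leb (\<lambda>x. indicator {a<..b} (norm x) * F x) \<and>
    (\<forall>t. a \<le> t \<longrightarrow> t \<le> b \<longrightarrow> A t = A a + (LINT x|leb. indicator {a<..t} (norm x) * F x))"

lemma prim_on_value:
  assumes "prim_on a b A F" "a \<le> t" "t \<le> b"
  shows "(LINT x|leb. indicator {a<..t} (norm x) * F x) = A t - A a"
proof -
  have "A t = A a + (LINT x|leb. indicator {a<..t} (norm x) * F x)"
    using assms unfolding prim_on_def by blast
  then show ?thesis by linarith
qed

text \<open>Inside the annulus the truncated integrals of \<open>ordered_product_rule\<close> equal
  A(|x|) - A(a) and B(|x|) - B(a). Multiplying out and moving the constants A(a) and B(a) to the
  other side gives the Leibniz rule.\<close>

lemma prim_on_mult: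
  assumes A: "prim_on a b A F" and B: "prim_on a b B K" and "a \<le> b"
  shows "prim_on a b (\<lambda>t. A t * B t) (\<lambda>x. F x * B (norm x) + A (norm x) * K x)"
proof -
  have sub: "integrable leb (\<lambda>x. indicator {a<..t} (norm x) * G x)"
    if "integrable leb (\<lambda>x. indicator {a<..b} (norm x) * G x)" "t \<le> b" for t and G :: "real^6 \<Rightarrow> real"
  proof -
    have m: "(\<lambda>x::real^6. indicator {a<..t} (norm x) :: real) \<in> borel_measurable leb" by measurable
    have "integrable leb (\<lambda>x::real^6. indicator {a<..t} (norm x) * (indicator {a<..b} (norm x) * G x))"
      by (rule Bochner_Integration.integrable_bound[OF that(1)])
        (intro borel_measurable_times m borel_measurable_integrable[OF that(1)], auto simp: indicator_def)
    moreover have "(\<lambda>x::real^6. indicator {a<..t} (norm x) * (indicator {a<..b} (norm x) * G x)) = (\<lambda>x. indicator {a<..t} (norm x) * G x)"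
      using that(2) by (auto simp: indicator_def fun_eq_iff)
    ultimately show ?thesis by simp
  qed
  note FA = sub[OF A[unfolded prim_on_def, THEN conjunct1]] and KB = sub[OF B[unfolded prim_on_def, THEN conjunct1]]
  have Av: "(LINT x|leb. indicator {a<..t} (norm x) * F x) = A t - A a" if "a \<le> t" "t \<le> b" for t
    using prim_on_value[OF A that] .
  have Bv: "(LINT x|leb. indicator {a<..t} (norm x) * K x) = B t - B a" if "a \<le> t" "t \<le> b" for t
    using prim_on_value[OF B that] .
  have main: "integrable leb (\<lambda>x. indicator {a<..t} (norm x) * (F x * B (norm x) + A (norm x) * K x)) \<and>
     A t * B t = A a * B a + (LINT x|leb. indicator {a<..t} (norm x) * (F x * B (norm x) + A (norm x) * K x))"
    if t: "a \<le> t" "t \<le> b" for t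
  proof -
    let ?F = "\<lambda>x. indicator {a<..t} (norm x) * F x" and ?K = "\<lambda>x. indicator {a<..t} (norm x) * K x"
    note R = ordered_product_rule[OF sigma_finite_lebesgue FA[OF t(2)] KB[OF t(2)] measurable_norm_lebesgue AE_norm_neq]
    have in1: "?F x * (LINT y|leb. indicator {..norm x} (norm y) * ?K y) = ?F x * B (norm x) - B a * ?F x" for x
    proof (cases "norm x \<in> {a<..t}")
      case True
      have "(LINT y|leb. indicator {..norm x} (norm y) * ?K y) = (LINT y|leb. indicator {a<..norm x} (norm y) * K y)"
        by (intro Bochner_Integration.integral_cong) (use True in \<open>auto simp: indicator_def\<close>)
      also have "\<dots> = B (norm x) - B a" using True t by (intro Bv) auto
      finally have e: "(LINT y|leb. indicator {..norm x} (norm y) * ?K y) = B (norm x) - B a" .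
      show ?thesis unfolding e by (simp add: algebra_simps)
    qed auto
    have in2: "?K x * (LINT y|leb. indicator {..norm x} (norm y) * ?F y) = ?K x * A (norm x) - A a * ?K x" for x
    proof (cases "norm x \<in> {a<..t}")
      case True
      have "(LINT y|leb. indicator {..norm x} (norm y) * ?F y) = (LINT y|leb. indicator {a<..norm x} (norm y) * F y)"
        by (intro Bochner_Integration.integral_cong) (use True in \<open>auto simp: indicator_def\<close>)
      also have "\<dots> = A (norm x) - A a" using True t by (intro Av) auto
      finally have e: "(LINT y|leb. indicator {..norm x} (norm y) * ?F y) = A (norm x) - A a" .
      show ?thesis unfolding e by (simp add: algebra_simps)
    qed auto
    have i1: "integrable leb (\<lambda>x. ?F x * B (norm x) - B a * ?F x)" using R(1) unfolding in1 .
    have i2: "integrable leb (\<lambda>x. ?K x * A (norm x) - A a * ?K x)" using R(2) unfolding in2 .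
    have j1: "integrable leb (\<lambda>x. ?F x * B (norm x))"
      using Bochner_Integration.integrable_add[OF i1 integrable_mult_right[OF FA[OF t(2)], of "B a"]] by simp
    have j2: "integrable leb (\<lambda>x. ?K x * A (norm x))"
      using Bochner_Integration.integrable_add[OF i2 integrable_mult_right[OF KB[OF t(2)], of "A a"]] by simp
    have eq: "indicator {a<..t} (norm x) * (F x * B (norm x) + A (norm x) * K x) = ?F x * B (norm x) + ?K x * A (norm x)" for x
      by (simp add: algebra_simps)
    have "(A t - A a) * (B t - B a) = (LINT x|leb. ?F x * B (norm x) - B a * ?F x) + (LINT x|leb. ?K x * A (norm x) - A a * ?K x)"
      using R(3) unfolding in1 in2 Av[OF t] Bv[OF t] .
    also have "(LINT x|leb. ?F x * B (norm x) - B a * ?F x) = (LINT x|leb. ?F x * B (norm x)) - B a * (A t - A a)"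
      by (subst Bochner_Integration.integral_diff[OF j1 integrable_mult_right[OF FA[OF t(2)]]]) (simp only: integral_mult_right_zero Av[OF t])
    also have "(LINT x|leb. ?K x * A (norm x) - A a * ?K x) = (LINT x|leb. ?K x * A (norm x)) - A a * (B t - B a)"
      by (subst Bochner_Integration.integral_diff[OF j2 integrable_mult_right[OF KB[OF t(2)]]]) (simp only: integral_mult_right_zero Bv[OF t])
    finally have "A t * B t = A a * B a + ((LINT x|leb. ?F x * B (norm x)) + (LINT x|leb. ?K x * A (norm x)))"
      by (simp add: algebra_simps)
    also have "(LINT x|leb. ?F x * B (norm x)) + (LINT x|leb. ?K x * A (norm x)) = (LINT x|leb. ?F x * B (norm x) + ?K x * A (norm x))"
      by (rule Bochner_Integration.integral_add[OF j1 j2, symmetric])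
    finally show ?thesis unfolding eq using Bochner_Integration.integrable_add[OF j1 j2] by blast
  qed
  then show ?thesis using \<open>a \<le> b\<close> unfolding prim_on_def by blast
qed

lemma prim_on_radial_prim:
  assumes "sq_int f" "0 < a" "a \<le> b"
  shows "prim_on a b (radial_prim f) (\<lambda>x. f x / norm x ^ 5 / sphere_area)"
  unfolding prim_on_def
proof (intro conjI allI impI)
  have "integrable leb (\<lambda>x. indicator {a<..b} (norm x) * (f x / norm x ^ 5))"
    by (rule radial_prim_integrable[OF assms(1,2)]) auto
  then have "integrable leb (\<lambda>x. indicator {a<..b} (norm x) * (f x / norm x ^ 5) / sphere_area)" by (rule integrable_divide)
  then show "integrable leb (\<lambda>x. indicator {a<..b} (norm x) * (f x / norm x ^ 5 / sphere_area))" by simp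
  fix t assume "a \<le> t" "t \<le> b"
  have "(LINT x|leb. indicator {a<..t} (norm x) * (f x / norm x ^ 5 / sphere_area))
     = (LINT x|leb. indicator {a<..t} (norm x) * (f x / norm x ^ 5) / sphere_area)" by simp
  also have "\<dots> = (LINT x|leb. indicator {a<..t} (norm x) * (f x / norm x ^ 5)) / sphere_area" by (rule integral_divide_zero)
  finally show "radial_prim f t = radial_prim f a + (LINT x|leb. indicator {a<..t} (norm x) * (f x / norm x ^ 5 / sphere_area))"
    using radial_prim_diff[OF assms(1,2) \<open>a \<le> t\<close>] by simp
qed

lemma prim_on_C1:
  assumes "0 < a" "a \<le> b"
    and d: "\<And>r. a \<le> r \<Longrightarrow> r \<le> b \<Longrightarrow> (p has_real_derivative p' r) (at r)"
    and c: "continuous_on {a..b} p'"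
  shows "prim_on a b p (\<lambda>x. p' (norm x) / norm x ^ 5 / sphere_area)"
  unfolding prim_on_def
proof (intro conjI allI impI)
  have "integrable leb (\<lambda>x. indicator {a<..b} (norm x) * (p' (norm x) / norm x ^ 5) / sphere_area)"
    by (intro integrable_divide annulus_FTC) (use assms in auto)
  then show "integrable leb (\<lambda>x. indicator {a<..b} (norm x) * (p' (norm x) / norm x ^ 5 / sphere_area))" by simp
  fix t assume t: "a \<le> t" "t \<le> b"
  have "(LINT x|leb. indicator {a<..t} (norm x) * (p' (norm x) / norm x ^ 5 / sphere_area))
     = (LINT x|leb. indicator {a<..t} (norm x) * (p' (norm x) / norm x ^ 5) / sphere_area)" by simp
  also have "\<dots> = (LINT x|leb. indicator {a<..t} (norm x) * (p' (norm x) / norm x ^ 5)) / sphere_area" by (rule integral_divide_zero)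
  also have "\<dots> = p t - p a"
    by (subst annulus_FTC) (use assms t in \<open>auto intro: continuous_on_subset\<close>)
  finally show "p t = p a + (LINT x|leb. indicator {a<..t} (norm x) * (p' (norm x) / norm x ^ 5 / sphere_area))"
    by simp
qed

lemma borel_measurable_radial_prim [measurable]:
  assumes "sq_int f" shows "radial_prim f \<in> borel_measurable borel"
proof -
  interpret sigma_finite_measure "lebesgue :: (real^6) measure" by (rule sigma_finite_lebesgue)
  note [measurable] = sq_int_meas[OF assms]
  have "(\<lambda>(r, x::real^6). indicator {r<..} (norm x) * (f x / norm x ^ 5)) \<in> borel_measurable (borel \<Otimes>\<^sub>M lebesgue)"
    by (simp add: indicator_def) measurable
  then have "(\<lambda>r. LINT x|leb. indicator {r<..} (norm x) * (f x / norm x ^ 5)) \<in> borel_measurable borel"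
    by (rule borel_measurable_lebesgue_integral)
  then show ?thesis unfolding radial_prim_def[abs_def]
    by (intro borel_measurable_divide borel_measurable_uminus) auto
qed

text \<open>The tail energy tends to zero by dominated convergence, which improves O(r^-2) to
  o(r^-2). This removes the boundary term at infinity when the field in an integration by parts is
  only of size r^-3.\<close>

lemma radial_prim_decay:
  assumes "sq_int f"
  shows "(\<lambda>n. (real (Suc n))\<^sup>2 * radial_prim f (real (Suc n))) \<longlonglongrightarrow> 0"
proof -
  note [measurable] = sq_int_meas[OF assms]
  let ?I = "\<lambda>n. (LINT x|leb. (indicator {real (Suc n)<..} (norm x) * f x)\<^sup>2)"
  have "?I \<longlonglongrightarrow> (LINT x|leb. 0)"
  proof (rule integral_dominated_convergence[where w = "\<lambda>x. (f x)\<^sup>2"])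
    show "AE x in leb. (\<lambda>n. (indicator {real (Suc n)<..} (norm x) * f x)\<^sup>2) \<longlonglongrightarrow> 0"
    proof (rule AE_I2)
      fix x :: "real^6"
      have "eventually (\<lambda>n. (indicator {real (Suc n)<..} (norm x) * f x)\<^sup>2 = 0) sequentially"
        using filterlim_real_sequentially[unfolded filterlim_at_top_dense, rule_format, of "norm x"]
        by eventually_elim (auto simp: indicator_def)
      then show "(\<lambda>n. (indicator {real (Suc n)<..} (norm x) * f x)\<^sup>2) \<longlonglongrightarrow> 0"
        by (rule tendsto_eventually)
    qed
  qed (use assms in \<open>auto simp: sq_int_def indicator_def\<close>)
  then have I0: "(\<lambda>n. sqrt (?I n / (4 * sphere_area))) \<longlonglongrightarrow> 0"
    by (auto intro!: tendsto_eq_intros)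
  show ?thesis
  proof (rule Lim_null_comparison[OF always_eventually[OF allI] I0])
    fix n
    let ?r = "real (Suc n)"
    have "(?r\<^sup>2 * radial_prim f ?r)\<^sup>2 = ?r^4 * (radial_prim f ?r)\<^sup>2"
      by (simp add: power_mult_distrib flip: power_mult)
    also have "\<dots> \<le> ?r^4 * (?I n / (4 * sphere_area * ?r^4))"
      by (intro mult_left_mono radial_prim_bound[OF assms]) auto
    also have "\<dots> = ?I n / (4 * sphere_area)" by simp
    finally have "sqrt ((?r\<^sup>2 * radial_prim f ?r)\<^sup>2) \<le> sqrt (?I n / (4 * sphere_area))"
      by (rule real_sqrt_le_mono)
    then show "norm (?r\<^sup>2 * radial_prim f ?r) \<le> sqrt (?I n / (4 * sphere_area))"
      by (simp only: real_sqrt_abs real_norm_def)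
  qed
qed

lemma radial_prim_abs_bound:
  assumes "sq_int f" "r > 0"
  shows "\<bar>r\<^sup>2 * radial_prim f r\<bar> \<le> sqrt ((LINT x|leb. (f x)\<^sup>2) / (4 * sphere_area))"
proof -
  have "(r\<^sup>2 * radial_prim f r)\<^sup>2 = r^4 * (radial_prim f r)\<^sup>2"
    by (simp add: power_mult_distrib flip: power_mult)
  also have "\<dots> \<le> r^4 * ((LINT x|leb. (f x)\<^sup>2) / (4 * sphere_area * r^4))"
    using assms by (intro mult_left_mono radial_prim_bound'[OF assms]) auto
  also have "\<dots> = (LINT x|leb. (f x)\<^sup>2) / (4 * sphere_area)" using assms by simp
  finally have "sqrt ((r\<^sup>2 * radial_prim f r)\<^sup>2) \<le> sqrt ((LINT x|leb. (f x)\<^sup>2) / (4 * sphere_area))"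
    by (rule real_sqrt_le_mono)
  then show ?thesis by (simp only: real_sqrt_abs)
qed

text \<open>The hypothesis on r^5 \<Phi> says that \<psi> is the divergence in R^6 of the radial
  field with component \<Phi>, so this is the divergence theorem for the primitive times that
  field.\<close>

lemma radial_by_parts_annulus:
  assumes f: "sq_int f" and ab: "0 < a" "a \<le> b"
    and d: "\<And>r. r > 0 \<Longrightarrow> ((\<lambda>r. r^5 * \<Phi> r) has_real_derivative r^5 * \<psi> r) (at r)"
    and c: "continuous_on {0<..} \<psi>"
  shows "(LINT x|leb. indicator {a<..b} (norm x) * (f x * \<Phi> (norm x) + radial_prim f (norm x) * \<psi> (norm x)))
     = sphere_area * (b^5 * \<Phi> b * radial_prim f b - a^5 * \<Phi> a * radial_prim f a)"
proof -
  have p: "prim_on a b (\<lambda>r. r^5 * \<Phi> r) (\<lambda>x. norm x^5 * \<psi> (norm x) / norm x ^ 5 / sphere_area)"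
    by (rule prim_on_C1) (use ab d c in \<open>auto intro!: continuous_intros intro: continuous_on_subset\<close>)
  have "(LINT x|leb. indicator {a<..b} (norm x) * (f x * \<Phi> (norm x) + radial_prim f (norm x) * \<psi> (norm x)))
    = (LINT x|leb. sphere_area * (indicator {a<..b} (norm x) * (f x / norm x ^ 5 / sphere_area * (norm x ^ 5 * \<Phi> (norm x))
        + radial_prim f (norm x) * (norm x^5 * \<psi> (norm x) / norm x ^ 5 / sphere_area))))"
    by (intro Bochner_Integration.integral_cong refl) (use ab in \<open>auto simp: indicator_def field_simps\<close>)
  also have "\<dots> = sphere_area * (radial_prim f b * (b^5 * \<Phi> b) - radial_prim f a * (a^5 * \<Phi> a))"
    by (simp only: integral_mult_right_zero prim_on_value[OF prim_on_mult[OF prim_on_radial_prim[OF f ab] p ab(2)] ab(2) order_refl])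
  finally show ?thesis by (simp add: algebra_simps)
qed

lemma annuli_limit:
  fixes G :: "real^6 \<Rightarrow> real"
  assumes "integrable leb G"
  shows "(\<lambda>n. LINT x|leb. indicator {1/real (Suc n)<..real (Suc n)} (norm x) * G x) \<longlonglongrightarrow> (LINT x|leb. G x)"
proof (rule integral_dominated_convergence[where w = "\<lambda>x. \<bar>G x\<bar>"])
  note [measurable] = borel_measurable_integrable[OF assms]
  show "G \<in> borel_measurable leb" by measurable
  show "integrable leb (\<lambda>x. \<bar>G x\<bar>)" using assms by simp
  show "(\<lambda>x. indicator {1/real (Suc n)<..real (Suc n)} (norm x) * G x) \<in> borel_measurable leb" for n
    by measurable
  have "AE x in leb. x \<noteq> 0"
    by (intro AE_completion AE_lborel_singleton)
  then show "AE x in leb. (\<lambda>n. indicator {1/real (Suc n)<..real (Suc n)} (norm x) * G x) \<longlonglongrightarrow> G x"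
  proof eventually_elim
    case (elim x)
    have "eventually (\<lambda>n. real n > norm x) sequentially"
      using filterlim_real_sequentially by (simp add: filterlim_at_top_dense)
    moreover have "eventually (\<lambda>n. real n > 1 / norm x) sequentially"
      using filterlim_real_sequentially by (simp add: filterlim_at_top_dense)
    ultimately have "eventually (\<lambda>n. indicator {1/real (Suc n)<..real (Suc n)} (norm x) * G x = G x) sequentially"
    proof eventually_elim
      case (elim n)
      have "1 / norm x < real (Suc n)" using elim by simp
      then have "1 / real (Suc n) < norm x" using \<open>x \<noteq> 0\<close> by (simp add: field_simps)
      with elim show ?case by (auto simp: indicator_def)
    qed
    then show ?case by (rule tendsto_eventually)
  qed
qed (auto simp: indicator_def)

text \<open>The two bounds on \<Phi> are what the boundary terms require. Near the origin r^5 \<Phi>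
  H is O(r^3) because H is O(r^-2); at infinity r^3 \<Phi> is bounded while r^2 H tends to
  zero.\<close>

lemma radial_by_parts:
  assumes f: "sq_int f"
    and d: "\<And>r. r > 0 \<Longrightarrow> ((\<lambda>r. r^5 * \<Phi> r) has_real_derivative r^5 * \<psi> r) (at r)"
    and c: "continuous_on {0<..} \<psi>"
    and b1: "\<And>r. r > 0 \<Longrightarrow> \<bar>\<Phi> r\<bar> \<le> C" and b2: "\<And>r. r > 0 \<Longrightarrow> \<bar>r^3 * \<Phi> r\<bar> \<le> C"
    and i1: "integrable leb (\<lambda>x. f x * \<Phi> (norm x))"
    and i2: "integrable leb (\<lambda>x. radial_prim f (norm x) * \<psi> (norm x))"
  shows "(LINT x|leb. f x * \<Phi> (norm x)) = - (LINT x|leb. radial_prim f (norm x) * \<psi> (norm x))"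
proof -
  let ?H = "radial_prim f"
  let ?b = "\<lambda>n. real (Suc n)" and ?a = "\<lambda>n. 1 / real (Suc n)"
  let ?K = "sqrt ((LINT x|leb. (f x)\<^sup>2) / (4 * sphere_area))"
  have B: "(\<lambda>n. (?b n)^5 * \<Phi> (?b n) * ?H (?b n)) \<longlonglongrightarrow> 0"
  proof (rule Lim_null_comparison[OF always_eventually[OF allI]])
    show "(\<lambda>n. C * \<bar>(?b n)\<^sup>2 * ?H (?b n)\<bar>) \<longlonglongrightarrow> 0"
      using tendsto_mult_right_zero[OF tendsto_rabs_zero[OF radial_prim_decay[OF f]]] .
    fix n
    have "norm ((?b n)^5 * \<Phi> (?b n) * ?H (?b n)) = \<bar>(?b n)^3 * \<Phi> (?b n)\<bar> * \<bar>(?b n)\<^sup>2 * ?H (?b n)\<bar>"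
      by (simp add: abs_mult eval_nat_numeral)
    also have "\<dots> \<le> C * \<bar>(?b n)\<^sup>2 * ?H (?b n)\<bar>" by (intro mult_right_mono b2) auto
    finally show "norm ((?b n)^5 * \<Phi> (?b n) * ?H (?b n)) \<le> C * \<bar>(?b n)\<^sup>2 * ?H (?b n)\<bar>" .
  qed
  have A: "(\<lambda>n. (?a n)^5 * \<Phi> (?a n) * ?H (?a n)) \<longlonglongrightarrow> 0"
  proof (rule Lim_null_comparison[OF always_eventually[OF allI]])
    have "(\<lambda>n. ?a n ^ 3) \<longlonglongrightarrow> 0 ^ 3"
      by (intro tendsto_power lim_1_over_n[THEN LIMSEQ_Suc])
    then have "(\<lambda>n. C * ?K * ?a n ^ 3) \<longlonglongrightarrow> C * ?K * 0" by (intro tendsto_mult tendsto_const) simp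
    then show "(\<lambda>n. C * ?K * ?a n ^ 3) \<longlonglongrightarrow> 0" by simp
    fix n
    have a: "?a n > 0" by simp
    have "norm ((?a n)^5 * \<Phi> (?a n) * ?H (?a n)) = (?a n)^3 * (\<bar>\<Phi> (?a n)\<bar> * \<bar>(?a n)\<^sup>2 * ?H (?a n)\<bar>)"
      by (simp add: abs_mult eval_nat_numeral)
    also have "\<dots> \<le> (?a n)^3 * (C * ?K)"
      using b1[OF a] radial_prim_abs_bound[OF f a] by (intro mult_left_mono mult_mono) auto
    finally show "norm ((?a n)^5 * \<Phi> (?a n) * ?H (?a n)) \<le> C * ?K * ?a n ^ 3" by (simp only: mult_ac)
  qed
  have "(\<lambda>n. sphere_area * ((?b n)^5 * \<Phi> (?b n) * ?H (?b n) - (?a n)^5 * \<Phi> (?a n) * ?H (?a n))) \<longlonglongrightarrow> sphere_area * (0 - 0)"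
    by (intro tendsto_mult tendsto_diff tendsto_const A B)
  then have L0: "(\<lambda>n. sphere_area * ((?b n)^5 * \<Phi> (?b n) * ?H (?b n) - (?a n)^5 * \<Phi> (?a n) * ?H (?a n))) \<longlonglongrightarrow> 0" by simp
  have E: "(LINT x|leb. indicator {?a n<..?b n} (norm x) * (f x * \<Phi> (norm x) + ?H (norm x) * \<psi> (norm x)))
      = sphere_area * ((?b n)^5 * \<Phi> (?b n) * ?H (?b n) - (?a n)^5 * \<Phi> (?a n) * ?H (?a n))" for n
    by (rule radial_by_parts_annulus[OF f _ _ d c]) (auto simp: field_simps)
  have L1: "(\<lambda>n. LINT x|leb. indicator {?a n<..?b n} (norm x) * (f x * \<Phi> (norm x) + ?H (norm x) * \<psi> (norm x))) \<longlonglongrightarrow> (LINT x|leb. f x * \<Phi> (norm x) + ?H (norm x) * \<psi> (norm x))"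
    by (rule annuli_limit[OF Bochner_Integration.integrable_add[OF i1 i2]])
  have "(LINT x|leb. f x * \<Phi> (norm x) + ?H (norm x) * \<psi> (norm x)) = 0"
    by (rule LIMSEQ_unique[OF L1[unfolded E] L0])
  then show ?thesis using Bochner_Integration.integral_add[OF i1 i2] by simp
qed

section \<open>Picone and Hardy inequalities\<close>

text \<open>If X is the logarithmic derivative of a positive U, the hypothesis on q says that U is a
  supersolution, -\<Delta>U \<ge> q U, written as a Riccati inequality so that U need not appear.
  The proof integrates (f - X H)^2 \<ge> 0 and recognises the cross term in the derivative of r^5 X
  H^2.\<close>

lemma picone:
  assumes f: "sq_int f" and ab: "0 < a" "a \<le> b"
    and X: "\<And>r. a \<le> r \<Longrightarrow> r \<le> b \<Longrightarrow> (X has_real_derivative X' r) (at r)"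
    and cX': "continuous_on {a..b} X'"
    and q: "\<And>r. a \<le> r \<Longrightarrow> r \<le> b \<Longrightarrow> q r \<le> - X' r - 5 * X r / r - (X r)\<^sup>2"
    and iq: "integrable leb (\<lambda>x. indicator {a<..b} (norm x) * (q (norm x) * (radial_prim f (norm x))\<^sup>2))"
  shows "(LINT x|leb. indicator {a<..b} (norm x) * (q (norm x) * (radial_prim f (norm x))\<^sup>2))
      + sphere_area * (b^5 * X b * (radial_prim f b)\<^sup>2 - a^5 * X a * (radial_prim f a)\<^sup>2)
    \<le> (LINT x|leb. indicator {a<..b} (norm x) * (f x)\<^sup>2)"
proof -
  let ?H = "radial_prim f"
  let ?p' = "\<lambda>r. 5 * r^4 * X r + r^5 * X' r"
  let ?F = "\<lambda>x. f x / norm x ^ 5 / sphere_area"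
  have cX: "continuous_on {a..b} X"
    using X by (intro continuous_at_imp_continuous_on ballI DERIV_isCont) auto
  have p: "prim_on a b (\<lambda>r. r^5 * X r) (\<lambda>x. ?p' (norm x) / norm x ^ 5 / sphere_area)"
  proof (rule prim_on_C1[OF ab])
    fix r assume "a \<le> r" "r \<le> b"
    from X[OF this] show "((\<lambda>r. r^5 * X r) has_real_derivative ?p' r) (at r)"
      by (auto intro!: derivative_eq_intros)
  next
    show "continuous_on {a..b} ?p'" by (intro continuous_intros cX cX')
  qed
  note h = prim_on_radial_prim[OF f ab]
  let ?G = "\<lambda>x. (?F x * ?H (norm x) + ?H (norm x) * ?F x) * (norm x ^ 5 * X (norm x))
      + ?H (norm x) * ?H (norm x) * (?p' (norm x) / norm x ^ 5 / sphere_area)"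
  have P: "prim_on a b (\<lambda>t. ?H t * ?H t * (t^5 * X t)) ?G"
    by (rule prim_on_mult[OF prim_on_mult[OF h h ab(2)] p ab(2)])
  have iG: "integrable leb (\<lambda>x. sphere_area * (indicator {a<..b} (norm x) * ?G x))"
    using P unfolding prim_on_def by (intro integrable_mult_right) blast
  have vG: "(LINT x|leb. sphere_area * (indicator {a<..b} (norm x) * ?G x))
      = sphere_area * (?H b * ?H b * (b^5 * X b) - ?H a * ?H a * (a^5 * X a))"
    by (simp only: integral_mult_right_zero prim_on_value[OF P ab(2) order_refl])
  have "(LINT x|leb. indicator {a<..b} (norm x) * (q (norm x) * (?H (norm x))\<^sup>2) + sphere_area * (indicator {a<..b} (norm x) * ?G x))
     \<le> (LINT x|leb. indicator {a<..b} (norm x) * (f x)\<^sup>2)"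
  proof (rule integral_mono)
    show "integrable leb (\<lambda>x. indicator {a<..b} (norm x) * (q (norm x) * (?H (norm x))\<^sup>2) + sphere_area * (indicator {a<..b} (norm x) * ?G x))"
      by (intro Bochner_Integration.integrable_add iq iG)
    have e: "(indicator {a<..b} (norm x) * f x)\<^sup>2 = indicator {a<..b} (norm x) * (f x)\<^sup>2" for x :: "real^6"
      by (auto simp: indicator_def)
    have "sq_int (\<lambda>x. indicator {a<..b} (norm x) * f x)" by (rule sq_int_restrict[OF f]) auto
    then show "integrable leb (\<lambda>x. indicator {a<..b} (norm x) * (f x)\<^sup>2)"
      by (simp add: sq_int_def e)
    fix x :: "real^6"
    show "indicator {a<..b} (norm x) * (q (norm x) * (?H (norm x))\<^sup>2) + sphere_area * (indicator {a<..b} (norm x) * ?G x)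
        \<le> indicator {a<..b} (norm x) * (f x)\<^sup>2"
    proof (cases "norm x \<in> {a<..b}")
      case True
      define r where "r = norm x"
      define H where "H = ?H r"
      have r: "a \<le> r" "r \<le> b" "r > 0" using True ab by (auto simp: r_def)
      have G: "sphere_area * ?G x = 2 * f x * H * X r + H\<^sup>2 * (X' r + 5 * X r / r)"
      proof -
        have "?G x = (f x / r^5 / sphere_area * H + H * (f x / r^5 / sphere_area)) * (r^5 * X r)
          + H * H * ((5 * r^4 * X r + r^5 * X' r) / r^5 / sphere_area)" by (simp add: r_def H_def)
        also have "sphere_area * \<dots> = 2 * f x * H * X r + H\<^sup>2 * (X' r + 5 * X r / r)"
          using r by (simp add: field_simps power2_eq_square) (simp add: algebra_simps eval_nat_numeral)
        finally show ?thesis .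
      qed
      have "q r * H\<^sup>2 \<le> (- X' r - 5 * X r / r - (X r)\<^sup>2) * H\<^sup>2"
        using q[OF r(1,2)] by (intro mult_right_mono) auto
      moreover have "0 \<le> (f x - X r * H)\<^sup>2" by simp
      ultimately have "q r * H\<^sup>2 + (2 * f x * H * X r + H\<^sup>2 * (X' r + 5 * X r / r)) \<le> (f x)\<^sup>2"
        by (simp add: power2_eq_square algebra_simps)
      then show ?thesis using True unfolding G[symmetric] by (simp add: r_def H_def)
    qed auto
  qed
  also have "(LINT x|leb. indicator {a<..b} (norm x) * (q (norm x) * (?H (norm x))\<^sup>2) + sphere_area * (indicator {a<..b} (norm x) * ?G x))
    = (LINT x|leb. indicator {a<..b} (norm x) * (q (norm x) * (?H (norm x))\<^sup>2)) + (LINT x|leb. sphere_area * (indicator {a<..b} (norm x) * ?G x))"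
    by (rule Bochner_Integration.integral_add[OF iq iG])
  finally show ?thesis unfolding vG by (simp add: power2_eq_square algebra_simps)
qed

text \<open>The bound |H| \<le> K |x|^-2 turns the exponents 3 and 5 of the weight into 5 and 7.
  With two primitives, as in the next lemma, the exponents start at 1 and 3.\<close>

lemma integrable_weight_prim:
  fixes k :: "real^6 \<Rightarrow> real"
  assumes f: "sq_int f" and [measurable]: "k \<in> borel_measurable leb"
    and near: "\<And>x. x \<noteq> 0 \<Longrightarrow> norm x \<le> 1 \<Longrightarrow> \<bar>k x\<bar> \<le> C / norm x^3"
    and far: "\<And>x. norm x > 1 \<Longrightarrow> \<bar>k x\<bar> \<le> C / norm x^5"
  shows "integrable leb (\<lambda>x. k x * radial_prim f (norm x))"
proof (rule integrable_two_powers)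
  let ?K = "sqrt ((LINT x|lebesgue. (f x)\<^sup>2) / (4 * sphere_area))"
  note [measurable] = borel_measurable_radial_prim[OF f]
  show "(\<lambda>x. k x * radial_prim f (norm x)) \<in> borel_measurable leb" by measurable
  have b: "\<bar>k x * radial_prim f (norm x)\<bar> \<le> C * ?K / norm x^(j+2)" if "x \<noteq> 0" "\<bar>k x\<bar> \<le> C / norm x^j" for x j
  proof -
    have "\<bar>(norm x)\<^sup>2 * radial_prim f (norm x)\<bar> \<le> ?K" using radial_prim_abs_bound[OF f, of "norm x"] that by simp
    then have "\<bar>radial_prim f (norm x)\<bar> \<le> ?K / (norm x)\<^sup>2" using that by (simp add: field_simps abs_mult)
    then have "\<bar>k x\<bar> * \<bar>radial_prim f (norm x)\<bar> \<le> C / norm x^j * (?K / (norm x)\<^sup>2)"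
      using that by (intro mult_mono) auto
    then show ?thesis by (simp add: abs_mult power_add power2_eq_square mult_ac)
  qed
  show "\<bar>k x * radial_prim f (norm x)\<bar> \<le> C * ?K / norm x ^ 5" if "x \<noteq> 0" "norm x \<le> 1" for x :: "real^6"
    using b[of x 3] near[of x] that by simp
  show "\<bar>k x * radial_prim f (norm x)\<bar> \<le> C * ?K / norm x ^ 7" if "norm x > 1" for x :: "real^6"
    using b[of x 5] far[of x] that by (cases "x = 0") auto
qed

lemma integrable_weight_prim2:
  assumes f: "sq_int f" and g: "sq_int g" and [measurable]: "k \<in> borel_measurable borel"
    and near: "\<And>r. 0 < r \<Longrightarrow> r \<le> 1 \<Longrightarrow> \<bar>k r\<bar> \<le> C / r"
    and far: "\<And>r. r > 1 \<Longrightarrow> \<bar>k r\<bar> \<le> C / r^3"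
  shows "integrable leb (\<lambda>x. k (norm x) * (radial_prim f (norm x) * radial_prim g (norm x)))"
proof -
  let ?K = "sqrt ((LINT x|lebesgue. (f x)\<^sup>2) / (4 * sphere_area))"
  note [measurable] = borel_measurable_radial_prim[OF f]
  have b: "\<bar>k r * radial_prim f r\<bar> \<le> C * ?K / r^(j+2)" if "r > 0" "\<bar>k r\<bar> \<le> C / r^j" for r j
  proof -
    have "\<bar>r\<^sup>2 * radial_prim f r\<bar> \<le> ?K" by (rule radial_prim_abs_bound[OF f that(1)])
    then have "\<bar>radial_prim f r\<bar> \<le> ?K / r\<^sup>2" using that by (simp add: field_simps abs_mult)
    then have "\<bar>k r\<bar> * \<bar>radial_prim f r\<bar> \<le> C / r^j * (?K / r\<^sup>2)"
      using that by (intro mult_mono) auto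
    then show ?thesis by (simp add: abs_mult power_add power2_eq_square mult_ac)
  qed
  have "integrable leb (\<lambda>x. (k (norm x) * radial_prim f (norm x)) * radial_prim g (norm x))"
  proof (rule integrable_weight_prim[OF g])
    show "(\<lambda>x. k (norm x) * radial_prim f (norm x)) \<in> borel_measurable leb" by measurable
    show "\<bar>k (norm x) * radial_prim f (norm x)\<bar> \<le> C * ?K / norm x^3" if "x \<noteq> 0" "norm x \<le> 1" for x :: "real^6"
      using b[of "norm x" 1] near[of "norm x"] that by (simp add: numeral_3_eq_3)
    show "\<bar>k (norm x) * radial_prim f (norm x)\<bar> \<le> C * ?K / norm x^5" if "norm x > 1" for x :: "real^6"
      using b[of "norm x" 3] far[of "norm x"] that by (cases "x = 0") auto
  qed
  then show ?thesis by (simp add: mult.assoc)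
qed

text \<open>Picone with X = -2/r, the logarithmic derivative of r^-2, for which 4/r^2 is the Hardy
  potential in dimension 6. The boundary term at b costs at most half of the energy, so the constant
  is 3/8, rounded up to 1.\<close>

lemma hardy_truncated:
  assumes f: "sq_int f" and b: "b \<ge> 1"
  shows "(LINT x|leb. indicator {1<..b} (norm x) / (norm x)\<^sup>2 * (radial_prim f (norm x))\<^sup>2) \<le> (LINT x|leb. (f x)\<^sup>2)"
proof -
  let ?H = "radial_prim f" and ?E = "LINT x|leb. (f x)\<^sup>2"
  have i: "integrable leb (\<lambda>x. (indicator {1<..b} (norm x) / (norm x)\<^sup>2) * (?H (norm x) * ?H (norm x)))"
  proof (rule integrable_weight_prim2[OF f f, where C = "b"])
    show "\<bar>indicator {1<..b} r / r\<^sup>2\<bar> \<le> b / r" if "0 < r" "r \<le> 1" for r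
      using that b by auto
    show "\<bar>indicator {1<..b} r / r\<^sup>2\<bar> \<le> b / r^3" if "1 < r" for r
      using that b by (auto simp: indicator_def field_simps eval_nat_numeral)
  qed measurable
  then have i4: "integrable leb (\<lambda>x. indicator {1<..b} (norm x) * (4 / (norm x)\<^sup>2 * (?H (norm x))\<^sup>2))"
    using integrable_mult_right[OF i, of 4] by (simp add: power2_eq_square mult_ac)
  have P: "(LINT x|leb. indicator {1<..b} (norm x) * (4 / (norm x)\<^sup>2 * (?H (norm x))\<^sup>2))
      + sphere_area * (b^5 * (-2/b) * (?H b)\<^sup>2 - 1^5 * (-2/1) * (?H 1)\<^sup>2)
    \<le> (LINT x|leb. indicator {1<..b} (norm x) * (f x)\<^sup>2)"
  proof (rule picone[OF f _ b, where X' = "\<lambda>r. 2 / r\<^sup>2"])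
    fix r assume "1 \<le> r" "r \<le> b"
    then show "((\<lambda>r. -2/r) has_real_derivative 2 / r\<^sup>2) (at r)"
      by (auto intro!: derivative_eq_intros simp: power2_eq_square)
    show "4 / r\<^sup>2 \<le> - (2 / r\<^sup>2) - 5 * (- 2 / r) / r - (- 2 / r)\<^sup>2"
      using \<open>1 \<le> r\<close> by (simp add: field_simps power2_eq_square)
  next
    show "continuous_on {1..b} (\<lambda>r. 2 / r\<^sup>2)" by (intro continuous_intros) auto
  qed (use i4 in auto)
  have "(LINT x|leb. indicator {1<..b} (norm x) * (f x)\<^sup>2) \<le> ?E"
  proof -
    have e: "(indicator {1<..b} (norm x) * f x)\<^sup>2 = indicator {1<..b} (norm x) * (f x)\<^sup>2" for x :: "real^6"
      by (auto simp: indicator_def)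
    have "sq_int (\<lambda>x. indicator {1<..b} (norm x) * f x)" by (rule sq_int_restrict[OF f]) auto
    then have "integrable leb (\<lambda>x. indicator {1<..b} (norm x) * (f x)\<^sup>2)" by (simp only: sq_int_def e)
    then show ?thesis using f by (intro integral_mono) (auto simp: sq_int_def indicator_def)
  qed
  moreover have "sphere_area * (b^4 * (?H b)\<^sup>2) \<le> ?E / 4"
    using radial_prim_bound'[OF f, of b] b by (simp add: field_simps)
  moreover have "0 \<le> sphere_area * (?H 1)\<^sup>2" by simp
  moreover have "(LINT x|leb. indicator {1<..b} (norm x) * (4 / (norm x)\<^sup>2 * (?H (norm x))\<^sup>2))
    = 4 * (LINT x|leb. indicator {1<..b} (norm x) / (norm x)\<^sup>2 * (?H (norm x))\<^sup>2)"
    by (subst integral_mult_right_zero[symmetric]) (simp add: mult_ac)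
  moreover have "sphere_area * (b^5 * (-2/b) * (?H b)\<^sup>2 - 1^5 * (-2/1) * (?H 1)\<^sup>2)
      = - 2 * (sphere_area * (b^4 * (?H b)\<^sup>2)) + 2 * (sphere_area * (?H 1)\<^sup>2)"
    using b by (simp add: field_simps eval_nat_numeral)
  moreover have "0 \<le> ?E" by simp
  ultimately show ?thesis using P by linarith
qed

text \<open>Up to scaling the conformal factor of stereographic projection; 2 \<open>ub\<close> - 1
  is the height on the sphere. The profiles of W, \<Lambda>W and the comparison functions are
  polynomials in \<open>ub\<close>, and \<open>ub_sq\<close> removes even powers of r from their
  derivatives.\<close>

definition ub :: "real \<Rightarrow> real" where "ub r = 1 / (1 + r\<^sup>2 / 24)"

lemma ub_pos [simp]: "ub r > 0" unfolding ub_def by (intro divide_pos_pos add_pos_nonneg) auto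
lemma ub_nonneg [simp]: "ub r \<ge> 0" using ub_pos[of r] by linarith
lemma ub_le1: "ub r \<le> 1" unfolding ub_def by (simp add: divide_le_eq add_pos_nonneg)
lemma ub_nz [simp]: "ub r \<noteq> 0" using ub_pos[of r] by linarith
lemma ub_sq: "r\<^sup>2 * ub r = 24 * (1 - ub r)"
proof -
  have "1 + r\<^sup>2 / 24 > 0" by (intro add_pos_nonneg) auto
  then show ?thesis unfolding ub_def by (simp add: field_simps)
qed

lemma DERIV_ub [derivative_intros]:
  assumes "(g has_real_derivative g') (at r within A)"
  shows "((\<lambda>r. ub (g r)) has_real_derivative (- (g r / 12) * (ub (g r))\<^sup>2) * g') (at r within A)"
proof -
  have p: "1 + s\<^sup>2 / 24 > 0" for s :: real by (intro add_pos_nonneg) auto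
  have "(ub has_real_derivative - (s / 12) * (ub s)\<^sup>2) (at s)" for s
    unfolding ub_def[abs_def] using p[of s]
    by (auto intro!: derivative_eq_intros simp: power2_eq_square)
  from DERIV_chain2[OF this assms] show ?thesis .
qed

lemma continuous_on_ub [continuous_intros]: "continuous_on A g \<Longrightarrow> continuous_on A (\<lambda>x. ub (g x))"
proof -
  assume g: "continuous_on A g"
  have "1 + s\<^sup>2 / 24 \<noteq> 0" for s :: real
    using add_pos_nonneg[of 1 "s\<^sup>2 / 24"] by simp
  then show ?thesis unfolding ub_def by (intro continuous_intros g ballI) auto
qed

lemma borel_measurable_ub [measurable]: "ub \<in> borel_measurable borel"
  by (intro borel_measurable_continuous_onI continuous_intros)

lemma W_eq: "W x = (ub (norm x))\<^sup>2"
  by (simp add: W_def ub_def power_divide)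

text \<open>The comparison function is U = ub^2 (\<alpha> + \<beta> ub + \<gamma> ub^2). Dividing by
  ub^2 gives U'/U = N/Q and -\<Delta>U = ub^2 S, so that the requirement -\<Delta>U \<ge> 7/3 W U
  becomes the quadratic inequality \<open>cond\<close> in \<open>ub\<close> alone.\<close>

lemma picone_zone:
  fixes \<alpha> \<beta> \<gamma> :: real
  defines "N \<equiv> \<lambda>r. - (r / 12) * (2*\<alpha>*ub r + 3*\<beta>*(ub r)^2 + 4*\<gamma>*(ub r)^3)"
    and "Q \<equiv> \<lambda>r. \<alpha> + \<beta> * ub r + \<gamma> * (ub r)^2"
  assumes f: "sq_int f" and ab: "0 < a" "a \<le> b"
    and Q: "\<And>r. a \<le> r \<Longrightarrow> r \<le> b \<Longrightarrow> Q r > 0"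
    and cond: "\<And>r. a \<le> r \<Longrightarrow> r \<le> b \<Longrightarrow> (\<beta>/2 + 4*\<alpha>/3) + (4*\<gamma>/3 + \<beta>/3) * ub r - \<gamma> * (ub r)^2 \<le> 0"
  shows "7/3 * (LINT x|leb. indicator {a<..b} (norm x) * (W x * (radial_prim f (norm x))\<^sup>2))
      + sphere_area * (b^5 * (N b / Q b) * (radial_prim f b)\<^sup>2 - a^5 * (N a / Q a) * (radial_prim f a)\<^sup>2)
    \<le> (LINT x|leb. indicator {a<..b} (norm x) * (f x)\<^sup>2)"
proof -
  define N' where "N' = (\<lambda>r. - (1/12) * (2*\<alpha>*ub r + 3*\<beta>*(ub r)^2 + 4*\<gamma>*(ub r)^3)
     + (r^2 * ub r / 144) * (2*\<alpha>*ub r + 6*\<beta>*(ub r)^2 + 12*\<gamma>*(ub r)^3))"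
  define Q' where "Q' = (\<lambda>r. - (r / 12) * (ub r)^2 * (\<beta> + 2*\<gamma> * ub r))"
  let ?H = "radial_prim f"
  have dN: "(N has_real_derivative N' r) (at r)" for r
    unfolding N_def N'_def
    by (auto intro!: derivative_eq_intros simp: power2_eq_square power3_eq_cube algebra_simps) (simp add: field_simps)
  have dQ: "(Q has_real_derivative Q' r) (at r)" for r
    unfolding Q_def Q'_def
    by (auto intro!: derivative_eq_intros simp: power2_eq_square power3_eq_cube algebra_simps)
  \<comment> \<open>The product rule for U = ub^2 Q with U' = ub^2 N, after division by
    ub^2.\<close>
  have rel: "Q' r = N r + r / 6 * ub r * Q r" for r
    unfolding Q'_def N_def Q_def by (simp add: field_simps eval_nat_numeral)
  \<comment> \<open>The quotient of -\<Delta>U by ub^2. The third eigenvalue 10/3 appears as the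
    coefficient of \<gamma> in top degree.\<close>
  define S where "S = (\<lambda>r. - ((ub r)^2 * ((\<beta>/2 - \<alpha>) + (4*\<gamma>/3 - 2*\<beta>) * ub r - 10/3*\<gamma>*(ub r)^2)))"
  have key: "- N' r + r / 6 * ub r * N r - 5 * N r / r = S r" if "r > 0" for r
  proof -
    let ?M = "2*\<alpha>*ub r + 3*\<beta>*(ub r)^2 + 4*\<gamma>*(ub r)^3"
    have "- N' r + r / 6 * ub r * N r - 5 * N r / r
      = 1/12 * ?M - (r^2 * ub r / 144) * (2*\<alpha>*ub r + 6*\<beta>*(ub r)^2 + 12*\<gamma>*(ub r)^3)
        - (r^2 * ub r) / 72 * ?M + 5/12 * ?M"
      unfolding N_def N'_def using that by (simp add: power2_eq_square)
    also have "\<dots> = S r"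
      unfolding ub_sq S_def by (simp add: field_simps eval_nat_numeral)
    finally show ?thesis .
  qed
  have i0: "integrable leb (\<lambda>x. (\<lambda>r. indicator {a<..b} r * (7/3 * (ub r)\<^sup>2)) (norm x) * (?H (norm x) * ?H (norm x)))"
  proof (rule integrable_weight_prim2[OF f f, where C = "7/3 * (1 + b^3)"])
    have u2: "(ub r)\<^sup>2 \<le> 1" for r by (rule power_le_one) (use ub_pos[of r] ub_le1[of r] in auto)
    have b0: "b > 0" using ab by simp
    show "\<bar>indicator {a<..b} r * (7/3 * (ub r)\<^sup>2)\<bar> \<le> 7/3 * (1 + b^3) / r" if "0 < r" "r \<le> 1" for r
    proof -
      have "\<bar>indicator {a<..b} r * (7/3 * (ub r)\<^sup>2)\<bar> \<le> 7/3 * 1" using u2[of r] by (auto simp: indicator_def)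
      also have "\<dots> \<le> 7/3 * (1 + b^3) / r" using that b0 by (simp add: field_simps add_increasing2)
      finally show ?thesis .
    qed
    show "\<bar>indicator {a<..b} r * (7/3 * (ub r)\<^sup>2)\<bar> \<le> 7/3 * (1 + b^3) / r^3" if "1 < r" for r
    proof (cases "r \<le> b")
      case True
      have "\<bar>indicator {a<..b} r * (7/3 * (ub r)\<^sup>2)\<bar> \<le> 7/3 * 1" using u2[of r] by (auto simp: indicator_def)
      also have "r^3 \<le> b^3" using True that by (intro power_mono) auto
      then have "7/3 * 1 \<le> 7/3 * (1 + b^3) / r^3" using that by (simp add: field_simps)
      finally show ?thesis .
    next
      case False
      then show ?thesis using that b0 by (auto simp: indicator_def)
    qed
  qed measurable
  have "(LINT x|leb. indicator {a<..b} (norm x) * (7/3 * (ub (norm x))\<^sup>2 * (?H (norm x))\<^sup>2))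
      + sphere_area * (b^5 * (N b / Q b) * (?H b)\<^sup>2 - a^5 * (N a / Q a) * (?H a)\<^sup>2)
    \<le> (LINT x|leb. indicator {a<..b} (norm x) * (f x)\<^sup>2)"
  proof (rule picone[OF f ab, where X' = "\<lambda>r. (N' r * Q r - N r * Q' r) / (Q r)\<^sup>2"])
    fix r assume r: "a \<le> r" "r \<le> b"
    have Qr: "Q r > 0" "r > 0" using Q r ab by auto
    show "((\<lambda>r. N r / Q r) has_real_derivative (N' r * Q r - N r * Q' r) / (Q r)\<^sup>2) (at r)"
      using DERIV_divide[OF dN[of r] dQ[of r]] Qr by (simp add: power2_eq_square)
    have "7/3 * (ub r)\<^sup>2 \<le> S r / Q r"
    proof -
      have "7/3 * (ub r)\<^sup>2 * Q r - S r = (ub r)\<^sup>2 * ((\<beta>/2 + 4*\<alpha>/3) + (4*\<gamma>/3 + \<beta>/3) * ub r - \<gamma> * (ub r)^2)"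
        unfolding S_def Q_def by (simp add: field_simps eval_nat_numeral)
      also have "\<dots> \<le> 0" using cond[OF r] by (intro mult_nonneg_nonpos) auto
      finally show ?thesis using Qr by (simp add: field_simps)
    qed
    also have "S r / Q r = - ((N' r * Q r - N r * Q' r) / (Q r)\<^sup>2) - 5 * (N r / Q r) / r - (N r / Q r)\<^sup>2"
      unfolding key[OF Qr(2), symmetric] rel using Qr by (simp add: field_simps power2_eq_square)
    finally show "7/3 * (ub r)\<^sup>2 \<le> - ((N' r * Q r - N r * Q' r) / (Q r)\<^sup>2) - 5 * (N r / Q r) / r - (N r / Q r)\<^sup>2" .
  next
    have "Q r \<noteq> 0" if "r \<in> {a..b}" for r using Q[of r] that by auto
    then show "continuous_on {a..b} (\<lambda>r. (N' r * Q r - N r * Q' r) / (Q r)\<^sup>2)"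
      unfolding N'_def Q'_def N_def Q_def by (intro continuous_intros ballI) auto
    show "integrable leb (\<lambda>x. indicator {a<..b} (norm x) * (7/3 * (ub (norm x))\<^sup>2 * (?H (norm x))\<^sup>2))"
      using i0 by (simp add: power2_eq_square mult_ac)
  qed
  also have "(LINT x|leb. indicator {a<..b} (norm x) * (7/3 * (ub (norm x))\<^sup>2 * (?H (norm x))\<^sup>2))
     = 7/3 * (LINT x|leb. indicator {a<..b} (norm x) * (W x * (?H (norm x))\<^sup>2))"
    by (subst integral_mult_right_zero[symmetric]) (simp add: W_eq mult_ac)
  finally show ?thesis by simp
qed

lemma ub_zone: "r > 0 \<Longrightarrow> c > 0 \<Longrightarrow> r\<^sup>2 \<le> 24 * (1 / c - 1) \<Longrightarrow> c \<le> ub r"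
  "r > 0 \<Longrightarrow> c > 0 \<Longrightarrow> r\<^sup>2 \<ge> 24 * (1 / c - 1) \<Longrightarrow> ub r \<le> c"
  unfolding ub_def by (simp_all add: field_simps add_pos_nonneg)

lemma integrable_W_prim2:
  assumes "sq_int f" "sq_int g"
  shows "integrable leb (\<lambda>x. W x * (radial_prim f (norm x) * radial_prim g (norm x)))"
  unfolding W_eq
\<comment> \<open>Here 576 = 24^2 is the supremum of r^4 W.\<close>
proof (rule integrable_weight_prim2[OF assms, where C = 576])
  have u2: "(ub r)\<^sup>2 \<le> 1" for r by (rule power_le_one) (use ub_pos[of r] ub_le1[of r] in auto)
  show "\<bar>(ub r)\<^sup>2\<bar> \<le> 576 / r" if "0 < r" "r \<le> 1" for r
    using mult_mono[of r 1 "(ub r)\<^sup>2" 1] u2[of r] that by (simp add: field_simps)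
  show "\<bar>(ub r)\<^sup>2\<bar> \<le> 576 / r^3" if "1 < r" for r
  proof -
    have "r\<^sup>2 * ub r \<le> 24" using ub_sq[of r] ub_pos[of r] by simp
    then have "(r\<^sup>2 * ub r)\<^sup>2 \<le> 24\<^sup>2" by (intro power_mono) (use ub_pos[of r] in auto)
    then have "r^4 * (ub r)\<^sup>2 \<le> 576" by (simp add: power_mult_distrib flip: power_mult)
    moreover have "r^3 * (ub r)\<^sup>2 \<le> r^4 * (ub r)\<^sup>2"
      using that by (intro mult_right_mono power_increasing) auto
    ultimately have "r^3 * (ub r)\<^sup>2 \<le> 576" by linarith
    then show ?thesis using that by (simp add: field_simps)
  qed
qed measurable

text \<open>Two nodes suffice: for the third radial eigenfunction they would be at its zeros, but any two
  nodes for which each zone carries a positive supersolution will do. The nodes \<open>|x|\<^sup>2 = 12\<close> and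
  \<open>|x|\<^sup>2 = 48\<close> correspond to \<open>\<plusminus>1/3\<close> on the polar axis of the sphere.\<close>

lemma two_node_gap:
  assumes f: "sq_int f" and z1: "radial_prim f (sqrt 12) = 0" and z2: "radial_prim f (sqrt 48) = 0"
  shows "7/3 * (LINT x|leb. W x * (radial_prim f (norm x))\<^sup>2) \<le> (LINT x|leb. (f x)\<^sup>2)"
proof -
  let ?H = "radial_prim f"
  let ?a = "\<lambda>n. 1 / real (Suc n)" and ?b = "\<lambda>n. real (Suc n)"
  let ?p = "\<lambda>a b. (LINT x|leb. indicator {a<..b} (norm x) * (W x * (?H (norm x))\<^sup>2))"
  let ?e = "\<lambda>a b. (LINT x|leb. indicator {a<..b} (norm x) * (f x)\<^sup>2)"
  \<comment> \<open>The logarithmic derivatives in the inner and the outer zone get names because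
    their boundary terms at radii tending to 0 and to infinity have to be shown to vanish.\<close>
  define Ni where "Ni = (\<lambda>r. - (r / 12) * (2*(-5)*ub r + 3*8*(ub r)^2 + 4*0*(ub r)^3) / (-5 + 8 * ub r + 0 * (ub r)^2))"
  define No where "No = (\<lambda>r. - (r / 12) * (2*3*ub r + 3*(-8)*(ub r)^2 + 4*0*(ub r)^3) / (3 + (-8) * ub r + 0 * (ub r)^2))"
  have iW: "integrable leb (\<lambda>x. W x * (?H (norm x))\<^sup>2)"
    using integrable_W_prim2[OF f f] by (simp add: power2_eq_square)
  have iE: "integrable leb (\<lambda>x. (f x)\<^sup>2)" using f by (simp add: sq_int_def)
  have ind: "integrable leb (\<lambda>x. indicator A (norm x) * G x)" if "integrable leb G" "A \<in> sets borel" for G :: "real^6 \<Rightarrow> real" and A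
  proof (rule Bochner_Integration.integrable_bound[OF that(1)])
    note [measurable] = borel_measurable_integrable[OF that(1)] that(2)
    show "(\<lambda>x. indicator A (norm x) * G x) \<in> borel_measurable leb" by measurable
  qed (auto simp: indicator_def)
  have split: "(LINT x|leb. indicator {a<..c} (norm x) * G x) = (LINT x|leb. indicator {a<..b} (norm x) * G x) + (LINT x|leb. indicator {b<..c} (norm x) * G x)"
    if "integrable leb G" "a \<le> b" "b \<le> c" for G :: "real^6 \<Rightarrow> real" and a b c :: real
  proof -
    have "(LINT x|leb. indicator {a<..c} (norm x) * G x) = (LINT x|leb. indicator {a<..b} (norm x) * G x + indicator {b<..c} (norm x) * G x)"
      by (intro Bochner_Integration.integral_cong refl) (use that in \<open>auto simp: indicator_def\<close>)
    also have "\<dots> = (LINT x|leb. indicator {a<..b} (norm x) * G x) + (LINT x|leb. indicator {b<..c} (norm x) * G x)"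
      by (intro Bochner_Integration.integral_add ind that) auto
    finally show ?thesis .
  qed
  have s: "sqrt 12 > 1" "sqrt 12 < sqrt 48" "sqrt 48 \<le> 7" by (auto intro: real_le_lsqrt simp: real_less_rsqrt)
  \<comment> \<open>In the height t = 2 ub - 1 the comparison polynomial is 4t - 1, positive for t
    \<ge> 1/3. The boundary term at the node drops out because the primitive vanishes there.\<close>
  have z_in: "7/3 * ?p a (sqrt 12) - sphere_area * (a^5 * Ni a * (?H a)\<^sup>2) \<le> ?e a (sqrt 12)" if "0 < a" "a \<le> 1" for a
  proof -
    have u: "2/3 \<le> ub r" if "a \<le> r" "r \<le> sqrt 12" for r
    proof -
      have "r\<^sup>2 \<le> (sqrt 12)\<^sup>2" using that \<open>0 < a\<close> by (intro power_mono) auto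
      then show ?thesis using that \<open>0 < a\<close> by (intro ub_zone) auto
    qed
    have "7/3 * ?p a (sqrt 12) + sphere_area * ((sqrt 12)^5 * (- (sqrt 12 / 12) * (2*(-5)*ub (sqrt 12) + 3*8*(ub (sqrt 12))^2 + 4*0*(ub (sqrt 12))^3) / (-5 + 8 * ub (sqrt 12) + 0 * (ub (sqrt 12))^2)) * (?H (sqrt 12))\<^sup>2
       - a^5 * (- (a / 12) * (2*(-5)*ub a + 3*8*(ub a)^2 + 4*0*(ub a)^3) / (-5 + 8 * ub a + 0 * (ub a)^2)) * (?H a)\<^sup>2) \<le> ?e a (sqrt 12)"
    proof (rule picone_zone[OF f])
      fix r assume r: "a \<le> r" "r \<le> sqrt 12"
      show "- 5 + 8 * ub r + 0 * (ub r)\<^sup>2 > 0" using u[OF r] by simp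
      show "8/2 + 4*(-5)/3 + (4*0/3 + 8/3) * ub r - 0 * (ub r)\<^sup>2 \<le> 0" using ub_le1[of r] by simp
    qed (insert that s, linarith+)
    then show ?thesis using z1 by (simp add: Ni_def)
  qed
  \<comment> \<open>The polynomial is 1 - 8 t^2, equal to 1/9 at both nodes. Its positivity and the
    supersolution condition both follow from (ub - 1/3)(ub - 2/3) \<le> 0.\<close>
  have z_mid: "7/3 * ?p (sqrt 12) (sqrt 48) \<le> ?e (sqrt 12) (sqrt 48)"
  proof -
    have u: "2/3 \<ge> ub r" "1/3 \<le> ub r" if "sqrt 12 \<le> r" "r \<le> sqrt 48" for r
    proof -
      have r0: "r > 0" using that s by linarith
      have "r\<^sup>2 \<le> (sqrt 48)\<^sup>2" using that r0 by (intro power_mono) auto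
      then show "1/3 \<le> ub r" using r0 by (intro ub_zone) auto
      have "(sqrt 12)\<^sup>2 \<le> r\<^sup>2" using that r0 by (intro power_mono) auto
      then show "2/3 \<ge> ub r" using r0 by (intro ub_zone) auto
    qed
    have q: "(t - 1/3) * (t - 2/3) \<le> 0" if "1/3 \<le> t" "t \<le> 2/3" for t :: real
      using that by (intro mult_nonneg_nonpos) auto
    let ?X = "\<lambda>r. (- (r / 12) * (2*(-7)*ub r + 3*32*(ub r)^2 + 4*(-32)*(ub r)^3) / (-7 + 32 * ub r + (-32) * (ub r)^2))"
    have "7/3 * ?p (sqrt 12) (sqrt 48) + sphere_area * ((sqrt 48)^5 * ?X (sqrt 48) * (?H (sqrt 48))\<^sup>2
       - (sqrt 12)^5 * ?X (sqrt 12) * (?H (sqrt 12))\<^sup>2) \<le> ?e (sqrt 12) (sqrt 48)"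
    proof (rule picone_zone[OF f])
      fix r assume r: "sqrt 12 \<le> r" "r \<le> sqrt 48"
      note q' = q[OF u(2)[OF r] u(1)[OF r]]
      show "- 7 + 32 * ub r + (-32) * (ub r)\<^sup>2 > 0" using q' by (simp add: algebra_simps power2_eq_square)
      show "32/2 + 4*(-7)/3 + (4*(-32)/3 + 32/3) * ub r - (-32) * (ub r)\<^sup>2 \<le> 0" using q' by (simp add: algebra_simps power2_eq_square)
    qed (insert s, linarith+)
    then show ?thesis using z1 z2 by simp
  qed
  \<comment> \<open>The polynomial -1 - 4t is the mirror image of the inner one under t to
    -t.\<close>
  have z_out: "7/3 * ?p (sqrt 48) b + sphere_area * (b^5 * No b * (?H b)\<^sup>2) \<le> ?e (sqrt 48) b" if "b \<ge> 7" for b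
  proof -
    have u: "ub r \<le> 1/3" if "sqrt 48 \<le> r" for r
    proof -
      have r0: "r > 0" using that s by linarith
      have "(sqrt 48)\<^sup>2 \<le> r\<^sup>2" using that r0 by (intro power_mono) auto
      then show ?thesis using r0 by (intro ub_zone) auto
    qed
    let ?X = "\<lambda>r. (- (r / 12) * (2*3*ub r + 3*(-8)*(ub r)^2 + 4*0*(ub r)^3) / (3 + (-8) * ub r + 0 * (ub r)^2))"
    have "7/3 * ?p (sqrt 48) b + sphere_area * (b^5 * ?X b * (?H b)\<^sup>2
       - (sqrt 48)^5 * ?X (sqrt 48) * (?H (sqrt 48))\<^sup>2) \<le> ?e (sqrt 48) b"
    proof (rule picone_zone[OF f])
      fix r assume r: "sqrt 48 \<le> r" "r \<le> b"
      show "3 + (-8) * ub r + 0 * (ub r)\<^sup>2 > 0" using u[OF r(1)] by simp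
      show "-8/2 + 4*3/3 + (4*0/3 + (-8)/3) * ub r - 0 * (ub r)\<^sup>2 \<le> 0" using ub_pos[of r] by simp
    qed (insert that s, linarith+)
    then show ?thesis using z2 by (simp add: No_def)
  qed
  have main: "7/3 * ?p (?a n) (?b n) + sphere_area * ((?b n)^5 * No (?b n) * (?H (?b n))\<^sup>2 - (?a n)^5 * Ni (?a n) * (?H (?a n))\<^sup>2)
     \<le> ?e (?a n) (?b n)" if "n \<ge> 7" for n
  proof -
    have n: "?a n \<le> 1" "0 < ?a n" "7 \<le> ?b n" using that by auto
    have o: "?a n \<le> sqrt 12" "sqrt 12 \<le> ?b n" "sqrt 12 \<le> sqrt 48" "sqrt 48 \<le> ?b n" using n s by linarith+
    have "?p (?a n) (?b n) = ?p (?a n) (sqrt 12) + (?p (sqrt 12) (sqrt 48) + ?p (sqrt 48) (?b n))"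
      by (simp only: split[OF iW o(1,2)] split[OF iW o(3,4)])
    moreover have "?e (?a n) (?b n) = ?e (?a n) (sqrt 12) + (?e (sqrt 12) (sqrt 48) + ?e (sqrt 48) (?b n))"
      by (simp only: split[OF iE o(1,2)] split[OF iE o(3,4)])
    ultimately show ?thesis
      using z_in[OF n(2,1)] z_mid z_out[OF n(3)] by (simp only: distrib_left right_diff_distrib)
  qed
  have uo: "ub r \<le> 1/3" if "7 \<le> r" for r :: real
  proof -
    have "7\<^sup>2 \<le> r\<^sup>2" using that by (intro power_mono) auto
    then show ?thesis using that by (intro ub_zone) auto
  qed
  have ui: "2/3 \<le> ub r" if "0 < r" "r \<le> 1" for r :: real
  proof -
    have "r\<^sup>2 \<le> 1\<^sup>2" using that by (intro power_mono) auto
    then show ?thesis using that by (intro ub_zone) auto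
  qed
  \<comment> \<open>Hence the boundary term at radius b is at most a constant times (b^2 H(b))^2,
    which tends to zero.\<close>
  have Bo: "\<bar>r * No r\<bar> \<le> 36" if "r \<ge> 7" for r
  proof -
    have u: "ub r \<le> 1/3" "ub r > 0" using uo[OF that] by auto
    have "r * No r = - (r\<^sup>2 * ub r / 12) * (6 - 24 * ub r) / (3 - 8 * ub r)"
      unfolding No_def by (simp add: power2_eq_square algebra_simps)
    also have "r\<^sup>2 * ub r / 12 = 2 * (1 - ub r)" using ub_sq[of r] by simp
    finally have e: "\<bar>r * No r\<bar> = 2 * (1 - ub r) * \<bar>6 - 24 * ub r\<bar> / (3 - 8 * ub r)"
      using u by (simp add: abs_mult)
    have "2 * (1 - ub r) * \<bar>6 - 24 * ub r\<bar> \<le> 2 * 6"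
    proof (rule mult_mono)
      show "\<bar>6 - 24 * ub r\<bar> \<le> 6" using u by linarith
    qed (use u in auto)
    also have "\<dots> \<le> 36 * (3 - 8 * ub r)" using u by simp
    finally show ?thesis unfolding e using u by (simp add: divide_le_eq)
  qed
  \<comment> \<open>With H of size a^-2, the boundary term at radius a is then of size a^5 a a^-4 =
    a^2.\<close>
  have Bi: "\<bar>Ni r\<bar> \<le> 6 * r" if "0 < r" "r \<le> 1" for r
  proof -
    have u: "2/3 \<le> ub r" "ub r \<le> 1" using ui[OF that] ub_le1 by auto
    have "Ni r = - (r / 12) * (ub r * (24 * ub r - 10)) / (8 * ub r - 5)"
      unfolding Ni_def by (simp add: power2_eq_square algebra_simps)
    then have e: "\<bar>Ni r\<bar> = r / 12 * (ub r * (24 * ub r - 10)) / (8 * ub r - 5)"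
      using u that by (simp add: abs_mult)
    have "r / 12 * (ub r * (24 * ub r - 10)) \<le> r / 12 * (1 * 24)" using u that by (intro mult_left_mono mult_mono) auto
    also have "\<dots> = 6 * r * (1/3)" by simp
    also have "\<dots> \<le> 6 * r * (8 * ub r - 5)" using u that by (intro mult_left_mono) auto
    finally have "r / 12 * (ub r * (24 * ub r - 10)) \<le> 6 * r * (8 * ub r - 5)" .
    moreover have "8 * ub r - 5 > 0" using u by linarith
    ultimately show ?thesis unfolding e by (subst pos_divide_le_eq)
  qed
  let ?K = "sqrt ((LINT x|lebesgue. (f x)\<^sup>2) / (4 * sphere_area))"
  have Lb: "(\<lambda>n. (?b n)^5 * No (?b n) * (?H (?b n))\<^sup>2) \<longlonglongrightarrow> 0"
  proof (rule Lim_null_comparison)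
    have "(\<lambda>n. 36 * ((?b n)\<^sup>2 * ?H (?b n))\<^sup>2) \<longlonglongrightarrow> 36 * 0\<^sup>2"
      by (intro tendsto_mult tendsto_power tendsto_const radial_prim_decay[OF f])
    moreover have "36 * 0\<^sup>2 = (0::real)" by simp
    ultimately show "(\<lambda>n. 36 * ((?b n)\<^sup>2 * ?H (?b n))\<^sup>2) \<longlonglongrightarrow> 0" by (simp only:)
    show "eventually (\<lambda>n. norm ((?b n)^5 * No (?b n) * (?H (?b n))\<^sup>2) \<le> 36 * ((?b n)\<^sup>2 * ?H (?b n))\<^sup>2) sequentially"
      using eventually_ge_at_top[of 7]
    proof eventually_elim
      case (elim n)
      have "norm ((?b n)^5 * No (?b n) * (?H (?b n))\<^sup>2) = \<bar>?b n * No (?b n)\<bar> * ((?b n)\<^sup>2 * ?H (?b n))\<^sup>2"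
        by (simp add: abs_mult eval_nat_numeral)
      also have "\<dots> \<le> 36 * ((?b n)\<^sup>2 * ?H (?b n))\<^sup>2" using Bo[of "?b n"] elim by (intro mult_right_mono) auto
      finally show ?case .
    qed
  qed
  have La: "(\<lambda>n. (?a n)^5 * Ni (?a n) * (?H (?a n))\<^sup>2) \<longlonglongrightarrow> 0"
  proof (rule Lim_null_comparison[OF always_eventually[OF allI]])
    have "(\<lambda>n. ?a n ^ 2) \<longlonglongrightarrow> 0 ^ 2"
      by (intro tendsto_power lim_1_over_n[THEN LIMSEQ_Suc])
    then have "(\<lambda>n. 6 * ?K\<^sup>2 * ?a n ^ 2) \<longlonglongrightarrow> 6 * ?K\<^sup>2 * 0" by (intro tendsto_mult tendsto_const) simp
    then show "(\<lambda>n. 6 * ?K\<^sup>2 * ?a n ^ 2) \<longlonglongrightarrow> 0" by simp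
    fix n
    have a: "?a n > 0" "?a n \<le> 1" by auto
    have "norm ((?a n)^5 * Ni (?a n) * (?H (?a n))\<^sup>2) = ?a n * (\<bar>Ni (?a n)\<bar> * \<bar>(?a n)\<^sup>2 * ?H (?a n)\<bar>\<^sup>2)"
      by (simp add: abs_mult eval_nat_numeral)
    also have "\<dots> \<le> ?a n * ((6 * ?a n) * ?K\<^sup>2)"
      using Bi[OF a] radial_prim_abs_bound[OF f a(1)] by (intro mult_left_mono mult_mono power_mono) auto
    finally show "norm ((?a n)^5 * Ni (?a n) * (?H (?a n))\<^sup>2) \<le> 6 * ?K\<^sup>2 * ?a n ^ 2"
      by (simp only: mult_ac power2_eq_square)
  qed
  have "7/3 * (LINT x|leb. W x * (?H (norm x))\<^sup>2) + sphere_area * (0 - 0) \<le> (LINT x|leb. (f x)\<^sup>2)"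
  proof (rule LIMSEQ_le)
    show "(\<lambda>n. 7/3 * ?p (?a n) (?b n) + sphere_area * ((?b n)^5 * No (?b n) * (?H (?b n))\<^sup>2 - (?a n)^5 * Ni (?a n) * (?H (?a n))\<^sup>2))
       \<longlonglongrightarrow> 7/3 * (LINT x|leb. W x * (?H (norm x))\<^sup>2) + sphere_area * (0 - 0)"
      by (intro tendsto_intros annuli_limit[OF iW] La Lb)
    show "(\<lambda>n. ?e (?a n) (?b n)) \<longlonglongrightarrow> (LINT x|leb. (f x)\<^sup>2)" by (rule annuli_limit[OF iE])
  qed (use main in blast)
  then show ?thesis by simp
qed

section \<open>The modes \<open>W\<close> and \<open>\<Lambda>W\<close>\<close>

lemma AE_nonzero: "AE x in leb. x \<noteq> 0"
  by (intro AE_completion AE_lborel_singleton)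

lemma radial_prim_add:
  assumes "sq_int f" "sq_int g" "r > 0"
  shows "radial_prim (\<lambda>x. f x + g x) r = radial_prim f r + radial_prim g r"
proof -
  have "(LINT x|leb. indicator {r<..} (norm x) * ((f x + g x) / norm x ^ 5))
     = (LINT x|leb. indicator {r<..} (norm x) * (f x / norm x ^ 5) + indicator {r<..} (norm x) * (g x / norm x ^ 5))"
    by (intro Bochner_Integration.integral_cong refl) (simp add: add_divide_distrib distrib_left)
  also have "\<dots> = (LINT x|leb. indicator {r<..} (norm x) * (f x / norm x ^ 5)) + (LINT x|leb. indicator {r<..} (norm x) * (g x / norm x ^ 5))"
    by (intro Bochner_Integration.integral_add radial_prim_integrable[OF assms(1,3)] radial_prim_integrable[OF assms(2,3)]) auto
  finally have e: "(LINT x|leb. indicator {r<..} (norm x) * ((f x + g x) / norm x ^ 5))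
    = (LINT x|leb. indicator {r<..} (norm x) * (f x / norm x ^ 5)) + (LINT x|leb. indicator {r<..} (norm x) * (g x / norm x ^ 5))" .
  show ?thesis unfolding radial_prim_def e by (simp only: minus_add_distrib add_divide_distrib)
qed

lemma radial_prim_scale: "radial_prim (\<lambda>x. c * f x) r = c * radial_prim f r"
proof -
  have "(LINT x|leb. indicator {r<..} (norm x) * (c * f x / norm x ^ 5)) = (LINT x|leb. c * (indicator {r<..} (norm x) * (f x / norm x ^ 5)))"
    by (intro Bochner_Integration.integral_cong refl) simp
  then have e: "(LINT x|leb. indicator {r<..} (norm x) * (c * f x / norm x ^ 5)) = c * (LINT x|leb. indicator {r<..} (norm x) * (f x / norm x ^ 5))"
    by (simp only: integral_mult_right_zero)
  show ?thesis unfolding radial_prim_def e by simp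
qed

text \<open>Both functions have the same increments over annuli and tend to zero along the integers,
  so their difference is constant and hence zero.\<close>

lemma radial_prim_of_profile:
  assumes d: "\<And>r. r > 0 \<Longrightarrow> (y has_real_derivative y' r) (at r)"
    and c: "continuous_on {0<..} y'" and f: "sq_int (\<lambda>x. y' (norm x))"
    and lim: "(\<lambda>n. y (real n)) \<longlonglongrightarrow> 0" and "r > 0"
  shows "radial_prim (\<lambda>x. y' (norm x)) r = y r"
proof -
  let ?H = "radial_prim (\<lambda>x. y' (norm x))"
  have eq: "?H t = ?H r + (y t - y r)" if "t \<ge> r" for t
  proof -
    have "?H t = ?H r + (LINT x|leb. indicator {r<..t} (norm x) * (y' (norm x) / norm x ^ 5)) / sphere_area"
      by (rule radial_prim_diff[OF f \<open>r > 0\<close> that])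
    also have "(LINT x|leb. indicator {r<..t} (norm x) * (y' (norm x) / norm x ^ 5)) = sphere_area * (y t - y r)"
      by (rule annulus_FTC) (use that d \<open>r > 0\<close> c in \<open>auto intro: continuous_on_subset\<close>)
    finally show ?thesis by simp
  qed
  have H0: "(\<lambda>n. ?H (real (Suc n))) \<longlonglongrightarrow> 0"
  proof (rule Lim_null_comparison[OF always_eventually[OF allI]])
    show "(\<lambda>n. \<bar>(real (Suc n))\<^sup>2 * ?H (real (Suc n))\<bar>) \<longlonglongrightarrow> 0"
      by (intro tendsto_rabs_zero radial_prim_decay f)
    fix n
    have "1 * \<bar>?H (real (Suc n))\<bar> \<le> (real (Suc n))\<^sup>2 * \<bar>?H (real (Suc n))\<bar>"
      by (intro mult_right_mono one_le_power) auto
    then show "norm (?H (real (Suc n))) \<le> \<bar>(real (Suc n))\<^sup>2 * ?H (real (Suc n))\<bar>"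
      by (simp only: abs_mult abs_power2 real_norm_def mult_1)
  qed
  have y0: "(\<lambda>n. y (real (Suc n))) \<longlonglongrightarrow> 0" using lim by (rule LIMSEQ_Suc)
  have "(\<lambda>n. ?H r + (y (real (Suc n)) - y r)) \<longlonglongrightarrow> 0"
  proof (rule Lim_transform_eventually[OF H0])
    have "eventually (\<lambda>n. real n > r) sequentially"
      using filterlim_real_sequentially by (simp add: filterlim_at_top_dense)
    then show "eventually (\<lambda>n. ?H (real (Suc n)) = ?H r + (y (real (Suc n)) - y r)) sequentially"
      by eventually_elim (rule eq, simp)
  qed
  moreover have "(\<lambda>n. ?H r + (y (real (Suc n)) - y r)) \<longlonglongrightarrow> ?H r + (0 - y r)"
    by (intro tendsto_intros y0)
  ultimately have "?H r + (0 - y r) = 0" using LIMSEQ_unique by blast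
  then show ?thesis by simp
qed

lemma sq_int_profile:
  assumes [measurable]: "g \<in> borel_measurable borel"
    and near: "\<And>r. 0 < r \<Longrightarrow> r \<le> 1 \<Longrightarrow> \<bar>g r\<bar> \<le> C" and far: "\<And>r. r > 1 \<Longrightarrow> \<bar>g r\<bar> \<le> C / r^4"
  shows "sq_int (\<lambda>x. g (norm x))"
proof -
  have "integrable leb (\<lambda>x. (g (norm x))\<^sup>2)"
  proof (rule integrable_two_powers)
    show "\<bar>(g (norm x))\<^sup>2\<bar> \<le> C\<^sup>2 / norm x ^ 5" if "x \<noteq> 0" "norm x \<le> 1" for x :: "real^6"
    proof -
      have "\<bar>g (norm x)\<bar>\<^sup>2 \<le> C\<^sup>2" using near[of "norm x"] that by (intro power_mono) auto
      also have "\<dots> \<le> C\<^sup>2 / norm x ^ 5"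
        using that mult_left_mono[OF power_le_one[of "norm x" 5], of "C\<^sup>2"] by (simp add: field_simps)
      finally show ?thesis by simp
    qed
    show "\<bar>(g (norm x))\<^sup>2\<bar> \<le> C\<^sup>2 / norm x ^ 7" if "norm x > 1" for x :: "real^6"
    proof -
      have "\<bar>g (norm x)\<bar>\<^sup>2 \<le> (C / norm x ^ 4)\<^sup>2" using far[of "norm x"] that by (intro power_mono) auto
      also have "\<dots> = C\<^sup>2 / norm x ^ 8" by (simp add: power_divide flip: power_mult)
      also have "\<dots> \<le> C\<^sup>2 / norm x ^ 7" using that by (intro divide_left_mono power_increasing) auto
      finally show ?thesis by simp
    qed
  qed measurable
  then show ?thesis by (simp add: sq_int_def)
qed

lemma ub_pow_bound:
  assumes "j \<le> k" shows "r^(2*j) * (ub r)^k \<le> 24^j"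
proof -
  have "r^(2*j) * (ub r)^k = (r\<^sup>2 * ub r)^j * (ub r)^(k-j)"
    using assms by (simp add: power_mult_distrib power_mult flip: power_add)
  also have "\<dots> \<le> 24^j * 1"
    using ub_sq[of r] ub_pos[of r] ub_le1[of r] by (intro mult_mono power_mono power_le_one) auto
  finally show ?thesis by simp
qed

lemma ub_pow_bounds:
  assumes "r > 0"
  shows "(ub r)^k \<le> 1" "j \<le> k \<Longrightarrow> (ub r)^k \<le> 24^j / r^(2*j)"
    "j \<le> k \<Longrightarrow> r > 1 \<Longrightarrow> i \<le> 2 * j \<Longrightarrow> (ub r)^k \<le> 24^j / r^i"
proof -
  show "(ub r)^k \<le> 1" using ub_le1 by (intro power_le_one) auto
  show a: "(ub r)^k \<le> 24^j / r^(2*j)" if "j \<le> k" using ub_pow_bound[OF that, of r] assms by (simp add: field_simps)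
  show "(ub r)^k \<le> 24^j / r^i" if "j \<le> k" "r > 1" "i \<le> 2 * j"
  proof -
    have "24^j / r^(2*j) \<le> 24^j / r^i" using that by (intro divide_left_mono power_increasing) auto
    with a[OF that(1)] show ?thesis by linarith
  qed
qed

text \<open>The derivatives of the profiles of \<open>W\<close> and \<open>\<Lambda>W\<close>, which in terms of \<open>ub\<close> are \<open>ub\<^sup>2\<close> and \<open>4ub\<^sup>3 - 2ub\<^sup>2\<close>.\<close>

definition dW :: "real^6 \<Rightarrow> real" where "dW x = - (norm x / 6) * (ub (norm x))^3"
definition dLW :: "real^6 \<Rightarrow> real" where "dLW x = - (norm x / 3) * (3 * (ub (norm x))^4 - (ub (norm x))^3)"

lemma sq_int_dW: "sq_int dW"
  unfolding dW_def
proof (rule sq_int_profile[where C = "24^3"])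
  show "(\<lambda>r. - (r / 6) * ub r ^ 3) \<in> borel_measurable borel" by measurable
  fix r :: real
  show "\<bar>- (r / 6) * ub r ^ 3\<bar> \<le> 24^3" if "0 < r" "r \<le> 1"
    using mult_mono[of r 1 "ub r ^ 3" 1] ub_pow_bounds(1)[of r 3] that by (simp add: abs_mult)
  show "\<bar>- (r / 6) * ub r ^ 3\<bar> \<le> 24^3 / r^4" if "r > 1"
  proof -
    have "r * ub r ^ 3 \<le> r * (24^3 / r^5)"
      using that ub_pow_bounds(3)[of r 3 3 5] by (intro mult_left_mono) auto
    also have "\<dots> = 24^3 / r^4" using that by (simp add: eval_nat_numeral)
    finally have "r * ub r ^ 3 \<le> 24^3 / r^4" .
    moreover have "0 \<le> r * ub r ^ 3" using that by simp
    moreover have "\<bar>- (r / 6) * ub r ^ 3\<bar> = (r * ub r ^ 3) / 6" using that by (simp add: abs_mult)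
    ultimately show ?thesis by linarith
  qed
qed

lemma sq_int_dLW: "sq_int dLW"
  unfolding dLW_def
proof (rule sq_int_profile[where C = "2 * 24^3"])
  show "(\<lambda>r. - (r / 3) * (3 * ub r ^ 4 - ub r ^ 3)) \<in> borel_measurable borel" by measurable
  have b: "\<bar>- (r / 3) * (3 * ub r ^ 4 - ub r ^ 3)\<bar> \<le> 2 * (r * ub r ^ 3)" if "r > 0" for r :: real
  proof -
    have "\<bar>3 * ub r - 1\<bar> \<le> 3" using ub_le1[of r] ub_pos[of r] by linarith
    then have "r * ub r ^ 3 * \<bar>3 * ub r - 1\<bar> \<le> r * ub r ^ 3 * 3" using that by (intro mult_left_mono) auto
    moreover have "\<bar>- (r / 3) * (3 * ub r ^ 4 - ub r ^ 3)\<bar> = (r * ub r ^ 3 * \<bar>3 * ub r - 1\<bar>) / 3"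
    proof -
      have "- (r / 3) * (3 * ub r ^ 4 - ub r ^ 3) = - (r * ub r ^ 3 * (3 * ub r - 1)) / 3"
        by (simp add: algebra_simps eval_nat_numeral)
      then show ?thesis using that by (simp add: abs_mult)
    qed
    moreover have "0 \<le> r * ub r ^ 3" using that by simp
    ultimately show ?thesis by linarith
  qed
  fix r :: real
  show "\<bar>- (r / 3) * (3 * ub r ^ 4 - ub r ^ 3)\<bar> \<le> 2 * 24^3" if "0 < r" "r \<le> 1"
    using mult_mono[of r 1 "ub r ^ 3" 1] ub_pow_bounds(1)[of r 3] that b[OF that(1)] by simp
  show "\<bar>- (r / 3) * (3 * ub r ^ 4 - ub r ^ 3)\<bar> \<le> 2 * 24^3 / r^4" if "r > 1"
  proof -
    have "r * ub r ^ 3 \<le> r * (24^3 / r^5)"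
      using that ub_pow_bounds(3)[of r 3 3 5] by (intro mult_left_mono) auto
    also have "\<dots> = 24^3 / r^4" using that by (simp add: eval_nat_numeral)
    finally have "r * ub r ^ 3 \<le> 24^3 / r^4" .
    then show ?thesis using b[of r] that by simp
  qed
qed

lemma ub_tendsto_0: "(\<lambda>n. ub (real n)) \<longlonglongrightarrow> 0"
proof (rule LIMSEQ_offset[of _ 1], rule Lim_null_comparison[OF always_eventually[OF allI]])
  show "(\<lambda>n. 24 * (1 / real (Suc n))) \<longlonglongrightarrow> 0"
    using tendsto_mult_right_zero[OF lim_1_over_n[THEN LIMSEQ_Suc]] .
  fix n
  show "norm (ub (real (n + 1))) \<le> 24 * (1 / real (Suc n))"
  proof -
    have "ub (real (Suc n)) ^ 1 \<le> 24^1 / (real (Suc n))^(2*1)" by (rule ub_pow_bounds) auto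
    also have "\<dots> \<le> 24^1 / (real (Suc n))^1" by (intro divide_left_mono power_increasing) auto
    finally show ?thesis by simp
  qed
qed

lemma radial_prim_dW: "r > 0 \<Longrightarrow> radial_prim dW r = (ub r)^2"
  unfolding dW_def[abs_def]
proof (rule radial_prim_of_profile)
  show "((\<lambda>r. (ub r)\<^sup>2) has_real_derivative - (r / 6) * ub r ^ 3) (at r)" for r
    by (auto intro!: derivative_eq_intros simp: power2_eq_square power3_eq_cube)
  show "(\<lambda>n. (ub (real n))\<^sup>2) \<longlonglongrightarrow> 0" using tendsto_power[OF ub_tendsto_0, of 2] by simp
  show "sq_int (\<lambda>x. - (norm x / 6) * ub (norm x) ^ 3)" using sq_int_dW unfolding dW_def[abs_def] .
qed (auto intro!: continuous_intros)

lemma radial_prim_dLW: "r > 0 \<Longrightarrow> radial_prim dLW r = 4 * (ub r)^3 - 2 * (ub r)^2"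
  unfolding dLW_def[abs_def]
proof (rule radial_prim_of_profile)
  show "((\<lambda>r. 4 * ub r ^ 3 - 2 * (ub r)\<^sup>2) has_real_derivative - (r / 3) * (3 * ub r ^ 4 - ub r ^ 3)) (at r)" for r
    by (auto intro!: derivative_eq_intros simp: algebra_simps eval_nat_numeral)
  have "(\<lambda>n. 4 * (ub (real n))^3 - 2 * (ub (real n))^2) \<longlonglongrightarrow> 4 * 0^3 - 2 * 0^2" by (intro tendsto_intros ub_tendsto_0)
  then show "(\<lambda>n. 4 * (ub (real n))^3 - 2 * (ub (real n))\<^sup>2) \<longlonglongrightarrow> 0" by simp
  show "sq_int (\<lambda>x. - (norm x / 3) * (3 * ub (norm x) ^ 4 - ub (norm x) ^ 3))" using sq_int_dLW unfolding dLW_def[abs_def] .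
qed (auto intro!: continuous_intros)

section \<open>The Dirichlet form and the form weighted by W\<close>

definition dirichlet :: "(real^6 \<Rightarrow> real) \<Rightarrow> (real^6 \<Rightarrow> real) \<Rightarrow> real"
  where "dirichlet f g = (LINT x|leb. f x * g x)"

definition wform :: "(real^6 \<Rightarrow> real) \<Rightarrow> (real^6 \<Rightarrow> real) \<Rightarrow> real"
  where "wform f g = (LINT x|leb. W x * (radial_prim f (norm x) * radial_prim g (norm x)))"

lemma dirichlet_commute: "dirichlet f g = dirichlet g f"
  by (simp add: dirichlet_def mult.commute)

lemma wform_commute: "wform f g = wform g f"
  by (simp add: wform_def mult.commute)

lemma dirichlet_add: "sq_int f \<Longrightarrow> sq_int g \<Longrightarrow> sq_int h \<Longrightarrow> dirichlet (\<lambda>x. f x + g x) h = dirichlet f h + dirichlet g h"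
  unfolding dirichlet_def distrib_right by (intro Bochner_Integration.integral_add sq_int_mult)

lemma dirichlet_scale: "dirichlet (\<lambda>x. c * f x) h = c * dirichlet f h"
  by (simp add: dirichlet_def mult.assoc)

lemma W_measurable [measurable]: "W \<in> borel_measurable borel"
  unfolding W_eq[abs_def] by measurable

lemma W_measurable_leb [measurable]: "W \<in> borel_measurable leb"
  by (rule borel_measurable_lebesgueI[OF W_measurable])

lemma wform_add:
  assumes "sq_int f" "sq_int g" "sq_int h"
  shows "wform (\<lambda>x. f x + g x) h = wform f h + wform g h"
proof -
  note [measurable] = borel_measurable_radial_prim[OF assms(1)] borel_measurable_radial_prim[OF assms(2)] borel_measurable_radial_prim[OF assms(3)] borel_measurable_radial_prim[OF sq_int_add[OF assms(1,2)]]
  have "wform (\<lambda>x. f x + g x) h = (LINT x|leb. W x * (radial_prim f (norm x) * radial_prim h (norm x)) + W x * (radial_prim g (norm x) * radial_prim h (norm x)))"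
    unfolding wform_def
  proof (rule integral_cong_AE)
    show "AE x in leb. W x * (radial_prim (\<lambda>x. f x + g x) (norm x) * radial_prim h (norm x)) =
       W x * (radial_prim f (norm x) * radial_prim h (norm x)) + W x * (radial_prim g (norm x) * radial_prim h (norm x))"
      using AE_nonzero by eventually_elim (use assms in \<open>simp add: radial_prim_add algebra_simps\<close>)
  qed measurable
  also have "\<dots> = wform f h + wform g h"
    unfolding wform_def by (intro Bochner_Integration.integral_add integrable_W_prim2 assms)
  finally show ?thesis .
qed

lemma wform_scale: "wform (\<lambda>x. c * f x) h = c * wform f h"
  unfolding wform_def radial_prim_scale
  by (subst integral_mult_right_zero[symmetric]) (simp add: mult_ac)

lemma dirichlet_nonneg: "dirichlet f f \<ge> 0" by (simp add: dirichlet_def)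
lemma wform_nonneg: "wform f f \<ge> 0" by (simp add: wform_def W_eq)

text \<open>The weak form of -\<Delta>W = W^2: the divergence of the field W' x/|x| is -ub^4. Thus W
  has eigenvalue 1 for the pair of forms.\<close>

lemma dirichlet_dW:
  assumes f: "sq_int f" shows "dirichlet f dW = wform f dW"
proof -
  note [measurable] = borel_measurable_radial_prim[OF f] borel_measurable_radial_prim[OF sq_int_dW]
  have "(LINT x|leb. f x * (- (norm x / 6) * ub (norm x) ^ 3)) = - (LINT x|leb. radial_prim f (norm x) * - ((ub (norm x))^4))"
  proof (rule radial_by_parts[OF f, where C = 600])
    fix r :: real assume r: "r > 0"
    have "((\<lambda>r. r ^ 5 * (- (r / 6) * ub r ^ 3)) has_real_derivative (r^5 * (r^2 * ub r) / 24 * (ub r)^3 - r^5 * (ub r)^3)) (at r)"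
      by (auto intro!: derivative_eq_intros simp: algebra_simps eval_nat_numeral) (simp add: field_simps)
    also have "r^5 * (r^2 * ub r) / 24 * (ub r)^3 - r^5 * (ub r)^3 = r^5 * - (ub r ^ 4)"
      unfolding ub_sq by (simp add: field_simps eval_nat_numeral)
    finally show "((\<lambda>r. r ^ 5 * (- (r / 6) * ub r ^ 3)) has_real_derivative r^5 * - (ub r ^ 4)) (at r)" .
    have "r^2 * ub r^3 \<le> 24" "r^4 * ub r ^ 3 \<le> 24^2" using ub_pow_bound[of 1 3 r] ub_pow_bound[of 2 3 r] by auto
    have "r * ub r ^ 3 \<le> 600"
    proof (cases "r \<le> 1")
      case True then show ?thesis using mult_mono[of r 1 "ub r ^ 3" 1] ub_pow_bounds(1)[OF r, of 3] r by simp
    next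
      case False
      then have "r * ub r ^ 3 \<le> r^2 * ub r ^ 3" by (intro mult_right_mono) (auto simp: power2_eq_square)
      then show ?thesis using \<open>r^2 * ub r^3 \<le> 24\<close> by linarith
    qed
    then show "\<bar>- (r / 6) * ub r ^ 3\<bar> \<le> 600" using r by (simp add: abs_mult)
    show "\<bar>r ^ 3 * (- (r / 6) * ub r ^ 3)\<bar> \<le> 600" using \<open>r^4 * ub r ^ 3 \<le> 24^2\<close> r by (simp add: abs_mult eval_nat_numeral)
  next
    show "integrable leb (\<lambda>x. f x * (- (norm x / 6) * ub (norm x) ^ 3))"
      using sq_int_mult[OF f sq_int_dW] unfolding dW_def .
    have "integrable leb (\<lambda>x. - ((ub (norm x))^4) * radial_prim f (norm x))"
    proof (rule integrable_weight_prim[OF f, where C = "24^3"])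
      show "\<bar>- (ub (norm x) ^ 4)\<bar> \<le> 24 ^ 3 / norm x ^ 3" if "x \<noteq> 0" "norm x \<le> 1" for x :: "real^6"
      proof -
        have "ub (norm x) ^ 4 * norm x ^ 3 \<le> 1 * 1" using that ub_le1[of "norm x"] by (intro mult_mono power_le_one) auto
        then show ?thesis using that by (simp add: field_simps)
      qed
      show "\<bar>- (ub (norm x) ^ 4)\<bar> \<le> 24 ^ 3 / norm x ^ 5" if "norm x > 1" for x :: "real^6"
        using ub_pow_bounds(3)[of "norm x" 3 4 5] that by (cases "x = 0") auto
    qed measurable
    then show "integrable leb (\<lambda>x. radial_prim f (norm x) * - ((ub (norm x))^4))" by (simp add: mult.commute)
  qed (auto intro!: continuous_intros)
  also have "\<dots> = (LINT x|leb. W x * (radial_prim f (norm x) * radial_prim dW (norm x)))"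
    unfolding Bochner_Integration.integral_minus[symmetric]
  proof (rule integral_cong_AE)
    show "AE x in leb. - (radial_prim f (norm x) * - ((ub (norm x))^4)) = W x * (radial_prim f (norm x) * radial_prim dW (norm x))"
      using AE_nonzero by eventually_elim (simp add: radial_prim_dW W_eq flip: power_add)
  qed measurable
  finally show ?thesis by (simp add: dirichlet_def wform_def dW_def)
qed

text \<open>The weak form of -\<Delta>(\<Lambda>W) = 2 W \<Lambda>W, the equation of W
  differentiated along its scaling; here it is checked directly as a polynomial identity in
  \<open>ub\<close>.\<close>

lemma dirichlet_dLW:
  assumes f: "sq_int f" shows "dirichlet f dLW = 2 * wform f dLW"
proof -
  note [measurable] = borel_measurable_radial_prim[OF f] borel_measurable_radial_prim[OF sq_int_dLW]
  let ?\<psi> = "\<lambda>r. 4 * (ub r)^4 - 8 * (ub r)^5"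
  have "(LINT x|leb. f x * (- (norm x / 3) * (3 * ub (norm x) ^ 4 - ub (norm x) ^ 3))) = - (LINT x|leb. radial_prim f (norm x) * ?\<psi> (norm x))"
  proof (rule radial_by_parts[OF f, where C = 2400])
    fix r :: real assume r: "r > 0"
    have "((\<lambda>r. r ^ 5 * (- (r / 3) * (3 * ub r ^ 4 - ub r ^ 3))) has_real_derivative
        r^5 * (2 * (ub r)^3 - 6 * (ub r)^4 - (r^2 * ub r) / 36 * (3 * (ub r)^3 - 12 * (ub r)^4))) (at r)"
      by (auto intro!: derivative_eq_intros simp: algebra_simps eval_nat_numeral) (simp add: field_simps)
    also have "r^5 * (2 * (ub r)^3 - 6 * (ub r)^4 - (r^2 * ub r) / 36 * (3 * (ub r)^3 - 12 * (ub r)^4)) = r^5 * ?\<psi> r"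
      unfolding ub_sq by (simp add: field_simps eval_nat_numeral)
    finally show "((\<lambda>r. r ^ 5 * (- (r / 3) * (3 * ub r ^ 4 - ub r ^ 3))) has_real_derivative r^5 * ?\<psi> r) (at r)" .
    have "r^2 * ub r^3 \<le> 24" "r^4 * ub r ^ 3 \<le> 24^2" using ub_pow_bound[of 1 3 r] ub_pow_bound[of 2 3 r] by auto
    have b1: "r * ub r ^ 3 \<le> 600"
    proof (cases "r \<le> 1")
      case True then show ?thesis using mult_mono[of r 1 "ub r ^ 3" 1] ub_pow_bounds(1)[OF r, of 3] r by simp
    next
      case False
      then have "r * ub r ^ 3 \<le> r^2 * ub r ^ 3" by (intro mult_right_mono) (auto simp: power2_eq_square)
      then show ?thesis using \<open>r^2 * ub r^3 \<le> 24\<close> by linarith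
    qed
    have "\<bar>3 * ub r - 1\<bar> \<le> 3" using ub_le1[of r] ub_pos[of r] by linarith
    have e: "- (r / 3) * (3 * ub r ^ 4 - ub r ^ 3) = - (r * ub r ^ 3) / 3 * (3 * ub r - 1)"
      by (simp add: field_simps eval_nat_numeral)
    have "(r * ub r ^ 3) / 3 * \<bar>3 * ub r - 1\<bar> \<le> 200 * 3"
      using b1 \<open>\<bar>3 * ub r - 1\<bar> \<le> 3\<close> by (intro mult_mono) auto
    then show "\<bar>- (r / 3) * (3 * ub r ^ 4 - ub r ^ 3)\<bar> \<le> 2400" unfolding e using r by (simp add: abs_mult)
    have "(r^4 * ub r ^ 3) / 3 * \<bar>3 * ub r - 1\<bar> \<le> 192 * 3"
      using \<open>r^4 * ub r ^ 3 \<le> 24^2\<close> \<open>\<bar>3 * ub r - 1\<bar> \<le> 3\<close> by (intro mult_mono) auto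
    moreover have "r^3 * (- (r * ub r ^ 3) / 3 * (3 * ub r - 1)) = - ((r^4 * ub r ^ 3) / 3 * (3 * ub r - 1))"
      by (simp add: eval_nat_numeral)
    moreover have "\<bar>- ((r^4 * ub r ^ 3) / 3 * (3 * ub r - 1))\<bar> = (r^4 * ub r ^ 3) / 3 * \<bar>3 * ub r - 1\<bar>"
      using r by (simp add: abs_mult)
    ultimately show "\<bar>r ^ 3 * (- (r / 3) * (3 * ub r ^ 4 - ub r ^ 3))\<bar> \<le> 2400" unfolding e by linarith
  next
    show "integrable leb (\<lambda>x. f x * (- (norm x / 3) * (3 * ub (norm x) ^ 4 - ub (norm x) ^ 3)))"
      using sq_int_mult[OF f sq_int_dLW] unfolding dLW_def .
    have "integrable leb (\<lambda>x. ?\<psi> (norm x) * radial_prim f (norm x))"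
    proof (rule integrable_weight_prim[OF f, where C = "12 * 24^3"])
      have p: "\<bar>?\<psi> r\<bar> \<le> 12 * ub r ^ 4" for r
      proof -
        have "ub r ^ 5 \<le> ub r ^ 4" using ub_le1 by (intro power_decreasing) auto
        moreover have "0 \<le> ub r ^ 5" "0 \<le> ub r ^ 4" by auto
        ultimately show ?thesis by linarith
      qed
      show "\<bar>?\<psi> (norm x)\<bar> \<le> 12 * 24 ^ 3 / norm x ^ 3" if "x \<noteq> 0" "norm x \<le> 1" for x :: "real^6"
      proof -
        have "ub (norm x) ^ 4 * norm x ^ 3 \<le> 1 * 1" using that ub_le1[of "norm x"] by (intro mult_mono power_le_one) auto
        then have "12 * ub (norm x) ^ 4 \<le> 12 * 24^3 / norm x ^ 3" using that by (simp add: field_simps)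
        then show ?thesis using p[of "norm x"] by linarith
      qed
      show "\<bar>?\<psi> (norm x)\<bar> \<le> 12 * 24 ^ 3 / norm x ^ 5" if "norm x > 1" for x :: "real^6"
      proof -
        have "ub (norm x) ^ 4 \<le> 24^3 / norm x ^ 5" using ub_pow_bounds(3)[of "norm x" 3 4 5] that by (cases "x = 0") auto
        then show ?thesis using p[of "norm x"] by simp
      qed
    qed measurable
    then show "integrable leb (\<lambda>x. radial_prim f (norm x) * ?\<psi> (norm x))" by (simp add: mult.commute)
  qed (auto intro!: continuous_intros)
  also have "\<dots> = (LINT x|leb. 2 * (W x * (radial_prim f (norm x) * radial_prim dLW (norm x))))"
    unfolding Bochner_Integration.integral_minus[symmetric]
  proof (rule integral_cong_AE)
    show "AE x in leb. - (radial_prim f (norm x) * ?\<psi> (norm x)) = 2 * (W x * (radial_prim f (norm x) * radial_prim dLW (norm x)))"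
      using AE_nonzero by eventually_elim (simp add: radial_prim_dLW W_eq algebra_simps eval_nat_numeral)
  qed measurable
  finally show ?thesis by (simp add: dirichlet_def wform_def dLW_def)
qed

text \<open>Eigenfunctions of a symmetric pair of forms with distinct eigenvalues 1 and 2 are
  orthogonal.\<close>

lemma wform_dW_dLW: "wform dW dLW = 0"
  using dirichlet_dW[OF sq_int_dLW] dirichlet_dLW[OF sq_int_dW] dirichlet_commute[of dW dLW] wform_commute[of dW dLW] by simp

lemma LINT_pos:
  fixes F :: "real^6 \<Rightarrow> real"
  assumes "integrable leb F" "\<And>x. F x \<ge> 0" "\<And>x. 0 < norm x \<Longrightarrow> norm x < 1 \<Longrightarrow> F x > 0"
  shows "(LINT x|leb. F x) > 0"
proof (rule ccontr)
  assume "\<not> ?thesis"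
  then have "(LINT x|leb. F x) = 0" using assms(2) by (simp add: not_less antisym)
  then have "AE x in leb. F x = 0" using integral_nonneg_eq_0_iff_AE[OF assms(1)] assms(2) by simp
  then have "AE x in leb. x \<notin> ball 0 1"
    using AE_nonzero by eventually_elim (use assms(3) in force)
  then have "emeasure leb {x \<in> space leb. \<not> (x \<notin> ball 0 1)} = 0"
    by (subst (asm) AE_iff_measurable[OF _ refl]) auto
  then have "emeasure leb (ball (0::real^6) 1) = 0" by (simp add: ball_def)
  then have "unit_ball_vol 6 = 0" by (simp add: emeasure_ball)
  then show False using unit_ball_vol_pos[of 6] by linarith
qed

lemma wform_dW_pos: "wform dW dW > 0" unfolding wform_def
  by (rule LINT_pos[OF integrable_W_prim2[OF sq_int_dW sq_int_dW]]) (auto simp: W_eq radial_prim_dW)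

lemma wform_dLW_pos: "wform dLW dLW > 0" unfolding wform_def
proof (rule LINT_pos[OF integrable_W_prim2[OF sq_int_dLW sq_int_dLW]])
  fix x :: "real^6" assume x: "0 < norm x" "norm x < 1"
  have "(norm x)\<^sup>2 \<le> 1" using x by (simp add: power_le_one)
  then have "ub (norm x) \<ge> 2/3" using x by (intro ub_zone) auto
  then have "4 * (ub (norm x))^3 - 2 * (ub (norm x))^2 > 0"
  proof -
    have "4 * (ub (norm x))^3 - 2 * (ub (norm x))^2 = (ub (norm x))^2 * (4 * ub (norm x) - 2)" by (simp add: algebra_simps eval_nat_numeral)
    also have "\<dots> > 0" using \<open>ub (norm x) \<ge> 2/3\<close> by (intro mult_pos_pos zero_less_power) auto
    finally show ?thesis .
  qed
  then show "0 < W x * (radial_prim dLW (norm x) * radial_prim dLW (norm x))"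
    using x by (simp add: W_eq radial_prim_dLW)
qed (simp add: W_eq)

lemma dirichlet_add2: "sq_int f \<Longrightarrow> sq_int g \<Longrightarrow> sq_int h \<Longrightarrow> dirichlet h (\<lambda>x. f x + g x) = dirichlet h f + dirichlet h g"
  by (simp add: dirichlet_commute[of h] dirichlet_add)

lemma wform_add2: "sq_int f \<Longrightarrow> sq_int g \<Longrightarrow> sq_int h \<Longrightarrow> wform h (\<lambda>x. f x + g x) = wform h f + wform h g"
  by (simp add: wform_commute[of h] wform_add)

lemma dirichlet_scale2: "dirichlet h (\<lambda>x. c * f x) = c * dirichlet h f"
  by (simp add: dirichlet_commute[of h] dirichlet_scale)

lemma wform_scale2: "wform h (\<lambda>x. c * f x) = c * wform h f"
  by (simp add: wform_commute[of h] wform_scale)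

lemmas form_simps = dirichlet_add dirichlet_add2 dirichlet_scale dirichlet_scale2
  wform_add wform_add2 wform_scale wform_scale2 sq_int_add sq_int_scale

definition modes :: "(real^6 \<Rightarrow> real) \<Rightarrow> real \<Rightarrow> real \<Rightarrow> real^6 \<Rightarrow> real"
  where "modes z a b = (\<lambda>x. z x + (a * dW x + b * dLW x))"

lemma sq_int_modes: "sq_int z \<Longrightarrow> sq_int (modes z a b)"
  by (simp add: modes_def sq_int_add sq_int_scale sq_int_dW sq_int_dLW)

lemma form_dW_dLW:
  "dirichlet dW dW = wform dW dW" "dirichlet dLW dLW = 2 * wform dLW dLW"
  "dirichlet dW dLW = 0" "dirichlet dLW dW = 0" "wform dLW dW = 0"
  using dirichlet_dW[OF sq_int_dW] dirichlet_dLW[OF sq_int_dLW] dirichlet_dLW[OF sq_int_dW]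
    dirichlet_dW[OF sq_int_dLW] wform_dW_dLW wform_commute[of dLW dW] by auto

lemma modes_dirichlet:
  assumes z: "sq_int z"
  shows "dirichlet (modes z a b) (modes z a b) =
    dirichlet z z + a\<^sup>2 * wform dW dW + 2 * b\<^sup>2 * wform dLW dLW + 2 * a * wform z dW + 4 * b * wform z dLW"
  using z dirichlet_dW[OF z] dirichlet_dLW[OF z] dirichlet_commute[of dW z] dirichlet_commute[of dLW z]
  by (simp add: modes_def form_simps sq_int_dW sq_int_dLW form_dW_dLW power2_eq_square algebra_simps)

lemma modes_wform:
  assumes z: "sq_int z"
  shows "wform (modes z a b) (modes z a b) =
    wform z z + a\<^sup>2 * wform dW dW + b\<^sup>2 * wform dLW dLW + 2 * a * wform z dW + 2 * b * wform z dLW"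
  using z wform_commute[of dW z] wform_commute[of dLW z]
  by (simp add: modes_def form_simps sq_int_dW sq_int_dLW form_dW_dLW wform_dW_dLW power2_eq_square algebra_simps)

text \<open>Orthogonality is imposed for the weighted form only; for the Dirichlet form it follows
  from the two eigenvalue equations.\<close>

definition orth_modes :: "(real^6 \<Rightarrow> real) \<Rightarrow> bool"
  where "orth_modes z \<longleftrightarrow> sq_int z \<and> wform z dW = 0 \<and> wform z dLW = 0"

text \<open>Subtracting the combination of \<open>W\<close> and \<open>\<Lambda>W\<close> that interpolates \<open>z\<close> at the two nodes only
  worsens the inequality, since \<open>7/3\<close> exceeds the eigenvalues 1 and 2 of these two modes.\<close>

lemma orth_modes_gap:
  assumes "orth_modes z"
  shows "7/3 * wform z z \<le> dirichlet z z"
proof -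
  have z: "sq_int z" "wform z dW = 0" "wform z dLW = 0" using assms by (auto simp: orth_modes_def)
  define Z1 where "Z1 = radial_prim z (sqrt 12)"
  define Z2 where "Z2 = radial_prim z (sqrt 48)"
  \<comment> \<open>At the nodes the profile of W takes the values 4/9 and 1/9, that of \<Lambda>W
    the values 8/27 and -2/27; a and b solve the resulting 2 by 2 system.\<close>
  define b where "b = - ((Z1 - 4 * Z2) * 27 / 16)"
  define a where "a = - (9 * Z2) + 2 / 3 * b"
  let ?w = "modes z a b"
  have w: "sq_int ?w" by (rule sq_int_modes[OF z(1)])
  have H: "radial_prim ?w r = radial_prim z r + (a * (ub r)^2 + b * (4 * (ub r)^3 - 2 * (ub r)^2))" if "r > 0" for r
    unfolding modes_def using that z
    by (simp add: radial_prim_add radial_prim_scale sq_int_add sq_int_scale sq_int_dW sq_int_dLW radial_prim_dW radial_prim_dLW)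
  have u: "ub (sqrt 12) = 2/3" "ub (sqrt 48) = 1/3" by (simp_all add: ub_def)
  have "radial_prim ?w (sqrt 12) = Z1 + (a * (2/3)^2 + b * (4 * (2/3)^3 - 2 * (2/3)^2))"
    by (simp add: H u Z1_def)
  also have "\<dots> = 0" unfolding a_def b_def by (simp add: field_simps eval_nat_numeral)
  finally have n1: "radial_prim ?w (sqrt 12) = 0" .
  have "radial_prim ?w (sqrt 48) = Z2 + (a * (1/3)^2 + b * (4 * (1/3)^3 - 2 * (1/3)^2))"
    by (simp add: H u Z2_def)
  also have "\<dots> = 0" unfolding a_def b_def by (simp add: field_simps eval_nat_numeral)
  finally have n2: "radial_prim ?w (sqrt 48) = 0" .
  have "7/3 * wform ?w ?w \<le> dirichlet ?w ?w"
    using two_node_gap[OF w n1 n2] by (simp add: wform_def dirichlet_def power2_eq_square)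
  \<comment> \<open>The extra coefficients are 7/3 - 1 for W and 7/3 - 2 for \<Lambda>W, both
    positive.\<close>
  then have "7/3 * wform z z + 4/3 * (a\<^sup>2 * wform dW dW) + 1/3 * (b\<^sup>2 * wform dLW dLW) \<le> dirichlet z z"
    unfolding modes_dirichlet[OF z(1)] modes_wform[OF z(1)] z(2,3)
    by (simp only: mult.assoc mult_zero_right add_0_right distrib_left)
  moreover have "0 \<le> a\<^sup>2 * wform dW dW" "0 \<le> b\<^sup>2 * wform dLW dLW" by (auto intro: mult_nonneg_nonneg wform_nonneg)
  ultimately show ?thesis by linarith
qed

lemma mode_decomposition:
  assumes f: "sq_int f"
  obtains a b z where "orth_modes z" "f = modes z a b"
proof
  define a where "a = - (wform f dW / wform dW dW)"
  define b where "b = - (wform f dLW / wform dLW dLW)"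
  let ?z = "modes f a b"
  have nz: "wform dW dW \<noteq> 0" "wform dLW dLW \<noteq> 0" using wform_dW_pos wform_dLW_pos by auto
  show "orth_modes ?z"
    unfolding orth_modes_def
  proof (intro conjI sq_int_modes[OF f])
    have "wform ?z dW = wform f dW + a * wform dW dW"
      using f by (simp add: modes_def wform_add sq_int_add sq_int_scale sq_int_dW sq_int_dLW wform_scale form_dW_dLW)
    then show "wform ?z dW = 0" using nz by (simp add: a_def)
    have "wform ?z dLW = wform f dLW + b * wform dLW dLW"
      using f by (simp add: modes_def wform_add sq_int_add sq_int_scale sq_int_dW sq_int_dLW wform_scale wform_dW_dLW)
    then show "wform ?z dLW = 0" using nz by (simp add: b_def)
  qed
  show "f = modes ?z (- a) (- b)" by (simp add: modes_def fun_eq_iff)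
qed

lemma orth_modes_values:
  assumes "orth_modes z"
  shows "dirichlet (modes z a b) (modes z a b) = dirichlet z z + a\<^sup>2 * wform dW dW + 2 * b\<^sup>2 * wform dLW dLW"
    and "wform (modes z a b) (modes z a b) = wform z z + a\<^sup>2 * wform dW dW + b\<^sup>2 * wform dLW dLW"
  using assms by (simp_all add: orth_modes_def modes_dirichlet modes_wform)

lemma wform_le_dirichlet: "sq_int f \<Longrightarrow> wform f f \<le> dirichlet f f"
proof -
  assume "sq_int f"
  then obtain a b z where z: "orth_modes z" and f: "f = modes z a b" by (rule mode_decomposition)
  have "0 \<le> b\<^sup>2 * wform dLW dLW" by (intro mult_nonneg_nonneg wform_nonneg) auto
  then show ?thesis using orth_modes_gap[OF z] wform_nonneg[of z] unfolding f orth_modes_values[OF z] by linarith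
qed

section \<open>Pairings of kernels with primitives\<close>

definition lin :: "(real^6 \<Rightarrow> real) \<Rightarrow> (real^6 \<Rightarrow> real) \<Rightarrow> real"
  where "lin k f = (LINT x|leb. k x * radial_prim f (norm x))"

text \<open>The two bounds are what pairing with a primitive of size |x|^-2 needs: the product is
  integrable at the origin and decays like |x|^-7 at infinity.\<close>

definition kernel :: "(real^6 \<Rightarrow> real) \<Rightarrow> bool"
  where "kernel k \<longleftrightarrow> k \<in> borel_measurable leb \<and> (\<exists>C. \<forall>x. \<bar>k x\<bar> \<le> C \<and> \<bar>k x\<bar> * norm x ^ 5 \<le> C)"

lemma kernel_integrable:
  assumes "kernel k" "sq_int f"
  shows "integrable leb (\<lambda>x. k x * radial_prim f (norm x))"
proof -
  obtain C where C: "\<And>x. \<bar>k x\<bar> \<le> C" "\<And>x. \<bar>k x\<bar> * norm x ^ 5 \<le> C" using assms by (auto simp: kernel_def)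
  show ?thesis
  proof (rule integrable_weight_prim[OF assms(2)])
    show "k \<in> borel_measurable leb" using assms by (simp add: kernel_def)
    show "\<bar>k x\<bar> \<le> C / norm x ^ 3" if "x \<noteq> 0" "norm x \<le> 1" for x
    proof -
      have "\<bar>k x\<bar> * norm x ^ 3 \<le> C * 1" using C(1)[of x] that by (intro mult_mono power_le_one) auto
      then show ?thesis using that by (simp add: field_simps)
    qed
    show "\<bar>k x\<bar> \<le> C / norm x ^ 5" if "norm x > 1" for x
    proof -
      have "0 < norm x ^ 5" using that by (intro zero_less_power) linarith
      then show ?thesis using C(2)[of x] by (simp add: pos_le_divide_eq)
    qed
  qed
qed

lemma lin_add:
  assumes k: "kernel k" and fg: "sq_int f" "sq_int g"
  shows "lin k (\<lambda>x. f x + g x) = lin k f + lin k g"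
proof -
  note [measurable] = borel_measurable_radial_prim[OF fg(1)] borel_measurable_radial_prim[OF fg(2)] borel_measurable_radial_prim[OF sq_int_add[OF fg]]
  have [measurable]: "k \<in> borel_measurable leb" using k by (simp add: kernel_def)
  have "lin k (\<lambda>x. f x + g x) = (LINT x|leb. k x * radial_prim f (norm x) + k x * radial_prim g (norm x))"
    unfolding lin_def
  proof (rule integral_cong_AE)
    show "AE x in leb. k x * radial_prim (\<lambda>x. f x + g x) (norm x) = k x * radial_prim f (norm x) + k x * radial_prim g (norm x)"
      using AE_nonzero by eventually_elim (use fg in \<open>simp add: radial_prim_add algebra_simps\<close>)
  qed measurable
  also have "\<dots> = lin k f + lin k g"
    unfolding lin_def by (intro Bochner_Integration.integral_add kernel_integrable k fg)
  finally show ?thesis .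
qed

lemma lin_scale: "lin k (\<lambda>x. c * f x) = c * lin k f"
  unfolding lin_def radial_prim_scale by (subst integral_mult_right_zero[symmetric]) (simp add: mult_ac)

lemma lin_modes:
  assumes "kernel k" "sq_int z"
  shows "lin k (modes z a b) = lin k z + a * lin k dW + b * lin k dLW"
  using assms by (simp add: modes_def lin_add lin_scale sq_int_add sq_int_scale sq_int_dW sq_int_dLW)

lemma integrable_W_sq: "integrable leb (\<lambda>x. (ub (norm x))^4)" "integrable leb (\<lambda>x. (ub (norm x))^5)"
proof -
  have "integrable leb (\<lambda>x. (ub (norm x))^k)" if "k \<ge> 4" for k
  proof (rule integrable_two_powers[where C = "24^4"])
    show "\<bar>(ub (norm x))^k\<bar> \<le> 24^4 / norm x ^ 5" if "x \<noteq> 0" "norm x \<le> 1" for x :: "real^6"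
    proof -
      have "(ub (norm x))^k * norm x ^ 5 \<le> 1 * 1" using that ub_le1[of "norm x"] by (intro mult_mono power_le_one) auto
      then show ?thesis using that by (simp add: field_simps)
    qed
    show "\<bar>(ub (norm x))^k\<bar> \<le> 24^4 / norm x ^ 7" if "norm x > 1" for x :: "real^6"
      using ub_pow_bounds(3)[of "norm x" 4 k 7] that \<open>k \<ge> 4\<close> by (cases "x = 0") auto
  qed measurable
  then show "integrable leb (\<lambda>x. (ub (norm x))^4)" "integrable leb (\<lambda>x. (ub (norm x))^5)" by auto
qed

text \<open>This is \<langle>W, \<Lambda>W\<rangle> = -||W||^2, because \<Lambda> = 2 + x.\<nabla>
  and x.\<nabla> + 3 is antisymmetric in dimension 6. As the value is nonzero, each of the two modes
  can be detected by pairing with the other.\<close>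

lemma W_LW_pairing:
  "(LINT x|leb. (ub (norm x))^2 * (4 * (ub (norm x))^3 - 2 * (ub (norm x))^2)) = - (LINT x|leb. (ub (norm x))^4)"
proof -
  note [measurable] = borel_measurable_radial_prim[OF sq_int_dW]
  have e: "ub r ^ 2 * ub r ^ 2 = ub r ^ 4" "ub r ^ 2 * ub r ^ 3 = ub r ^ 5" for r by (simp_all flip: power_add)
  have i1: "integrable leb (\<lambda>x. 4 * (ub (norm x))^5 - 4 * (ub (norm x))^4)"
    "integrable leb (\<lambda>x. 2 * (ub (norm x))^4 + 4 * (ub (norm x))^5)" using integrable_W_sq by auto
  have a: "dW x * (norm x * (ub (norm x))^2) = 4 * (ub (norm x))^5 - 4 * (ub (norm x))^4" for x
  proof -
    have "dW x * (norm x * (ub (norm x))^2) = - ((norm x)\<^sup>2 * ub (norm x)) / 6 * (ub (norm x))^4"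
      by (simp add: dW_def eval_nat_numeral)
    also have "\<dots> = 4 * (ub (norm x))^5 - 4 * (ub (norm x))^4" unfolding ub_sq by (simp add: field_simps eval_nat_numeral)
    finally show ?thesis .
  qed
  have b: "AE x in leb. radial_prim dW (norm x) * (2 * (ub (norm x))^2 + 4 * (ub (norm x))^3) = 2 * (ub (norm x))^4 + 4 * (ub (norm x))^5"
    using AE_nonzero by eventually_elim (simp add: radial_prim_dW distrib_left mult.left_commute e)
  \<comment> \<open>The field is x W, with divergence 6 W + x.\<nabla>W = 2 ub^2 + 4 ub^3.\<close>
  have "(LINT x|leb. dW x * (norm x * (ub (norm x))^2)) = - (LINT x|leb. radial_prim dW (norm x) * (2 * (ub (norm x))^2 + 4 * (ub (norm x))^3))"
  proof (rule radial_by_parts[OF sq_int_dW, where C = 600])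
    fix r :: real assume r: "r > 0"
    have "((\<lambda>r. r ^ 5 * (r * (ub r)^2)) has_real_derivative r^5 * (6 * (ub r)^2 - (r^2 * ub r) / 6 * (ub r)^2)) (at r)"
      by (auto intro!: derivative_eq_intros simp: algebra_simps eval_nat_numeral)
    also have "6 * (ub r)^2 - (r^2 * ub r) / 6 * (ub r)^2 = 2 * (ub r)^2 + 4 * (ub r)^3"
      unfolding ub_sq by (simp add: field_simps eval_nat_numeral)
    finally show "((\<lambda>r. r ^ 5 * (r * (ub r)^2)) has_real_derivative r^5 * (2 * (ub r)^2 + 4 * (ub r)^3)) (at r)" .
    have "r^2 * ub r^2 \<le> 24" "r^4 * ub r ^ 2 \<le> 24^2" using ub_pow_bound[of 1 2 r] ub_pow_bound[of 2 2 r] by auto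
    have "r * ub r ^ 2 \<le> 600"
    proof (cases "r \<le> 1")
      case True then show ?thesis using mult_mono[of r 1 "ub r ^ 2" 1] ub_pow_bounds(1)[OF r, of 2] r by simp
    next
      case False
      then have "r * ub r ^ 2 \<le> r^2 * ub r ^ 2" by (intro mult_right_mono) (auto simp: power2_eq_square)
      then show ?thesis using \<open>r^2 * ub r^2 \<le> 24\<close> by linarith
    qed
    then show "\<bar>r * (ub r)^2\<bar> \<le> 600" using r by (simp add: abs_mult)
    show "\<bar>r ^ 3 * (r * (ub r)^2)\<bar> \<le> 600" using \<open>r^4 * ub r ^ 2 \<le> 24^2\<close> r by (simp add: abs_mult eval_nat_numeral)
  next
    show "integrable leb (\<lambda>x. dW x * (norm x * (ub (norm x))^2))" unfolding a by (rule i1)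
    show "integrable leb (\<lambda>x. radial_prim dW (norm x) * (2 * (ub (norm x))^2 + 4 * (ub (norm x))^3))"
      by (subst integrable_cong_AE[OF _ _ b]) (measurable, rule i1)
  qed (auto intro!: continuous_intros)
  also have "(LINT x|leb. radial_prim dW (norm x) * (2 * (ub (norm x))^2 + 4 * (ub (norm x))^3)) = (LINT x|leb. 2 * (ub (norm x))^4 + 4 * (ub (norm x))^5)"
    by (rule integral_cong_AE[OF _ _ b]) measurable
  finally have "4 * (LINT x|leb. (ub (norm x))^5) - 4 * (LINT x|leb. (ub (norm x))^4) = - (2 * (LINT x|leb. (ub (norm x))^4) + 4 * (LINT x|leb. (ub (norm x))^5))"
    unfolding a using integrable_W_sq by simp
  moreover have "(LINT x|leb. (ub (norm x))^2 * (4 * (ub (norm x))^3 - 2 * (ub (norm x))^2)) = (LINT x|leb. 4 * (ub (norm x))^5 - 2 * (ub (norm x))^4)"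
    by (intro Bochner_Integration.integral_cong refl) (simp add: right_diff_distrib mult.left_commute e)
  moreover have "\<dots> = 4 * (LINT x|leb. (ub (norm x))^5) - 2 * (LINT x|leb. (ub (norm x))^4)"
    using integrable_W_sq by simp
  ultimately show ?thesis by linarith
qed

text \<open>Outside the unit ball |x| k is paired with H/|x|, and Hardy controls the latter. Since
  |k| \<le> 576 M |x|^-4, the square of |x| k integrates over 1 < |x| \<le> 2R to at most a constant
  times the integral of dr/r, hence the logarithm. Inside the unit ball the pointwise bound on H
  suffices.\<close>

lemma kernel_truncated_bound:
  assumes k [measurable]: "k \<in> borel_measurable leb" and kW: "\<And>x. \<bar>k x\<bar> \<le> M * W x"
    and supp: "\<And>x. norm x > 2 * R \<Longrightarrow> k x = 0" and R: "R \<ge> 2" and f: "sq_int f" and kk: "kernel k"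
  shows "(lin k f)\<^sup>2 \<le> 4 * 576\<^sup>2 * M\<^sup>2 * sphere_area * (1 + ln R) * dirichlet f f"
proof -
  let ?H = "radial_prim f" and ?E = "dirichlet f f"
  note [measurable] = borel_measurable_radial_prim[OF f]
  have M0: "M \<ge> 0" using kW[of 0] by (simp add: W_eq ub_def)
  have E: "?E = (LINT x|leb. (f x)\<^sup>2)" by (simp add: dirichlet_def power2_eq_square)
  have E0: "?E \<ge> 0" by (rule dirichlet_nonneg)
  let ?A = "\<lambda>x. indicator {..1} (norm x) * (k x * ?H (norm x))" and ?B = "\<lambda>x. indicator {1<..2*R} (norm x) * (k x * ?H (norm x))"
  have i: "integrable leb (\<lambda>x. k x * ?H (norm x))" by (rule kernel_integrable[OF kk f])
  have iA: "integrable leb ?A" by (rule Bochner_Integration.integrable_bound[OF i]) (measurable, auto simp: indicator_def)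
  have iB: "integrable leb ?B" by (rule Bochner_Integration.integrable_bound[OF i]) (measurable, auto simp: indicator_def)
  have "lin k f = (LINT x|leb. ?A x + ?B x)"
    unfolding lin_def by (intro Bochner_Integration.integral_cong refl) (use supp in \<open>auto simp: indicator_def not_le\<close>)
  also have "\<dots> = (LINT x|leb. ?A x) + (LINT x|leb. ?B x)" by (rule Bochner_Integration.integral_add[OF iA iB])
  finally have L: "lin k f = (LINT x|leb. ?A x) + (LINT x|leb. ?B x)" .
  let ?K = "sqrt (?E / (4 * sphere_area))"
  have A: "\<bar>LINT x|leb. ?A x\<bar> \<le> M * ?K * (sphere_area / 4)"
  proof -
    have "\<bar>LINT x|leb. ?A x\<bar> \<le> (LINT x|leb. \<bar>?A x\<bar>)" using integral_norm_bound[of leb ?A] by simp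
    also have "\<dots> \<le> (LINT x|leb. M * ?K * (indicator {..1} (norm x) * (1 / norm x ^ 2)))"
    proof (rule integral_mono_AE)
      show "integrable leb (\<lambda>x. \<bar>?A x\<bar>)" using iA by simp
      show "integrable leb (\<lambda>x. M * ?K * (indicator {..1} (norm x) * (1 / norm x ^ 2)))"
        by (intro integrable_mult_right ball_power) auto
      show "AE x in leb. \<bar>?A x\<bar> \<le> M * ?K * (indicator {..1} (norm x) * (1 / norm x ^ 2))"
        using AE_nonzero
      proof eventually_elim
        case (elim x)
        have "\<bar>(norm x)\<^sup>2 * ?H (norm x)\<bar> \<le> ?K" using radial_prim_abs_bound[OF f, of "norm x"] elim E by simp
        then have h: "\<bar>?H (norm x)\<bar> \<le> ?K / norm x ^ 2" using elim by (simp add: field_simps abs_mult)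
        have "W x \<le> 1" unfolding W_eq by (intro power_le_one ub_le1) auto
        then have "\<bar>k x\<bar> \<le> M * 1" using kW[of x] M0 by (meson mult_left_mono order_trans)
        then have "\<bar>k x\<bar> * \<bar>?H (norm x)\<bar> \<le> M * (?K / norm x ^ 2)" using h M0 by (intro mult_mono) auto
        then show ?case by (auto simp: indicator_def abs_mult)
      qed
    qed
    also have "\<dots> = M * ?K * (sphere_area / 4)"
      by (simp only: integral_mult_right_zero) (subst ball_power(2), auto)
    finally show ?thesis .
  qed
  have B: "(LINT x|leb. ?B x)\<^sup>2 \<le> 576\<^sup>2 * M\<^sup>2 * (sphere_area * ln (2*R)) * ?E"
  proof -
    let ?g1 = "\<lambda>x. indicator {1<..2*R} (norm x) * (norm x * k x)" and ?g2 = "\<lambda>x. indicator {1<..2*R} (norm x) / norm x * ?H (norm x)"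
    have eqB: "(LINT x|leb. ?B x) = (LINT x|leb. ?g1 x * ?g2 x)"
      by (intro Bochner_Integration.integral_cong refl) (auto simp: indicator_def)
    have g2sq: "(?g2 x)\<^sup>2 = indicator {1<..2*R} (norm x) / (norm x)\<^sup>2 * (?H (norm x))\<^sup>2" for x :: "real^6"
      by (auto simp: indicator_def power2_eq_square)
    \<comment> \<open>The density is |x|^-6, written as (1/|x|)/|x|^5 so that
      \<open>annulus_FTC\<close> applies with the logarithm as antiderivative.\<close>
    have iln: "integrable leb (\<lambda>x. 576\<^sup>2 * M\<^sup>2 * (indicator {1<..2*R} (norm x) * (1 / norm x / norm x ^ 5)))"
      "(LINT x|leb. indicator {1<..2*R} (norm x) * (1 / norm x / norm x ^ 5)) = sphere_area * (ln (2*R) - ln 1)"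
    proof -
      have d: "(ln has_real_derivative 1 / r) (at r)" if "1 \<le> r" for r :: real
        using DERIV_ln_divide[of r] that by simp
      have c: "continuous_on {1..2*R} (\<lambda>r. 1 / r)" by (intro continuous_intros) auto
      have 2: "1 \<le> 2 * R" using R by simp
      show "integrable leb (\<lambda>x. 576\<^sup>2 * M\<^sup>2 * (indicator {1<..2*R} (norm x) * (1 / norm x / norm x ^ 5)))"
        by (rule integrable_mult_right, rule annulus_FTC(1)[OF zero_less_one 2 d c])
      show "(LINT x|leb. indicator {1<..2*R} (norm x) * (1 / norm x / norm x ^ 5)) = sphere_area * (ln (2*R) - ln 1)"
        by (rule annulus_FTC(2)[OF zero_less_one 2 d c])
    qed
    have le: "(?g1 x)\<^sup>2 \<le> 576\<^sup>2 * M\<^sup>2 * (indicator {1<..2*R} (norm x) * (1 / norm x / norm x ^ 5))" for x :: "real^6"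
    proof (cases "norm x \<in> {1<..2*R}")
      case True
      have "W x \<le> 24^2 / norm x^4" unfolding W_eq using ub_pow_bounds(2)[of "norm x" 2 2] True by (cases "x = 0") auto
      then have "\<bar>k x\<bar> \<le> M * (24^2 / norm x^4)" using kW[of x] M0 by (meson mult_left_mono order_trans)
      then have "norm x * \<bar>k x\<bar> \<le> norm x * (M * (24^2 / norm x^4))" by (intro mult_left_mono) auto
      also have "\<dots> = 576 * M / norm x^3" using True by (simp add: field_simps eval_nat_numeral)
      finally have "(norm x * \<bar>k x\<bar>)\<^sup>2 \<le> (576 * M / norm x^3)\<^sup>2" by (intro power_mono) auto
      then show ?thesis using True by (simp add: power_mult_distrib power_divide eval_nat_numeral)
    qed auto
    have ig1: "integrable leb (\<lambda>x. (?g1 x)\<^sup>2)"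
      by (rule Bochner_Integration.integrable_bound[OF iln(1)]) (measurable, use le in \<open>auto intro!: AE_I2 order_trans[OF _ abs_ge_self]\<close>)
    have "(LINT x|leb. (?g1 x)\<^sup>2) \<le> (LINT x|leb. 576\<^sup>2 * M\<^sup>2 * (indicator {1<..2*R} (norm x) * (1 / norm x / norm x ^ 5)))"
      by (rule integral_mono[OF ig1 iln(1) le])
    also have "\<dots> = 576\<^sup>2 * M\<^sup>2 * (sphere_area * ln (2*R))" by (simp only: integral_mult_right_zero iln(2)) simp
    finally have b1: "(LINT x|leb. (?g1 x)\<^sup>2) \<le> 576\<^sup>2 * M\<^sup>2 * (sphere_area * ln (2*R))" .
    have ig2: "integrable leb (\<lambda>x. (?g2 x)\<^sup>2)"
    proof -
      have "integrable leb (\<lambda>x. (indicator {1<..2*R} (norm x) / (norm x)\<^sup>2) * (?H (norm x) * ?H (norm x)))"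
      proof (rule integrable_weight_prim2[OF f f, where C = "2*R"])
        show "\<bar>indicator {1<..2*R} r / r\<^sup>2\<bar> \<le> 2*R / r" if "0 < r" "r \<le> 1" for r
          using that R by auto
        show "\<bar>indicator {1<..2*R} r / r\<^sup>2\<bar> \<le> 2*R / r^3" if "1 < r" for r
          using that R by (auto simp: indicator_def field_simps eval_nat_numeral)
      qed measurable
      then show ?thesis unfolding g2sq by (simp add: power2_eq_square)
    qed
    have b2: "(LINT x|leb. (?g2 x)\<^sup>2) \<le> ?E" unfolding g2sq E using R by (intro hardy_truncated f) auto
    have "(LINT x|leb. ?B x)\<^sup>2 \<le> (LINT x|leb. (?g1 x)\<^sup>2) * (LINT x|leb. (?g2 x)\<^sup>2)"
      unfolding eqB by (rule cauchy_schwarz_integral[OF _ _ ig1 ig2]) measurable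
    also have "\<dots> \<le> 576\<^sup>2 * M\<^sup>2 * (sphere_area * ln (2*R)) * ?E" using b1 b2 R by (intro mult_mono) auto
    finally show ?thesis .
  qed
  have "(LINT x|leb. ?A x)\<^sup>2 \<le> (M * ?K * (sphere_area / 4))\<^sup>2" using power_mono[OF A, of 2] by simp
  also have "\<dots> = M\<^sup>2 * sphere_area * ?E / 64"
  proof -
    have "?K\<^sup>2 = ?E / (4 * sphere_area)" using E0 by simp
    then show ?thesis by (simp add: power_mult_distrib power_divide) (simp add: field_simps power2_eq_square)
  qed
  finally have A2: "(LINT x|leb. ?A x)\<^sup>2 \<le> M\<^sup>2 * sphere_area * ?E / 64" .
  have MS: "0 \<le> M\<^sup>2 * sphere_area * ?E" using E0 by simp
  have "ln (2*R) = ln 2 + ln R" using R by (simp add: ln_mult)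
  moreover have "ln (2::real) \<le> 1" using ln_le_minus_one[of 2] by simp
  ultimately have "ln (2*R) \<le> 1 + ln R" by linarith
  then have "M\<^sup>2 * sphere_area * ?E * ln (2*R) \<le> M\<^sup>2 * sphere_area * ?E * (1 + ln R)" using MS by (rule mult_left_mono)
  then have "576\<^sup>2 * (M\<^sup>2 * sphere_area * ?E * ln (2*R)) \<le> 576\<^sup>2 * (M\<^sup>2 * sphere_area * ?E * (1 + ln R))"
    by (rule mult_left_mono) simp
  moreover have "(LINT x|leb. ?B x)\<^sup>2 \<le> 576\<^sup>2 * (M\<^sup>2 * sphere_area * ?E * ln (2*R))" using B by (simp only: mult_ac)
  ultimately have B2: "(LINT x|leb. ?B x)\<^sup>2 \<le> 576\<^sup>2 * (M\<^sup>2 * sphere_area * ?E * (1 + ln R))" by linarith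
  have lnR: "ln R \<ge> 0" using R by simp
  have A3: "(LINT x|leb. ?A x)\<^sup>2 \<le> M\<^sup>2 * sphere_area * ?E * (1 + ln R)"
  proof -
    have "M\<^sup>2 * sphere_area * ?E / 64 \<le> M\<^sup>2 * sphere_area * ?E * 1" using MS by linarith
    also have "\<dots> \<le> M\<^sup>2 * sphere_area * ?E * (1 + ln R)" using MS lnR by (intro mult_left_mono) auto
    finally show ?thesis using A2 by linarith
  qed
  have "(lin k f)\<^sup>2 \<le> 2 * (LINT x|leb. ?A x)\<^sup>2 + 2 * (LINT x|leb. ?B x)\<^sup>2"
    unfolding L using sum_squares_bound[of "LINT x|leb. ?A x" "LINT x|leb. ?B x"] by (simp add: power2_sum)
  also have "\<dots> \<le> 4 * 576\<^sup>2 * (M\<^sup>2 * sphere_area * ?E * (1 + ln R))"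
  proof -
    have "0 \<le> M\<^sup>2 * sphere_area * ?E * (1 + ln R)" using MS lnR by (intro mult_nonneg_nonneg[OF MS]) simp
    moreover have n: "(576::real)\<^sup>2 = 331776" by simp
    ultimately show ?thesis using A3 B2 unfolding n by linarith
  qed
  finally show ?thesis by (simp add: mult_ac)
qed

section \<open>Coercivity\<close>

definition W_mass :: real where "W_mass = (LINT x|leb. (ub (norm x))^4)"

lemma W_mass_pos: "W_mass > 0"
  unfolding W_mass_def by (rule LINT_pos[OF integrable_W_sq(1)]) auto

text \<open>Uniform in the truncation: W^2 is integrable at infinity, so the modes, unlike a general
  function of finite energy, pair with truncated kernels without a logarithm.\<close>

lemma lin_mode_bounds:
  assumes k: "kernel k" and kW: "\<And>x. \<bar>k x\<bar> \<le> M * W x" and M: "M \<ge> 0"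
  shows "\<bar>lin k dW\<bar> \<le> 2 * M * W_mass" "\<bar>lin k dLW\<bar> \<le> 2 * M * W_mass"
proof -
  have [measurable]: "k \<in> borel_measurable leb" using k by (simp add: kernel_def)
  have *: "\<bar>lin k f\<bar> \<le> 2 * M * W_mass" if f: "sq_int f" and b: "\<And>r. r > 0 \<Longrightarrow> \<bar>radial_prim f r\<bar> \<le> 2 * (ub r)^2" for f
  proof -
    note [measurable] = borel_measurable_radial_prim[OF f]
    have "\<bar>lin k f\<bar> \<le> (LINT x|leb. \<bar>k x * radial_prim f (norm x)\<bar>)"
      unfolding lin_def using integral_norm_bound[of leb "\<lambda>x. k x * radial_prim f (norm x)"] by simp
    also have "\<dots> \<le> (LINT x|leb. 2 * M * (ub (norm x))^4)"
    proof (rule integral_mono_AE)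
      show "integrable leb (\<lambda>x. \<bar>k x * radial_prim f (norm x)\<bar>)" using kernel_integrable[OF k f] by simp
      show "integrable leb (\<lambda>x. 2 * M * ub (norm x) ^ 4)" using integrable_W_sq(1) by simp
      show "AE x in leb. \<bar>k x * radial_prim f (norm x)\<bar> \<le> 2 * M * ub (norm x) ^ 4"
        using AE_nonzero
      proof eventually_elim
        case (elim x)
        have "\<bar>k x\<bar> * \<bar>radial_prim f (norm x)\<bar> \<le> (M * (ub (norm x))^2) * (2 * (ub (norm x))^2)"
          using kW[of x] b[of "norm x"] elim M by (intro mult_mono) (auto simp: W_eq)
        also have "\<dots> = 2 * M * ub (norm x) ^ 4" by (simp add: eval_nat_numeral)
        finally show ?case by (simp add: abs_mult)
      qed
    qed
    also have "\<dots> = 2 * M * W_mass" by (simp add: W_mass_def)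
    finally show ?thesis .
  qed
  show "\<bar>lin k dW\<bar> \<le> 2 * M * W_mass" by (rule *[OF sq_int_dW]) (simp add: radial_prim_dW)
  show "\<bar>lin k dLW\<bar> \<le> 2 * M * W_mass"
  proof (rule *[OF sq_int_dLW])
    fix r :: real assume r: "r > 0"
    have "4 * ub r ^ 3 - 2 * (ub r)\<^sup>2 = (ub r)^2 * (4 * ub r - 2)" by (simp add: algebra_simps eval_nat_numeral)
    moreover have "\<bar>4 * ub r - 2\<bar> \<le> 2" using ub_le1[of r] ub_pos[of r] by linarith
    ultimately show "\<bar>radial_prim dLW r\<bar> \<le> 2 * (ub r)\<^sup>2"
      using r mult_left_mono[of "\<bar>4 * ub r - 2\<bar>" 2 "(ub r)^2"] by (simp add: radial_prim_dLW abs_mult)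
  qed
qed

text \<open>The linear relation is solved for a, whose coefficient l1 stays away from zero. It
  serves to recover the coefficient of W for L- and, with a and b exchanged, that of \<Lambda>W for
  L+.\<close>

lemma mode_coeff_bound:
  fixes a b l l1 l2 lz E L K m N :: real
  assumes l: "l = lz + a * l1 + b * l2" and m: "0 < m" "m \<le> \<bar>l1\<bar>" and N: "\<bar>l2\<bar> \<le> N" and lz: "lz\<^sup>2 \<le> K * L * E"
    and pos: "0 \<le> K" "0 \<le> L" "0 \<le> E"
  shows "a\<^sup>2 \<le> 3 * (1 + N\<^sup>2 + K) / m\<^sup>2 * (l\<^sup>2 + b\<^sup>2 + L * E)"
proof -
  have "m\<^sup>2 \<le> l1\<^sup>2" using m power_mono[of m "\<bar>l1\<bar>" 2] by simp
  then have "a\<^sup>2 * m\<^sup>2 \<le> a\<^sup>2 * l1\<^sup>2" by (intro mult_left_mono) auto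
  also have "\<dots> = (l - b * l2 - lz)\<^sup>2" using l by (simp add: power_mult_distrib)
  also have "\<dots> \<le> 3 * (l\<^sup>2 + (b * l2)\<^sup>2 + lz\<^sup>2)"
  proof -
    have "0 \<le> (l + b * l2)\<^sup>2 + (l + lz)\<^sup>2 + (b * l2 - lz)\<^sup>2" by simp
    then show ?thesis by (simp add: power2_eq_square algebra_simps)
  qed
  also have "\<dots> \<le> 3 * (1 + N\<^sup>2 + K) * (l\<^sup>2 + b\<^sup>2 + L * E)"
  proof -
    have "l2\<^sup>2 \<le> N\<^sup>2" using N power_mono[of "\<bar>l2\<bar>" N 2] by simp
    then have "l2\<^sup>2 * b\<^sup>2 \<le> N\<^sup>2 * b\<^sup>2" by (intro mult_right_mono) auto
    then have "(b * l2)\<^sup>2 \<le> N\<^sup>2 * b\<^sup>2" by (simp only: power_mult_distrib mult.commute)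
    moreover have "0 \<le> N\<^sup>2 * l\<^sup>2" "0 \<le> N\<^sup>2 * (L * E)" "0 \<le> K * l\<^sup>2" "0 \<le> K * b\<^sup>2" "0 \<le> L * E" "0 \<le> b\<^sup>2"
      using pos by auto
    moreover have "lz\<^sup>2 \<le> K * (L * E)" using lz by (simp only: mult.assoc)
    moreover have "(1 + N\<^sup>2 + K) * (l\<^sup>2 + b\<^sup>2 + L * E) = l\<^sup>2 + b\<^sup>2 + L * E + N\<^sup>2 * l\<^sup>2 + N\<^sup>2 * b\<^sup>2 + N\<^sup>2 * (L * E) + K * l\<^sup>2 + K * b\<^sup>2 + K * (L * E)"
      by (simp add: algebra_simps)
    ultimately have "l\<^sup>2 + (b * l2)\<^sup>2 + lz\<^sup>2 \<le> (1 + N\<^sup>2 + K) * (l\<^sup>2 + b\<^sup>2 + L * E)"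
      by linarith
    then have "3 * (l\<^sup>2 + (b * l2)\<^sup>2 + lz\<^sup>2) \<le> 3 * ((1 + N\<^sup>2 + K) * (l\<^sup>2 + b\<^sup>2 + L * E))"
      by (rule mult_left_mono) simp
    then show ?thesis by (simp only: mult.assoc)
  qed
  finally show ?thesis using m by (simp add: field_simps)
qed

text \<open>Abstracts what the cutoff times W and the cutoff times \<Lambda>W have in common, so
  that both forms share the same estimates.\<close>

definition truncated_kernels :: "(real \<Rightarrow> real^6 \<Rightarrow> real) \<Rightarrow> real \<Rightarrow> bool"
  where "truncated_kernels k M \<longleftrightarrow> M \<ge> 0 \<and> (\<forall>R\<ge>2. kernel (k R) \<and> (\<forall>x. \<bar>k R x\<bar> \<le> M * W x) \<and> (\<forall>x. norm x > 2 * R \<longrightarrow> k R x = 0))"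

lemma truncated_kernels_bound:
  assumes k: "truncated_kernels k M" and R: "R \<ge> 2" "ln R \<ge> 1" and f: "sq_int f"
  shows "(lin (k R) f)\<^sup>2 \<le> (8 * 576\<^sup>2 * M\<^sup>2 * sphere_area) * ln R * dirichlet f f"
proof -
  have kR: "kernel (k R)" "\<And>x. \<bar>k R x\<bar> \<le> M * W x" "\<And>x. norm x > 2 * R \<Longrightarrow> k R x = 0"
    using k R by (auto simp: truncated_kernels_def)
  have [measurable]: "k R \<in> borel_measurable leb" using kR by (simp add: kernel_def)
  have "(lin (k R) f)\<^sup>2 \<le> 4 * 576\<^sup>2 * M\<^sup>2 * sphere_area * (1 + ln R) * dirichlet f f"
    by (rule kernel_truncated_bound) (use kR R f in auto)
  also have "\<dots> \<le> 4 * 576\<^sup>2 * M\<^sup>2 * sphere_area * (2 * ln R) * dirichlet f f"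
    using R dirichlet_nonneg[of f] by (intro mult_right_mono mult_left_mono) auto
  finally show ?thesis by (simp add: mult_ac)
qed

lemma coercive_minus:
  assumes k: "truncated_kernels k M" and m: "m > 0" and l1: "eventually (\<lambda>R. \<bar>lin (k R) dW\<bar> \<ge> m) at_top"
  shows "\<exists>c>0. \<exists>C>0. eventually (\<lambda>R. \<forall>f. sq_int f \<longrightarrow>
    dirichlet f f - wform f f \<ge> c / ln R * dirichlet f f - C * (lin (k R) f)\<^sup>2) at_top"
proof -
  define p where "p = wform dW dW"
  define q where "q = wform dLW dLW"
  have pq: "p > 0" "q > 0" using wform_dW_pos wform_dLW_pos by (auto simp: p_def q_def)
  have M: "M \<ge> 0" using k by (simp add: truncated_kernels_def)
  define K where "K = 8 * 576\<^sup>2 * M\<^sup>2 * sphere_area"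
  have K: "K \<ge> 0" by (simp add: K_def)
  define N where "N = 2 * M * W_mass"
  define A where "A = 3 * (1 + N\<^sup>2 + K) / m\<^sup>2"
  have "1 + N\<^sup>2 + K > 0" using K zero_le_power2[of N] by linarith
  then have A: "A > 0" unfolding A_def using m by (intro divide_pos_pos mult_pos_pos) auto
  \<comment> \<open>The first summand pays for b and the second for z: from Pz \<le> 3/7 Ez follows
    Ez \<le> 7/4 (Ez - Pz).\<close>
  define B where "B = (p * A + 2 * q) / q + 7/4 * (p * A + 1)"
  have B: "B > 0" unfolding B_def using pq A by (intro add_pos_pos divide_pos_pos mult_pos_pos) auto
  have "eventually (\<lambda>R::real. R \<ge> 3) at_top" by (rule eventually_ge_at_top)
  then have "eventually (\<lambda>R. \<forall>f. sq_int f \<longrightarrow>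
    dirichlet f f - wform f f \<ge> (1/B) / ln R * dirichlet f f - (p * A / B) * (lin (k R) f)\<^sup>2) at_top"
    using l1
  proof eventually_elim
    case (elim R)
    \<comment> \<open>The threshold 3 exceeds e, so that ln R \<ge> 1 and constants can be absorbed
      into multiples of ln R.\<close>
    have "exp 1 \<le> R" using e_less_272 elim by simp
    then have lnR: "ln R \<ge> 1" using elim by (subst ln_ge_iff) auto
    have kR: "kernel (k R)" "\<And>x. \<bar>k R x\<bar> \<le> M * W x" using k elim by (auto simp: truncated_kernels_def)
    show ?case
    proof (intro allI impI)
      fix f assume "sq_int f"
      then obtain a b z where z: "orth_modes z" and f: "f = modes z a b" by (rule mode_decomposition)
      have sz: "sq_int z" using z by (simp add: orth_modes_def)
      define Ez where "Ez = dirichlet z z"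
      define Pz where "Pz = wform z z"
      have P: "7/3 * Pz \<le> Ez" "Pz \<ge> 0" "Ez \<ge> 0"
        using orth_modes_gap[OF z] wform_nonneg dirichlet_nonneg by (auto simp: Ez_def Pz_def)
      have D: "dirichlet f f = Ez + a\<^sup>2 * p + 2 * b\<^sup>2 * q" and V: "wform f f = Pz + a\<^sup>2 * p + b\<^sup>2 * q"
        unfolding f orth_modes_values[OF z] by (simp_all add: Ez_def Pz_def p_def q_def)
      define Q where "Q = dirichlet f f - wform f f"
      define l where "l = lin (k R) f"
      have Q: "Q = b\<^sup>2 * q + (Ez - Pz)" unfolding Q_def D V by simp
      have "a\<^sup>2 \<le> A * (l\<^sup>2 + b\<^sup>2 + ln R * Ez)" unfolding A_def
      proof (rule mode_coeff_bound)
        show "l = lin (k R) z + a * lin (k R) dW + b * lin (k R) dLW"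
          unfolding l_def f by (rule lin_modes[OF kR(1) sz])
        show "\<bar>lin (k R) dLW\<bar> \<le> N" unfolding N_def by (rule lin_mode_bounds[OF kR M])
        show "(lin (k R) z)\<^sup>2 \<le> K * ln R * Ez"
          unfolding K_def Ez_def by (rule truncated_kernels_bound[OF k _ lnR sz]) (use elim in auto)
      qed (use m elim K lnR P in auto)
      then have "a\<^sup>2 * p \<le> A * (l\<^sup>2 + b\<^sup>2 + ln R * Ez) * p" using pq by (intro mult_right_mono) auto
      then have "dirichlet f f \<le> p * A * l\<^sup>2 + (p * A + 2 * q) * b\<^sup>2 + (p * A * ln R + 1) * Ez"
        unfolding D by (simp add: algebra_simps)
      also have "\<dots> \<le> p * A * l\<^sup>2 + B * ln R * Q"
      proof -
        have 0: "0 \<le> p * A" using pq A by simp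
        have bq: "0 \<le> b\<^sup>2 * q" using pq by simp
        have "b\<^sup>2 * q \<le> Q" using P unfolding Q by linarith
        have "Ez \<le> 7/4 * Q" using P bq unfolding Q distrib_left right_diff_distrib by linarith
        have "0 \<le> Q" using P bq unfolding Q by linarith
        have "(p * A + 2 * q) * b\<^sup>2 = (p * A + 2 * q) / q * (b\<^sup>2 * q)" using pq by simp
        also have "\<dots> \<le> (p * A + 2 * q) / q * Q" using \<open>b\<^sup>2 * q \<le> Q\<close> pq 0 by (intro mult_left_mono) auto
        also have "\<dots> \<le> (p * A + 2 * q) / q * Q * ln R" using mult_left_mono[OF lnR, of "(p * A + 2 * q) / q * Q"] pq 0 \<open>0 \<le> Q\<close> by simp
        finally have 1: "(p * A + 2 * q) * b\<^sup>2 \<le> (p * A + 2 * q) / q * Q * ln R" .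
        have "(p * A * ln R + 1) * Ez \<le> ((p * A + 1) * ln R) * (7/4 * Q)"
        proof (rule mult_mono)
          show "p * A * ln R + 1 \<le> (p * A + 1) * ln R" using lnR by (simp add: algebra_simps)
          show "0 \<le> (p * A + 1) * ln R" using 0 lnR by (intro mult_nonneg_nonneg) auto
        qed fact+
        moreover have gen: "(w + 7/4 * v) * L * Q' = w * Q' * L + (v * L) * (7/4 * Q')" for w v L Q' :: real
          by (simp add: algebra_simps)
        ultimately show ?thesis using 1 unfolding B_def gen by linarith
      qed
      finally have "dirichlet f f - p * A * l\<^sup>2 \<le> B * ln R * Q" by simp
      then have "(dirichlet f f - p * A * l\<^sup>2) / (B * ln R) \<le> Q" using B lnR by (simp add: divide_le_eq mult_ac)
      moreover have "(p * A * l\<^sup>2) / (B * ln R) \<le> p * A * l\<^sup>2 / B"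
        using B lnR pq A by (intro divide_left_mono mult_pos_pos) (auto simp: mult_le_cancel_left1)
      ultimately show "1 / B / ln R * dirichlet f f - p * A / B * (lin (k R) f)\<^sup>2 \<le> dirichlet f f - wform f f"
        unfolding Q_def[symmetric] l_def[symmetric] by (simp add: diff_divide_distrib)
    qed
  qed
  then show ?thesis using A B pq by (intro exI[of _ "1/B"] conjI exI[of _ "p * A / B"]) auto
qed

text \<open>The form of L+ has one negative direction W, the null direction \<Lambda>W, and is
  positive on the complement. Here y and Y stand for Y1 and Y2: \<open>eig\<close> is the weak
  equation L+ y = -\<nu> Y, and \<open>\<alpha>\<close> makes the form negative at y. On the
  orthogonal complement, with respect to the form, of a negative vector such a form is nonnegative;
  the factor \<theta> in the proof makes this quantitative.\<close>

lemma coercive_plus: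
  assumes k: "truncated_kernels k M" and m: "m > 0" and l1: "eventually (\<lambda>R. \<bar>lin (k R) dLW\<bar> \<ge> m) at_top"
    and y: "sq_int y" and Y: "kernel Y" and \<nu>: "\<nu> > 0" and \<alpha>: "lin Y y > 0"
    and eig: "\<And>f. sq_int f \<Longrightarrow> dirichlet f y - 2 * wform f y = - \<nu> * lin Y f"
    and ly: "\<And>R. R \<ge> 2 \<Longrightarrow> \<bar>lin (k R) y\<bar> \<le> My"
  shows "\<exists>c>0. \<exists>C>0. eventually (\<lambda>R. \<forall>f. sq_int f \<longrightarrow>
    dirichlet f f - 2 * wform f f \<ge> c / ln R * dirichlet f f - C * ((lin (k R) f)\<^sup>2 + (lin Y f)\<^sup>2)) at_top"
proof -
  define p where "p = wform dW dW"
  define q where "q = wform dLW dLW"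
  have pq: "p > 0" "q > 0" using wform_dW_pos wform_dLW_pos by (auto simp: p_def q_def)
  have M: "M \<ge> 0" using k by (simp add: truncated_kernels_def)
  define K where "K = 8 * 576\<^sup>2 * M\<^sup>2 * sphere_area"
  have K: "K \<ge> 0" by (simp add: K_def)
  define N where "N = 2 * M * W_mass"
  define A where "A = 3 * (1 + N\<^sup>2 + K) / m\<^sup>2"
  have "1 + N\<^sup>2 + K > 0" using K zero_le_power2[of N] by linarith
  then have A: "A > 0" unfolding A_def using m by (intro divide_pos_pos mult_pos_pos) auto
  define \<alpha>' where "\<alpha>' = lin Y y"
  have \<alpha>0: "\<alpha>' > 0" using \<alpha> by (simp add: \<alpha>'_def)
  define B where "B = (\<lambda>f g. dirichlet f g - 2 * wform f g)"
  have Bcomm: "B f g = B g f" for f g unfolding B_def by (simp add: dirichlet_commute wform_commute)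
  have Badd: "B (\<lambda>x. f x + g x) h = B f h + B g h" if "sq_int f" "sq_int g" "sq_int h" for f g h
    unfolding B_def using that by (simp add: form_simps)
  have Bscale: "B (\<lambda>x. c * f x) h = c * B f h" for c f h
    unfolding B_def by (simp add: form_simps algebra_simps)
  have Badd2: "B h (\<lambda>x. f x + g x) = B h f + B h g" if "sq_int f" "sq_int g" "sq_int h" for f g h
    using Badd[OF that] Bcomm by metis
  have Bscale2: "B h (\<lambda>x. c * f x) = c * B h f" for c f h using Bscale Bcomm by metis
  have BdW0: "B dW dW = - p" using form_dW_dLW by (simp add: B_def p_def)
  have BdW: "B dLW f = 0" "B f dLW = 0" if "sq_int f" for f
    using that dirichlet_dLW[of f] form_dW_dLW dirichlet_commute[of dLW f] wform_commute[of dLW f]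
    by (simp_all add: B_def p_def)
  have BzW: "B z dW = 0" "B dW z = 0" if "orth_modes z" for z
    using that dirichlet_dW[of z] dirichlet_commute[of dW z] wform_commute[of dW z] by (simp_all add: B_def orth_modes_def)
  have Bmodes: "B (modes z a b) (modes z' a' b') = B z z' - a * a' * p" if z: "orth_modes z" "orth_modes z'" for z z' a b a' b'
  proof -
    have s: "sq_int z" "sq_int z'" using z by (auto simp: orth_modes_def)
    show ?thesis unfolding modes_def
      by (simp add: Badd Badd2 Bscale Bscale2 s sq_int_add sq_int_scale sq_int_dW sq_int_dLW BdW0 BdW BzW z)
  qed
  \<comment> \<open>Here 1/7 = 1 - 2 * 3/7.\<close>
  have Bpos: "B z z \<ge> 1/7 * dirichlet z z" if "orth_modes z" for z
    using orth_modes_gap[OF that] by (simp add: B_def)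
  have orth_comb: "orth_modes (\<lambda>x. z x + t * z' x)" if "orth_modes z" "orth_modes z'" for z z' t
    using that by (auto simp: orth_modes_def form_simps sq_int_dW sq_int_dLW)
  \<comment> \<open>Ordinary Cauchy-Schwarz, available because B is nonnegative on functions
    orthogonal to both modes.\<close>
  have BCS: "(B z z')\<^sup>2 \<le> B z z * B z' z'" if z: "orth_modes z" "orth_modes z'" for z z'
  proof -
    have s: "sq_int z" "sq_int z'" using z by (auto simp: orth_modes_def)
    have q: "0 \<le> B z z + 2 * t * B z z' + t\<^sup>2 * B z' z'" for t
    proof -
      have "0 \<le> B (\<lambda>x. z x + t * z' x) (\<lambda>x. z x + t * z' x)"
        using Bpos[OF orth_comb[OF z, of t]] dirichlet_nonneg[of "\<lambda>x. z x + t * z' x"] by simp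
      also have "\<dots> = B z z + 2 * t * B z z' + t\<^sup>2 * B z' z'"
        using Bcomm[of z' z] by (simp add: Badd Badd2 Bscale Bscale2 s sq_int_add sq_int_scale power2_eq_square algebra_simps)
      finally show ?thesis .
    qed
    have nn: "B z z \<ge> 0" "B z' z' \<ge> 0" using Bpos[OF z(1)] Bpos[OF z(2)] dirichlet_nonneg[of z] dirichlet_nonneg[of z'] by auto
    show ?thesis
    proof (cases "B z' z' = 0")
      case True
      have "B z z' = 0"
      proof (rule ccontr)
        assume "B z z' \<noteq> 0"
        with q[of "- (B z z + 1) / (2 * B z z')"] True show False by (simp add: field_simps)
      qed
      then show ?thesis using nn by simp
    next
      case False
      then have "B z' z' > 0" using nn by simp
      with q[of "- B z z' / B z' z'"] show ?thesis by (simp add: power2_eq_square field_simps)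
    qed
  qed
  obtain a1 b1 z1 where z1: "orth_modes z1" and y1: "y = modes z1 a1 b1" using mode_decomposition[OF y] .
  have By: "B y y = - (\<nu> * \<alpha>')" using eig[OF y] by (simp add: B_def \<alpha>'_def)
  have Bz1: "B z1 z1 = a1\<^sup>2 * p - \<nu> * \<alpha>'"
    using Bmodes[OF z1 z1, of a1 b1 a1 b1] By y1 by (simp add: power2_eq_square)
  have nn1: "B z1 z1 \<ge> 0" using Bpos[OF z1] dirichlet_nonneg[of z1] by simp
  have a1p: "a1\<^sup>2 * p > 0" using Bz1 nn1 \<nu> \<alpha>0 by (smt (verit) mult_pos_pos)
  \<comment> \<open>The share of the negative part a1^2 p of y that its positive part z1 does not
    compensate, since B(y, y) = B(z1, z1) - a1^2 p = -\<nu> \<alpha>'.\<close>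
  define \<theta> where "\<theta> = \<nu> * \<alpha>' / (a1\<^sup>2 * p)"
  have \<theta>: "0 < \<theta>" "\<theta> \<le> 1" using \<nu> \<alpha>0 a1p Bz1 nn1 by (auto simp: \<theta>_def divide_le_eq)
  \<comment> \<open>The reversed Cauchy-Schwarz inequality: orthogonality to y says B(z, z1) = a a1
    p, so the negative component is dominated by the positive one with a factor less than 1.\<close>
  have core: "a\<^sup>2 * p \<le> (1 - \<theta>) * B z z" if z: "orth_modes z" and 0: "B (modes z a b) y = 0" for z a b
  proof -
    have "B z z1 = a * a1 * p" using 0 unfolding y1 Bmodes[OF z z1] by simp
    then have "(a * a1 * p)\<^sup>2 \<le> B z z * (a1\<^sup>2 * p - \<nu> * \<alpha>')" using BCS[OF z z1] Bz1 by simp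
    also have "a1\<^sup>2 * p - \<nu> * \<alpha>' = (1 - \<theta>) * (a1\<^sup>2 * p)"
    proof -
      have "\<theta> * (a1\<^sup>2 * p) = \<nu> * \<alpha>'" by (metis \<theta>_def a1p less_irrefl nonzero_divide_eq_eq)
      then show ?thesis by (simp only: left_diff_distrib mult_1)
    qed
    finally have "(a\<^sup>2 * p) * (a1\<^sup>2 * p) \<le> ((1 - \<theta>) * B z z) * (a1\<^sup>2 * p)" by (simp add: power_mult_distrib power2_eq_square mult_ac)
    then show ?thesis using a1p by (simp only: mult_le_cancel_right_pos)
  qed
  \<comment> \<open>The trailing 1 + 7 pays for a^2 p \<le> B(z, z) and Ez \<le> 7 B(z, z); the
    product in front pays for b^2 after \<open>mode_coeff_bound\<close>.\<close>
  define G where "G = (2 * q * A + 1) * (1 / p + 7) + 1 + 7"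
  have G: "G > 0" unfolding G_def using pq A by (intro add_pos_pos mult_pos_pos) auto
  define Dy where "Dy = dirichlet y y"
  have Dy: "Dy \<ge> 0" by (simp add: Dy_def dirichlet_nonneg)
  define H where "H = 4 * q * A * 2 * (1 + My\<^sup>2 / \<alpha>'\<^sup>2) + 2 * Dy / \<alpha>'\<^sup>2"
  have H: "H > 0" unfolding H_def using pq A Dy by (intro add_pos_nonneg mult_pos_pos) (auto intro: add_pos_nonneg)
  have "eventually (\<lambda>R::real. R \<ge> 3) at_top" by (rule eventually_ge_at_top)
  then have "eventually (\<lambda>R. \<forall>f. sq_int f \<longrightarrow>
    dirichlet f f - 2 * wform f f \<ge> (\<theta> / (2 * G)) / ln R * dirichlet f f - (\<theta> * H / (2 * G) + \<nu> / \<alpha>') * ((lin (k R) f)\<^sup>2 + (lin Y f)\<^sup>2)) at_top"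
    using l1
  proof eventually_elim
    case (elim R)
    have "exp 1 \<le> R" using e_less_272 elim by simp
    then have lnR: "ln R \<ge> 1" using elim by (subst ln_ge_iff) auto
    have kR: "kernel (k R)" "\<And>x. \<bar>k R x\<bar> \<le> M * W x" using k elim by (auto simp: truncated_kernels_def)
    show ?case
    proof (intro allI impI)
      fix f assume sf: "sq_int f"
      define l where "l = lin (k R) f"
      define e where "e = lin Y f"
      \<comment> \<open>With this coefficient g = f - \<beta> y satisfies lin Y g = 0, which by
        \<open>eig\<close> is B(g, y) = 0.\<close>
      define \<beta> where "\<beta> = e / \<alpha>'"
      define \<gamma> where "\<gamma> = - \<beta>"
      define g where "g = (\<lambda>x. f x + \<gamma> * y x)"
      have sg: "sq_int g" unfolding g_def by (intro sq_int_add sf sq_int_scale y)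
      have fg: "f = (\<lambda>x. g x + \<beta> * y x)" by (simp add: g_def \<gamma>_def fun_eq_iff)
      have Bgy: "B g y = 0"
      proof -
        have "lin Y g = e + \<gamma> * \<alpha>'" unfolding g_def e_def \<alpha>'_def using Y sf y by (simp add: lin_add lin_scale sq_int_scale)
        also have "\<dots> = 0" using \<alpha>0 by (simp add: \<beta>_def \<gamma>_def)
        finally show ?thesis using eig[OF sg] by (simp add: B_def)
      qed
      have Bf: "B f f = B g g - \<nu> * \<alpha>' * \<beta>\<^sup>2"
        using Bgy Bcomm[of y g] By unfolding fg
        by (simp add: Badd Badd2 Bscale Bscale2 sg y sq_int_add sq_int_scale power2_eq_square algebra_simps)
      obtain a b z where z: "orth_modes z" and g: "g = modes z a b" using mode_decomposition[OF sg] .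
      have sz: "sq_int z" using z by (simp add: orth_modes_def)
      define Ez where "Ez = dirichlet z z"
      have Ez: "Ez \<ge> 0" "Ez \<le> 7 * B z z" using Bpos[OF z] dirichlet_nonneg[of z] by (auto simp: Ez_def)
      have ap: "a\<^sup>2 * p \<le> (1 - \<theta>) * B z z" by (rule core[OF z]) (use Bgy g in simp)
      have Bgg: "B g g = B z z - a\<^sup>2 * p" unfolding g Bmodes[OF z z] by (simp add: power2_eq_square)
      have Q: "\<theta> * B z z \<le> B g g" unfolding Bgg using ap by (simp add: algebra_simps)
      have Bz0: "B z z \<ge> 0" using Ez by linarith
      have "a\<^sup>2 * p \<le> B z z" using ap \<theta> Bz0 mult_right_mono[of "1 - \<theta>" 1 "B z z"] by simp
      then have aB: "a\<^sup>2 \<le> B z z / p" using pq by (simp add: field_simps)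
      define lg where "lg = lin (k R) g"
      \<comment> \<open>The summands are ordered so that b is the coefficient to be recovered and
        the contribution of W is the bounded extra term.\<close>
      have lgz: "lg = lin (k R) z + b * lin (k R) dLW + a * lin (k R) dW"
        unfolding lg_def g using lin_modes[OF kR(1) sz] by simp
      have bb: "b\<^sup>2 \<le> A * (lg\<^sup>2 + a\<^sup>2 + ln R * Ez)" unfolding A_def
      proof (rule mode_coeff_bound[OF lgz])
        show "\<bar>lin (k R) dW\<bar> \<le> N" unfolding N_def by (rule lin_mode_bounds[OF kR M])
        show "(lin (k R) z)\<^sup>2 \<le> K * ln R * Ez"
          unfolding K_def Ez_def by (rule truncated_kernels_bound[OF k _ lnR sz]) (use elim in auto)
      qed (use m elim K lnR Ez in auto)
      have "lg = l + \<gamma> * lin (k R) y"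
        unfolding lg_def g_def l_def using kR sf y by (simp add: lin_add lin_scale sq_int_scale)
      then have "lg\<^sup>2 = (l - \<beta> * lin (k R) y)\<^sup>2" by (simp add: \<gamma>_def)
      also have "\<dots> \<le> 2 * l\<^sup>2 + 2 * (\<beta> * lin (k R) y)\<^sup>2"
      proof -
        have "0 \<le> (l + \<beta> * lin (k R) y)\<^sup>2" by simp
        then show ?thesis by (simp add: power2_eq_square algebra_simps)
      qed
      also have "(\<beta> * lin (k R) y)\<^sup>2 \<le> \<beta>\<^sup>2 * My\<^sup>2"
        unfolding power_mult_distrib using ly[of R] elim power_mono[of "\<bar>lin (k R) y\<bar>" My 2] by (intro mult_left_mono) auto
      also have "2 * l\<^sup>2 + 2 * (\<beta>\<^sup>2 * My\<^sup>2) \<le> 2 * (1 + My\<^sup>2 / \<alpha>'\<^sup>2) * (l\<^sup>2 + e\<^sup>2)"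
      proof -
        have "\<beta>\<^sup>2 * My\<^sup>2 = My\<^sup>2 / \<alpha>'\<^sup>2 * e\<^sup>2" by (simp add: \<beta>_def power_divide)
        moreover have "0 \<le> My\<^sup>2 / \<alpha>'\<^sup>2 * l\<^sup>2" by simp
        ultimately show ?thesis using zero_le_power2[of e] by (simp only: distrib_left distrib_right)
      qed
      finally have lg: "lg\<^sup>2 \<le> 2 * (1 + My\<^sup>2 / \<alpha>'\<^sup>2) * (l\<^sup>2 + e\<^sup>2)" by simp
      have Dg: "dirichlet g g = Ez + a\<^sup>2 * p + 2 * b\<^sup>2 * q"
        unfolding g orth_modes_values[OF z] by (simp add: Ez_def p_def q_def)
      have Dg2: "dirichlet g g \<le> 2 * q * A * lg\<^sup>2 + G * ln R * B z z"
      proof -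
        have "2 * b\<^sup>2 * q \<le> 2 * q * A * (lg\<^sup>2 + a\<^sup>2 + ln R * Ez)" using bb pq mult_left_mono[OF bb, of "2 * q"] by (simp add: mult_ac)
        then have "dirichlet g g \<le> 2 * q * A * lg\<^sup>2 + (Ez + a\<^sup>2 * p + 2 * q * A * (a\<^sup>2 + ln R * Ez))" unfolding Dg by (simp add: algebra_simps)
        also have "Ez + a\<^sup>2 * p + 2 * q * A * (a\<^sup>2 + ln R * Ez) \<le> G * ln R * B z z"
        proof -
          have qA: "0 \<le> 2 * q * A" using pq A by simp
          have BL: "B z z \<le> ln R * B z z" using mult_right_mono[OF lnR Bz0] by simp
          have "B z z / p \<le> ln R * B z z / p" using BL pq by (intro divide_right_mono) auto
          moreover have "ln R * Ez \<le> ln R * (7 * B z z)" using Ez lnR by (intro mult_left_mono) auto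
          ultimately have "a\<^sup>2 + ln R * Ez \<le> (1 / p + 7) * (ln R * B z z)" using aB by (simp add: algebra_simps)
          then have "2 * q * A * (a\<^sup>2 + ln R * Ez) \<le> 2 * q * A * ((1 / p + 7) * (ln R * B z z))" using qA by (rule mult_left_mono)
          moreover have "Ez + a\<^sup>2 * p \<le> 8 * (ln R * B z z)" using Ez BL \<open>a\<^sup>2 * p \<le> B z z\<close> by linarith
          moreover have "0 \<le> (1 / p + 7) * (ln R * B z z)" using pq lnR Bz0 by (intro mult_nonneg_nonneg) auto
          ultimately show ?thesis unfolding G_def by (simp add: algebra_simps)
        qed
        finally show ?thesis by simp
      qed
      have Df: "dirichlet f f \<le> 2 * dirichlet g g + 2 * \<beta>\<^sup>2 * Dy"
      proof -
        have s: "sq_int (\<lambda>x. g x + \<gamma> * y x)" by (intro sq_int_add sg sq_int_scale y)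
        have "0 \<le> dirichlet (\<lambda>x. g x + \<gamma> * y x) (\<lambda>x. g x + \<gamma> * y x)" by (rule dirichlet_nonneg)
        also have "\<dots> = dirichlet g g + 2 * \<gamma> * dirichlet g y + \<gamma>\<^sup>2 * Dy"
          using sg y s dirichlet_commute[of y g] by (simp add: form_simps Dy_def power2_eq_square algebra_simps)
        finally have "2 * \<beta> * dirichlet g y \<le> dirichlet g g + \<beta>\<^sup>2 * Dy" by (simp add: \<gamma>_def)
        moreover have "dirichlet f f = dirichlet g g + 2 * \<beta> * dirichlet g y + \<beta>\<^sup>2 * Dy"
          unfolding fg using sg y dirichlet_commute[of y g] by (simp add: form_simps Dy_def power2_eq_square algebra_simps)
        ultimately show ?thesis by linarith
      qed
      define S where "S = l\<^sup>2 + e\<^sup>2"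
      have S: "S \<ge> 0" by (simp add: S_def)
      have "dirichlet f f \<le> H * S + 2 * G * ln R * B z z"
      proof -
        have "2 * (2 * q * A * lg\<^sup>2) \<le> 2 * (2 * q * A * (2 * (1 + My\<^sup>2 / \<alpha>'\<^sup>2) * S))"
          unfolding S_def using lg pq A by (intro mult_left_mono) auto
        moreover have "2 * \<beta>\<^sup>2 * Dy \<le> 2 * Dy / \<alpha>'\<^sup>2 * S"
        proof -
          have "2 * \<beta>\<^sup>2 * Dy = 2 * Dy / \<alpha>'\<^sup>2 * e\<^sup>2" by (simp add: \<beta>_def power_divide)
          also have "\<dots> \<le> 2 * Dy / \<alpha>'\<^sup>2 * S" unfolding S_def using Dy by (intro mult_left_mono) auto
          finally show ?thesis .
        qed
        ultimately show ?thesis using Df Dg2 unfolding H_def by (simp add: algebra_simps)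
      qed
      then have "(dirichlet f f - H * S) / (2 * G * ln R) \<le> B z z" using G lnR by (simp add: divide_le_eq mult_ac)
      moreover have "H * S / (2 * G * ln R) \<le> H * S / (2 * G)"
        using G lnR H S by (intro divide_left_mono mult_pos_pos) (auto simp: mult_le_cancel_left1)
      ultimately have "dirichlet f f / (2 * G * ln R) - H * S / (2 * G) \<le> B z z" by (simp add: diff_divide_distrib)
      then have "\<theta> * (dirichlet f f / (2 * G * ln R) - H * S / (2 * G)) \<le> B g g"
        using Q \<theta> mult_left_mono[of "dirichlet f f / (2 * G * ln R) - H * S / (2 * G)" "B z z" \<theta>] by linarith
      moreover have "\<nu> * \<alpha>' * \<beta>\<^sup>2 \<le> \<nu> / \<alpha>' * S"
      proof -
        have "\<nu> * \<alpha>' * \<beta>\<^sup>2 = \<nu> / \<alpha>' * e\<^sup>2" using \<alpha>0 by (simp add: \<beta>_def power2_eq_square field_simps)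
        also have "\<dots> \<le> \<nu> / \<alpha>' * S" unfolding S_def using \<nu> \<alpha>0 by (intro mult_left_mono) auto
        finally show ?thesis .
      qed
      ultimately have "\<theta> * (dirichlet f f / (2 * G * ln R) - H * S / (2 * G)) - \<nu> / \<alpha>' * S \<le> B f f"
        unfolding Bf by linarith
      moreover have "t * (D / (2 * G * L) - H * S / (2 * G)) - w * S = t / (2 * G) / L * D - (t * H / (2 * G) + w) * S" for t D L w :: real
        by (simp add: algebra_simps)
      ultimately have "\<theta> / (2 * G) / ln R * dirichlet f f - (\<theta> * H / (2 * G) + \<nu> / \<alpha>') * S \<le> B f f"
        by (simp only:)
      then show "\<theta> / (2 * G) / ln R * dirichlet f f - (\<theta> * H / (2 * G) + \<nu> / \<alpha>') * ((lin (k R) f)\<^sup>2 + (lin Y f)\<^sup>2)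
          \<le> dirichlet f f - 2 * wform f f"
        by (simp add: S_def l_def e_def B_def)
    qed
  qed
  then show ?thesis using \<theta> G H \<nu> \<alpha>0
    by (intro exI[of _ "\<theta> / (2 * G)"] conjI exI[of _ "\<theta> * H / (2 * G) + \<nu> / \<alpha>'"]) (auto intro!: add_pos_pos divide_pos_pos mult_pos_pos)
qed

section \<open>Splitting at a radius\<close>

lemma radial_prim_outside:
  assumes "A \<inter> {r<..} = {}"
  shows "radial_prim (\<lambda>x. indicator A (norm x) * f x) r = 0"
proof -
  have "(LINT x|leb. indicator {r<..} (norm x) * (indicator A (norm x) * f x / norm x ^ 5)) = (LINT x|leb. 0)"
    by (intro Bochner_Integration.integral_cong refl) (use assms in \<open>auto simp: indicator_def\<close>)
  then show ?thesis by (simp add: radial_prim_def)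
qed

text \<open>The primitive of the part of f outside r1 is constant inside r1, so the pointwise bound
  at r1 serves there as well.\<close>

lemma radial_prim_tail:
  assumes f: "sq_int f" and r1: "r1 > 0" and r: "r > 0"
  defines "g \<equiv> \<lambda>x. indicator {r1<..} (norm x) * f x"
  shows "(radial_prim g r)\<^sup>2 \<le> dirichlet g g / (4 * sphere_area * (max r r1)^4)"
proof -
  have g: "sq_int g" unfolding g_def by (rule sq_int_restrict[OF f]) auto
  have "radial_prim g r = radial_prim g (max r r1)"
    unfolding radial_prim_def g_def by (intro arg_cong[where f = "\<lambda>y. - y / sphere_area"] Bochner_Integration.integral_cong refl) (auto simp: indicator_def)
  then show ?thesis
    using radial_prim_bound'[OF g, of "max r r1"] r by (simp add: dirichlet_def power2_eq_square)
qed

lemma young_wform: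
  assumes f: "sq_int f" and g: "sq_int g" and t: "t > 0"
  shows "wform (\<lambda>x. f x + g x) (\<lambda>x. f x + g x) \<le> (1 + t) * wform f f + (1 + 1/t) * wform g g"
proof -
  \<comment> \<open>Positivity of the form at f - g/t, multiplied by t, is the weighted Young
    inequality for the cross term.\<close>
  define s where "s = - (1/t)"
  have "0 \<le> wform (\<lambda>x. f x + s * g x) (\<lambda>x. f x + s * g x)" by (rule wform_nonneg)
  also have "\<dots> = wform f f + 2 * s * wform f g + s\<^sup>2 * wform g g"
    using f g wform_commute[of g f] by (simp add: form_simps power2_eq_square algebra_simps)
  finally have "0 \<le> t * (wform f f + 2 * s * wform f g + s\<^sup>2 * wform g g)" using t by simp
  also have "\<dots> = t * wform f f - 2 * wform f g + 1/t * wform g g"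
    using t by (simp add: s_def field_simps power2_eq_square)
  finally have "2 * wform f g \<le> t * wform f f + 1/t * wform g g" by simp
  moreover have "wform (\<lambda>x. f x + g x) (\<lambda>x. f x + g x) = wform f f + 2 * wform f g + wform g g"
    using f g wform_commute[of g f] by (simp add: form_simps)
  ultimately show ?thesis by (simp add: algebra_simps)
qed

text \<open>The growth R^2 of the L1 norm is that of |x|^-4 over a ball of radius 2R. The L1 norm is
  used for the part of f outside r1, the sup norm for the part inside r2.\<close>

definition cut_kernels :: "(real \<Rightarrow> real^6 \<Rightarrow> real) \<Rightarrow> real \<Rightarrow> bool"
  where "cut_kernels k B \<longleftrightarrow> B \<ge> 0 \<and> (\<forall>R\<ge>2. kernel (k R) \<and> (\<forall>x. \<bar>k R x\<bar> \<le> B) \<and> integrable leb (k R) \<and> (LINT x|leb. \<bar>k R x\<bar>) \<le> B * R\<^sup>2)"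

text \<open>The power |x|^-3 makes W integrable at infinity. It is gained from r1 |x|^3 \<le>
  max(|x|, r1)^4 in \<open>outer_cut\<close>, which leaves one power of r1 as decay.\<close>

definition W_weight :: real where "W_weight = (LINT x|leb. (ub (norm x))^2 / norm x ^ 3)"

lemma integrable_W_weight: "integrable leb (\<lambda>x. (ub (norm x))^2 / norm x ^ 3)"
proof (rule integrable_two_powers[where C = "24^2"])
  show "\<bar>(ub (norm x))\<^sup>2 / norm x ^ 3\<bar> \<le> 24\<^sup>2 / norm x ^ 5" if "x \<noteq> 0" "norm x \<le> 1" for x :: "real^6"
  proof -
    have "(ub (norm x))\<^sup>2 * norm x^2 \<le> 1 * 1" using that ub_le1[of "norm x"] by (intro mult_mono power_le_one) auto
    then have "(ub (norm x))\<^sup>2 * norm x^2 / norm x ^ 5 \<le> 24\<^sup>2 / norm x ^ 5" by (intro divide_right_mono) auto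
    then show ?thesis using that by (simp add: field_simps eval_nat_numeral)
  qed
  show "\<bar>(ub (norm x))\<^sup>2 / norm x ^ 3\<bar> \<le> 24\<^sup>2 / norm x ^ 7" if "norm x > 1" for x :: "real^6"
  proof -
    have "norm x ^ 4 * (ub (norm x))\<^sup>2 \<le> 24^2" using ub_pow_bound[of 2 2 "norm x"] by simp
    then have "norm x ^ 4 * (ub (norm x))\<^sup>2 / norm x ^ 7 \<le> 24^2 / norm x ^ 7" by (intro divide_right_mono) auto
    then show ?thesis using that by (cases "x = 0") (auto simp: field_simps eval_nat_numeral)
  qed
qed measurable

text \<open>The pairing gains (R/r1)^4 because the primitive is at most of size r1^-2 everywhere
  while the kernel has mass of order R^2.\<close>

lemma outer_cut:
  assumes f: "sq_int f" and r1: "r1 > 0"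
  defines "g \<equiv> \<lambda>x. indicator {r1<..} (norm x) * f x"
  shows "wform g g \<le> W_weight / (4 * sphere_area * r1) * dirichlet g g"
    and "cut_kernels k B \<Longrightarrow> R \<ge> 2 \<Longrightarrow> (lin (k R) g)\<^sup>2 \<le> B\<^sup>2 / (4 * sphere_area) * (R / r1)^4 * dirichlet g g"
proof -
  have g: "sq_int g" unfolding g_def by (rule sq_int_restrict[OF f]) auto
  note [measurable] = borel_measurable_radial_prim[OF g]
  let ?E = "dirichlet g g"
  have E: "?E \<ge> 0" by (rule dirichlet_nonneg)
  have b: "(radial_prim g r)\<^sup>2 \<le> ?E / (4 * sphere_area * (max r r1)^4)" if "r > 0" for r
    using radial_prim_tail[OF f r1 that] unfolding g_def .
  have "wform g g \<le> (LINT x|leb. ?E / (4 * sphere_area * r1) * ((ub (norm x))^2 / norm x ^ 3))"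
    unfolding wform_def
  proof (rule integral_mono_AE)
    show "integrable leb (\<lambda>x. W x * (radial_prim g (norm x) * radial_prim g (norm x)))" by (rule integrable_W_prim2[OF g g])
    show "integrable leb (\<lambda>x. ?E / (4 * sphere_area * r1) * ((ub (norm x))^2 / norm x ^ 3))"
      by (intro integrable_mult_right integrable_W_weight)
    show "AE x in leb. W x * (radial_prim g (norm x) * radial_prim g (norm x)) \<le> ?E / (4 * sphere_area * r1) * ((ub (norm x))^2 / norm x ^ 3)"
      using AE_nonzero
    proof eventually_elim
      case (elim x)
      define r where "r = norm x"
      have r: "r > 0" using elim by (simp add: r_def)
      have "r1 * r^3 \<le> max r r1 * (max r r1)^3" using r r1 by (intro mult_mono power_mono) auto
      then have "4 * sphere_area * (r1 * r^3) \<le> 4 * sphere_area * (max r r1)^4" by (simp add: eval_nat_numeral)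
      then have "?E / (4 * sphere_area * (max r r1)^4) \<le> ?E / (4 * sphere_area * (r1 * r^3))"
        using E r r1 by (intro divide_left_mono mult_pos_pos) auto
      then have "(radial_prim g r)\<^sup>2 \<le> ?E / (4 * sphere_area * (r1 * r^3))" using b[OF r] by linarith
      then have "(ub r)^2 * (radial_prim g r)\<^sup>2 \<le> (ub r)^2 * (?E / (4 * sphere_area * (r1 * r^3)))" by (intro mult_left_mono) auto
      then show ?case unfolding r_def[symmetric] W_eq by (simp add: power2_eq_square mult_ac)
    qed
  qed
  also have "\<dots> = W_weight / (4 * sphere_area * r1) * dirichlet g g"
    by (simp only: integral_mult_right_zero W_weight_def[symmetric]) simp
  finally show "wform g g \<le> W_weight / (4 * sphere_area * r1) * dirichlet g g" .
  assume k: "cut_kernels k B" and R: "R \<ge> 2"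
  have kR: "kernel (k R)" "integrable leb (k R)" "(LINT x|leb. \<bar>k R x\<bar>) \<le> B * R\<^sup>2" "B \<ge> 0"
    using k R by (auto simp: cut_kernels_def)
  have [measurable]: "k R \<in> borel_measurable leb" using kR by (simp add: kernel_def)
  define T where "T = sqrt (?E / (4 * sphere_area * r1^4))"
  have T: "T \<ge> 0" "T\<^sup>2 = ?E / (4 * sphere_area * r1^4)" using E r1 by (auto simp: T_def)
  have "\<bar>lin (k R) g\<bar> \<le> (LINT x|leb. \<bar>k R x * radial_prim g (norm x)\<bar>)"
    unfolding lin_def using integral_norm_bound[of leb "\<lambda>x. k R x * radial_prim g (norm x)"] by simp
  also have "\<dots> \<le> (LINT x|leb. T * \<bar>k R x\<bar>)"
  proof (rule integral_mono_AE)
    show "integrable leb (\<lambda>x. \<bar>k R x * radial_prim g (norm x)\<bar>)" using kernel_integrable[OF kR(1) g] by simp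
    show "integrable leb (\<lambda>x. T * \<bar>k R x\<bar>)" using kR by simp
    show "AE x in leb. \<bar>k R x * radial_prim g (norm x)\<bar> \<le> T * \<bar>k R x\<bar>"
      using AE_nonzero
    proof eventually_elim
      case (elim x)
      have "(radial_prim g (norm x))\<^sup>2 \<le> ?E / (4 * sphere_area * (max (norm x) r1)^4)" using b elim by simp
      also have "\<dots> \<le> ?E / (4 * sphere_area * r1^4)"
        using E r1 by (intro divide_left_mono mult_left_mono power_mono mult_pos_pos zero_less_power) auto
      finally have "\<bar>radial_prim g (norm x)\<bar> \<le> T" unfolding T_def by (rule real_le_rsqrt[of "\<bar>radial_prim g (norm x)\<bar>", simplified])
      then have "\<bar>radial_prim g (norm x)\<bar> * \<bar>k R x\<bar> \<le> T * \<bar>k R x\<bar>" by (intro mult_right_mono) auto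
      then show ?case by (simp add: abs_mult mult.commute)
    qed
  qed
  also have "\<dots> \<le> T * (B * R\<^sup>2)" using kR T by (simp add: mult_left_mono)
  finally have "(lin (k R) g)\<^sup>2 \<le> (T * (B * R\<^sup>2))\<^sup>2" using power_mono[of "\<bar>lin (k R) g\<bar>" _ 2] by simp
  also have "\<dots> = B\<^sup>2 / (4 * sphere_area) * (R / r1)^4 * ?E"
    by (simp add: power_mult_distrib T power_divide flip: power_mult)
  finally show "(lin (k R) g)\<^sup>2 \<le> B\<^sup>2 / (4 * sphere_area) * (R / r1)^4 * ?E" .
qed

text \<open>The primitive of the inner part vanishes beyond r2, so all integrals live on a small
  ball. The factor 1/8 is 1/4 from the pointwise bound times 1/2 from integrating r^(5-4).\<close>

lemma inner_cut:
  assumes f: "sq_int f" and r2: "r2 > 0"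
  defines "g \<equiv> \<lambda>x. indicator {..<r2} (norm x) * f x"
  shows "wform g g \<le> r2\<^sup>2 / 8 * dirichlet g g"
    and "cut_kernels k B \<Longrightarrow> R \<ge> 2 \<Longrightarrow> (lin (k R) g)\<^sup>2 \<le> B\<^sup>2 * sphere_area * r2^8 * dirichlet g g"
proof -
  have g: "sq_int g" unfolding g_def by (rule sq_int_restrict[OF f]) auto
  note [measurable] = borel_measurable_radial_prim[OF g]
  let ?E = "dirichlet g g"
  have E: "?E \<ge> 0" by (rule dirichlet_nonneg)
  have b: "(radial_prim g r)\<^sup>2 \<le> ?E / (4 * sphere_area * r^4) * indicator {..r2} r" if "r > 0" for r
  proof (cases "r \<le> r2")
    case True
    then show ?thesis using radial_prim_bound'[OF g that] by (simp add: dirichlet_def power2_eq_square)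
  next
    case False
    then have "radial_prim g r = 0" unfolding g_def by (intro radial_prim_outside) auto
    then show ?thesis using False by simp
  qed
  have "wform g g \<le> (LINT x|leb. ?E / (4 * sphere_area) * (indicator {..r2} (norm x) * (1 / norm x ^ 4)))"
    unfolding wform_def
  proof (rule integral_mono_AE)
    show "integrable leb (\<lambda>x. W x * (radial_prim g (norm x) * radial_prim g (norm x)))" by (rule integrable_W_prim2[OF g g])
    show "integrable leb (\<lambda>x. ?E / (4 * sphere_area) * (indicator {..r2} (norm x) * (1 / norm x ^ 4)))"
      using r2 by (intro integrable_mult_right ball_power) auto
    show "AE x in leb. W x * (radial_prim g (norm x) * radial_prim g (norm x)) \<le> ?E / (4 * sphere_area) * (indicator {..r2} (norm x) * (1 / norm x ^ 4))"
      using AE_nonzero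
    proof eventually_elim
      case (elim x)
      have "W x \<le> 1" unfolding W_eq by (intro power_le_one ub_le1) auto
      then have "W x * (radial_prim g (norm x))\<^sup>2 \<le> 1 * (?E / (4 * sphere_area * norm x^4) * indicator {..r2} (norm x))"
        using b[of "norm x"] elim by (intro mult_mono) auto
      then show ?case by (simp add: power2_eq_square mult_ac)
    qed
  qed
  also have "\<dots> = r2\<^sup>2 / 8 * ?E"
    using r2 by (simp only: integral_mult_right_zero) (subst ball_power(2), auto)
  finally show "wform g g \<le> r2\<^sup>2 / 8 * ?E" .
  assume k: "cut_kernels k B" and R: "R \<ge> 2"
  have kR: "kernel (k R)" "\<And>x. \<bar>k R x\<bar> \<le> B" "B \<ge> 0"
    using k R by (auto simp: cut_kernels_def)
  have [measurable]: "k R \<in> borel_measurable leb" using kR by (simp add: kernel_def)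
  define T where "T = sqrt (?E / (4 * sphere_area))"
  have T: "T \<ge> 0" "T\<^sup>2 = ?E / (4 * sphere_area)" using E by (auto simp: T_def)
  have "\<bar>lin (k R) g\<bar> \<le> (LINT x|leb. \<bar>k R x * radial_prim g (norm x)\<bar>)"
    unfolding lin_def using integral_norm_bound[of leb "\<lambda>x. k R x * radial_prim g (norm x)"] by simp
  also have "\<dots> \<le> (LINT x|leb. B * T * (indicator {..r2} (norm x) * (1 / norm x ^ 2)))"
  proof (rule integral_mono_AE)
    show "integrable leb (\<lambda>x. \<bar>k R x * radial_prim g (norm x)\<bar>)" using kernel_integrable[OF kR(1) g] by simp
    show "integrable leb (\<lambda>x. B * T * (indicator {..r2} (norm x) * (1 / norm x ^ 2)))"
      using r2 by (intro integrable_mult_right ball_power) auto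
    show "AE x in leb. \<bar>k R x * radial_prim g (norm x)\<bar> \<le> B * T * (indicator {..r2} (norm x) * (1 / norm x ^ 2))"
      using AE_nonzero
    proof eventually_elim
      case (elim x)
      have "(radial_prim g (norm x))\<^sup>2 \<le> (T / norm x ^ 2 * indicator {..r2} (norm x))\<^sup>2"
      proof -
        have "(T / norm x ^ 2 * indicator {..r2} (norm x))\<^sup>2 = ?E / (4 * sphere_area * norm x^4) * indicator {..r2} (norm x)"
          by (cases "norm x \<le> r2") (simp_all add: power_divide T(2) flip: power_mult)
        then show ?thesis using b[of "norm x"] elim by simp
      qed
      then have "\<bar>radial_prim g (norm x)\<bar> \<le> T / norm x ^ 2 * indicator {..r2} (norm x)"
        by (rule abs_le_square_iff[THEN iffD2, THEN order_trans]) (use T in auto)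
      then have "\<bar>k R x\<bar> * \<bar>radial_prim g (norm x)\<bar> \<le> B * (T / norm x ^ 2 * indicator {..r2} (norm x))"
        using kR by (intro mult_mono) auto
      then show ?case by (simp add: abs_mult mult_ac)
    qed
  qed
  also have "\<dots> = B * T * (sphere_area * r2^4 / 4)"
    using r2 by (simp only: integral_mult_right_zero) (subst ball_power(2), auto)
  finally have "(lin (k R) g)\<^sup>2 \<le> (B * T * (sphere_area * r2^4 / 4))\<^sup>2" using power_mono[of "\<bar>lin (k R) g\<bar>" _ 2] by simp
  also have "\<dots> = B\<^sup>2 * sphere_area * r2^8 * ?E / 64"
    by (simp add: power_mult_distrib T power_divide flip: power_mult) (simp add: power2_eq_square)
  also have "\<dots> \<le> B\<^sup>2 * sphere_area * r2^8 * ?E" using E r2 by simp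
  finally show "(lin (k R) g)\<^sup>2 \<le> B\<^sup>2 * sphere_area * r2^8 * ?E" .
qed

text \<open>Write t = c d. Young with parameter 2t costs 4t E1 and the factor 1 - 2t costs 2t E1,
  which explains \<open>6 * c \<le> c0\<close>. The removed part costs t/4 E2 through P2 and t/2 E2
  through S2, less than the available t E2. The 1/8 in the bound for P2 is the one delivered by
  \<open>inner_cut\<close>.\<close>

lemma cut_arith:
  fixes E1 E2 P1 P2 P S S1 S2 c d c0 C0 C \<kappa> :: real
  assumes coer: "c0 * d * E1 - C0 * S1 \<le> E1 - \<kappa> * P1" and P: "P \<le> (1 + 2*(c*d)) * P1 + (1 + 1/(2*(c*d))) * P2"
    and P1: "0 \<le> P1" "P1 \<le> E1" and S1: "S1 \<le> 2 * S + 2 * S2" and \<kappa>: "1 \<le> \<kappa>" "\<kappa> \<le> 2"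
    and c: "0 < c" "6 * c \<le> c0" and d: "0 < d" "2 * (c * d) \<le> 1"
    and P2: "0 \<le> P2" "P2 \<le> (c * d)\<^sup>2 / 8 * E2" and S2: "4 * C0 * S2 \<le> c * d * E2"
    and C: "0 \<le> C0" "2 * C0 \<le> C" "0 \<le> S" and E2: "0 \<le> E2"
  shows "(1 - 2 * c * d) * E1 + c * d * E2 - \<kappa> * P \<ge> - (C * S)"
proof -
  define t where "t = c * d"
  have t: "t > 0" "2 * t \<le> 1" using c d by (auto simp: t_def)
  have "\<kappa> * P \<le> \<kappa> * ((1 + 2*t) * P1 + (1 + 1/(2*t)) * P2)" using P \<kappa> unfolding t_def by (intro mult_left_mono) auto
  also have "\<dots> = \<kappa> * P1 + 2 * t * (\<kappa> * P1) + \<kappa> * ((1 + 1/(2*t)) * P2)" by (simp add: algebra_simps)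
  also have "2 * t * (\<kappa> * P1) \<le> 2 * t * (2 * E1)" using \<kappa> P1 t by (intro mult_left_mono mult_mono) auto
  also have "\<kappa> * ((1 + 1/(2*t)) * P2) \<le> 2 * ((1/t) * (t\<^sup>2 / 8 * E2))"
    using \<kappa> P2 t E2 by (intro mult_mono) (auto simp: t_def[symmetric] field_simps)
  also have "2 * ((1/t) * (t\<^sup>2 / 8 * E2)) = t * E2 / 4" using t by (simp add: power2_eq_square)
  finally have 1: "\<kappa> * P \<le> \<kappa> * P1 + 4 * (t * E1) + t * E2 / 4" by simp
  have "6 * t * E1 \<le> c0 * d * E1" using c d P1 unfolding t_def by (intro mult_right_mono) (auto simp: mult_right_mono)
  then have 2: "6 * (t * E1) \<le> c0 * d * E1" by simp
  have "C0 * S1 \<le> C0 * (2 * S + 2 * S2)" using S1 C by (intro mult_left_mono) auto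
  moreover have "2 * C0 * S \<le> C * S" using C by (intro mult_right_mono) auto
  ultimately have 3: "C0 * S1 \<le> C * S + 2 * C0 * S2" by (simp add: algebra_simps)
  have 4: "4 * C0 * S2 \<le> t * E2" using S2 by (simp add: t_def)
  have "0 \<le> t * E2" "0 \<le> t * E1" using t E2 P1 by auto
  then show ?thesis using 1 2 3 4 coer
    by (simp add: t_def[symmetric] mult.assoc left_diff_distrib)
qed

text \<open>The value 1 of \<kappa> is L- and the value 2 is L+. The conclusion records that
  \<delta> and 1 - 2 c \<delta> are nonnegative, because the Dirichlet energies of the pieces of f
  will later be replaced by larger gradient energies.\<close>

lemma cut_coercivity:
  assumes k1: "cut_kernels k1 B" and k2: "cut_kernels k2 B" and \<kappa>: "1 \<le> \<kappa>" "\<kappa> \<le> 2"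
    and c0: "c0 > 0" and C0: "C0 > 0"
    and coer: "eventually (\<lambda>R. \<forall>f. sq_int f \<longrightarrow> dirichlet f f - \<kappa> * wform f f \<ge>
      c0 / ln R * dirichlet f f - C0 * ((lin (k1 R) f)\<^sup>2 + (lin (k2 R) f)\<^sup>2)) at_top"
    and c: "0 < c" "6 * c \<le> c0" and C: "2 * C0 \<le> C"
  defines "S \<equiv> \<lambda>R f. (lin (k1 R) f)\<^sup>2 + (lin (k2 R) f)\<^sup>2" and "\<delta> \<equiv> \<lambda>R. ln R powr (- (4/3))"
  shows "eventually (\<lambda>R. 0 \<le> \<delta> R \<and> 2 * (c * \<delta> R) \<le> 1 \<and>
    (\<forall>f. sq_int f \<longrightarrow> (1 - c * \<delta> R) * dirichlet f f - \<kappa> * wform f f \<ge> - (C * S R f)) \<and>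
    (\<forall>r1 f. r1 \<ge> inverse c * R * ln R powr (4/3) \<longrightarrow> sq_int f \<longrightarrow>
      (1 - 2 * c * \<delta> R) * dirichlet (\<lambda>x. indicator {..r1} (norm x) * f x) (\<lambda>x. indicator {..r1} (norm x) * f x)
      + c * \<delta> R * dirichlet (\<lambda>x. indicator {r1<..} (norm x) * f x) (\<lambda>x. indicator {r1<..} (norm x) * f x)
      - \<kappa> * wform f f \<ge> - (C * S R f)) \<and>
    (\<forall>r2 f. 0 < r2 \<longrightarrow> r2 \<le> c * \<delta> R \<longrightarrow> sq_int f \<longrightarrow>
      (1 - 2 * c * \<delta> R) * dirichlet (\<lambda>x. indicator {r2..} (norm x) * f x) (\<lambda>x. indicator {r2..} (norm x) * f x)
      + c * \<delta> R * dirichlet (\<lambda>x. indicator {..<r2} (norm x) * f x) (\<lambda>x. indicator {..<r2} (norm x) * f x)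
      - \<kappa> * wform f f \<ge> - (C * S R f))) at_top"
proof -
  \<comment> \<open>Large enough for both cuts: the outer one produces B^2/(4
    \<open>sphere_area\<close>), the inner one B^2 \<open>sphere_area\<close>, each twice because S
    is a sum of two squares.\<close>
  define K where "K = 2 * B\<^sup>2 * (sphere_area + 1 / (4 * sphere_area))"
  have K: "K \<ge> 0" "2 * (B\<^sup>2 * sphere_area) \<le> K" "2 * (B\<^sup>2 / (4 * sphere_area)) \<le> K"
  proof -
    have a: "0 \<le> B\<^sup>2 * sphere_area" "0 \<le> B\<^sup>2 / (4 * sphere_area)" by auto
    have "K = 2 * (B\<^sup>2 * sphere_area) + 2 * (B\<^sup>2 / (4 * sphere_area))" by (simp add: K_def algebra_simps)
    then show "K \<ge> 0" "2 * (B\<^sup>2 * sphere_area) \<le> K" "2 * (B\<^sup>2 / (4 * sphere_area)) \<le> K" using a by linarith+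
  qed
  have lnR: "filterlim (\<lambda>R::real. ln R) at_top at_top" by (rule ln_at_top)
  have \<delta>0: "(\<delta> \<longlongrightarrow> 0) at_top" unfolding \<delta>_def using lnR by (intro tendsto_neg_powr) auto
  \<comment> \<open>Since R outgrows (ln R)^(4/3), the bound of order 1/r1 for the outer part of the
    weighted form drops below (c d)^2 / 8.\<close>
  have R\<delta>: "((\<lambda>R. (W_weight / (4 * sphere_area)) * 8 * (1 / (R * \<delta> R))) \<longlongrightarrow> 0) at_top"
    unfolding \<delta>_def by real_asymp
  have e1: "eventually (\<lambda>R. \<delta> R < 1 / (2 * c)) at_top" using order_tendstoD(2)[OF \<delta>0, of "1 / (2*c)"] c by simp
  have "((\<lambda>R. 4 * C0 * K * c * \<delta> R) \<longlongrightarrow> 0) at_top" using tendsto_mult_right_zero[OF \<delta>0] .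
  then have e2: "eventually (\<lambda>R. 4 * C0 * K * c * \<delta> R < 1) at_top" by (rule order_tendstoD) simp
  have e3: "eventually (\<lambda>R. (W_weight / (4 * sphere_area)) * 8 * (1 / (R * \<delta> R)) < c) at_top" using order_tendstoD(2)[OF R\<delta> c(1)] by simp
  have e4: "eventually (\<lambda>R::real. R \<ge> 3) at_top" by (rule eventually_ge_at_top)
  from e1 e2 e3 e4 coer show ?thesis
  proof eventually_elim
    case (elim R)
    define d where "d = \<delta> R"
    have "exp 1 \<le> R" using e_less_272 elim by simp
    then have ln1: "ln R \<ge> 1" using elim by (subst ln_ge_iff) auto
    have d: "d > 0" "2 * (c * d) \<le> 1" using elim ln1 c by (auto simp: d_def \<delta>_def field_simps)
    have dL: "d \<le> 1 / ln R"
    proof -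
      have "ln R powr (- (4/3)) \<le> ln R powr (- 1)" using ln1 by (intro powr_mono) auto
      then show ?thesis using ln1 by (simp add: d_def \<delta>_def powr_minus_divide)
    qed
    have dinv: "ln R powr (4/3) = 1 / d" using ln1 by (simp add: d_def \<delta>_def powr_minus_divide)
    have coerd: "c0 * d * dirichlet f f - C0 * S R f \<le> dirichlet f f - \<kappa> * wform f f" if f: "sq_int f" for f
    proof -
      have "c0 * d \<le> c0 / ln R" using mult_left_mono[OF dL, of c0] c0 by simp
      then have "c0 * d * dirichlet f f \<le> c0 / ln R * dirichlet f f" using dirichlet_nonneg by (intro mult_right_mono) auto
      then show ?thesis using elim(5) f unfolding S_def by fastforce
    qed
    have S0: "S R f \<ge> 0" for f by (simp add: S_def)
    have R2: "R \<ge> 2" using elim by simp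
    have ker: "kernel (k1 R)" "kernel (k2 R)" using k1 k2 R2 by (auto simp: cut_kernels_def)
    have cd: "0 < c * d" "c * d \<le> 1" using c d by auto
    \<comment> \<open>The common core of both cuts: g carries the coercivity, and h is a removed
      part whose influence is quadratically small in c d.\<close>
    have cut: "(1 - 2 * c * d) * dirichlet g g + c * d * dirichlet h h - \<kappa> * wform f f \<ge> - (C * S R f)"
      if g: "sq_int g" and h: "sq_int h" and f: "f = (\<lambda>x. g x + h x)"
        and Ph: "wform h h \<le> (c * d)\<^sup>2 / 8 * dirichlet h h" and Sh: "S R h \<le> K * (c * d)\<^sup>2 * dirichlet h h" for f g h
    proof (rule cut_arith[OF coerd[OF g]])
      show "wform f f \<le> (1 + 2 * (c * d)) * wform g g + (1 + 1 / (2 * (c * d))) * wform h h"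
        unfolding f using c d by (intro young_wform g h) auto
      have two: "(x + y)\<^sup>2 \<le> 2 * x\<^sup>2 + 2 * y\<^sup>2" for x y :: real
        using sum_squares_bound[of x y] by (simp add: power2_sum)
      have gl: "lin k g = lin k f + (- 1) * lin k h" if "kernel k" for k
        unfolding f using lin_add[OF that g h] by simp
      have "(lin k g)\<^sup>2 \<le> 2 * (lin k f)\<^sup>2 + 2 * (lin k h)\<^sup>2" if "kernel k" for k
        unfolding gl[OF that] using two[of "lin k f" "(-1) * lin k h"] by simp
      from this[OF ker(1)] this[OF ker(2)] show "S R g \<le> 2 * S R f + 2 * S R h" by (simp add: S_def)
      have Eh: "0 \<le> dirichlet h h" by (rule dirichlet_nonneg)
      have "4 * C0 * S R h \<le> 4 * C0 * (K * (c * d)\<^sup>2 * dirichlet h h)" using Sh C0 by (intro mult_left_mono) auto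
      also have "\<dots> = (4 * C0 * K * c * d) * (c * d * dirichlet h h)" by (simp add: power2_eq_square)
      also have "\<dots> \<le> 1 * (c * d * dirichlet h h)" using elim(2) Eh c d unfolding d_def by (intro mult_right_mono) auto
      finally show "4 * C0 * S R h \<le> c * d * dirichlet h h" by simp
    qed (use wform_nonneg wform_le_dirichlet[OF g] \<kappa> c d C0 C S0 dirichlet_nonneg Ph in auto)
    have pow: "t ^ n \<le> t\<^sup>2" if "0 \<le> t" "t \<le> 1" "n \<ge> 2" for t :: real and n
      using that by (intro power_decreasing) auto
    have p1: "(1 - c * d) * dirichlet f f - \<kappa> * wform f f \<ge> - (C * S R f)" if f: "sq_int f" for f
    proof -
      have "c * d * dirichlet f f \<le> c0 * d * dirichlet f f" using c d dirichlet_nonneg[of f] by (intro mult_right_mono) auto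
      moreover have "C0 * S R f \<le> C * S R f" using C C0 S0[of f] by (intro mult_right_mono) auto
      ultimately show ?thesis using coerd[OF f] by (simp add: left_diff_distrib)
    qed
    have p2: "(1 - 2 * c * d) * dirichlet (\<lambda>x. indicator {..r1} (norm x) * f x) (\<lambda>x. indicator {..r1} (norm x) * f x)
      + c * d * dirichlet (\<lambda>x. indicator {r1<..} (norm x) * f x) (\<lambda>x. indicator {r1<..} (norm x) * f x)
      - \<kappa> * wform f f \<ge> - (C * S R f)" if r1: "r1 \<ge> inverse c * R * ln R powr (4/3)" and f: "sq_int f" for r1 f
    proof (rule cut)
      have "inverse c * R * ln R powr (4/3) = R / (c * d)" unfolding dinv by (simp add: field_simps)
      then have r1': "R / (c * d) \<le> r1" using r1 by simp
      have "0 < R / (c * d)" using R2 cd by simp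
      then have r10: "r1 > 0" using r1' by linarith
      have q: "R / r1 \<le> c * d" using r1' r10 cd R2 by (simp add: field_simps)
      show "sq_int (\<lambda>x. indicator {..r1} (norm x) * f x)" "sq_int (\<lambda>x. indicator {r1<..} (norm x) * f x)"
        by (intro sq_int_restrict f; simp)+
      show "f = (\<lambda>x. indicator {..r1} (norm x) * f x + indicator {r1<..} (norm x) * f x)"
        by (auto simp: indicator_def fun_eq_iff)
      let ?h = "\<lambda>x. indicator {r1<..} (norm x) * f x"
      have Eh: "0 \<le> dirichlet ?h ?h" by (rule dirichlet_nonneg)
      have "W_weight / (4 * sphere_area * r1) = (W_weight / (4 * sphere_area)) * (1 / R) * (R / r1)" using R2 by simp
      also have "\<dots> \<le> (W_weight / (4 * sphere_area)) * (1 / R) * (c * d)"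
        using q R2 by (intro mult_left_mono) (auto simp: W_weight_def)
      also have "\<dots> = (W_weight / (4 * sphere_area) * 8 * (1 / (R * d))) * (c * d\<^sup>2 / 8)" using d R2 by (simp add: power2_eq_square)
      also have "\<dots> \<le> c * (c * d\<^sup>2 / 8)" using elim(3) c unfolding d_def by (intro mult_right_mono) auto
      also have "\<dots> = (c * d)\<^sup>2 / 8" by (simp add: power2_eq_square)
      finally have w: "W_weight / (4 * sphere_area * r1) \<le> (c * d)\<^sup>2 / 8" .
      show "wform ?h ?h \<le> (c * d)\<^sup>2 / 8 * dirichlet ?h ?h"
        using outer_cut(1)[OF f r10] mult_right_mono[OF w Eh] by linarith
      have "(R / r1)^4 \<le> (c * d)^4" using q R2 r10 by (intro power_mono) auto
      also have "\<dots> \<le> (c * d)\<^sup>2" using cd by (intro pow) auto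
      finally have q4: "(R / r1)^4 \<le> (c * d)\<^sup>2" .
      have l: "(lin (k R) ?h)\<^sup>2 \<le> B\<^sup>2 / (4 * sphere_area) * (c * d)\<^sup>2 * dirichlet ?h ?h" if k: "cut_kernels k B" for k
      proof -
        have "B\<^sup>2 / (4 * sphere_area) * (R / r1)^4 * dirichlet ?h ?h \<le> B\<^sup>2 / (4 * sphere_area) * (c * d)\<^sup>2 * dirichlet ?h ?h"
          using q4 Eh by (intro mult_right_mono mult_left_mono) auto
        then show ?thesis using outer_cut(2)[OF f r10 k R2] by linarith
      qed
      have "S R ?h \<le> 2 * (B\<^sup>2 / (4 * sphere_area)) * ((c * d)\<^sup>2 * dirichlet ?h ?h)"
        using l[OF k1] l[OF k2] unfolding S_def by (simp add: mult_ac)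
      also have "\<dots> \<le> K * ((c * d)\<^sup>2 * dirichlet ?h ?h)" using K Eh by (intro mult_right_mono) auto
      finally show "S R ?h \<le> K * (c * d)\<^sup>2 * dirichlet ?h ?h" by (simp add: mult_ac)
    qed
    have p3: "(1 - 2 * c * d) * dirichlet (\<lambda>x. indicator {r2..} (norm x) * f x) (\<lambda>x. indicator {r2..} (norm x) * f x)
      + c * d * dirichlet (\<lambda>x. indicator {..<r2} (norm x) * f x) (\<lambda>x. indicator {..<r2} (norm x) * f x)
      - \<kappa> * wform f f \<ge> - (C * S R f)" if r2: "0 < r2" "r2 \<le> c * d" and f: "sq_int f" for r2 f
    proof (rule cut)
      show "sq_int (\<lambda>x. indicator {r2..} (norm x) * f x)" "sq_int (\<lambda>x. indicator {..<r2} (norm x) * f x)"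
        by (intro sq_int_restrict f; simp)+
      show "f = (\<lambda>x. indicator {r2..} (norm x) * f x + indicator {..<r2} (norm x) * f x)"
        by (auto simp: indicator_def fun_eq_iff)
      let ?h = "\<lambda>x. indicator {..<r2} (norm x) * f x"
      have Eh: "0 \<le> dirichlet ?h ?h" by (rule dirichlet_nonneg)
      have q2: "r2\<^sup>2 \<le> (c * d)\<^sup>2" using r2 by (intro power_mono) auto
      have "r2\<^sup>2 / 8 \<le> (c * d)\<^sup>2 / 8" using q2 by simp
      then show "wform ?h ?h \<le> (c * d)\<^sup>2 / 8 * dirichlet ?h ?h"
        using inner_cut(1)[OF f r2(1)] mult_right_mono[of "r2\<^sup>2 / 8" "(c * d)\<^sup>2 / 8", OF _ Eh] by linarith
      have "r2 ^ 8 \<le> r2\<^sup>2" using r2 cd by (intro pow) auto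
      then have q8: "r2 ^ 8 \<le> (c * d)\<^sup>2" using q2 by linarith
      have l: "(lin (k R) ?h)\<^sup>2 \<le> B\<^sup>2 * sphere_area * (c * d)\<^sup>2 * dirichlet ?h ?h" if k: "cut_kernels k B" for k
      proof -
        have "B\<^sup>2 * sphere_area * r2 ^ 8 * dirichlet ?h ?h \<le> B\<^sup>2 * sphere_area * (c * d)\<^sup>2 * dirichlet ?h ?h"
          using q8 Eh by (intro mult_right_mono mult_left_mono) auto
        then show ?thesis using inner_cut(2)[OF f r2(1) k R2] by linarith
      qed
      have "S R ?h \<le> 2 * (B\<^sup>2 * sphere_area) * ((c * d)\<^sup>2 * dirichlet ?h ?h)"
        using l[OF k1] l[OF k2] unfolding S_def by (simp add: mult_ac)
      also have "\<dots> \<le> K * ((c * d)\<^sup>2 * dirichlet ?h ?h)" using K Eh by (intro mult_right_mono) auto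
      finally show "S R ?h \<le> K * (c * d)\<^sup>2 * dirichlet ?h ?h" by (simp add: mult_ac)
    qed
    show ?case
      unfolding d_def[symmetric] using d p1 p2 p3 by auto
  qed
qed

section \<open>Radial Schwartz functions and cutoffs\<close>

lemma has_derivative_radial:
  fixes x :: "real^6"
  assumes "x \<noteq> 0" "(y has_real_derivative y') (at (norm x))"
  shows "((\<lambda>x. y (norm x)) has_derivative (\<lambda>h. y' * (x \<bullet> h / norm x))) (at x)"
proof -
  have n: "(norm has_derivative (\<lambda>h. x \<bullet> h / norm x)) (at x)"
  proof -
    have "(norm has_derivative (\<lambda>h. h \<bullet> sgn x)) (at x)" using assms(1) by (rule has_derivative_norm)
    moreover have "(\<lambda>h. h \<bullet> sgn x) = (\<lambda>h. x \<bullet> h / norm x)"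
      by (simp add: fun_eq_iff sgn_div_norm inner_commute divide_inverse mult.commute)
    ultimately show ?thesis by simp
  qed
  have "(y has_derivative (\<lambda>t. y' * t)) (at (norm x))"
    using assms(2) by (simp add: has_field_derivative_def mult_commute_abs)
  from has_derivative_compose[OF n this] show ?thesis .
qed

lemma partial_deriv_eqI: "(f has_derivative f') (at x) \<Longrightarrow> partial_deriv i f x = f' (axis i 1)"
  unfolding partial_deriv_def by (metis frechet_derivative_at)

lemma partial_deriv_radial:
  fixes x :: "real^6"
  assumes "x \<noteq> 0" "(y has_real_derivative y') (at (norm x))"
  shows "partial_deriv i (\<lambda>x. y (norm x)) x = y' * (x $ i / norm x)"
  using partial_deriv_eqI[OF has_derivative_radial[OF assms], of i] by (simp add: inner_axis)

lemma sum_square_components: "(\<Sum>i\<in>UNIV. x $ i * x $ i) = (norm x)\<^sup>2" for x :: "real^'n"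
  by (simp add: power2_norm_eq_inner inner_vec_def)

lemma Lam_W: "Lam W x = 4 * (ub (norm x))^3 - 2 * (ub (norm x))^2"
proof (cases "x = 0")
  case True
  then show ?thesis by (simp add: Lam_def W_def ub_def)
next
  case False
  let ?r = "norm x"
  have d: "((\<lambda>r. (ub r)\<^sup>2) has_real_derivative - (?r / 6) * ub ?r ^ 3) (at ?r)"
    by (auto intro!: derivative_eq_intros simp: power2_eq_square power3_eq_cube)
  have W': "W = (\<lambda>x. (ub (norm x))\<^sup>2)" by (simp add: W_eq fun_eq_iff)
  have pd: "partial_deriv i W x = - (?r / 6) * ub ?r ^ 3 * (x $ i / ?r)" for i
    unfolding W' by (rule partial_deriv_radial[OF False d])
  have "(\<Sum>i\<in>UNIV. x $ i * partial_deriv i W x) = (\<Sum>i\<in>UNIV. (- (ub ?r ^ 3) / 6) * (x $ i * x $ i))"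
    unfolding pd using False by (intro sum.cong) auto
  also have "\<dots> = (- (ub ?r ^ 3) / 6) * ?r\<^sup>2" by (simp only: sum_distrib_left[symmetric] sum_square_components)
  also have "\<dots> = - (?r\<^sup>2 * ub ?r) / 6 * ub ?r ^ 2" by (simp add: eval_nat_numeral)
  also have "\<dots> = 4 * ub ?r ^ 3 - 4 * ub ?r ^ 2" unfolding ub_sq by (simp add: field_simps eval_nat_numeral)
  finally show ?thesis by (simp add: Lam_def W_eq)
qed

lemma abs_Lam_W: "\<bar>Lam W x\<bar> \<le> 2 * W x"
proof -
  let ?u = "ub (norm x)"
  have "Lam W x = ?u^2 * (4 * ?u - 2)" unfolding Lam_W by (simp add: algebra_simps eval_nat_numeral)
  moreover have "\<bar>4 * ?u - 2\<bar> \<le> 2" using ub_le1[of "norm x"] ub_pos[of "norm x"] by linarith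
  ultimately show ?thesis using mult_left_mono[of "\<bar>4 * ?u - 2\<bar>" 2 "?u^2"] by (simp add: W_eq abs_mult)
qed

section \<open>Profiles of radial smooth functions\<close>

lemma smooth_partial: "smooth f \<Longrightarrow> smooth (partial_deriv i f)"
  unfolding smooth_def
proof
  fix "is" assume "\<forall>is. foldr partial_deriv is f differentiable_on UNIV"
  then have "foldr partial_deriv (is @ [i]) f differentiable_on UNIV" by blast
  then show "foldr partial_deriv is (partial_deriv i f) differentiable_on UNIV" by simp
qed

lemma smooth_has_derivative: "smooth f \<Longrightarrow> (f has_derivative frechet_derivative f (at x)) (at x)"
  unfolding smooth_def using frechet_derivative_works[of f "at x"]
  by (metis UNIV_I differentiable_on_def foldr_Nil id_apply)

lemma smooth_continuous: "smooth f \<Longrightarrow> continuous_on UNIV f"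
  by (intro continuous_at_imp_continuous_on ballI has_derivative_continuous[OF smooth_has_derivative])

lemma smooth_line_derivative:
  fixes f :: "real^6 \<Rightarrow> real"
  assumes "smooth f"
  shows "((\<lambda>r. f (r *\<^sub>R axis i 1)) has_real_derivative partial_deriv i f (r *\<^sub>R axis i 1)) (at r)"
proof -
  let ?e = "axis i 1 :: real^6"
  have "((\<lambda>r. f (r *\<^sub>R ?e)) has_derivative (\<lambda>t. frechet_derivative f (at (r *\<^sub>R ?e)) (t *\<^sub>R ?e))) (at r)"
    by (rule has_derivative_compose[OF _ smooth_has_derivative[OF assms]]) (auto intro!: derivative_eq_intros)
  moreover have "frechet_derivative f (at (r *\<^sub>R ?e)) (t *\<^sub>R ?e) = partial_deriv i f (r *\<^sub>R ?e) * t" for t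
    using linear_scale[OF has_derivative_linear[OF smooth_has_derivative[OF assms]], of "r *\<^sub>R ?e" t ?e] by (simp add: partial_deriv_def)
  ultimately show ?thesis by (simp add: has_field_derivative_def)
qed

text \<open>The profile is read off on the ray through \<open>axis 1 1\<close>, where it inherits
  differentiability on the whole line from Y; the function g supplied by \<open>radial\<close> need
  not even be continuous at negative arguments.\<close>

lemma radial_profile:
  fixes Y :: "real^6 \<Rightarrow> real"
  assumes s: "smooth Y" and r: "radial Y"
  defines "y \<equiv> \<lambda>r. Y (r *\<^sub>R axis 1 1)" and "y' \<equiv> \<lambda>r. partial_deriv 1 Y (r *\<^sub>R axis 1 1)"
    and "y'' \<equiv> \<lambda>r. partial_deriv 1 (partial_deriv 1 Y) (r *\<^sub>R axis 1 1)"
  shows "Y x = y (norm x)" "(y has_real_derivative y' t) (at t)" "(y' has_real_derivative y'' t) (at t)"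
    "x \<noteq> 0 \<Longrightarrow> laplacian Y x = y'' (norm x) + 5 * y' (norm x) / norm x"
proof -
  obtain g where g: "\<And>x. Y x = g (norm x)" using r by (auto simp: radial_def)
  show Yy: "Y x = y (norm x)" for x unfolding y_def by (simp add: g)
  show dy: "(y has_real_derivative y' t) (at t)" for t
    unfolding y_def y'_def by (rule smooth_line_derivative[OF s])
  show dy': "(y' has_real_derivative y'' t) (at t)" for t
    unfolding y'_def y''_def by (rule smooth_line_derivative[OF smooth_partial[OF s]])
  have Y: "Y = (\<lambda>x. y (norm x))" using Yy by auto
  have pd: "partial_deriv i Y x = y' (norm x) / norm x * x $ i" if "x \<noteq> 0" for i x
    unfolding Y using partial_deriv_radial[OF that dy] by simp
  assume x: "x \<noteq> 0"
  let ?r = "norm x"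
  define k' where "k' = (y'' ?r * ?r - y' ?r) / ?r\<^sup>2"
  have dk: "((\<lambda>r. y' r / r) has_real_derivative k') (at ?r)"
    using DERIV_divide[OF dy'[of ?r] DERIV_ident, of] x by (simp add: k'_def power2_eq_square)
  have pp: "partial_deriv i (partial_deriv i Y) x = k' / ?r * (x $ i * x $ i) + y' ?r / ?r" for i
  proof -
    have "((\<lambda>x. y' (norm x) / norm x * x $ i) has_derivative (\<lambda>h. (y' ?r / ?r) * h $ i + (k' * (x \<bullet> h / ?r)) * x $ i)) (at x)"
      by (rule has_derivative_mult[OF has_derivative_radial[OF x dk]]) (auto intro!: derivative_eq_intros bounded_linear_imp_has_derivative bounded_linear_vec_nth)
    then have D: "(partial_deriv i Y has_derivative (\<lambda>h. (y' ?r / ?r) * h $ i + (k' * (x \<bullet> h / ?r)) * x $ i)) (at x)"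
      by (rule has_derivative_transform_within_open[where s = "- {0}"]) (use x pd in auto)
    have "axis i 1 $ i = (1::real)" by (simp add: axis_def)
    then show ?thesis using partial_deriv_eqI[OF D, of i] by (simp add: inner_axis)
  qed
  have "laplacian Y x = (\<Sum>i\<in>UNIV. k' / ?r * (x $ i * x $ i)) + (\<Sum>i\<in>(UNIV::6 set). y' ?r / ?r)"
    unfolding laplacian_def pp by (rule sum.distrib)
  also have "\<dots> = k' / ?r * ?r\<^sup>2 + 6 * (y' ?r / ?r)"
    by (simp only: sum_distrib_left[symmetric] sum_square_components) simp
  also have "\<dots> = y'' ?r + 5 * y' ?r / ?r" unfolding k'_def using x by (simp add: field_simps power2_eq_square)
  finally show "laplacian Y x = y'' ?r + 5 * y' ?r / ?r" .
qed

text \<open>One constant for all powers up to 7: the power 5 is asked for by \<open>kernel\<close>,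
  and the power 7 gives integrability at infinity.\<close>

lemma schwartz_bounds:
  fixes Y :: "real^6 \<Rightarrow> real"
  assumes "schwartz Y"
  obtains C where "C \<ge> 0" "\<And>x j. j \<le> 7 \<Longrightarrow> \<bar>Y x\<bar> * norm x ^ j \<le> C" "\<And>x j. j \<le> 7 \<Longrightarrow> \<bar>partial_deriv 1 Y x\<bar> * norm x ^ j \<le> C"
proof -
  have b: "\<exists>C. \<forall>x. \<bar>foldr partial_deriv is Y x\<bar> * norm x ^ j \<le> C" for "is" j
  proof -
    have "bounded (range (\<lambda>x. norm x ^ j *\<^sub>R foldr partial_deriv is Y x))" using assms by (simp add: schwartz_def)
    then obtain C where "\<And>x. norm (norm x ^ j *\<^sub>R foldr partial_deriv is Y x) \<le> C" unfolding bounded_iff by auto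
    then show ?thesis by (auto simp: abs_mult mult.commute)
  qed
  obtain C1 where C1: "\<And>j x. \<bar>Y x\<bar> * norm x ^ j \<le> C1 j"
    using b[of "[]"] by simp metis
  obtain C2 where C2: "\<And>j x. \<bar>partial_deriv 1 Y x\<bar> * norm x ^ j \<le> C2 j"
    using b[of "[1]"] by simp metis
  define C where "C = (\<Sum>j\<le>7. \<bar>C1 j\<bar> + \<bar>C2 j\<bar>)"
  have le: "\<bar>C1 j\<bar> + \<bar>C2 j\<bar> \<le> C" if "j \<le> 7" for j
    unfolding C_def using that by (intro member_le_sum) auto
  show thesis
  proof (rule that[of C])
    show "C \<ge> 0" unfolding C_def by (intro sum_nonneg) auto
    show "\<bar>Y x\<bar> * norm x ^ j \<le> C" if "j \<le> 7" for x j using C1[of x j] le[OF that] by linarith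
    show "\<bar>partial_deriv 1 Y x\<bar> * norm x ^ j \<le> C" if "j \<le> 7" for x j using C2[of x j] le[OF that] by linarith
  qed
qed

text \<open>For radial Y this is the radial derivative off the origin, the counterpart for Y of
  \<open>dW\<close> for W.\<close>

definition radial_slope :: "(real^6 \<Rightarrow> real) \<Rightarrow> real^6 \<Rightarrow> real"
  where "radial_slope Y x = partial_deriv 1 Y (norm x *\<^sub>R axis 1 1)"

lemma schwartz_smooth: "schwartz Y \<Longrightarrow> smooth Y" by (simp add: schwartz_def)

lemma smooth_measurable: "smooth f \<Longrightarrow> f \<in> borel_measurable borel"
  by (intro borel_measurable_continuous_onI smooth_continuous)

lemma radial_slope_sq_int:
  assumes "schwartz Y" shows "sq_int (radial_slope Y)"
proof -
  obtain C where C: "C \<ge> 0" "\<And>x j. j \<le> 7 \<Longrightarrow> \<bar>partial_deriv 1 Y x\<bar> * norm x ^ j \<le> C" using schwartz_bounds[OF assms] by metis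
  have "sq_int (\<lambda>x. (\<lambda>r. partial_deriv 1 Y (r *\<^sub>R axis 1 1)) (norm x))"
  proof (rule sq_int_profile[where C = C])
    show "(\<lambda>r. partial_deriv 1 Y (r *\<^sub>R axis 1 1)) \<in> borel_measurable borel"
      by (intro borel_measurable_continuous_onI continuous_on_compose2[OF smooth_continuous[OF smooth_partial[OF schwartz_smooth[OF assms]]]] continuous_intros) auto
    show "\<bar>partial_deriv 1 Y (r *\<^sub>R axis 1 1)\<bar> \<le> C" if "0 < r" "r \<le> 1" for r
      using C(2)[of 0 "r *\<^sub>R axis 1 1"] by simp
    show "\<bar>partial_deriv 1 Y (r *\<^sub>R axis 1 1)\<bar> \<le> C / r^4" if "1 < r" for r
      using C(2)[of 4 "r *\<^sub>R axis 1 1"] that by (simp add: field_simps)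
  qed
  then show ?thesis by (simp add: radial_slope_def[abs_def])
qed

lemma radial_prim_slope:
  assumes Y: "schwartz Y" "radial Y" and "x \<noteq> 0"
  shows "radial_prim (radial_slope Y) (norm x) = Y x"
proof -
  note p = radial_profile[OF schwartz_smooth[OF Y(1)] Y(2)]
  obtain C where C: "C \<ge> 0" "\<And>x j. j \<le> 7 \<Longrightarrow> \<bar>Y x\<bar> * norm x ^ j \<le> C" using schwartz_bounds[OF Y(1)] by metis
  have "radial_prim (\<lambda>x. (\<lambda>r. partial_deriv 1 Y (r *\<^sub>R axis 1 1)) (norm x)) (norm x) = Y (norm x *\<^sub>R axis 1 1)"
  proof (rule radial_prim_of_profile)
    show "((\<lambda>r. Y (r *\<^sub>R axis 1 1)) has_real_derivative partial_deriv 1 Y (r *\<^sub>R axis 1 1)) (at r)" for r by (rule p)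
    show "continuous_on {0<..} (\<lambda>r. partial_deriv 1 Y (r *\<^sub>R axis 1 1))"
      by (intro continuous_on_compose2[OF smooth_continuous[OF smooth_partial[OF schwartz_smooth[OF Y(1)]]]] continuous_intros) auto
    show "sq_int (\<lambda>x. partial_deriv 1 Y (norm x *\<^sub>R axis 1 1))" using radial_slope_sq_int[OF Y(1)] by (simp add: radial_slope_def[abs_def])
    show "(\<lambda>n. Y (real n *\<^sub>R axis 1 1)) \<longlonglongrightarrow> 0"
    proof (rule Lim_null_comparison)
      show "(\<lambda>n. C * (1 / real n)) \<longlonglongrightarrow> 0" using tendsto_mult_right_zero[OF lim_1_over_n] .
      show "eventually (\<lambda>n. norm (Y (real n *\<^sub>R axis 1 1)) \<le> C * (1 / real n)) sequentially"
        using eventually_gt_at_top[of 0]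
      proof eventually_elim
        case (elim n) then show ?case using C(2)[of 1 "real n *\<^sub>R axis 1 1"] by (simp add: field_simps)
      qed
    qed
  qed (use assms in auto)
  then show ?thesis using p(1)[of x] by (simp add: radial_slope_def[abs_def])
qed

lemma schwartz_kernel:
  fixes Y :: "real^6 \<Rightarrow> real"
  assumes "schwartz Y"
  shows "kernel Y" "integrable leb Y" "\<exists>B. cut_kernels (\<lambda>R. Y) B"
proof -
  obtain C where C: "C \<ge> 0" "\<And>x j. j \<le> 7 \<Longrightarrow> \<bar>Y x\<bar> * norm x ^ j \<le> C" using schwartz_bounds[OF assms] by metis
  have m: "Y \<in> borel_measurable leb" by (intro borel_measurable_lebesgueI smooth_measurable schwartz_smooth assms)
  show k: "kernel Y" unfolding kernel_def using m C(2)[of 0] C(2)[of 5] by auto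
  show i: "integrable leb Y"
  proof (rule integrable_two_powers[OF m])
    show "\<bar>Y x\<bar> \<le> C / norm x ^ 5" if "x \<noteq> 0" "norm x \<le> 1" for x using C(2)[of 5 x] that by (simp add: field_simps)
    show "\<bar>Y x\<bar> \<le> C / norm x ^ 7" if "norm x > 1" for x using C(2)[of 7 x] that by (cases "x = 0") (auto simp: field_simps)
  qed
  define B where "B = C + (LINT x|leb. \<bar>Y x\<bar>)"
  have I0: "0 \<le> (LINT x|leb. \<bar>Y x\<bar>)" by simp
  have "cut_kernels (\<lambda>R. Y) B" unfolding cut_kernels_def
  proof (intro conjI allI impI k i)
    show "0 \<le> B" using C I0 by (simp add: B_def)
    show "\<bar>Y x\<bar> \<le> B" for x
    proof -
      have "\<bar>Y x\<bar> \<le> C" using C(2)[of 0 x] by simp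
      then show ?thesis using I0 unfolding B_def by linarith
    qed
    fix R :: real assume "2 \<le> R"
    then have "1 \<le> R\<^sup>2" by (simp add: one_le_power)
    then have "B * 1 \<le> B * R\<^sup>2" using \<open>0 \<le> B\<close> by (rule mult_left_mono)
    then show "(LINT x|leb. \<bar>Y x\<bar>) \<le> B * R\<^sup>2" using C by (simp add: B_def)
  qed
  then show "\<exists>B. cut_kernels (\<lambda>R. Y) B" ..
qed

text \<open>Green's identity. The Laplacian is required as a continuous profile G because regularity
  of y'' + 5 y'/r at the origin is not visible; in the application the eigenvalue equation supplies
  G.\<close>

lemma dirichlet_slope:
  assumes Y: "schwartz Y" "radial Y" and f: "sq_int f"
    and lap: "\<And>x. laplacian Y x = G (norm x)" and cG: "continuous_on UNIV G" and kG: "kernel (\<lambda>x. G (norm x))"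
  shows "dirichlet f (radial_slope Y) = - lin (\<lambda>x. G (norm x)) f"
proof -
  note p = radial_profile[OF schwartz_smooth[OF Y(1)] Y(2)]
  let ?y' = "\<lambda>r. partial_deriv 1 Y (r *\<^sub>R axis 1 1)"
  obtain C where C: "C \<ge> 0" "\<And>x j. j \<le> 7 \<Longrightarrow> \<bar>partial_deriv 1 Y x\<bar> * norm x ^ j \<le> C" using schwartz_bounds[OF Y(1)] by metis
  have "(LINT x|leb. f x * ?y' (norm x)) = - (LINT x|leb. radial_prim f (norm x) * G (norm x))"
  proof (rule radial_by_parts[OF f])
    fix r :: real assume r: "r > 0"
    have "G r = partial_deriv 1 (partial_deriv 1 Y) (r *\<^sub>R axis 1 1) + 5 * ?y' r / r"
      using p(4)[of "r *\<^sub>R axis 1 1"] lap[of "r *\<^sub>R axis 1 1"] r by simp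
    then have "r^5 * G r = 5 * r^4 * ?y' r + partial_deriv 1 (partial_deriv 1 Y) (r *\<^sub>R axis 1 1) * r^5"
      using r by (simp add: field_simps eval_nat_numeral)
    moreover have "((\<lambda>r. r ^ 5 * ?y' r) has_real_derivative 5 * r^4 * ?y' r + partial_deriv 1 (partial_deriv 1 Y) (r *\<^sub>R axis 1 1) * r^5) (at r)"
      by (rule DERIV_mult[OF _ p(3)]) (auto intro!: derivative_eq_intros)
    ultimately show "((\<lambda>r. r ^ 5 * ?y' r) has_real_derivative r^5 * G r) (at r)" by simp
    show "\<bar>?y' r\<bar> \<le> C" using C(2)[of 0 "r *\<^sub>R axis 1 1"] by simp
    show "\<bar>r^3 * ?y' r\<bar> \<le> C" using C(2)[of 3 "r *\<^sub>R axis 1 1"] r by (simp add: abs_mult mult.commute)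
  next
    show "continuous_on {0<..} G" using cG by (rule continuous_on_subset) simp
    show "integrable leb (\<lambda>x. f x * ?y' (norm x))"
      using sq_int_mult[OF f radial_slope_sq_int[OF Y(1)]] by (simp add: radial_slope_def)
    show "integrable leb (\<lambda>x. radial_prim f (norm x) * G (norm x))"
      using kernel_integrable[OF kG f] by (simp add: mult.commute)
  qed
  then show ?thesis by (simp add: dirichlet_def lin_def radial_slope_def mult.commute)
qed

text \<open>The constant is 1152 = 2 * 576: W is at most 576 |x|^-4, which integrates over the ball
  of radius 2R to 576 \<open>sphere_area\<close> (2R)^2 / 2.\<close>

lemma truncated_cut_kernels:
  assumes "truncated_kernels k M" shows "cut_kernels k (M + 1152 * sphere_area * M)"
  unfolding cut_kernels_def
proof (intro conjI allI impI)
  have M: "M \<ge> 0" using assms by (simp add: truncated_kernels_def)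
  show "0 \<le> M + 1152 * sphere_area * M" using M by simp
  fix R :: real assume R: "2 \<le> R"
  have kR: "kernel (k R)" "\<And>x. \<bar>k R x\<bar> \<le> M * W x" "\<And>x. norm x > 2 * R \<Longrightarrow> k R x = 0"
    using assms R by (auto simp: truncated_kernels_def)
  have m [measurable]: "k R \<in> borel_measurable leb" using kR by (simp add: kernel_def)
  show "kernel (k R)" by fact
  have W1: "W x \<le> 1" for x unfolding W_eq by (intro power_le_one ub_le1) auto
  show "\<bar>k R x\<bar> \<le> M + 1152 * sphere_area * M" for x
  proof -
    have "M * W x \<le> M * 1" using W1 M by (rule mult_left_mono)
    moreover have "0 \<le> 1152 * sphere_area * M" using M by simp
    ultimately show ?thesis using kR(2)[of x] by linarith
  qed
  have i: "integrable leb (\<lambda>x. 576 * M * (indicator {..2*R} (norm x) * (1 / norm x ^ 4)))"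
    using R by (intro integrable_mult_right ball_power) auto
  have le: "AE x in leb. \<bar>k R x\<bar> \<le> 576 * M * (indicator {..2*R} (norm x) * (1 / norm x ^ 4))"
    using AE_nonzero
  proof eventually_elim
    case (elim x)
    have "W x \<le> 24^2 / norm x ^ 4" unfolding W_eq using ub_pow_bounds(2)[of "norm x" 2 2] elim by simp
    then have "M * W x \<le> M * (24^2 / norm x ^ 4)" using M by (rule mult_left_mono)
    then have "\<bar>k R x\<bar> \<le> 576 * M / norm x ^ 4" using kR(2)[of x] by (simp add: mult.commute)
    then show ?case using kR(3)[of x] by (auto simp: indicator_def)
  qed
  show ik: "integrable leb (k R)"
  proof (rule Bochner_Integration.integrable_bound[OF i m])
    show "AE x in leb. norm (k R x) \<le> norm (576 * M * (indicator {..2*R} (norm x) * (1 / norm x ^ 4)))"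
      using le by eventually_elim (unfold real_norm_def, erule order_trans[OF _ abs_ge_self])
  qed
  have "(LINT x|leb. \<bar>k R x\<bar>) \<le> (LINT x|leb. 576 * M * (indicator {..2*R} (norm x) * (1 / norm x ^ 4)))"
    using ik by (intro integral_mono_AE i le) auto
  also have "\<dots> = 576 * M * (sphere_area * (2*R)^2 / 2)"
    using R by (simp only: integral_mult_right_zero) (subst ball_power(2), auto)
  also have "\<dots> = (1152 * sphere_area * M) * R\<^sup>2" by (simp add: power_mult_distrib)
  also have "\<dots> \<le> (M + 1152 * sphere_area * M) * R\<^sup>2" using M by (intro mult_right_mono) auto
  finally show "(LINT x|leb. \<bar>k R x\<bar>) \<le> (M + 1152 * sphere_area * M) * R\<^sup>2" .
qed

text \<open>The limit as the cutoff is removed is dominated convergence. Integrability of W times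
  the primitive is a hypothesis because it fails for some functions of finite energy; the two modes
  satisfy it.\<close>

lemma cutoff_kernels:
  fixes \<phi> w :: "real^6 \<Rightarrow> real"
  assumes \<phi>: "smooth \<phi>" "\<And>x. norm x \<le> 1 \<Longrightarrow> \<phi> x = 1" "\<And>x. norm x \<ge> 2 \<Longrightarrow> \<phi> x = 0"
    and w: "w \<in> borel_measurable borel" "\<And>x. \<bar>w x\<bar> \<le> 2 * W x"
  shows "\<exists>M. truncated_kernels (\<lambda>R x. rescale R \<phi> x * w x) M"
    and "sq_int f \<Longrightarrow> integrable leb (\<lambda>x. W x * radial_prim f (norm x)) \<Longrightarrow>
      ((\<lambda>R. lin (\<lambda>x. rescale R \<phi> x * w x) f) \<longlongrightarrow> (LINT x|leb. w x * radial_prim f (norm x))) at_top"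
proof -
  have c\<phi>: "continuous_on UNIV \<phi>" by (rule smooth_continuous[OF \<phi>(1)])
  have "compact (\<phi> ` cball 0 2)" by (intro compact_continuous_image continuous_on_subset[OF c\<phi>]) auto
  then have "bounded (\<phi> ` cball 0 2)" by (rule compact_imp_bounded)
  then obtain m where m0: "\<forall>y\<in>\<phi> ` cball 0 2. norm y \<le> m" unfolding bounded_iff by blast
  have m: "\<bar>\<phi> x\<bar> \<le> m" if "norm x \<le> 2" for x using m0 that by simp
  define N where "N = \<bar>m\<bar>"
  have N: "\<bar>\<phi> x\<bar> \<le> N" "N \<ge> 0" for x using m[of x] \<phi>(3)[of x] by (cases "norm x \<le> 2"; auto simp: N_def)+
  have meas: "(\<lambda>x. rescale R \<phi> x * w x) \<in> borel_measurable leb" for R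
  proof -
    have "continuous_on UNIV (\<lambda>x. \<phi> (x /\<^sub>R R))" by (rule continuous_on_compose2[OF c\<phi>]) (auto intro!: continuous_intros)
    then have "(\<lambda>x. \<phi> (x /\<^sub>R R)) \<in> borel_measurable borel" by (rule borel_measurable_continuous_onI)
    then show ?thesis unfolding rescale_def by (intro borel_measurable_lebesgueI borel_measurable_times w)
  qed
  have b: "\<bar>rescale R \<phi> x * w x\<bar> \<le> 2 * N * W x" for R x
  proof -
    have "\<bar>rescale R \<phi> x\<bar> * \<bar>w x\<bar> \<le> N * (2 * W x)" unfolding rescale_def using N w(2)[of x] by (intro mult_mono) auto
    then show ?thesis by (simp add: abs_mult mult_ac)
  qed
  have z: "rescale R \<phi> x * w x = 0" if "norm x > 2 * R" "R > 0" for R x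
  proof -
    have "norm (x /\<^sub>R R) \<ge> 2" using that by (simp add: field_simps)
    then show ?thesis by (simp add: rescale_def \<phi>(3))
  qed
  have W1: "W x \<le> 1" "W x \<ge> 0" for x unfolding W_eq by (auto intro: power_le_one ub_le1)
  have "truncated_kernels (\<lambda>R x. rescale R \<phi> x * w x) (2 * N)"
    unfolding truncated_kernels_def
  proof (intro conjI allI impI)
    show "0 \<le> 2 * N" using N by simp
    fix R :: real assume R: "2 \<le> R"
    show "\<bar>rescale R \<phi> x * w x\<bar> \<le> 2 * N * W x" for x by (rule b)
    show "norm x > 2 * R \<Longrightarrow> rescale R \<phi> x * w x = 0" for x using z R by auto
    show "kernel (\<lambda>x. rescale R \<phi> x * w x)" unfolding kernel_def
    proof (intro conjI meas exI allI)
      fix x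
      have le: "\<bar>rescale R \<phi> x * w x\<bar> \<le> 2 * N" using b[of R x] mult_left_mono[OF W1(1)[of x], of "2 * N"] N by simp
      also have "\<dots> \<le> 2 * N * (1 + (2 * R)^5)" using N R mult_left_mono[of 1 "1 + (2 * R)^5" "2 * N"] by simp
      finally show "\<bar>rescale R \<phi> x * w x\<bar> \<le> 2 * N * (1 + (2 * R)^5)" .
      show "\<bar>rescale R \<phi> x * w x\<bar> * norm x ^ 5 \<le> 2 * N * (1 + (2 * R)^5)"
      proof (cases "norm x > 2 * R")
        case True
        then have "rescale R \<phi> x * w x = 0" using R by (intro z) auto
        moreover have "0 \<le> 2 * N * (1 + (2 * R)^5)" using N R by (intro mult_nonneg_nonneg) auto
        ultimately show ?thesis by (simp only: abs_zero mult_zero_left)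
      next
        case False
        have "norm x ^ 5 \<le> (2 * R)^5" using False by (intro power_mono) auto
        then have "norm x ^ 5 \<le> 1 + (2 * R)^5" by simp
        then show ?thesis using le N by (intro mult_mono) auto
      qed
    qed
  qed
  then show "\<exists>M. truncated_kernels (\<lambda>R x. rescale R \<phi> x * w x) M" ..
  assume f: "sq_int f" and i: "integrable leb (\<lambda>x. W x * radial_prim f (norm x))"
  note [measurable] = borel_measurable_radial_prim[OF f] meas borel_measurable_lebesgueI[OF w(1)]
  show "((\<lambda>R. lin (\<lambda>x. rescale R \<phi> x * w x) f) \<longlongrightarrow> (LINT x|leb. w x * radial_prim f (norm x))) at_top"
    unfolding lin_def
  proof (rule integral_dominated_convergence_at_top[where w = "\<lambda>x. 2 * N * \<bar>W x * radial_prim f (norm x)\<bar>"])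
    show "integrable leb (\<lambda>x. 2 * N * \<bar>W x * radial_prim f (norm x)\<bar>)" using i by simp
    show "AE x in leb. ((\<lambda>R. rescale R \<phi> x * w x * radial_prim f (norm x)) \<longlongrightarrow> w x * radial_prim f (norm x)) at_top"
    proof (rule AE_I2)
      fix x :: "real^6"
      have "eventually (\<lambda>R. rescale R \<phi> x * w x * radial_prim f (norm x) = w x * radial_prim f (norm x)) at_top"
        using eventually_ge_at_top[of "max 1 (norm x)"]
      proof eventually_elim
        case (elim R)
        then have "norm (x /\<^sub>R R) \<le> 1" by (simp add: field_simps)
        then show ?case by (simp add: rescale_def \<phi>(2))
      qed
      then show "((\<lambda>R. rescale R \<phi> x * w x * radial_prim f (norm x)) \<longlongrightarrow> w x * radial_prim f (norm x)) at_top"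
        by (rule tendsto_eventually)
    qed
    show "eventually (\<lambda>R. AE x in leb. norm (rescale R \<phi> x * w x * radial_prim f (norm x)) \<le> 2 * N * \<bar>W x * radial_prim f (norm x)\<bar>) at_top"
    proof (rule always_eventually, intro allI AE_I2)
      fix R and x :: "real^6"
      have "\<bar>rescale R \<phi> x * w x\<bar> * \<bar>radial_prim f (norm x)\<bar> \<le> 2 * N * W x * \<bar>radial_prim f (norm x)\<bar>"
        using b by (intro mult_right_mono) auto
      then show "norm (rescale R \<phi> x * w x * radial_prim f (norm x)) \<le> 2 * N * \<bar>W x * radial_prim f (norm x)\<bar>"
        using W1(2)[of x] by (simp add: abs_mult mult.assoc)
    qed
  qed measurable
qed

lemma eventually_abs_ge_half:
  assumes "(F \<longlongrightarrow> - L) at_top" "(L::real) > 0"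
  shows "eventually (\<lambda>R::real. \<bar>F R\<bar> \<ge> L / 2) at_top"
proof -
  have "eventually (\<lambda>R. F R < - (L / 2)) at_top" using assms by (intro order_tendstoD(2)[OF assms(1)]) simp
  then show ?thesis by eventually_elim linarith
qed

lemma integrable_W_modes:
  "integrable leb (\<lambda>x. W x * radial_prim dW (norm x))" "integrable leb (\<lambda>x. W x * radial_prim dLW (norm x))"
proof -
  note [measurable] = borel_measurable_radial_prim[OF sq_int_dW] borel_measurable_radial_prim[OF sq_int_dLW]
  show "integrable leb (\<lambda>x. W x * radial_prim dW (norm x))"
  proof (rule integrable_cong_AE_imp[OF integrable_W_sq(1)])
    show "AE x in leb. ub (norm x) ^ 4 = W x * radial_prim dW (norm x)"
      using AE_nonzero by eventually_elim (simp add: radial_prim_dW W_eq flip: power_add)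
  qed measurable
  have i: "integrable leb (\<lambda>x. 4 * (ub (norm x))^5 - 2 * (ub (norm x))^4)" using integrable_W_sq by simp
  show "integrable leb (\<lambda>x. W x * radial_prim dLW (norm x))"
  proof (rule integrable_cong_AE_imp[OF i])
    show "AE x in leb. 4 * (ub (norm x))^5 - 2 * (ub (norm x))^4 = W x * radial_prim dLW (norm x)"
      using AE_nonzero by eventually_elim (simp add: radial_prim_dLW W_eq algebra_simps eval_nat_numeral)
  qed measurable
qed

lemma Lam_W_measurable: "Lam W \<in> borel_measurable borel"
proof -
  have "Lam W = (\<lambda>x. 4 * (ub (norm x))^3 - 2 * (ub (norm x))^2)" by (simp add: Lam_W fun_eq_iff)
  then show ?thesis by simp
qed

lemma pairing_limits:
  "(LINT x|leb. W x * radial_prim dLW (norm x)) = - W_mass"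
  "(LINT x|leb. Lam W x * radial_prim dW (norm x)) = - W_mass"
proof -
  note [measurable] = borel_measurable_radial_prim[OF sq_int_dW] borel_measurable_radial_prim[OF sq_int_dLW]
    borel_measurable_lebesgueI[OF Lam_W_measurable]
  have "(LINT x|leb. W x * radial_prim dLW (norm x)) = (LINT x|leb. (ub (norm x))^2 * (4 * (ub (norm x))^3 - 2 * (ub (norm x))^2))"
  proof (rule integral_cong_AE)
    show "AE x in leb. W x * radial_prim dLW (norm x) = (ub (norm x))^2 * (4 * (ub (norm x))^3 - 2 * (ub (norm x))^2)"
      using AE_nonzero by eventually_elim (simp add: radial_prim_dLW W_eq)
  qed measurable
  then show "(LINT x|leb. W x * radial_prim dLW (norm x)) = - W_mass" by (simp add: W_LW_pairing W_mass_def)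
  have "(LINT x|leb. Lam W x * radial_prim dW (norm x)) = (LINT x|leb. (ub (norm x))^2 * (4 * (ub (norm x))^3 - 2 * (ub (norm x))^2))"
  proof (rule integral_cong_AE)
    show "AE x in leb. Lam W x * radial_prim dW (norm x) = (ub (norm x))^2 * (4 * (ub (norm x))^3 - 2 * (ub (norm x))^2)"
      using AE_nonzero by eventually_elim (simp add: radial_prim_dW Lam_W)
  qed measurable
  then show "(LINT x|leb. Lam W x * radial_prim dW (norm x)) = - W_mass" by (simp add: W_LW_pairing W_mass_def)
qed

lemma cut_kernels_mono: "cut_kernels k B \<Longrightarrow> B \<le> B' \<Longrightarrow> cut_kernels k B'"
  unfolding cut_kernels_def
proof (elim conjE, intro conjI allI impI)
  fix R :: real
  assume b: "0 \<le> B" "B \<le> B'" "2 \<le> R" and k: "\<forall>R\<ge>2. kernel (k R) \<and> (\<forall>x. \<bar>k R x\<bar> \<le> B) \<and> integrable leb (k R) \<and> (LINT x|leb. \<bar>k R x\<bar>) \<le> B * R\<^sup>2"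
  have kR: "kernel (k R)" "\<bar>k R x\<bar> \<le> B" "integrable leb (k R)" "(LINT x|leb. \<bar>k R x\<bar>) \<le> B * R\<^sup>2" for x using k b by auto
  show "kernel (k R)" "integrable leb (k R)" by fact+
  show "\<bar>k R x\<bar> \<le> B'" for x using kR(2)[of x] b by linarith
  show "(LINT x|leb. \<bar>k R x\<bar>) \<le> B' * R\<^sup>2" using kR(4) mult_right_mono[OF b(2) zero_le_power2[of R]] by linarith
qed simp

lemma cut_kernels_zero: "B \<ge> 0 \<Longrightarrow> cut_kernels (\<lambda>R x. 0) B"
  by (auto simp: cut_kernels_def kernel_def)

lemma W_bounds: "0 \<le> W x" "W x \<le> 1" unfolding W_eq by (auto intro: power_le_one ub_le1)

section \<open>The eigenpair and its weak equations\<close>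

locale eigenpair =
  fixes Y1 Y2 :: "real^6 \<Rightarrow> real" and \<nu> :: real
  assumes Y1: "schwartz Y1" "radial Y1" and Y2: "schwartz Y2" "radial Y2" and \<nu>: "\<nu> > 0"
    and eq1: "\<And>x. schroedinger Vplus Y1 x = - \<nu> * Y2 x" and eq2: "\<And>x. schroedinger Vminus Y2 x = \<nu> * Y1 x"
    and Y2_norm: "L2norm Y2 = 1"
begin

lemma profile_continuous: "schwartz Y \<Longrightarrow> continuous_on UNIV (\<lambda>r. Y (r *\<^sub>R axis 1 1 :: real^6) :: real)"
  by (rule continuous_on_compose2[OF smooth_continuous[OF schwartz_smooth]]) (auto intro!: continuous_intros)

lemma profile_value: "schwartz Y \<Longrightarrow> radial Y \<Longrightarrow> Y (norm x *\<^sub>R axis 1 1) = (Y x :: real)" for x :: "real^6"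
  using radial_profile(1)[OF schwartz_smooth, of Y x] by simp

lemma kernel_lincomb:
  assumes "schwartz A" "schwartz B"
  shows "kernel (\<lambda>x. a * A x + b * (W x * B x))"
proof -
  obtain CA where CA: "CA \<ge> 0" "\<And>x j. j \<le> 7 \<Longrightarrow> \<bar>A x\<bar> * norm x ^ j \<le> CA" using schwartz_bounds[OF assms(1)] by metis
  obtain CB where CB: "CB \<ge> 0" "\<And>x j. j \<le> 7 \<Longrightarrow> \<bar>B x\<bar> * norm x ^ j \<le> CB" using schwartz_bounds[OF assms(2)] by metis
  have "\<bar>a * A x + b * (W x * B x)\<bar> * norm x ^ j \<le> \<bar>a\<bar> * CA + \<bar>b\<bar> * CB" if "j \<le> 7" for x j
  proof -
    have "\<bar>W x * B x\<bar> \<le> \<bar>B x\<bar>" using W_bounds[of x] mult_right_mono[of "W x" 1 "\<bar>B x\<bar>"] by (simp add: abs_mult)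
    then have "\<bar>b\<bar> * \<bar>W x * B x\<bar> \<le> \<bar>b\<bar> * \<bar>B x\<bar>" by (intro mult_left_mono) auto
    then have "\<bar>a * A x + b * (W x * B x)\<bar> \<le> \<bar>a\<bar> * \<bar>A x\<bar> + \<bar>b\<bar> * \<bar>B x\<bar>"
      using abs_triangle_ineq[of "a * A x" "b * (W x * B x)"] unfolding abs_mult by linarith
    then have "\<bar>a * A x + b * (W x * B x)\<bar> * norm x ^ j \<le> (\<bar>a\<bar> * \<bar>A x\<bar> + \<bar>b\<bar> * \<bar>B x\<bar>) * norm x ^ j"
      by (intro mult_right_mono) auto
    also have "\<dots> = \<bar>a\<bar> * (\<bar>A x\<bar> * norm x ^ j) + \<bar>b\<bar> * (\<bar>B x\<bar> * norm x ^ j)" by (simp add: algebra_simps)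
    also have "\<dots> \<le> \<bar>a\<bar> * CA + \<bar>b\<bar> * CB" using CA(2)[OF that, of x] CB(2)[OF that, of x] by (intro add_mono mult_left_mono) auto
    finally show ?thesis .
  qed
  from this[of 0] this[of 5] have "\<forall>x. \<bar>a * A x + b * (W x * B x)\<bar> \<le> \<bar>a\<bar> * CA + \<bar>b\<bar> * CB \<and> \<bar>a * A x + b * (W x * B x)\<bar> * norm x ^ 5 \<le> \<bar>a\<bar> * CA + \<bar>b\<bar> * CB"
    by simp
  moreover have "(\<lambda>x. a * A x + b * (W x * B x)) \<in> borel_measurable leb"
    by (intro borel_measurable_lebesgueI borel_measurable_add borel_measurable_times borel_measurable_const W_measurable smooth_measurable schwartz_smooth assms)
  ultimately show ?thesis unfolding kernel_def by blast
qed

text \<open>Both equations have the shape \<Delta>A = a B + b W A, so one computation serves Y1,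
  with a = \<nu> and b = -2, and Y2, with a = -\<nu> and b = -1.\<close>

lemma dirichlet_eigen:
  assumes A: "schwartz A" "radial A" and B: "schwartz B" "radial B" and f: "sq_int f"
    and lap: "\<And>x. laplacian A x = a * B x + b * (W x * A x)"
  shows "dirichlet f (radial_slope A) = - (a * lin B f) - b * wform f (radial_slope A)"
proof -
  let ?G = "\<lambda>r. a * B (r *\<^sub>R axis 1 1) + b * ((ub r)^2 * A (r *\<^sub>R axis 1 1))"
  have G: "?G (norm x) = a * B x + b * (W x * A x)" for x by (simp add: profile_value A B W_eq)
  have sA: "sq_int (radial_slope A)" by (rule radial_slope_sq_int[OF A(1)])
  note [measurable] = borel_measurable_radial_prim[OF f] borel_measurable_radial_prim[OF sA]
    borel_measurable_lebesgueI[OF smooth_measurable[OF schwartz_smooth[OF A(1)]]] borel_measurable_lebesgueI[OF smooth_measurable[OF schwartz_smooth[OF B(1)]]]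
  have "dirichlet f (radial_slope A) = - lin (\<lambda>x. ?G (norm x)) f"
  proof (rule dirichlet_slope[OF A f])
    show "laplacian A x = ?G (norm x)" for x unfolding G by (rule lap)
    show "continuous_on UNIV ?G" by (intro continuous_intros profile_continuous A B)
    show "kernel (\<lambda>x. ?G (norm x))" unfolding G by (rule kernel_lincomb[OF B(1) A(1)])
  qed
  also have "lin (\<lambda>x. ?G (norm x)) f = (LINT x|leb. a * (B x * radial_prim f (norm x)) + b * (W x * (radial_prim f (norm x) * radial_prim (radial_slope A) (norm x))))"
    unfolding lin_def G
  proof (rule integral_cong_AE)
    show "AE x in leb. (a * B x + b * (W x * A x)) * radial_prim f (norm x) = a * (B x * radial_prim f (norm x)) + b * (W x * (radial_prim f (norm x) * radial_prim (radial_slope A) (norm x)))"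
      using AE_nonzero by eventually_elim (simp add: radial_prim_slope[OF A] algebra_simps)
  qed measurable
  also have "\<dots> = a * lin B f + b * wform f (radial_slope A)"
    unfolding lin_def wform_def using kernel_integrable[OF schwartz_kernel(1)[OF B(1)] f] integrable_W_prim2[OF f sA] by simp
  finally show ?thesis by simp
qed

lemma laplacians: "laplacian Y1 x = \<nu> * Y2 x + (- 2) * (W x * Y1 x)" "laplacian Y2 x = (- \<nu>) * Y1 x + (- 1) * (W x * Y2 x)"
  using eq1[of x] eq2[of x] by (auto simp: schroedinger_def Vplus_def Vminus_def)

lemma eigen_form: "sq_int f \<Longrightarrow> dirichlet f (radial_slope Y1) - 2 * wform f (radial_slope Y1) = - \<nu> * lin Y2 f"
  using dirichlet_eigen[OF Y1 Y2 _ laplacians(1)] by simp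

text \<open>\<open>\<nu>\<langle>Y1, Y2\<rangle>\<close> is the nonnegative form of \<open>L\<^sup>-\<close> at \<open>Y2\<close>; it cannot vanish, since otherwise \<open>Y2\<close> would be
  a multiple of \<open>W\<close>, which decays only like \<open>|x|\<^sup>-\<^sup>4\<close>.\<close>

lemma lin_pos: "lin Y2 (radial_slope Y1) > 0"
proof (rule ccontr)
  assume neg: "\<not> ?thesis"
  let ?f = "radial_slope Y2"
  have s1: "sq_int (radial_slope Y1)" and s2: "sq_int ?f" using radial_slope_sq_int Y1 Y2 by auto
  note [measurable] = borel_measurable_radial_prim[OF s1] borel_measurable_radial_prim[OF s2]
    borel_measurable_lebesgueI[OF smooth_measurable[OF schwartz_smooth[OF Y1(1)]]] borel_measurable_lebesgueI[OF smooth_measurable[OF schwartz_smooth[OF Y2(1)]]]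
  have "lin Y2 (radial_slope Y1) = lin Y1 ?f"
    unfolding lin_def
  proof (rule integral_cong_AE)
    show "AE x in leb. Y2 x * radial_prim (radial_slope Y1) (norm x) = Y1 x * radial_prim ?f (norm x)"
      using AE_nonzero by eventually_elim (simp add: radial_prim_slope Y1 Y2)
  qed measurable
  moreover have "dirichlet ?f ?f - wform ?f ?f = \<nu> * lin Y1 ?f"
    using dirichlet_eigen[OF Y2 Y1 s2 laplacians(2)] by simp
  \<comment> \<open>The form of L- is nonnegative, so this forces every component of Y2 except the
    one along W to vanish.\<close>
  ultimately have Q: "dirichlet ?f ?f - wform ?f ?f \<le> 0" using neg \<nu> by (simp add: mult_nonneg_nonpos)
  obtain a b z where z: "orth_modes z" and f: "?f = modes z a b" using mode_decomposition[OF s2] .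
  have sz: "sq_int z" using z by (simp add: orth_modes_def)
  have "b\<^sup>2 * wform dLW dLW + (dirichlet z z - wform z z) \<le> 0" using Q unfolding f orth_modes_values[OF z] by (simp add: algebra_simps)
  moreover have "0 \<le> b\<^sup>2 * wform dLW dLW" by (intro mult_nonneg_nonneg wform_nonneg) auto
  moreover have "7/3 * wform z z \<le> dirichlet z z" "0 \<le> wform z z" "0 \<le> dirichlet z z"
    using orth_modes_gap[OF z] wform_nonneg dirichlet_nonneg by auto
  ultimately have "b\<^sup>2 * wform dLW dLW = 0" "dirichlet z z = 0" by linarith+
  then have b: "b = 0" and Ez: "dirichlet z z = 0" using wform_dLW_pos by auto
  have zr: "radial_prim z r = 0" if "r > 0" for r
  proof -
    have "(radial_prim z r)\<^sup>2 \<le> 0"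
      using radial_prim_bound'[OF sz that] Ez by (simp add: dirichlet_def power2_eq_square)
    then show ?thesis by simp
  qed
  have Y2v: "Y2 x = a * (ub (norm x))^2" if "x \<noteq> 0" for x
  proof -
    have "Y2 x = radial_prim ?f (norm x)" using radial_prim_slope[OF Y2 that] by simp
    also have "\<dots> = a * (ub (norm x))^2"
      unfolding f modes_def b using that sz zr[of "norm x"]
      by (simp add: radial_prim_add radial_prim_scale sq_int_scale sq_int_dW radial_prim_dW)
    finally show ?thesis .
  qed
  obtain C where C: "C \<ge> 0" "\<And>x j. j \<le> 7 \<Longrightarrow> \<bar>Y2 x\<bar> * norm x ^ j \<le> C" using schwartz_bounds[OF Y2(1)] by metis
  have a0: "a = 0"
  proof (rule ccontr)
    assume a: "a \<noteq> 0"
    \<comment> \<open>For r \<ge> 5 the quantity r^2 ub is at least 12, half of its limit, so |Y2|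
      r^5 \<ge> 144 |a| r, which exceeds C because |a| r > C.\<close>
    define r where "r = 5 + C / \<bar>a\<bar>"
    have r: "r \<ge> 5" using C by (simp add: r_def)
    have "5\<^sup>2 \<le> r\<^sup>2" using r by (intro power_mono) auto
    then have u: "12 \<le> r\<^sup>2 * ub r" unfolding ub_def by (simp add: field_simps add_pos_nonneg)
    have "\<bar>Y2 (r *\<^sub>R axis 1 1)\<bar> * r ^ 5 \<le> C" using C(2)[of 5 "r *\<^sub>R axis 1 1"] r by simp
    moreover have "Y2 (r *\<^sub>R axis 1 1) = a * (ub r)^2" using Y2v[of "r *\<^sub>R axis 1 1"] r by simp
    ultimately have "\<bar>a\<bar> * ((r\<^sup>2 * ub r)^2 * r) \<le> C" using r by (simp add: abs_mult power_mult_distrib eval_nat_numeral mult_ac)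
    moreover have "12^2 * r \<le> (r\<^sup>2 * ub r)^2 * r" using u r by (intro mult_right_mono power_mono) auto
    then have "\<bar>a\<bar> * (12^2 * r) \<le> \<bar>a\<bar> * ((r\<^sup>2 * ub r)^2 * r)" by (rule mult_left_mono) simp
    ultimately have "144 * (\<bar>a\<bar> * r) \<le> C" by simp
    moreover have "\<bar>a\<bar> * r = 5 * \<bar>a\<bar> + C" using a by (simp add: r_def distrib_left)
    ultimately show False using a C by simp
  qed
  have "AE x in leb. (norm (Y2 x))\<^sup>2 = 0" using AE_nonzero by eventually_elim (simp add: Y2v a0)
  then have "(LINT x|leb. (norm (Y2 x))\<^sup>2) = 0" by (rule integral_eq_zero_AE)
  then show False using Y2_norm by (simp add: L2norm_def)
qed

text \<open>For L- one pairing is enough; the zero kernel is added as a second one so that both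
  estimates have the shape that \<open>cut_coercivity\<close> expects.\<close>

lemma coercivity:
  assumes \<phi>: "smooth \<phi>" "\<And>x. norm x \<le> 1 \<Longrightarrow> \<phi> x = 1" "\<And>x. norm x \<ge> 2 \<Longrightarrow> \<phi> x = 0"
  defines "kW \<equiv> \<lambda>R x. rescale R \<phi> x * W x" and "kL \<equiv> \<lambda>R x. rescale R \<phi> x * Lam W x"
  obtains B c0 C0 where "c0 > 0" "C0 > 0" "cut_kernels kW B" "cut_kernels kL B" "cut_kernels (\<lambda>R. Y2) B"
    "eventually (\<lambda>R. \<forall>f. sq_int f \<longrightarrow> dirichlet f f - 1 * wform f f \<ge>
      c0 / ln R * dirichlet f f - C0 * ((lin (kL R) f)\<^sup>2 + (lin (\<lambda>x. 0) f)\<^sup>2)) at_top"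
    "eventually (\<lambda>R. \<forall>f. sq_int f \<longrightarrow> dirichlet f f - 2 * wform f f \<ge>
      c0 / ln R * dirichlet f f - C0 * ((lin (kW R) f)\<^sup>2 + (lin Y2 f)\<^sup>2)) at_top"
proof -
  have wW: "\<bar>W x\<bar> \<le> 2 * W x" for x using W_bounds[of x] by simp
  obtain M1 where M1: "truncated_kernels kW M1"
    using cutoff_kernels(1)[OF \<phi> W_measurable wW] unfolding kW_def by blast
  obtain M2 where M2: "truncated_kernels kL M2"
    using cutoff_kernels(1)[OF \<phi> Lam_W_measurable abs_Lam_W] unfolding kL_def by blast
  have limW: "((\<lambda>R. lin (kW R) dLW) \<longlongrightarrow> - W_mass) at_top"
    using cutoff_kernels(2)[OF \<phi> W_measurable wW sq_int_dLW integrable_W_modes(2)] unfolding kW_def pairing_limits .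
  have limL: "((\<lambda>R. lin (kL R) dW) \<longlongrightarrow> - W_mass) at_top"
    using cutoff_kernels(2)[OF \<phi> Lam_W_measurable abs_Lam_W sq_int_dW integrable_W_modes(1)] unfolding kL_def pairing_limits .
  have m: "W_mass / 2 > 0" using W_mass_pos by simp
  obtain c1 C1 where 1: "c1 > 0" "C1 > 0" and e1: "eventually (\<lambda>R. \<forall>f. sq_int f \<longrightarrow>
    dirichlet f f - wform f f \<ge> c1 / ln R * dirichlet f f - C1 * (lin (kL R) f)\<^sup>2) at_top"
    using coercive_minus[OF M2 m eventually_abs_ge_half[OF limL W_mass_pos]] by blast
  have s1: "sq_int (radial_slope Y1)" using radial_slope_sq_int Y1 by auto
  note [measurable] = borel_measurable_radial_prim[OF s1] borel_measurable_lebesgueI[OF smooth_measurable[OF schwartz_smooth[OF Y1(1)]]]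
  \<comment> \<open>A bound independent of R, because Y1 is integrable and all kernels are bounded
    by M1.\<close>
  define My where "My = M1 * (LINT x|leb. \<bar>Y1 x\<bar>)"
  have iY1: "integrable leb Y1" by (rule schwartz_kernel(2)[OF Y1(1)])
  have ly: "\<bar>lin (kW R) (radial_slope Y1)\<bar> \<le> My" if R: "R \<ge> 2" for R
  proof -
    have kR: "kernel (kW R)" "\<And>x. \<bar>kW R x\<bar> \<le> M1 * W x" "M1 \<ge> 0" using M1 R by (auto simp: truncated_kernels_def)
    have "\<bar>lin (kW R) (radial_slope Y1)\<bar> \<le> (LINT x|leb. \<bar>kW R x * radial_prim (radial_slope Y1) (norm x)\<bar>)"
      unfolding lin_def using integral_norm_bound[of leb "\<lambda>x. kW R x * radial_prim (radial_slope Y1) (norm x)"] by simp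
    also have "\<dots> \<le> (LINT x|leb. M1 * \<bar>Y1 x\<bar>)"
    proof (rule integral_mono_AE)
      show "integrable leb (\<lambda>x. \<bar>kW R x * radial_prim (radial_slope Y1) (norm x)\<bar>)" using kernel_integrable[OF kR(1) s1] by simp
      show "integrable leb (\<lambda>x. M1 * \<bar>Y1 x\<bar>)" using iY1 by simp
      show "AE x in leb. \<bar>kW R x * radial_prim (radial_slope Y1) (norm x)\<bar> \<le> M1 * \<bar>Y1 x\<bar>"
        using AE_nonzero
      proof eventually_elim
        case (elim x)
        have "M1 * W x \<le> M1 * 1" using kR W_bounds by (intro mult_left_mono) auto
        then have "\<bar>kW R x\<bar> \<le> M1" using kR(2)[of x] by simp
        then show ?case using elim by (simp add: radial_prim_slope Y1 abs_mult mult_right_mono)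
      qed
    qed
    finally show ?thesis by (simp add: My_def)
  qed
  obtain c2 C2 where 2: "c2 > 0" "C2 > 0" and e2: "eventually (\<lambda>R. \<forall>f. sq_int f \<longrightarrow>
    dirichlet f f - 2 * wform f f \<ge> c2 / ln R * dirichlet f f - C2 * ((lin (kW R) f)\<^sup>2 + (lin Y2 f)\<^sup>2)) at_top"
    using coercive_plus[OF M1 m eventually_abs_ge_half[OF limW W_mass_pos] s1 schwartz_kernel(1)[OF Y2(1)] \<nu> lin_pos eigen_form ly] by blast
  obtain B3 where B3: "cut_kernels (\<lambda>R. Y2) B3" using schwartz_kernel(3)[OF Y2(1)] by blast
  define B1 where "B1 = M1 + 1152 * sphere_area * M1"
  define B2 where "B2 = M2 + 1152 * sphere_area * M2"
  define B where "B = max B1 (max B2 B3)"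
  define c0 where "c0 = min c1 c2"
  define C0 where "C0 = max C1 C2"
  have mono: "c0 / ln R * D - C0 * S \<le> c / ln R * D - C * S" if "c0 \<le> c" "C \<le> C0" "0 \<le> D" "0 \<le> S" "R \<ge> 1" for R D S c C
  proof -
    have "c0 / ln R \<le> c / ln R" using that by (intro divide_right_mono) auto
    then have "c0 / ln R * D \<le> c / ln R * D" using that by (intro mult_right_mono) auto
    moreover have "C * S \<le> C0 * S" using that by (intro mult_right_mono) auto
    ultimately show ?thesis by linarith
  qed
  have g1: "eventually (\<lambda>R::real. R \<ge> 1) at_top" by (rule eventually_ge_at_top)
  show thesis
  proof (rule that[of c0 C0 B])
    show "c0 > 0" "C0 > 0" using 1 2 by (auto simp: c0_def C0_def)
    show "cut_kernels kW B" by (rule cut_kernels_mono[OF truncated_cut_kernels[OF M1]]) (simp add: B_def B1_def)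
    show "cut_kernels kL B" by (rule cut_kernels_mono[OF truncated_cut_kernels[OF M2]]) (simp add: B_def B2_def)
    show "cut_kernels (\<lambda>R. Y2) B" by (rule cut_kernels_mono[OF B3]) (simp add: B_def)
    show "eventually (\<lambda>R. \<forall>f. sq_int f \<longrightarrow> dirichlet f f - 1 * wform f f \<ge>
      c0 / ln R * dirichlet f f - C0 * ((lin (kL R) f)\<^sup>2 + (lin (\<lambda>x. 0) f)\<^sup>2)) at_top"
      using e1 g1
    proof eventually_elim
      case (elim R)
      show ?case
      proof (intro allI impI)
        fix f assume "sq_int f"
        then show "c0 / ln R * dirichlet f f - C0 * ((lin (kL R) f)\<^sup>2 + (lin (\<lambda>x. 0) f)\<^sup>2) \<le> dirichlet f f - 1 * wform f f"
          using elim mono[of c1 C1 "dirichlet f f" "(lin (kL R) f)\<^sup>2" R] dirichlet_nonneg[of f]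
          by (force simp: c0_def C0_def lin_def)
      qed
    qed
    show "eventually (\<lambda>R. \<forall>f. sq_int f \<longrightarrow> dirichlet f f - 2 * wform f f \<ge>
      c0 / ln R * dirichlet f f - C0 * ((lin (kW R) f)\<^sup>2 + (lin Y2 f)\<^sup>2)) at_top"
      using e2 g1
    proof eventually_elim
      case (elim R)
      show ?case
      proof (intro allI impI)
        fix f assume "sq_int f"
        then show "c0 / ln R * dirichlet f f - C0 * ((lin (kW R) f)\<^sup>2 + (lin Y2 f)\<^sup>2) \<le> dirichlet f f - 2 * wform f f"
          using elim mono[of c2 C2 "dirichlet f f" "(lin (kW R) f)\<^sup>2 + (lin Y2 f)\<^sup>2" R] dirichlet_nonneg[of f]
          by (force simp: c0_def C0_def)
      qed
    qed
  qed
qed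

end

section \<open>Radial test functions\<close>

text \<open>Differentiability n times on the whole line, with the successive derivatives as
  existential witnesses; closure under sums, products and affine substitution is then a plain
  induction.\<close>

primrec ndiff :: "nat \<Rightarrow> (real \<Rightarrow> real) \<Rightarrow> bool" where
  "ndiff 0 f \<longleftrightarrow> True"
| "ndiff (Suc n) f \<longleftrightarrow> (\<exists>f'. (\<forall>x. (f has_real_derivative f' x) (at x)) \<and> ndiff n f')"

lemma ndiff_mono: "ndiff (Suc n) f \<Longrightarrow> ndiff n f"
proof (induction n arbitrary: f)
  case (Suc n)
  then obtain f' where "\<forall>x. (f has_real_derivative f' x) (at x)" "ndiff (Suc n) f'" by auto
  with Suc.IH[of f'] show ?case by auto
qed simp

lemma ndiff_const: "ndiff n (\<lambda>x. c)"
proof (induction n arbitrary: c)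
  case (Suc n)
  show ?case using Suc[of 0] by (auto intro!: exI[of _ "\<lambda>x. 0"])
qed simp

lemma ndiff_add: "ndiff n f \<Longrightarrow> ndiff n g \<Longrightarrow> ndiff n (\<lambda>x. f x + g x)"
proof (induction n arbitrary: f g)
  case (Suc n)
  then obtain f' g' where "\<forall>x. (f has_real_derivative f' x) (at x)" "ndiff n f'"
    "\<forall>x. (g has_real_derivative g' x) (at x)" "ndiff n g'" by auto
  then show ?case using Suc.IH[of f' g'] by (auto intro!: exI[of _ "\<lambda>x. f' x + g' x"] derivative_eq_intros)
qed simp

lemma ndiff_mult: "ndiff n f \<Longrightarrow> ndiff n g \<Longrightarrow> ndiff n (\<lambda>x. f x * g x)"
proof (induction n arbitrary: f g)
  case (Suc n)
  then obtain f' g' where d: "\<forall>x. (f has_real_derivative f' x) (at x)" "ndiff n f'"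
    "\<forall>x. (g has_real_derivative g' x) (at x)" "ndiff n g'" by auto
  have "ndiff n (\<lambda>x. f' x * g x + f x * g' x)"
    using Suc ndiff_mono[OF Suc.prems(1)] ndiff_mono[OF Suc.prems(2)] d by (intro ndiff_add Suc.IH) auto
  moreover have "\<forall>x. ((\<lambda>x. f x * g x) has_real_derivative f' x * g x + f x * g' x) (at x)"
    using d by (auto intro!: derivative_eq_intros)
  ultimately show ?case by auto
qed simp

lemma ndiff_affine: "ndiff n f \<Longrightarrow> ndiff n (\<lambda>x. f (a * x + b))"
proof (induction n arbitrary: f)
  case (Suc n)
  then obtain f' where d: "\<And>x. (f has_real_derivative f' x) (at x)" "ndiff n f'" by auto
  have "\<forall>x. ((\<lambda>x. f (a * x + b)) has_real_derivative f' (a * x + b) * a) (at x)"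
    by (intro allI DERIV_chain2[OF d(1)]) (auto intro!: derivative_eq_intros)
  moreover have "ndiff n (\<lambda>x. f' (a * x + b) * a)" by (intro ndiff_mult ndiff_const Suc.IH d)
  ultimately show ?case by (auto intro!: exI[of _ "\<lambda>x. f' (a * x + b) * a"])
qed simp

text \<open>Only left difference quotients are compared, so the endpoint x = p is included.\<close>

lemma DERIV_zero_region:
  assumes "(f has_real_derivative f') (at x)" "\<And>y. y \<le> p \<Longrightarrow> f y = (0::real)" "x \<le> p"
  shows "f' = 0"
proof -
  have "((\<lambda>y. (f y - f x) / (y - x)) \<longlongrightarrow> f') (at_left x)"
    using has_field_derivative_at_within[OF assms(1), of "{..<x}"] by (simp add: has_field_derivative_iff)
  moreover have "((\<lambda>y. (f y - f x) / (y - x)) \<longlongrightarrow> 0) (at_left x)"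
    by (rule tendsto_eventually) (use assms in \<open>auto simp: eventually_at_left_field intro!: exI[of _ "x - 1"]\<close>)
  ultimately show ?thesis by (rule tendsto_unique[OF trivial_limit_at_left_real])
qed

text \<open>Since f vanishes near 0 and to its left, the singularity of 1/x is never met. Both terms
  of the quotient rule are again quotients of functions vanishing up to p, so the induction
  closes.\<close>

lemma ndiff_divide:
  assumes "ndiff n f" "p > 0" "\<And>x. x \<le> p \<Longrightarrow> f x = 0"
  shows "ndiff n (\<lambda>x. f x / x)"
  using assms
proof (induction n arbitrary: f)
  case (Suc n)
  then obtain f' where d: "\<And>x. (f has_real_derivative f' x) (at x)" "ndiff n f'" by auto
  have f'0: "f' x = 0" if "x \<le> p" for x by (rule DERIV_zero_region[OF d(1) Suc.prems(3) that])
  let ?g = "\<lambda>x. f' x / x + (- 1) * (f x / x / x)"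
  have "((\<lambda>x. f x / x) has_real_derivative ?g x) (at x)" for x
  proof (cases "x < p")
    case True
    have "((\<lambda>x. f x / x) has_real_derivative 0) (at x)"
      by (rule has_field_derivative_transform_within_open[OF DERIV_const[of 0], where S = "{..<p}"]) (use True Suc.prems in auto)
    then show ?thesis using f'0[of x] Suc.prems(3)[of x] True by simp
  next
    case False
    then have "x \<noteq> 0" using Suc.prems by auto
    then show ?thesis using DERIV_divide[OF d(1)[of x] DERIV_ident] by (simp add: field_simps)
  qed
  moreover have "ndiff n ?g"
  proof (intro ndiff_add ndiff_mult ndiff_const)
    show "ndiff n (\<lambda>x. f' x / x)" by (rule Suc.IH[OF d(2) Suc.prems(2) f'0])
    have "ndiff n (\<lambda>x. f x / x)" by (rule Suc.IH[OF ndiff_mono[OF Suc.prems(1)] Suc.prems(2,3)])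
    then show "ndiff n (\<lambda>x. f x / x / x)" by (rule Suc.IH[OF _ Suc.prems(2)]) (use Suc.prems(3) in auto)
  qed
  ultimately show ?case by (auto intro!: exI[of _ ?g])
qed simp

text \<open>The powers in the denominator make the family closed under differentiation up to linear
  combinations; a single limit at 0 then yields all derivatives there.\<close>

definition exp_bump :: "nat \<Rightarrow> real \<Rightarrow> real"
  where "exp_bump k v = (if v > 0 then exp (- (1 / v)) / v ^ k else 0)"

lemma exp_bump_tendsto_0: "(exp_bump k \<longlongrightarrow> 0) (at 0)"
proof -
  have "((\<lambda>v::real. inverse v ^ k / exp (inverse v)) \<longlongrightarrow> 0) (at_right 0)"
    by (rule filterlim_compose[OF tendsto_power_div_exp_0 filterlim_inverse_at_top_right])
  moreover have "eventually (\<lambda>v. inverse v ^ k / exp (inverse v) = exp_bump k v) (at_right 0)"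
    unfolding eventually_at_right_field by (intro exI[of _ 1]) (auto simp: exp_bump_def exp_minus field_simps)
  ultimately have "(exp_bump k \<longlongrightarrow> 0) (at_right 0)" by (rule Lim_transform_eventually)
  moreover have "(exp_bump k \<longlongrightarrow> 0) (at_left 0)"
    by (rule tendsto_eventually) (auto simp: exp_bump_def eventually_at_left_field intro!: exI[of _ "-1"])
  ultimately show ?thesis by (intro filterlim_split_at)
qed

lemma DERIV_exp_bump: "(exp_bump k has_real_derivative - real k * exp_bump (Suc k) v + exp_bump (k + 2) v) (at v)"
proof -
  consider "v > 0" | "v < 0" | "v = 0" by linarith
  then show ?thesis
  proof cases
    case 1
    have "((\<lambda>v. exp (- (1 / v)) / v ^ k) has_real_derivative - real k * exp_bump (Suc k) v + exp_bump (k + 2) v) (at v)"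
      using 1 by (auto intro!: derivative_eq_intros simp: exp_bump_def) (cases k; simp add: field_simps power2_eq_square)
    then show ?thesis
      by (rule has_field_derivative_transform_within_open[where S = "{0<..}"]) (use 1 in \<open>auto simp: exp_bump_def\<close>)
  next
    case 2
    have "(exp_bump k has_real_derivative 0) (at v)"
      by (rule has_field_derivative_transform_within_open[OF DERIV_const, where S = "{..<0}"]) (use 2 in \<open>auto simp: exp_bump_def\<close>)
    then show ?thesis using 2 by (simp add: exp_bump_def)
  next
    case 3
    have "(\<lambda>h. (exp_bump k (0 + h) - exp_bump k 0) / h) = exp_bump (Suc k)"
      by (auto simp: exp_bump_def fun_eq_iff)
    then have "(exp_bump k has_real_derivative 0) (at 0)" unfolding DERIV_def using exp_bump_tendsto_0[of "Suc k"] by simp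
    then show ?thesis using 3 by (simp add: exp_bump_def)
  qed
qed

lemma ndiff_exp_bump: "ndiff n (exp_bump k)"
proof (induction n arbitrary: k)
  case (Suc n)
  have "ndiff n (\<lambda>v. - real k * exp_bump (Suc k) v + exp_bump (k + 2) v)"
    by (intro ndiff_add ndiff_mult ndiff_const Suc)
  then show ?case unfolding ndiff.simps
    by (intro exI[of _ "\<lambda>v. - real k * exp_bump (Suc k) v + exp_bump (k + 2) v"] conjI allI DERIV_exp_bump)
qed simp

definition cinf :: "(real \<Rightarrow> real) \<Rightarrow> bool" where "cinf f \<longleftrightarrow> (\<forall>n. ndiff n f)"

text \<open>The witnesses in \<open>ndiff\<close> for different n might differ a priori; uniqueness
  of the derivative merges them into one.\<close>

lemma cinf_derivative:
  assumes "cinf f" obtains f' where "\<And>x. (f has_real_derivative f' x) (at x)" "cinf f'"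
proof -
  obtain f' where d: "\<And>x. (f has_real_derivative f' x) (at x)"
    using assms[unfolded cinf_def, rule_format, of "Suc 0"] by auto
  have "ndiff n f'" for n
  proof -
    obtain g where g: "\<And>x. (f has_real_derivative g x) (at x)" "ndiff n g"
      using assms[unfolded cinf_def, rule_format, of "Suc n"] by auto
    have "g = f'" using DERIV_unique[OF g(1) d] by auto
    with g show ?thesis by simp
  qed
  then show thesis using that d by (auto simp: cinf_def)
qed

lemma cinf_primitive:
  assumes "\<And>x. (F has_real_derivative f x) (at x)" "cinf f" shows "cinf F"
  unfolding cinf_def
proof
  fix n show "ndiff n F" using assms by (cases n) (auto simp: cinf_def)
qed

text \<open>The generators are chosen so that partial derivatives stay in the class, and every
  member is therefore smooth. Functions of |x|^2 are used rather than of |x| because the square is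
  smooth at the origin.\<close>

inductive_set radial_algebra :: "(real^6 \<Rightarrow> real) set" where
  const: "(\<lambda>x. c) \<in> radial_algebra"
| coord: "(\<lambda>x. x $ i) \<in> radial_algebra"
| comp: "cinf \<eta> \<Longrightarrow> (\<lambda>x. \<eta> ((norm x)\<^sup>2)) \<in> radial_algebra"
| add: "f \<in> radial_algebra \<Longrightarrow> g \<in> radial_algebra \<Longrightarrow> (\<lambda>x. f x + g x) \<in> radial_algebra"
| mult: "f \<in> radial_algebra \<Longrightarrow> g \<in> radial_algebra \<Longrightarrow> (\<lambda>x. f x * g x) \<in> radial_algebra"

lemma has_derivative_norm_sq: "((\<lambda>x::real^6. (norm x)\<^sup>2) has_derivative (\<lambda>h. 2 * (x \<bullet> h))) (at x)"
  unfolding power2_norm_eq_inner by (auto intro!: derivative_eq_intros simp: inner_commute)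

lemma has_derivative_comp_norm_sq:
  assumes "\<And>s. (\<eta> has_real_derivative \<eta>' s) (at s)"
  shows "((\<lambda>x::real^6. \<eta> ((norm x)\<^sup>2)) has_derivative (\<lambda>h. \<eta>' ((norm x)\<^sup>2) * (2 * (x \<bullet> h)))) (at x)"
  by (rule has_derivative_compose[OF has_derivative_norm_sq]) (use assms in \<open>simp add: has_field_derivative_def\<close>)

lemma radial_algebra_partial:
  assumes "f \<in> radial_algebra"
  shows "(\<forall>x. f differentiable (at x)) \<and> (\<forall>i. partial_deriv i f \<in> radial_algebra)"
  using assms
proof induction
  case (const c)
  have "partial_deriv i (\<lambda>x. c) = (\<lambda>x. 0)" for i :: 6 by (auto simp: partial_deriv_def fun_eq_iff)
  then show ?case using radial_algebra.const by simp
next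
  case (coord j)
  have d: "((\<lambda>x::real^6. x $ j) has_derivative (\<lambda>h. h $ j)) (at x)" for x
    by (rule bounded_linear_imp_has_derivative[OF bounded_linear_vec_nth])
  have "partial_deriv i (\<lambda>x. x $ j) = (\<lambda>x. axis i 1 $ j)" for i :: 6
    using partial_deriv_eqI[OF d] by (auto simp: fun_eq_iff)
  then show ?case using radial_algebra.const d by (auto simp: differentiable_def)
next
  case (comp \<eta>)
  then obtain \<eta>' where e: "\<And>s. (\<eta> has_real_derivative \<eta>' s) (at s)" "cinf \<eta>'" by (rule cinf_derivative) auto
  have "partial_deriv i (\<lambda>x. \<eta> ((norm x)\<^sup>2)) = (\<lambda>x. \<eta>' ((norm x)\<^sup>2) * (2 * x $ i))" for i :: 6
    using partial_deriv_eqI[OF has_derivative_comp_norm_sq[OF e(1)]] by (auto simp: fun_eq_iff inner_axis)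
  moreover have "(\<lambda>x. \<eta>' ((norm x)\<^sup>2) * (2 * x $ i)) \<in> radial_algebra" for i
    by (intro radial_algebra.intros e)
  ultimately show ?case using has_derivative_comp_norm_sq[OF e(1)] by (auto simp: differentiable_def)
next
  case (add f g)
  have d: "((\<lambda>x. f x + g x) has_derivative (\<lambda>h. frechet_derivative f (at x) h + frechet_derivative g (at x) h)) (at x)" for x
    using add frechet_derivative_works by (intro has_derivative_add) blast+
  have "partial_deriv i (\<lambda>x. f x + g x) = (\<lambda>x. partial_deriv i f x + partial_deriv i g x)" for i
    using partial_deriv_eqI[OF d] by (auto simp: fun_eq_iff partial_deriv_def)
  then show ?case using d add radial_algebra.add by (auto simp: differentiable_def)
next
  case (mult f g)
  have d: "((\<lambda>x. f x * g x) has_derivative (\<lambda>h. f x * frechet_derivative g (at x) h + frechet_derivative f (at x) h * g x)) (at x)" for x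
    using mult frechet_derivative_works by (intro has_derivative_mult) blast+
  have "partial_deriv i (\<lambda>x. f x * g x) = (\<lambda>x. f x * partial_deriv i g x + partial_deriv i f x * g x)" for i
    using partial_deriv_eqI[OF d] by (auto simp: fun_eq_iff partial_deriv_def)
  moreover have "(\<lambda>x. f x * partial_deriv i g x + partial_deriv i f x * g x) \<in> radial_algebra" for i
    using mult by (intro radial_algebra.intros) auto
  ultimately show ?case using d by (auto simp: differentiable_def)
qed

lemma radial_algebra_smooth: "f \<in> radial_algebra \<Longrightarrow> smooth f"
proof -
  assume f: "f \<in> radial_algebra"
  have "foldr partial_deriv is f \<in> radial_algebra" for "is"
    by (induction "is") (use f radial_algebra_partial in auto)
  then show ?thesis unfolding smooth_def differentiable_on_def
    using radial_algebra_partial differentiable_at_withinI by blast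
qed

text \<open>One component of the field x \<eta>(|x|^2). Summed over i, the derivatives give the
  divergence 6 \<eta> + 2 |x|^2 \<eta>' that \<open>radial_constant\<close> tests against.\<close>

lemma test_vector_field:
  fixes i :: 6
  assumes e: "cinf \<eta>" "\<And>s. (\<eta> has_real_derivative \<eta>' s) (at s)" and supp: "\<And>s. s \<ge> q \<Longrightarrow> \<eta> s = 0"
  shows "test_function (\<lambda>x. x $ i * \<eta> ((norm x)\<^sup>2))"
    and "partial_deriv i (\<lambda>x. x $ i * \<eta> ((norm x)\<^sup>2)) x = \<eta> ((norm x)\<^sup>2) + 2 * (x $ i * x $ i) * \<eta>' ((norm x)\<^sup>2)"
proof -
  have "smooth (\<lambda>x. x $ i * \<eta> ((norm x)\<^sup>2))"
    by (intro radial_algebra_smooth radial_algebra.intros e)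
  moreover have "x $ i * \<eta> ((norm x)\<^sup>2) = 0" if "norm x > max 1 q" for x
  proof -
    have "norm x \<le> (norm x)\<^sup>2" using that mult_left_mono[of 1 "norm x" "norm x"] by (simp add: power2_eq_square)
    then show ?thesis using that supp by simp
  qed
  ultimately show "test_function (\<lambda>x. x $ i * \<eta> ((norm x)\<^sup>2))" unfolding test_function_def by blast
  have "((\<lambda>x. x $ i * \<eta> ((norm x)\<^sup>2)) has_derivative (\<lambda>h. x $ i * (\<eta>' ((norm x)\<^sup>2) * (2 * (x \<bullet> h))) + h $ i * \<eta> ((norm x)\<^sup>2))) (at x)"
    by (rule has_derivative_mult[OF bounded_linear_imp_has_derivative[OF bounded_linear_vec_nth] has_derivative_comp_norm_sq[OF e(2)]])
  from partial_deriv_eqI[OF this, of i] show "partial_deriv i (\<lambda>x. x $ i * \<eta> ((norm x)\<^sup>2)) x = \<eta> ((norm x)\<^sup>2) + 2 * (x $ i * x $ i) * \<eta>' ((norm x)\<^sup>2)"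
  proof -
    have "axis i 1 $ i = (1::real)" by (simp add: axis_def)
    then show ?thesis using \<open>partial_deriv i _ x = _\<close> by (simp add: inner_axis)
  qed
qed

section \<open>Radial profiles of energy functions\<close>

text \<open>The sets over which f integrates to zero form a Dynkin class once the total integral is
  known to vanish, and that follows by exhausting the line with half-lines.\<close>

lemma AE_zero_of_integrals_atMost:
  fixes f :: "real \<Rightarrow> real"
  assumes sf: "sigma_finite_measure M" and M: "sets M = sets borel" and f: "integrable M f"
    and z: "\<And>t. (LINT x|M. indicator {..t} x * f x) = 0"
  shows "AE x in M. f x = 0"
proof (rule sigma_finite_measure.density_zero[OF sf f])
  have tot: "(LINT x|M. f x) = 0"
  proof -
    have "(\<lambda>n. LINT x|M. indicator {..real n} x * f x) \<longlonglongrightarrow> (LINT x|M. f x)"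
    proof (rule integral_dominated_convergence[where w = "\<lambda>x. \<bar>f x\<bar>"])
      show "AE x in M. (\<lambda>n. indicator {..real n} x * f x) \<longlonglongrightarrow> f x"
      proof (rule AE_I2)
        fix x
        have "eventually (\<lambda>n. real n > x) sequentially"
          using filterlim_real_sequentially by (simp add: filterlim_at_top_dense)
        then have "eventually (\<lambda>n. indicator {..real n} x * f x = f x) sequentially"
          by eventually_elim (auto simp: indicator_def)
        then show "(\<lambda>n. indicator {..real n} x * f x) \<longlonglongrightarrow> f x" by (rule tendsto_eventually)
      qed
      show "f \<in> borel_measurable M" using f by simp
      then show "(\<lambda>x. indicator {..real n} x * f x) \<in> borel_measurable M" for n
        by (intro borel_measurable_times borel_measurable_indicator) (simp_all add: M)
    qed (use f in \<open>auto simp: indicator_def\<close>)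
    moreover have "(\<lambda>n. LINT x|M. indicator {..real n} x * f x) = (\<lambda>n. 0)" using z by simp
    ultimately show ?thesis using LIMSEQ_unique[OF _ tendsto_const] by metis
  qed
  have sg: "sets M = sigma_sets UNIV (range (\<lambda>a::real. {..a}))" unfolding M by (simp add: borel_eq_atMost)
  have st: "Int_stable (range (\<lambda>a::real. {..a}))" "range (\<lambda>a::real. {..a}) \<subseteq> Pow UNIV" by (auto simp: Int_stable_def)
  fix A assume "A \<in> sets M"
  then have "A \<in> sigma_sets UNIV (range (\<lambda>a::real. {..a}))" by (simp only: sg)
  from st this show "set_lebesgue_integral M A f = 0"
  proof (induction rule: sigma_sets_induct_disjoint)
    case (basic A)
    then show ?case using z by (auto simp: set_lebesgue_integral_def)
  next
    case empty
    show ?case by (simp add: set_lebesgue_integral_def)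
  next
    case (compl A)
    then have A: "A \<in> sets M" by (simp only: sg)
    have "(LINT x|M. indicator (UNIV - A) x *\<^sub>R f x) = (LINT x|M. f x - indicator A x *\<^sub>R f x)"
      by (intro Bochner_Integration.integral_cong refl) (auto simp: indicator_def)
    also have "\<dots> = (LINT x|M. f x) - (LINT x|M. indicator A x *\<^sub>R f x)"
      by (intro Bochner_Integration.integral_diff f integrable_mult_indicator A)
    finally show ?case using compl tot by (simp add: set_lebesgue_integral_def)
  next
    case (union A)
    then have A: "A i \<in> sets M" for i unfolding sg by auto
    have "set_lebesgue_integral M (\<Union>i. A i) f = (\<Sum>i. set_lebesgue_integral M (A i) f)"
    proof (rule lebesgue_integral_countable_add)
      show "\<And>i j. i \<noteq> j \<Longrightarrow> A i \<inter> A j = {}" using union(1) by (auto simp: disjoint_family_on_def)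
      show "set_integrable M (\<Union>i. A i) f" unfolding set_integrable_def by (intro integrable_mult_indicator f) (use A in auto)
    qed (rule A)
    then show ?case using union by simp
  qed
qed

lemma AE_lborel_scale:
  fixes P :: "'a::euclidean_space \<Rightarrow> bool"
  assumes "AE x in lborel. P x" "c \<noteq> 0"
  shows "AE x in lborel. P (c *\<^sub>R x)"
proof -
  obtain N where N: "{x. \<not> P x} \<subseteq> N" "N \<in> sets lborel" "emeasure lborel N = 0" using assms(1) by (auto elim!: AE_E)
  have [measurable]: "N \<in> sets borel" using N by simp
  have "AE x in lborel. x \<notin> N" using N by (intro AE_not_in) (simp add: null_setsI)
  then have "AE x in density (distr lborel borel (\<lambda>x::'a. 0 + c *\<^sub>R x)) (\<lambda>_. ennreal (\<bar>c\<bar>^DIM('a))). x \<notin> N"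
    by (simp only: lborel_affine[OF assms(2), of "0::'a", symmetric])
  then have "AE x in distr lborel borel (\<lambda>x::'a. 0 + c *\<^sub>R x). x \<notin> N"
    using assms(2) by (subst (asm) AE_density) auto
  then have "AE x in lborel. (0::'a) + c *\<^sub>R x \<notin> N"
    by (subst (asm) AE_distr_iff) auto
  then show ?thesis by eventually_elim (use N in auto)
qed

text \<open>The profile in \<open>radial_ae\<close> need not be measurable. A Borel profile is found by restricting to
  a ray: by Fubini for the map \<open>(\<lambda>, x) \<mapsto> \<lambda>x\<close>, almost every ray meets the exceptional set in a null set.\<close>

lemma radial_borel_profile:
  fixes D :: "real^6 \<Rightarrow> real"
  assumes D: "D \<in> borel_measurable leb" and r: "AE x in leb. D x = \<gamma> (norm x)"
  shows "\<exists>g\<in>borel_measurable borel. AE x in leb. D x = g (norm x)"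
proof -
  obtain D' where D' [measurable]: "D' \<in> borel_measurable lborel" and DD': "AE x in lborel. D x = D' x"
    using completion_ex_borel_measurable_real[OF D] by blast
  have D'b [measurable]: "D' \<in> borel_measurable borel" using D' by simp
  have "AE x in lborel. D x = \<gamma> (norm x)" using r by (simp only: AE_completion_iff)
  with DD' have "AE x in lborel. D' x = \<gamma> (norm x)" by eventually_elim simp
  then obtain N where N: "{x. D' x \<noteq> \<gamma> (norm x)} \<subseteq> N" "N \<in> sets lborel" "emeasure lborel N = 0" by (auto elim!: AE_E)
  have [measurable]: "N \<in> sets borel" using N by simp
  have AEN: "AE x in lborel. x \<notin> N" using N by (intro AE_not_in) (simp add: null_setsI)
  have m: "{z \<in> space (lborel \<Otimes>\<^sub>M lborel). 0 < fst z \<longrightarrow> fst z *\<^sub>R snd z \<notin> N} \<in> sets ((lborel :: real measure) \<Otimes>\<^sub>M (lborel :: (real^6) measure))"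
    by measurable
  have "AE l in (lborel :: real measure). AE x in lborel. 0 < l \<longrightarrow> l *\<^sub>R x \<notin> N"
  proof (rule AE_I2)
    fix l :: real
    show "AE x in lborel. 0 < l \<longrightarrow> l *\<^sub>R x \<notin> N"
      using AE_lborel_scale[OF AEN, of l] by (cases "l > 0") auto
  qed
  then have "AE x in (lborel :: (real^6) measure). AE l in (lborel :: real measure). 0 < l \<longrightarrow> l *\<^sub>R x \<notin> N"
    using lborel_pair.AE_commute[OF m] by simp
  moreover have "AE x in (lborel :: (real^6) measure). x \<noteq> 0" by (rule AE_lborel_singleton)
  ultimately have ev: "AE x in (lborel :: (real^6) measure). x \<noteq> 0 \<and> (AE l in (lborel :: real measure). 0 < l \<longrightarrow> l *\<^sub>R x \<notin> N)"
    by eventually_elim simp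
  \<comment> \<open>Lebesgue measure is not zero, so a property that holds almost everywhere holds
    for at least one direction \<open>x0\<close>.\<close>
  have "ae_filter (lborel :: (real^6) measure) \<noteq> bot"
    by (simp add: ae_filter_eq_bot_iff)
  then obtain x0 :: "real^6" where x0: "x0 \<noteq> 0" "AE l in (lborel :: real measure). 0 < l \<longrightarrow> l *\<^sub>R x0 \<notin> N"
    using eventually_happens'[OF _ ev] by blast
  define g where "g = (\<lambda>r. D' ((r / norm x0) *\<^sub>R x0))"
  have "AE r in (lborel :: real measure). 0 < inverse (norm x0) *\<^sub>R r \<longrightarrow> (inverse (norm x0) *\<^sub>R r) *\<^sub>R x0 \<notin> N"
    using x0 by (intro AE_lborel_scale) auto
  then have "AE r in lborel. r > 0 \<longrightarrow> g r = \<gamma> r"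
  proof eventually_elim
    case (elim r)
    show ?case
    proof
      assume "r > 0"
      then have "(r / norm x0) *\<^sub>R x0 \<notin> N" using elim x0 by (simp add: divide_inverse mult.commute)
      then have "D' ((r / norm x0) *\<^sub>R x0) = \<gamma> (norm ((r / norm x0) *\<^sub>R x0))" using N by blast
      then show "g r = \<gamma> r" using x0 \<open>r > 0\<close> by (simp add: g_def)
    qed
  qed
  then have "AE x in leb. g (norm x) = \<gamma> (norm x)" by (rule AE_radial)
  with r have "AE x in leb. D x = g (norm x)" by eventually_elim simp
  moreover have "g \<in> borel_measurable borel" unfolding g_def by measurable
  ultimately show ?thesis by blast
qed

lemma continuous_primitive:
  fixes \<kappa> :: "real \<Rightarrow> real"
  assumes c: "continuous_on UNIV \<kappa>" and z: "\<And>x. x \<le> p \<Longrightarrow> \<kappa> x = 0"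
  obtains K where "\<And>x. (K has_real_derivative \<kappa> x) (at x)" "\<And>x. x \<le> p \<Longrightarrow> K x = 0"
proof
  let ?K = "\<lambda>u. LBINT y=p..u. \<kappa> y"
  show d: "(?K has_real_derivative \<kappa> x) (at x)" for x
  proof -
    \<comment> \<open>An interval containing both p and x in its interior, so that the one-sided
      formula gives a two-sided derivative at x.\<close>
    let ?a = "min p x - 1" and ?b = "max p x + 1"
    have "(?K has_vector_derivative \<kappa> x) (at x within {?a..?b})"
      by (rule interval_integral_FTC2) (use c in \<open>auto intro: continuous_on_subset\<close>)
    then have "(?K has_real_derivative \<kappa> x) (at x within {?a..?b})" by (simp add: has_real_derivative_iff_has_vector_derivative)
    moreover have "x \<in> interior {?a..?b}" by (auto simp: min_def max_def)
    ultimately show ?thesis by (simp only: at_within_interior)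
  qed
  show "?K x = 0" if "x \<le> p" for x
  proof (cases "x = p")
    case False
    then have "x < p" using that by simp
    then obtain z' where "x < z'" "z' < p" "?K p - ?K x = (p - x) * \<kappa> z'" using MVT2[of x p ?K \<kappa>] d by blast
    then have "?K p - ?K x = 0" using z[of z'] by simp
    then show ?thesis by simp
  qed simp
qed

text \<open>Smooth functions with values in [0, 1] that sharpen to the indicator of the open
  interval (p, q) as n grows, with support independent of n.\<close>

definition cutoff_bump :: "real \<Rightarrow> real \<Rightarrow> real \<Rightarrow> real \<Rightarrow> real"
  where "cutoff_bump n p q v = exp_bump 0 (n * (v - p)) * exp_bump 0 (n * (q - v))"

lemma cutoff_bump:
  assumes "n > 0"
  shows "cinf (cutoff_bump n p q)" "v \<le> p \<Longrightarrow> cutoff_bump n p q v = 0" "v \<ge> q \<Longrightarrow> cutoff_bump n p q v = 0"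
    "0 \<le> cutoff_bump n p q v" "cutoff_bump n p q v \<le> 1" "p < v \<Longrightarrow> v < q \<Longrightarrow> 0 < cutoff_bump n p q v"
proof -
  have "ndiff k (\<lambda>v. exp_bump 0 (n * v + (- (n * p))) * exp_bump 0 ((- n) * v + n * q))" for k
    by (intro ndiff_mult ndiff_affine ndiff_exp_bump)
  then show "cinf (cutoff_bump n p q)" unfolding cinf_def cutoff_bump_def[abs_def] by (simp add: algebra_simps)
  show "v \<le> p \<Longrightarrow> cutoff_bump n p q v = 0" "v \<ge> q \<Longrightarrow> cutoff_bump n p q v = 0"
    using assms by (auto simp: cutoff_bump_def exp_bump_def zero_less_mult_iff)
  have e: "0 \<le> exp_bump 0 w" "exp_bump 0 w \<le> 1" for w by (auto simp: exp_bump_def)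
  show "0 \<le> cutoff_bump n p q v" "cutoff_bump n p q v \<le> 1" unfolding cutoff_bump_def using e by (auto intro: mult_le_one)
  show "p < v \<Longrightarrow> v < q \<Longrightarrow> 0 < cutoff_bump n p q v" using assms by (auto simp: cutoff_bump_def exp_bump_def)
qed

lemma cutoff_bump_tendsto:
  "(\<lambda>n. cutoff_bump (real (Suc n)) p q v) \<longlonglongrightarrow> indicator {p<..<q} v"
proof (cases "v \<in> {p<..<q}")
  case True
  have e: "(\<lambda>n. exp_bump 0 (real (Suc n) * w)) \<longlonglongrightarrow> 1" if "w > 0" for w
  proof -
    have "(\<lambda>n. exp (- (1 / w * (1 / real (Suc n))))) \<longlonglongrightarrow> exp (- (1 / w * 0))"
      by (intro tendsto_intros lim_1_over_n[THEN LIMSEQ_Suc])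
    moreover have "(\<lambda>n. exp_bump 0 (real (Suc n) * w)) = (\<lambda>n. exp (- (1 / w * (1 / real (Suc n)))))"
      using that by (auto simp: exp_bump_def fun_eq_iff)
    ultimately show ?thesis by simp
  qed
  have "(\<lambda>n. cutoff_bump (real (Suc n)) p q v) \<longlonglongrightarrow> 1 * 1"
    unfolding cutoff_bump_def using True by (intro tendsto_mult e) auto
  then show ?thesis using True by simp
next
  case False
  then have "(\<lambda>n. cutoff_bump (real (Suc n)) p q v) = (\<lambda>n. 0)"
    using cutoff_bump(2,3)[of "real (Suc n)" for n] by (auto simp: fun_eq_iff not_less)
  then show ?thesis using False by simp
qed

lemma cinf_continuous: "cinf f \<Longrightarrow> continuous_on A f"
proof -
  assume "cinf f"
  then obtain f' where "\<And>x. (f has_real_derivative f' x) (at x)" by (rule cinf_derivative) auto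
  then show ?thesis by (intro continuous_at_imp_continuous_on ballI DERIV_isCont) auto
qed

lemma cinf_lincomb: "cinf f \<Longrightarrow> cinf g \<Longrightarrow> cinf (\<lambda>x. f x + c * g x)"
  unfolding cinf_def by (intro allI ndiff_add ndiff_mult ndiff_const) auto

text \<open>A du Bois-Reymond lemma: in the variable \<open>v = |x|\<^sup>2\<close>, the fields \<open>x \<eta>(|x|\<^sup>2)\<close> with \<open>\<eta> = K / v\<^sup>3\<close> have
  divergence \<open>2 K'(v) / v\<^sup>2\<close>, so that arbitrary test functions of mean zero occur as \<open>K'\<close>.\<close>

lemma radial_constant:
  fixes D :: "real^6 \<Rightarrow> real"
  assumes D: "D \<in> borel_measurable leb" and rad: "AE x in leb. D x = \<gamma> (norm x)"
    and int: "\<And>a b. 0 < a \<Longrightarrow> integrable leb (\<lambda>x. indicator {a<..b} (norm x) * D x)"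
    and weak: "\<And>\<eta> \<eta>' q. cinf \<eta> \<Longrightarrow> (\<And>s. (\<eta> has_real_derivative \<eta>' s) (at s)) \<Longrightarrow> (\<And>s. s \<ge> q \<Longrightarrow> \<eta> s = 0) \<Longrightarrow>
      (LINT x|leb. D x * (6 * \<eta> ((norm x)\<^sup>2) + 2 * (norm x)\<^sup>2 * \<eta>' ((norm x)\<^sup>2))) = 0"
  shows "\<exists>A. AE x in leb. D x = A"
proof -
  note [measurable] = D
  have intk: "integrable leb (\<lambda>x. D x * (\<kappa> ((norm x)\<^sup>2) / norm x ^ 4))"
    if c: "\<kappa> \<in> borel_measurable borel" and B: "\<And>v. \<bar>\<kappa> v\<bar> \<le> B" and z: "\<And>v. v \<le> p \<Longrightarrow> \<kappa> v = 0" "\<And>v. v \<ge> q \<Longrightarrow> \<kappa> v = 0" and p: "p > 0"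
    for \<kappa> B p q
  proof (rule Bochner_Integration.integrable_bound)
    note [measurable] = c
    show "integrable leb (\<lambda>x. (B / p^2) * (indicator {sqrt p<..sqrt q} (norm x) * D x))" using p by (intro integrable_mult_right int) simp
    show "(\<lambda>x. D x * (\<kappa> ((norm x)\<^sup>2) / norm x ^ 4)) \<in> borel_measurable leb" by measurable
    show "AE x in leb. norm (D x * (\<kappa> ((norm x)\<^sup>2) / norm x ^ 4)) \<le> norm ((B / p^2) * (indicator {sqrt p<..sqrt q} (norm x) * D x))"
    proof (rule AE_I2)
      fix x :: "real^6"
      show "norm (D x * (\<kappa> ((norm x)\<^sup>2) / norm x ^ 4)) \<le> norm ((B / p^2) * (indicator {sqrt p<..sqrt q} (norm x) * D x))"
      proof (cases "\<kappa> ((norm x)\<^sup>2) = 0")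
        case False
        have "p < (norm x)\<^sup>2" using z(1)[of "(norm x)\<^sup>2"] False by (metis not_le)
        moreover have "(norm x)\<^sup>2 < q" using z(2)[of "(norm x)\<^sup>2"] False by (metis not_le)
        ultimately have v: "p < (norm x)\<^sup>2" "(norm x)\<^sup>2 < q" by auto
        then have s: "sqrt p < norm x" "norm x \<le> sqrt q" by (auto intro: real_less_lsqrt real_le_rsqrt)
        have "p^2 \<le> ((norm x)\<^sup>2)^2" using v p by (intro power_mono) auto
        then have "p^2 \<le> norm x ^ 4" by (simp flip: power_mult)
        then have "\<bar>\<kappa> ((norm x)\<^sup>2)\<bar> / norm x ^ 4 \<le> B / p^2" using B[of "(norm x)\<^sup>2"] p by (intro frac_le) (auto intro: order_trans[OF abs_ge_zero])
        then have "\<bar>D x\<bar> * (\<bar>\<kappa> ((norm x)\<^sup>2)\<bar> / norm x ^ 4) \<le> \<bar>D x\<bar> * (B / p^2)" by (intro mult_left_mono) auto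
        moreover have "0 \<le> B" using B[of 0] by linarith
        ultimately show ?thesis using s by (simp add: abs_mult mult.commute)
      qed simp
    qed
  qed
  have zero: "(LINT x|leb. D x * (\<kappa> ((norm x)\<^sup>2) / norm x ^ 4)) = 0"
    if \<kappa>: "cinf \<kappa>" and K: "\<And>v. (K has_real_derivative \<kappa> v) (at v)" and z: "\<And>v. v \<le> p \<Longrightarrow> K v = 0" "\<And>v. v \<ge> q \<Longrightarrow> K v = 0" and p: "p > 0"
    for \<kappa> K p q
  proof -
    have cK: "cinf K" by (rule cinf_primitive[OF K \<kappa>])
    define \<eta> where "\<eta> = (\<lambda>v. K v / v / v / v)"
    have ce: "cinf \<eta>" unfolding cinf_def \<eta>_def
    proof
      fix n
      have "ndiff n K" using cK by (simp add: cinf_def)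
      then have 1: "ndiff n (\<lambda>v. K v / v)" by (rule ndiff_divide[OF _ p z(1)])
      then have 2: "ndiff n (\<lambda>v. K v / v / v)" by (rule ndiff_divide[OF _ p]) (use z in auto)
      then show "ndiff n (\<lambda>v. K v / v / v / v)" by (rule ndiff_divide[OF _ p]) (use z in auto)
    qed
    obtain \<eta>' where e': "\<And>s. (\<eta> has_real_derivative \<eta>' s) (at s)" "cinf \<eta>'" using cinf_derivative[OF ce] by blast
    have rel: "6 * \<eta> s + 2 * s * \<eta>' s = 2 * \<kappa> s / s^2" if "s > 0" for s
    proof -
      have "(\<eta> has_real_derivative (\<kappa> s / s^3 - 3 * K s / s^4)) (at s)"
        unfolding \<eta>_def using that K[of s] by (auto intro!: derivative_eq_intros simp: field_simps eval_nat_numeral)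
      then have e: "\<eta>' s = \<kappa> s / s^3 - 3 * K s / s^4" using DERIV_unique e'(1) by blast
      show ?thesis unfolding e \<eta>_def using that by (simp add: field_simps eval_nat_numeral)
    qed
    have "(LINT x|leb. 2 * (D x * (\<kappa> ((norm x)\<^sup>2) / norm x ^ 4))) = (LINT x|leb. D x * (6 * \<eta> ((norm x)\<^sup>2) + 2 * (norm x)\<^sup>2 * \<eta>' ((norm x)\<^sup>2)))"
    proof (rule integral_cong_AE)
      have [measurable]: "\<kappa> \<in> borel_measurable borel" "\<eta> \<in> borel_measurable borel" "\<eta>' \<in> borel_measurable borel"
        using \<kappa> ce e'(2) by (auto intro!: borel_measurable_continuous_onI cinf_continuous)
      show "(\<lambda>x. 2 * (D x * (\<kappa> ((norm x)\<^sup>2) / norm x ^ 4))) \<in> borel_measurable leb"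
        "(\<lambda>x. D x * (6 * \<eta> ((norm x)\<^sup>2) + 2 * (norm x)\<^sup>2 * \<eta>' ((norm x)\<^sup>2))) \<in> borel_measurable leb" by measurable
      show "AE x in leb. 2 * (D x * (\<kappa> ((norm x)\<^sup>2) / norm x ^ 4)) = D x * (6 * \<eta> ((norm x)\<^sup>2) + 2 * (norm x)\<^sup>2 * \<eta>' ((norm x)\<^sup>2))"
        using AE_nonzero by eventually_elim (subst rel, simp_all flip: power_mult)
    qed
    also have "\<dots> = 0" by (rule weak[OF ce e'(1), of q]) (use z in \<open>simp add: \<eta>_def\<close>)
    finally have "2 * (LINT x|leb. D x * (\<kappa> ((norm x)\<^sup>2) / norm x ^ 4)) = 0" by (simp only: integral_mult_right_zero)
    then show ?thesis by simp
  qed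
  \<comment> \<open>The substitution v = |x|^2 gives r^5 dr / r^4 = dv / 2, so the weighted integral
    of \<kappa> is a multiple of the total increment of K.\<close>
  have mass: "integrable leb (\<lambda>x. \<kappa> ((norm x)\<^sup>2) / norm x ^ 4) \<and> (LINT x|leb. \<kappa> ((norm x)\<^sup>2) / norm x ^ 4) = sphere_area / 2 * K q"
    if c: "continuous_on UNIV \<kappa>" and K: "\<And>v. (K has_real_derivative \<kappa> v) (at v)" and z: "\<And>v. v \<le> p \<Longrightarrow> K v = 0" "\<And>v. v \<le> p \<Longrightarrow> \<kappa> v = 0" "\<And>v. v \<ge> q \<Longrightarrow> \<kappa> v = 0"
      and p: "0 < p" "p < q" for \<kappa> K p q
  proof -
    have d: "((\<lambda>r. K (r\<^sup>2) / 2) has_real_derivative r * \<kappa> (r\<^sup>2)) (at r)" for r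
    proof -
      have "(power2 has_real_derivative 2 * r) (at r)" by (auto intro!: derivative_eq_intros)
      from DERIV_cdivide[OF DERIV_chain2[OF K this], of 2] show ?thesis by (simp add: mult.commute)
    qed
    have cc: "continuous_on {sqrt p..sqrt q} (\<lambda>r. r * \<kappa> (r\<^sup>2))"
      by (intro continuous_on_mult continuous_on_id continuous_on_compose2[OF c]) (auto intro!: continuous_intros)
    have sq: "0 < sqrt p" "sqrt p \<le> sqrt q" using p by auto
    have e: "indicator {sqrt p<..sqrt q} (norm x) * (norm x * \<kappa> ((norm x)\<^sup>2) / norm x ^ 5) = \<kappa> ((norm x)\<^sup>2) / norm x ^ 4" for x :: "real^6"
    proof (cases "\<kappa> ((norm x)\<^sup>2) = 0")
      case False
      have "p < (norm x)\<^sup>2" using z(2)[of "(norm x)\<^sup>2"] False by (metis not_le)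
      moreover have "(norm x)\<^sup>2 < q" using z(3)[of "(norm x)\<^sup>2"] False by (metis not_le)
      ultimately have v: "p < (norm x)\<^sup>2" "(norm x)\<^sup>2 < q" by auto
      then have s: "sqrt p < norm x" "norm x \<le> sqrt q" by (auto intro: real_less_lsqrt real_le_rsqrt)
      then have "x \<noteq> 0" using p by auto
      then show ?thesis using s by (simp add: eval_nat_numeral)
    qed simp
    show ?thesis
      using annulus_FTC[OF sq d cc] z(1)[of p] p unfolding e by simp
  qed
  \<comment> \<open>A fixed reference bump: subtracting a multiple of it gives any other bump mean
    zero, and the ratio of its two integrals is the candidate constant A.\<close>
  define \<rho> where "\<rho> = cutoff_bump 1 1 2"
  have \<rho>: "cinf \<rho>" unfolding \<rho>_def by (rule cutoff_bump) simp
  define J where "J = (\<lambda>\<kappa>. LINT x|leb. \<kappa> ((norm x)\<^sup>2) / norm x ^ 4)"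
  define I where "I = (\<lambda>\<kappa>. LINT x|leb. D x * (\<kappa> ((norm x)\<^sup>2) / norm x ^ 4))"
  define A where "A = I \<rho> / J \<rho>"
  have bump: "I (cutoff_bump n p q) = A * J (cutoff_bump n p q)" and iJ: "integrable leb (\<lambda>x. cutoff_bump n p q ((norm x)\<^sup>2) / norm x ^ 4)"
    if n: "n > 0" and p: "0 < p" "p < q" for n p q
  proof -
    let ?\<beta> = "cutoff_bump n p q"
    define P where "P = min p 1"
    define Q where "Q = max q 2"
    have PQ: "0 < P" "P < Q" "P \<le> p" "P \<le> 1" "q \<le> Q" "2 \<le> Q" using p by (auto simp: P_def Q_def)
    have \<beta>: "cinf ?\<beta>" by (rule cutoff_bump[OF n])
    have z\<beta>: "?\<beta> v = 0" if "v \<le> P \<or> v \<ge> Q" for v using that PQ cutoff_bump(2,3)[OF n, of v p q] cutoff_bump(3)[OF n, of q v p] by auto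
    have z\<rho>: "\<rho> v = 0" if "v \<le> P \<or> v \<ge> Q" for v using that PQ cutoff_bump(2)[of 1 v 1 2] cutoff_bump(3)[of 1 2 v 1] by (auto simp: \<rho>_def)
    obtain K\<beta> where K\<beta>: "\<And>x. (K\<beta> has_real_derivative ?\<beta> x) (at x)" "\<And>x. x \<le> P \<Longrightarrow> K\<beta> x = 0"
      using continuous_primitive[OF cinf_continuous[OF \<beta>], of P] z\<beta> by blast
    obtain K\<rho> where K\<rho>: "\<And>x. (K\<rho> has_real_derivative \<rho> x) (at x)" "\<And>x. x \<le> P \<Longrightarrow> K\<rho> x = 0"
      using continuous_primitive[OF cinf_continuous[OF \<rho>], of P] z\<rho> by blast
    have J\<beta>: "integrable leb (\<lambda>x. ?\<beta> ((norm x)\<^sup>2) / norm x ^ 4)" "J ?\<beta> = sphere_area / 2 * K\<beta> Q"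
      using mass[OF cinf_continuous[OF \<beta>] K\<beta> _ _ PQ(1,2)] z\<beta> unfolding J_def by auto
    have J\<rho>: "J \<rho> = sphere_area / 2 * K\<rho> Q"
      using mass[OF cinf_continuous[OF \<rho>] K\<rho> _ _ PQ(1,2)] z\<rho> unfolding J_def by auto
    have \<rho>0: "0 \<le> \<rho> v" for v unfolding \<rho>_def by (rule cutoff_bump) simp
    have "K\<rho> 1 < K\<rho> 2"
    proof (rule DERIV_pos_imp_increasing_open[of 1 2 K\<rho>])
      show "\<exists>y. (K\<rho> has_real_derivative y) (at x) \<and> 0 < y" if "1 < x" "x < 2" for x
        using that K\<rho>(1)[of x] cutoff_bump(6)[of 1 1 x 2] by (auto simp: \<rho>_def)
      show "continuous_on {1..2} K\<rho>" by (intro continuous_at_imp_continuous_on ballI DERIV_isCont[OF K\<rho>(1)])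
    qed simp
    moreover have "K\<rho> 2 \<le> K\<rho> Q" using PQ K\<rho>(1) \<rho>0 by (intro DERIV_nonneg_imp_nondecreasing[of 2 Q K\<rho>]) blast+
    moreover have "K\<rho> P \<le> K\<rho> 1" using PQ K\<rho>(1) \<rho>0 by (intro DERIV_nonneg_imp_nondecreasing[of P 1 K\<rho>]) blast+
    ultimately have K\<rho>Q: "K\<rho> Q > 0" using K\<rho>(2)[of P] by simp
    \<comment> \<open>Makes the combined primitive return to zero at Q, and hence vanish from there
      on.\<close>
    define c where "c = - (K\<beta> Q / K\<rho> Q)"
    let ?\<kappa> = "\<lambda>v. ?\<beta> v + c * \<rho> v" and ?K = "\<lambda>v. K\<beta> v + c * K\<rho> v"
    have dK: "(?K has_real_derivative ?\<kappa> v) (at v)" for v using K\<beta>(1)[of v] K\<rho>(1)[of v] by (auto intro!: derivative_eq_intros)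
    have KQ: "?K v = 0" if "v \<ge> Q" for v
    proof -
      have "?K Q = 0" using K\<rho>Q by (simp add: c_def)
      moreover have "?K v = ?K Q"
      proof (cases "v = Q")
        case False
        then have "Q < v" using that by simp
        then obtain w where "Q < w" "w < v" "?K v - ?K Q = (v - Q) * ?\<kappa> w" using MVT2[of Q v ?K ?\<kappa>] dK by blast
        then show ?thesis using z\<beta>[of w] z\<rho>[of w] by simp
      qed simp
      ultimately show ?thesis by simp
    qed
    have "I ?\<kappa> = 0" unfolding I_def
      by (rule zero[OF cinf_lincomb[OF \<beta> \<rho>] dK _ KQ PQ(1)]) (use K\<beta>(2) K\<rho>(2) in auto)
    moreover have "I ?\<kappa> = I ?\<beta> + c * I \<rho>"
    proof -
      have a1: "integrable leb (\<lambda>x. D x * (?\<beta> ((norm x)\<^sup>2) / norm x ^ 4))"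
        by (rule intk[where B = 1 and p = P and q = Q])
          (use PQ z\<beta> cutoff_bump(4,5)[OF n, of p q] in \<open>auto intro!: borel_measurable_continuous_onI cinf_continuous \<beta>\<close>)
      have a2: "integrable leb (\<lambda>x. D x * (\<rho> ((norm x)\<^sup>2) / norm x ^ 4))"
        by (rule intk[where B = 1 and p = P and q = Q])
          (use PQ z\<rho> cutoff_bump(4,5)[of 1 1 2] in \<open>auto simp: \<rho>_def intro!: borel_measurable_continuous_onI cinf_continuous \<rho>[unfolded \<rho>_def]\<close>)
      have "(LINT x|leb. D x * (?\<beta> ((norm x)\<^sup>2) / norm x ^ 4) + c * (D x * (\<rho> ((norm x)\<^sup>2) / norm x ^ 4))) = I ?\<beta> + c * I \<rho>"
        unfolding I_def
        by (subst Bochner_Integration.integral_add[OF a1 integrable_mult_right[OF a2]]) (simp only: integral_mult_right_zero)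
      moreover have "I ?\<kappa> = (LINT x|leb. D x * (?\<beta> ((norm x)\<^sup>2) / norm x ^ 4) + c * (D x * (\<rho> ((norm x)\<^sup>2) / norm x ^ 4)))"
        unfolding I_def by (intro Bochner_Integration.integral_cong refl) (simp add: add_divide_distrib distrib_left)
      ultimately show ?thesis by simp
    qed
    ultimately have "I ?\<beta> = K\<beta> Q / K\<rho> Q * I \<rho>" by (simp add: c_def)
    then show "I ?\<beta> = A * J ?\<beta>" unfolding A_def J\<beta> J\<rho> using K\<rho>Q by simp
    show "integrable leb (\<lambda>x. ?\<beta> ((norm x)\<^sup>2) / norm x ^ 4)" by (rule J\<beta>)
  qed
  have ind1: "integrable leb (\<lambda>x. indicator {a<..b} (norm x) * (1::real))" for a b
  proof -
    have "integrable leb (indicator {x. norm x \<in> {a<..b}} :: _ \<Rightarrow> real)"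
    proof (rule integrable_real_indicator)
      show "{x::real^6. norm x \<in> {a<..b}} \<in> sets leb"
        using measurable_sets[OF measurable_norm_lebesgue[where 'a="real^6"], of "{a<..b}"] by (simp add: vimage_def)
      have "emeasure leb {x::real^6. norm x \<in> {a<..b}} \<le> emeasure leb (cball (0::real^6) b)" by (intro emeasure_mono) auto
      also have "\<dots> < \<infinity>" using emeasure_bounded_finite[of "cball (0::real^6) b"] by simp
      finally show "emeasure leb {x::real^6. norm x \<in> {a<..b}} < \<infinity>" .
    qed
    moreover have "(indicator {x. norm x \<in> {a<..b}} :: real^6 \<Rightarrow> real) = (\<lambda>x. indicator {a<..b} (norm x) * 1)" by (auto simp: indicator_def fun_eq_iff)
    ultimately show ?thesis by simp
  qed
  have intDA: "integrable leb (\<lambda>x. indicator {a<..b} (norm x) * ((D x - A) / norm x ^ 4))" if a: "0 < a" for a b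
  proof (rule Bochner_Integration.integrable_bound)
    show "integrable leb (\<lambda>x. (1 / a^4) * (\<bar>indicator {a<..b} (norm x) * D x\<bar> + \<bar>A\<bar> * (indicator {a<..b} (norm x) * 1)))"
      by (intro integrable_mult_right Bochner_Integration.integrable_add integrable_abs int ind1 a)
    show "(\<lambda>x. indicator {a<..b} (norm x) * ((D x - A) / norm x ^ 4)) \<in> borel_measurable leb" by measurable
    show "AE x in leb. norm (indicator {a<..b} (norm x) * ((D x - A) / norm x ^ 4))
       \<le> norm ((1 / a^4) * (\<bar>indicator {a<..b} (norm x) * D x\<bar> + \<bar>A\<bar> * (indicator {a<..b} (norm x) * 1)))"
    proof (rule AE_I2)
      fix x :: "real^6"
      show "norm (indicator {a<..b} (norm x) * ((D x - A) / norm x ^ 4))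
       \<le> norm ((1 / a^4) * (\<bar>indicator {a<..b} (norm x) * D x\<bar> + \<bar>A\<bar> * (indicator {a<..b} (norm x) * 1)))"
      proof (cases "norm x \<in> {a<..b}")
        case True
        have "a^4 \<le> norm x ^ 4" using True a by (intro power_mono) auto
        then have "\<bar>D x - A\<bar> / norm x ^ 4 \<le> (\<bar>D x\<bar> + \<bar>A\<bar>) / a ^ 4" using a by (intro frac_le) auto
        then show ?thesis using True by (simp add: abs_mult)
      qed simp
    qed
  qed
  have ann: "(LINT x|leb. indicator {a<..b} (norm x) * ((D x - A) / norm x ^ 4)) = 0" if a: "0 < a" for a b
  proof (cases "a < b")
    case False
    then show ?thesis by (simp add: greaterThanAtMost_empty)
  next
    case True
    have sq: "0 < a\<^sup>2" "a\<^sup>2 < b\<^sup>2" using a True by (auto intro: power_strict_mono)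
    let ?\<beta> = "\<lambda>n. cutoff_bump (real (Suc n)) (a\<^sup>2) (b\<^sup>2)"
    have b0: "(LINT x|leb. (D x - A) * (?\<beta> n ((norm x)\<^sup>2) / norm x ^ 4)) = 0" for n
    proof -
      have n: "real (Suc n) > 0" by simp
      have i1: "integrable leb (\<lambda>x. D x * (?\<beta> n ((norm x)\<^sup>2) / norm x ^ 4))"
        by (rule intk[where B = 1 and p = "a\<^sup>2" and q = "b\<^sup>2"])
          (use sq cutoff_bump(2)[OF n, of _ "a\<^sup>2" "b\<^sup>2"] cutoff_bump(3)[OF n, of "b\<^sup>2" _ "a\<^sup>2"] cutoff_bump(4,5)[OF n, of "a\<^sup>2" "b\<^sup>2"] in \<open>auto intro!: borel_measurable_continuous_onI cinf_continuous cutoff_bump(1)\<close>)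
      have "(LINT x|leb. (D x - A) * (?\<beta> n ((norm x)\<^sup>2) / norm x ^ 4)) = (LINT x|leb. D x * (?\<beta> n ((norm x)\<^sup>2) / norm x ^ 4) - A * (?\<beta> n ((norm x)\<^sup>2) / norm x ^ 4))"
        by (intro Bochner_Integration.integral_cong refl) (simp only: left_diff_distrib)
      also have "\<dots> = I (?\<beta> n) - A * J (?\<beta> n)"
        unfolding I_def J_def
        by (subst Bochner_Integration.integral_diff[OF i1 integrable_mult_right[OF iJ[OF n sq]]]) (simp only: integral_mult_right_zero)
      also have "\<dots> = 0" using bump[OF n sq] by simp
      finally show ?thesis .
    qed
    have "(\<lambda>n. LINT x|leb. (D x - A) * (?\<beta> n ((norm x)\<^sup>2) / norm x ^ 4)) \<longlonglongrightarrow> (LINT x|leb. (D x - A) * (indicator {a\<^sup>2<..<b\<^sup>2} ((norm x)\<^sup>2) / norm x ^ 4))"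
    proof (rule integral_dominated_convergence[where w = "\<lambda>x. \<bar>indicator {a<..b} (norm x) * ((D x - A) / norm x ^ 4)\<bar>"])
      show "integrable leb (\<lambda>x. \<bar>indicator {a<..b} (norm x) * ((D x - A) / norm x ^ 4)\<bar>)" using intDA[OF a] by (rule integrable_abs)
      show "(\<lambda>x. (D x - A) * (?\<beta> n ((norm x)\<^sup>2) / norm x ^ 4)) \<in> borel_measurable leb" for n
      proof -
        have [measurable]: "?\<beta> n \<in> borel_measurable borel" by (intro borel_measurable_continuous_onI cinf_continuous cutoff_bump(1)) simp
        show ?thesis by measurable
      qed
      show "(\<lambda>x. (D x - A) * (indicator {a\<^sup>2<..<b\<^sup>2} ((norm x)\<^sup>2) / norm x ^ 4)) \<in> borel_measurable leb" by measurable
      show "AE x in leb. (\<lambda>n. (D x - A) * (?\<beta> n ((norm x)\<^sup>2) / norm x ^ 4)) \<longlonglongrightarrow> (D x - A) * (indicator {a\<^sup>2<..<b\<^sup>2} ((norm x)\<^sup>2) / norm x ^ 4)"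
        unfolding divide_inverse by (intro AE_I2 tendsto_mult tendsto_const cutoff_bump_tendsto)
      show "AE x in leb. norm ((D x - A) * (?\<beta> n ((norm x)\<^sup>2) / norm x ^ 4)) \<le> \<bar>indicator {a<..b} (norm x) * ((D x - A) / norm x ^ 4)\<bar>" for n
      proof (rule AE_I2)
        fix x :: "real^6"
        have n: "real (Suc n) > 0" by simp
        show "norm ((D x - A) * (?\<beta> n ((norm x)\<^sup>2) / norm x ^ 4)) \<le> \<bar>indicator {a<..b} (norm x) * ((D x - A) / norm x ^ 4)\<bar>"
        proof (cases "?\<beta> n ((norm x)\<^sup>2) = 0")
          case False
          have "a\<^sup>2 < (norm x)\<^sup>2" using cutoff_bump(2)[OF n] False by (metis not_le)
          moreover have "(norm x)\<^sup>2 < b\<^sup>2" using cutoff_bump(3)[OF n] False by (metis not_le)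
          ultimately have v: "a\<^sup>2 < (norm x)\<^sup>2" "(norm x)\<^sup>2 < b\<^sup>2" by auto
          have "a < norm x" using v(1) by (rule power2_less_imp_less) simp
          moreover have "norm x < b" using v(2) by (rule power2_less_imp_less) (use a True in simp)
          ultimately have "norm x \<in> {a<..b}" by simp
          moreover have "\<bar>D x - A\<bar> * (?\<beta> n ((norm x)\<^sup>2) / norm x ^ 4) \<le> \<bar>D x - A\<bar> * (1 / norm x ^ 4)"
            using cutoff_bump(5)[OF n] by (intro mult_left_mono divide_right_mono) auto
          ultimately show ?thesis using cutoff_bump(4)[OF n, of "a\<^sup>2" "b\<^sup>2" "(norm x)\<^sup>2"] by (simp add: abs_mult)
        qed simp
      qed
    qed
    then have "(LINT x|leb. (D x - A) * (indicator {a\<^sup>2<..<b\<^sup>2} ((norm x)\<^sup>2) / norm x ^ 4)) = 0"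
      unfolding b0 by (rule LIMSEQ_unique[OF _ tendsto_const])
    moreover have "(LINT x|leb. (D x - A) * (indicator {a\<^sup>2<..<b\<^sup>2} ((norm x)\<^sup>2) / norm x ^ 4)) = (LINT x|leb. indicator {a<..b} (norm x) * ((D x - A) / norm x ^ 4))"
    proof (rule integral_cong_AE)
      show "AE x in leb. (D x - A) * (indicator {a\<^sup>2<..<b\<^sup>2} ((norm x)\<^sup>2) / norm x ^ 4) = indicator {a<..b} (norm x) * ((D x - A) / norm x ^ 4)"
        using AE_norm_neq[of b]
      proof eventually_elim
        case (elim x)
        have "a\<^sup>2 < (norm x)\<^sup>2 \<longleftrightarrow> a < norm x" using a by (auto intro: power2_less_imp_less power_strict_mono)
        moreover have "(norm x)\<^sup>2 < b\<^sup>2 \<longleftrightarrow> norm x < b" using a True by (auto intro: power2_less_imp_less power_strict_mono)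
        ultimately show ?case using elim by (auto simp: indicator_def)
      qed
    qed measurable
    ultimately show ?thesis by simp
  qed
  obtain g where g [measurable]: "g \<in> borel_measurable borel" and Dg: "AE x in leb. D x = g (norm x)"
    using radial_borel_profile[OF D rad] by blast
  \<comment> \<open>Integrals over annuli are integrals over intervals for the law of the norm. The
    Borel profile g is needed here because D agrees with a function of |x| only almost
    everywhere.\<close>
  let ?M = "distr leb borel norm"
  have "AE x in leb. indicator {1 / real (Suc n)<..real (Suc n)} (norm x) * (g (norm x) - A) / norm x ^ 4 = 0" for n
  proof -
    let ?a = "1 / real (Suc n)" and ?b = "real (Suc n)"
    have a: "0 < ?a" by simp
    let ?F = "\<lambda>r. indicator {?a<..?b} r * ((g r - A) / r ^ 4)"
    have DF: "AE x in leb. indicator {?a<..?b} (norm x) * ((D x - A) / norm x ^ 4) = ?F (norm x)"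
      using Dg by eventually_elim simp
    have "AE r in ?M. ?F r = 0"
    proof (rule AE_zero_of_integrals_atMost)
      show "sigma_finite_measure ?M"
      proof
        have "emeasure ?M {..real n} \<noteq> \<infinity>" for n
        proof -
          have "norm -` {..real n} = cball (0::real^6) (real n)" by auto
          then show ?thesis by (subst emeasure_distr) (auto simp: emeasure_cball)
        qed
        then show "\<exists>A. countable A \<and> A \<subseteq> sets ?M \<and> \<Union>A = space ?M \<and> (\<forall>a\<in>A. emeasure ?M a \<noteq> \<infinity>)"
          using real_arch_simple by (intro exI[of _ "range (\<lambda>n. {..real n})"]) auto
      qed
      have "integrable leb (\<lambda>x. ?F (norm x))"
        by (rule integrable_cong_AE_imp[OF intDA[OF a]]) (measurable, rule DF)
      then show "integrable ?M ?F" by (subst integrable_distr_eq) auto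
      show "(LINT r|?M. indicator {..t} r * ?F r) = 0" for t
      proof -
        have "(LINT r|?M. indicator {..t} r * ?F r) = (LINT x|leb. indicator {..t} (norm x) * ?F (norm x))"
          by (subst integral_distr) auto
        also have "\<dots> = (LINT x|leb. indicator {?a<..min ?b t} (norm x) * ((D x - A) / norm x ^ 4))"
        proof (rule integral_cong_AE)
          show "AE x in leb. indicator {..t} (norm x) * ?F (norm x) = indicator {?a<..min ?b t} (norm x) * ((D x - A) / norm x ^ 4)"
            using Dg by eventually_elim (auto simp: indicator_def)
        qed measurable
        also have "\<dots> = 0" by (rule ann[OF a])
        finally show ?thesis .
      qed
    qed simp
    then have "AE x in leb. ?F (norm x) = 0" by (subst (asm) AE_distr_iff) auto
    then show ?thesis by eventually_elim simp
  qed
  then have "AE x in leb. \<forall>n. indicator {1 / real (Suc n)<..real (Suc n)} (norm x) * (g (norm x) - A) / norm x ^ 4 = 0"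
    unfolding AE_all_countable by (rule allI)
  with Dg AE_nonzero have "AE x in leb. D x = A"
  proof eventually_elim
    case (elim x)
    obtain n where n: "real n > norm x" "real n > 1 / norm x"
      by (meson reals_Archimedean2 less_trans max.strict_boundedE)
    have "1 / norm x < real (Suc n)" using n by simp
    then have "1 / real (Suc n) < norm x" using \<open>x \<noteq> 0\<close> by (simp add: field_simps)
    then have "norm x \<in> {1 / real (Suc n)<..real (Suc n)}" using n by auto
    moreover have "indicator {1 / real (Suc n)<..real (Suc n)} (norm x) * (g (norm x) - A) / norm x ^ 4 = 0" using elim by blast
    ultimately show ?case using elim by simp
  qed
  then show ?thesis by blast
qed

lemma locally_integrable_mult:
  fixes h :: "real^6 \<Rightarrow> 'b::euclidean_space"
  assumes h: "locally_integrable h" and k: "continuous_on UNIV k" and z: "\<And>x. norm x > B \<Longrightarrow> k x = (0::real)"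
  shows "integrable leb (\<lambda>x. k x *\<^sub>R h x)"
proof -
  have ih: "integrable leb (\<lambda>x. indicator (cball 0 B) x *\<^sub>R h x)"
    using h compact_cball unfolding locally_integrable_def set_integrable_def by blast
  have "compact (k ` cball 0 B)" by (intro compact_continuous_image continuous_on_subset[OF k]) auto
  then have "bounded (k ` cball 0 B)" by (rule compact_imp_bounded)
  then obtain C where C: "\<forall>y\<in>k ` cball 0 B. norm y \<le> C" unfolding bounded_iff by blast
  have [measurable]: "k \<in> borel_measurable leb" by (intro borel_measurable_lebesgueI borel_measurable_continuous_onI k)
  note [measurable] = borel_measurable_integrable[OF ih]
  have e: "k x *\<^sub>R h x = k x *\<^sub>R (indicator (cball 0 B) x *\<^sub>R h x)" for x
    using z[of x] by (cases "norm x > B") (auto simp: indicator_def)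
  show ?thesis unfolding e
  proof (rule Bochner_Integration.integrable_bound[OF integrable_scaleR_right[OF ih, of C]])
    show "AE x in leb. norm (k x *\<^sub>R (indicator (cball 0 B) x *\<^sub>R h x)) \<le> norm (C *\<^sub>R (indicator (cball 0 B) x *\<^sub>R h x))"
    proof (rule AE_I2)
      fix x :: "real^6"
      show "norm (k x *\<^sub>R (indicator (cball 0 B) x *\<^sub>R h x)) \<le> norm (C *\<^sub>R (indicator (cball 0 B) x *\<^sub>R h x))"
      proof (cases "x \<in> cball 0 B")
        case True
        then have "norm (k x) \<le> C" using C by blast
        then have "\<bar>k x\<bar> \<le> \<bar>C\<bar>" by simp
        then show ?thesis using True by (simp add: mult_right_mono)
      qed simp
    qed
  qed measurable
qed

lemma compact_profile_bound:
  fixes k :: "real \<Rightarrow> real"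
  assumes k: "continuous_on UNIV k" and z: "\<And>r. r \<ge> b \<Longrightarrow> k r = 0" and b: "b \<ge> 0"
  shows "\<exists>C\<ge>0. \<forall>r\<ge>0. \<bar>k r\<bar> \<le> C \<and> \<bar>k r\<bar> * r ^ 5 \<le> C"
proof -
  have "compact (k ` {0..b})" by (intro compact_continuous_image continuous_on_subset[OF k]) auto
  then have "bounded (k ` {0..b})" by (rule compact_imp_bounded)
  then obtain C where C: "\<forall>y\<in>k ` {0..b}. norm y \<le> C" unfolding bounded_iff by blast
  have C0: "0 \<le> C" using C b by (force intro: order_trans[OF norm_ge_zero])
  have kb: "\<bar>k r\<bar> \<le> C" if "r \<ge> 0" for r using C z[of r] C0 that by (cases "r \<le> b") auto
  show ?thesis
  proof (intro exI[of _ "C + C * b^5"] conjI allI impI)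
    show "C + C * b^5 \<ge> 0" using C0 b by simp
    fix r :: real assume r: "r \<ge> 0"
    have Cb: "0 \<le> C * b^5" using C0 b by simp
    show "\<bar>k r\<bar> \<le> C + C * b^5" using kb[OF r] Cb by linarith
    show "\<bar>k r\<bar> * r ^ 5 \<le> C + C * b^5"
    proof (cases "r \<le> b")
      case True
      then have "\<bar>k r\<bar> * r ^ 5 \<le> C * b^5" using kb[OF r] r C0 by (intro mult_mono power_mono) auto
      then show ?thesis using C0 by linarith
    next
      case False then show ?thesis using z[of r] C0 Cb by simp
    qed
  qed
qed

text \<open>Spherical averaging is avoided: only the radial component of the weak gradient enters, and it
  need not itself be a radial function.\<close>

lemma energy_space_profile:
  assumes h: "h \<in> energy_space" and re: "real_valued_ae h"
  obtains f where "sq_int f" "AE x in leb. h x = complex_of_real (radial_prim f (norm x))"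
    "\<And>x. \<bar>f x\<bar> \<le> norm (weak_gradient h x)" "in_Lp 2 (weak_gradient h)"
proof -
  define g where "g = weak_gradient h"
  have L3: "in_Lp 3 h" and wg: "has_weak_gradient h g" and L2: "in_Lp 2 g" and rad: "radial_ae h"
    using h by (auto simp: energy_space_def Hdot1_def g_def)
  have hm [measurable]: "h \<in> borel_measurable leb" and gm [measurable]: "g \<in> borel_measurable leb"
    using L3 L2 by (auto simp: in_Lp_def)
  have lh: "locally_integrable h" and lg: "locally_integrable g" using wg by (auto simp: has_weak_gradient_def)
  define gr where "gr = (\<lambda>x i. Re (g x $ i))"
  have grm [measurable]: "(\<lambda>x. gr x i) \<in> borel_measurable leb" for i
  proof -
    have "(\<lambda>v::complex^6. Re (v $ i)) \<in> borel_measurable borel" by (intro borel_measurable_continuous_onI continuous_intros)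
    from measurable_compose[OF gm this] show ?thesis by (simp add: gr_def)
  qed
  \<comment> \<open>The radial component of the real part of the weak gradient; at the origin
    division by zero makes it 0, which agrees with the bound by the gradient.\<close>
  define f where "f = (\<lambda>x. (\<Sum>i\<in>UNIV. x $ i * gr x i) / norm x)"
  have coordm [measurable]: "(\<lambda>x::real^6. x $ i) \<in> borel_measurable leb" for i
    by (intro borel_measurable_lebesgueI borel_measurable_continuous_onI continuous_intros)
  have fm [measurable]: "f \<in> borel_measurable leb" unfolding f_def by measurable
  have fg: "\<bar>f x\<bar> \<le> norm (g x)" for x
  proof (cases "x = 0")
    case False
    have "\<bar>\<Sum>i\<in>UNIV. x $ i * gr x i\<bar> = \<bar>x \<bullet> (\<chi> i. gr x i)\<bar>" by (simp add: inner_vec_def)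
    also have "\<dots> \<le> norm x * norm (\<chi> i. gr x i)" by (rule Cauchy_Schwarz_ineq2)
    also have "norm (\<chi> i. gr x i) \<le> norm (g x)"
      unfolding norm_vec_def by (intro L2_set_mono) (auto simp: gr_def abs_Re_le_cmod)
    finally have "\<bar>\<Sum>i\<in>UNIV. x $ i * gr x i\<bar> \<le> norm x * norm (g x)" by (simp add: mult_left_mono)
    then show ?thesis using False by (simp add: f_def divide_le_eq mult.commute)
  qed (simp add: f_def)
  have f: "sq_int f" unfolding sq_int_def
  proof (intro conjI fm)
    show "integrable leb (\<lambda>x. (f x)\<^sup>2)"
    proof (rule Bochner_Integration.integrable_bound)
      show "integrable leb (\<lambda>x. norm (g x) ^ 2)" using L2 by (simp add: in_Lp_def)
      show "AE x in leb. norm ((f x)\<^sup>2) \<le> norm (norm (g x) ^ 2)"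
        using power_mono[OF fg abs_ge_zero, of _ 2] by (intro AE_I2) simp
    qed measurable
  qed
  let ?H = "radial_prim f"
  note Hm [measurable] = borel_measurable_radial_prim[OF f]
  \<comment> \<open>The difference of two functions with the same radial derivative: it is shown to
    be a constant, and the L3 condition on h then makes this constant zero.\<close>
  define D where "D = (\<lambda>x. Re (h x) - ?H (norm x))"
  have Dm: "D \<in> borel_measurable leb" unfolding D_def by measurable
  obtain \<gamma> where \<gamma>: "AE x in leb. h x = \<gamma> (norm x)" using rad by (auto simp: radial_ae_def)
  have "\<exists>A. AE x in leb. D x = A"
  proof (rule radial_constant[OF Dm])
    show "AE x in leb. D x = (\<lambda>r. Re (\<gamma> r) - ?H r) (norm x)" using \<gamma> by eventually_elim (simp add: D_def)
  next
    fix a b :: real assume a: "0 < a"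
    have kb: "kernel (\<lambda>x. indicator {a<..b} (norm x))" unfolding kernel_def
    proof (intro conjI exI[of _ "1 + \<bar>b\<bar>^5"] allI)
      show "(\<lambda>x::real^6. indicator {a<..b} (norm x) :: real) \<in> borel_measurable leb" by measurable
      fix x :: "real^6"
      show "\<bar>indicator {a<..b} (norm x) :: real\<bar> \<le> 1 + \<bar>b\<bar>^5" by (auto simp: indicator_def)
      show "\<bar>indicator {a<..b} (norm x) :: real\<bar> * norm x ^ 5 \<le> 1 + \<bar>b\<bar>^5"
      proof (cases "norm x \<in> {a<..b}")
        case True
        then have "norm x ^ 5 \<le> \<bar>b\<bar>^5" by (intro power_mono) auto
        then have "norm x ^ 5 \<le> 1 + \<bar>b\<bar>^5" by linarith
        then show ?thesis using True by simp
      qed simp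
    qed
    have "integrable leb (\<lambda>x. indicator (cball 0 b) x *\<^sub>R h x)"
      using lh compact_cball unfolding locally_integrable_def set_integrable_def by blast
    then have ic: "integrable leb (\<lambda>x. Re (indicator (cball 0 b) x *\<^sub>R h x))" by (rule integrable_Re)
    have ih: "integrable leb (\<lambda>x. indicator {a<..b} (norm x) * Re (h x))"
      by (rule Bochner_Integration.integrable_bound[OF ic]) (measurable, auto simp: indicator_def)
    show "integrable leb (\<lambda>x. indicator {a<..b} (norm x) * D x)"
      using Bochner_Integration.integrable_diff[OF ih kernel_integrable[OF kb f]] by (simp add: D_def right_diff_distrib)
  next
    fix \<eta> \<eta>' q0 assume e: "cinf \<eta>" and e': "\<And>s. (\<eta> has_real_derivative \<eta>' s) (at s)" and z0: "\<And>s. s \<ge> q0 \<Longrightarrow> \<eta> s = 0"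
    \<comment> \<open>The extra 1 leaves a neighbourhood of [q, \<infinity>) on which \<eta>
      vanishes, so that \<eta>' vanishes from q on too.\<close>
    define q where "q = max 1 q0 + 1"
    have z: "\<eta> s = 0" if "s \<ge> q" for s using z0 that by (simp add: q_def)
    have z': "\<eta>' s = 0" if "s \<ge> q" for s
    proof -
      have "(\<eta> has_real_derivative 0) (at s)"
        by (rule has_field_derivative_transform_within_open[OF DERIV_const[of 0], where S = "{max 1 q0<..}"]) (use z0 that in \<open>auto simp: q_def\<close>)
      then show ?thesis using DERIV_unique e' by blast
    qed
    have q: "q > 1" by (simp add: q_def)
    obtain \<eta>'' where e'': "\<And>s. (\<eta> has_real_derivative \<eta>'' s) (at s)" "cinf \<eta>''" using cinf_derivative[OF e] by blast
    have "\<eta>'' = \<eta>'" by (rule ext) (rule DERIV_unique[OF e''(1) e'])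
    then have ce': "cinf \<eta>'" using e''(2) by simp
    have c: "continuous_on UNIV \<eta>" "continuous_on UNIV \<eta>'" using cinf_continuous e ce' by blast+
    have big: "(norm x)\<^sup>2 \<ge> q" if "norm x > q" for x :: "real^6"
      using that q mult_mono[of 1 "norm x" q "norm x"] by (simp add: power2_eq_square)
    have bigr: "r\<^sup>2 \<ge> q" if "r \<ge> q" for r :: real
      using that q mult_mono[of 1 r q r] by (simp add: power2_eq_square)
    let ?\<psi>r = "\<lambda>r. 6 * \<eta> (r\<^sup>2) + 2 * r\<^sup>2 * \<eta>' (r\<^sup>2)" and ?\<Phi> = "\<lambda>r. r * \<eta> (r\<^sup>2)"
    have cr: "continuous_on UNIV (\<lambda>r::real. \<eta> (r\<^sup>2))" "continuous_on UNIV (\<lambda>r::real. \<eta>' (r\<^sup>2))"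
      by (rule continuous_on_compose2[OF c(1)], auto intro!: continuous_intros) (rule continuous_on_compose2[OF c(2)], auto intro!: continuous_intros)
    have cx: "continuous_on UNIV (\<lambda>x::real^6. \<eta> ((norm x)\<^sup>2))" "continuous_on UNIV (\<lambda>x::real^6. \<eta>' ((norm x)\<^sup>2))"
      by (rule continuous_on_compose2[OF c(1)], auto intro!: continuous_intros) (rule continuous_on_compose2[OF c(2)], auto intro!: continuous_intros)
    have c\<psi>: "continuous_on UNIV ?\<psi>r" by (intro continuous_on_add continuous_on_mult continuous_on_const continuous_on_power continuous_on_id cr)
    have c\<Phi>: "continuous_on UNIV ?\<Phi>" by (intro continuous_on_mult continuous_on_id cr)
    obtain C1 where C1: "C1 \<ge> 0" "\<And>r. r \<ge> 0 \<Longrightarrow> \<bar>?\<psi>r r\<bar> \<le> C1" "\<And>r. r \<ge> 0 \<Longrightarrow> \<bar>?\<psi>r r\<bar> * r ^ 5 \<le> C1"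
    proof -
      have v: "?\<psi>r r = 0" if "r \<ge> q" for r using z[OF bigr[OF that]] z'[OF bigr[OF that]] by simp
      have "\<exists>C\<ge>0. \<forall>r\<ge>0. \<bar>?\<psi>r r\<bar> \<le> C \<and> \<bar>?\<psi>r r\<bar> * r ^ 5 \<le> C"
        by (rule compact_profile_bound[OF c\<psi> v]) (use q in auto)
      then show thesis using that by blast
    qed
    obtain C2 where C2: "C2 \<ge> 0" "\<And>r. r \<ge> 0 \<Longrightarrow> \<bar>?\<Phi> r\<bar> \<le> C2" "\<And>r. r \<ge> 0 \<Longrightarrow> \<bar>?\<Phi> r\<bar> * r ^ 5 \<le> C2"
    proof -
      have v: "?\<Phi> r = 0" if "r \<ge> q" for r using z[OF bigr[OF that]] by simp
      have "\<exists>C\<ge>0. \<forall>r\<ge>0. \<bar>?\<Phi> r\<bar> \<le> C \<and> \<bar>?\<Phi> r\<bar> * r ^ 5 \<le> C"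
        by (rule compact_profile_bound[OF c\<Phi> v]) (use q in auto)
      then show thesis using that by blast
    qed
    have k\<psi>: "kernel (\<lambda>x. ?\<psi>r (norm x))" unfolding kernel_def
      using C1 by (intro conjI borel_measurable_lebesgueI borel_measurable_continuous_onI exI[of _ C1] allI continuous_on_compose2[OF c\<psi>] continuous_on_norm continuous_on_id) auto
    have s\<Phi>: "sq_int (\<lambda>x. ?\<Phi> (norm x))"
    proof (rule sq_int_profile[where C = C2])
      show "?\<Phi> \<in> borel_measurable borel" by (intro borel_measurable_continuous_onI c\<Phi>)
      show "\<bar>?\<Phi> r\<bar> \<le> C2" if "0 < r" "r \<le> 1" for r using C2(2)[of r] that by simp
      show "\<bar>?\<Phi> r\<bar> \<le> C2 / r^4" if "1 < r" for r
      proof -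
        have "\<bar>?\<Phi> r\<bar> * r^4 \<le> \<bar>?\<Phi> r\<bar> * r^5" using that by (intro mult_left_mono power_increasing) auto
        also have "\<dots> \<le> C2" using C2(3)[of r] that by simp
        finally show ?thesis using that by (simp add: pos_le_divide_eq)
      qed
    qed
    have byparts: "(LINT x|leb. f x * ?\<Phi> (norm x)) = - (LINT x|leb. ?H (norm x) * ?\<psi>r (norm x))"
    proof (rule radial_by_parts[OF f, where C = "2 * C2"])
      fix r :: real assume r: "r > 0"
      have "((\<lambda>r. \<eta> (r\<^sup>2)) has_real_derivative \<eta>' (r\<^sup>2) * (2 * r)) (at r)"
        by (rule DERIV_chain2[OF e']) (auto intro!: derivative_eq_intros)
      then show "((\<lambda>r. r ^ 5 * ?\<Phi> r) has_real_derivative r ^ 5 * ?\<psi>r r) (at r)"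
        by (auto intro!: derivative_eq_intros simp: algebra_simps eval_nat_numeral)
      show "\<bar>?\<Phi> r\<bar> \<le> 2 * C2" using C2(1) C2(2)[of r] r by simp
      have "r^3 \<le> 1 + r^5"
      proof (cases "r \<le> 1")
        case True then show ?thesis using r power_le_one[of r 3] by (simp add: add_increasing2)
      next
        case False
        then have "r^3 \<le> r^5" by (intro power_increasing) auto
        then show ?thesis by linarith
      qed
      then have "\<bar>?\<Phi> r\<bar> * r^3 \<le> \<bar>?\<Phi> r\<bar> * (1 + r^5)" by (rule mult_left_mono) simp
      also have "\<dots> \<le> C2 + C2" using C2(2,3)[of r] r by (simp add: distrib_left)
      finally show "\<bar>r ^ 3 * ?\<Phi> r\<bar> \<le> 2 * C2" using r by (simp add: abs_mult mult_ac)
    next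
      show "continuous_on {0<..} ?\<psi>r" by (rule continuous_on_subset[OF c\<psi>]) simp
      show "integrable leb (\<lambda>x. f x * ?\<Phi> (norm x))" by (rule sq_int_mult[OF f s\<Phi>])
      show "integrable leb (\<lambda>x. ?H (norm x) * ?\<psi>r (norm x))" using kernel_integrable[OF k\<psi> f] by (simp add: mult.commute)
    qed
    let ?t = "\<lambda>i (x::real^6). x $ i * \<eta> ((norm x)\<^sup>2)" and ?dt = "\<lambda>i (x::real^6). \<eta> ((norm x)\<^sup>2) + 2 * (x $ i * x $ i) * \<eta>' ((norm x)\<^sup>2)"
    have cc: "continuous_on UNIV (\<lambda>x::real^6. x $ i)" for i by (intro continuous_intros)
    have ct: "continuous_on UNIV (?t i)" for i by (intro continuous_on_mult cc cx)
    have cdt: "continuous_on UNIV (?dt i)" for i by (intro continuous_on_add continuous_on_mult continuous_on_const cc cx)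
    have i1: "integrable leb (\<lambda>x. ?dt i x *\<^sub>R h x)" for i
      by (rule locally_integrable_mult[OF lh cdt, of q]) (use big z z' in auto)
    have i2: "integrable leb (\<lambda>x. ?t i x *\<^sub>R g x)" for i
      by (rule locally_integrable_mult[OF lg ct, of q]) (use big z in auto)
    have i2': "integrable leb (\<lambda>x. ?t i x *\<^sub>R (g x $ i))" for i
      using integrable_bounded_linear[OF bounded_linear_vec_nth i2[of i], of i] by simp
    have weak: "(LINT x|leb. ?dt i x * Re (h x)) = - (LINT x|leb. ?t i x * gr x i)" for i
    proof -
      have pd: "partial_deriv i (?t i) x = ?dt i x" for x by (rule test_vector_field(2)[OF e e' z])
      have w0: "(LINT x|leb. h x * of_real (partial_deriv i (?t i) x)) = - (LINT x|leb. g x $ i * of_real (?t i x))"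
        using wg test_vector_field(1)[OF e e' z] unfolding has_weak_gradient_def by blast
      have w1: "(LINT x|leb. ?dt i x *\<^sub>R h x) = (LINT x|leb. h x * of_real (?dt i x))"
        "(LINT x|leb. ?t i x *\<^sub>R (g x $ i)) = (LINT x|leb. g x $ i * of_real (?t i x))"
        unfolding scaleR_conv_of_real by (rule Bochner_Integration.integral_cong[OF refl], rule mult.commute)+
      have "(LINT x|leb. ?dt i x *\<^sub>R h x) = - (LINT x|leb. ?t i x *\<^sub>R (g x $ i))"
        unfolding w1 using w0 unfolding pd .
      then have "Re (LINT x|leb. ?dt i x *\<^sub>R h x) = - Re (LINT x|leb. ?t i x *\<^sub>R (g x $ i))" by simp
      then show ?thesis
        unfolding integral_Re[OF i1, symmetric] integral_Re[OF i2', symmetric] by (simp add: gr_def)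
    qed
    have r1: "integrable leb (\<lambda>x. ?dt i x * Re (h x))" for i using integrable_Re[OF i1[of i]] by simp
    have r2: "integrable leb (\<lambda>x. ?t i x * gr x i)" for i using integrable_Re[OF i2'[of i]] by (simp add: gr_def)
    have sum1: "(\<Sum>i\<in>UNIV. ?dt i x * Re (h x)) = ?\<psi>r (norm x) * Re (h x)" for x :: "real^6"
    proof -
      have "(\<Sum>i\<in>UNIV. ?dt i x) = 6 * \<eta> ((norm x)\<^sup>2) + (2 * \<eta>' ((norm x)\<^sup>2)) * (\<Sum>i\<in>UNIV. x $ i * x $ i)"
        by (simp add: sum.distrib sum_distrib_left mult_ac)
      then have S: "(\<Sum>i\<in>UNIV. ?dt i x) = ?\<psi>r (norm x)" unfolding sum_square_components by (simp add: mult_ac)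
      show ?thesis unfolding sum_distrib_right[symmetric] S ..
    qed
    \<comment> \<open>The test field is radial, so only the radial component f of the gradient
      survives the sum over i.\<close>
    have sum2: "(\<Sum>i\<in>UNIV. ?t i x * gr x i) = f x * ?\<Phi> (norm x)" for x
      by (cases "x = 0") (simp_all add: f_def sum_distrib_left sum_distrib_right sum_divide_distrib mult_ac)
    have "(LINT x|leb. ?\<psi>r (norm x) * Re (h x)) = (\<Sum>i\<in>UNIV. LINT x|leb. ?dt i x * Re (h x))"
      unfolding sum1[symmetric] by (rule Bochner_Integration.integral_sum) (rule r1)
    also have "\<dots> = - (\<Sum>i\<in>UNIV. LINT x|leb. ?t i x * gr x i)" unfolding weak by (simp add: sum_negf)
    also have "(\<Sum>i\<in>UNIV. LINT x|leb. ?t i x * gr x i) = (LINT x|leb. f x * ?\<Phi> (norm x))"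
      unfolding sum2[symmetric] by (rule Bochner_Integration.integral_sum[symmetric]) (rule r2)
    finally have W1: "(LINT x|leb. ?\<psi>r (norm x) * Re (h x)) = (LINT x|leb. ?H (norm x) * ?\<psi>r (norm x))"
      unfolding byparts by simp
    have j1: "integrable leb (\<lambda>x. ?\<psi>r (norm x) * Re (h x))"
      unfolding sum1[symmetric] by (rule Bochner_Integration.integrable_sum) (rule r1)
    have j2: "integrable leb (\<lambda>x. ?H (norm x) * ?\<psi>r (norm x))" using kernel_integrable[OF k\<psi> f] by (simp add: mult.commute)
    have "(LINT x|leb. D x * ?\<psi>r (norm x)) = (LINT x|leb. ?\<psi>r (norm x) * Re (h x) - ?H (norm x) * ?\<psi>r (norm x))"
      by (intro Bochner_Integration.integral_cong refl) (simp only: D_def left_diff_distrib mult.commute)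
    also have "\<dots> = 0" unfolding Bochner_Integration.integral_diff[OF j1 j2] W1 by simp
    finally show "(LINT x|leb. D x * (6 * \<eta> ((norm x)\<^sup>2) + 2 * (norm x)\<^sup>2 * \<eta>' ((norm x)\<^sup>2))) = 0" .
  qed
  then obtain A where A: "AE x in leb. D x = A" by blast
  have "A = 0"
  proof (rule ccontr)
    assume A0: "A \<noteq> 0"
    define K where "K = sqrt ((LINT x|lebesgue. (f x)\<^sup>2) / (4 * sphere_area))"
    have K: "K \<ge> 0" by (simp add: K_def)
    \<comment> \<open>For |x| > R \<ge> 1 the primitive is at most K/|x|^2 \<le> K/R \<le> |A|/2, so
      |h| \<ge> |A|/2 on a set of infinite measure, against the L3 condition.\<close>
    define R where "R = 1 + 2 * K / \<bar>A\<bar>"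
    have R: "R \<ge> 1" using K by (simp add: R_def)
    let ?S = "{x::real^6. norm x > R}"
    have Sm: "?S \<in> sets leb"
      using measurable_sets[OF measurable_norm_lebesgue[where 'a="real^6"], of "{R<..}"] by (simp add: vimage_def)
    have lower: "AE x in leb. (\<bar>A\<bar> / 2)^3 * indicator ?S x \<le> norm (h x) ^ 3"
      using A
    proof eventually_elim
      case (elim x)
      show ?case
      proof (cases "norm x > R")
        case True
        have r: "norm x > 0" "norm x \<ge> 1" using True R by linarith+
        have "\<bar>(norm x)\<^sup>2 * ?H (norm x)\<bar> \<le> K" unfolding K_def by (rule radial_prim_abs_bound[OF f r(1)])
        then have "norm x * (norm x * \<bar>?H (norm x)\<bar>) \<le> K" by (simp add: abs_mult power2_eq_square)
        moreover have "1 * (norm x * \<bar>?H (norm x)\<bar>) \<le> norm x * (norm x * \<bar>?H (norm x)\<bar>)" using r by (intro mult_right_mono) auto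
        ultimately have "norm x * \<bar>?H (norm x)\<bar> \<le> K" by linarith
        moreover have "(2 * K / \<bar>A\<bar>) * \<bar>?H (norm x)\<bar> \<le> norm x * \<bar>?H (norm x)\<bar>" using True by (intro mult_right_mono) (auto simp: R_def)
        moreover have "R * \<bar>?H (norm x)\<bar> \<le> norm x * \<bar>?H (norm x)\<bar>" using True by (intro mult_right_mono) auto
        ultimately have RK: "R * \<bar>?H (norm x)\<bar> \<le> K" by linarith
        have "\<bar>A\<bar> * (R * \<bar>?H (norm x)\<bar>) \<le> \<bar>A\<bar> * K" using RK by (intro mult_left_mono) auto
        moreover have "\<bar>A\<bar> * R = \<bar>A\<bar> + 2 * K" using A0 by (simp add: R_def distrib_left)
        ultimately have "(\<bar>A\<bar> + 2 * K) * \<bar>?H (norm x)\<bar> \<le> \<bar>A\<bar> * K" by (simp only: mult.assoc[symmetric])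
        moreover have "\<bar>A\<bar> * K \<le> (\<bar>A\<bar> + 2 * K) * (\<bar>A\<bar> / 2)" using K by (simp add: algebra_simps)
        ultimately have "(\<bar>A\<bar> + 2 * K) * \<bar>?H (norm x)\<bar> \<le> (\<bar>A\<bar> + 2 * K) * (\<bar>A\<bar> / 2)" by linarith
        moreover have "0 < \<bar>A\<bar> + 2 * K" using A0 K by simp
        ultimately have "\<bar>?H (norm x)\<bar> \<le> \<bar>A\<bar> / 2" by (simp only: mult_le_cancel_left_pos)
        moreover have "Re (h x) = A + ?H (norm x)" using elim by (simp add: D_def)
        ultimately have "\<bar>A\<bar> / 2 \<le> \<bar>Re (h x)\<bar>" by linarith
        also have "\<dots> \<le> norm (h x)" by (rule abs_Re_le_cmod)
        finally have "(\<bar>A\<bar> / 2)^3 \<le> norm (h x) ^ 3" by (intro power_mono) auto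
        then show ?thesis by (simp add: indicator_def)
      qed simp
    qed
    have "integrable leb (\<lambda>x. (\<bar>A\<bar> / 2)^3 * indicator ?S x)"
    proof (rule Bochner_Integration.integrable_bound)
      show "integrable leb (\<lambda>x. norm (h x) ^ 3)" using L3 by (simp add: in_Lp_def)
      show "(\<lambda>x. (\<bar>A\<bar> / 2)^3 * indicator ?S x) \<in> borel_measurable leb" using Sm by measurable
      show "AE x in leb. norm ((\<bar>A\<bar> / 2)^3 * indicator ?S x) \<le> norm (norm (h x) ^ 3)"
        using lower by eventually_elim (simp add: abs_mult)
    qed
    then have "integrable leb (indicator ?S :: real^6 \<Rightarrow> real)" using A0 by simp
    then have fin: "emeasure leb ?S < \<infinity>" using Sm by (simp add: integrable_indicator_iff)
    have "emeasure leb (UNIV :: (real^6) set) \<le> emeasure leb (cball (0::real^6) R \<union> ?S)" by (intro emeasure_mono) auto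
    also have "\<dots> \<le> emeasure leb (cball (0::real^6) R) + emeasure leb ?S" by (rule emeasure_subadditive) (use Sm in auto)
    also have "\<dots> < \<infinity>" using fin emeasure_bounded_finite[of "cball (0::real^6) R"] by simp
    finally show False by (simp add: emeasure_lborel_UNIV)
  qed
  with A have Dz: "AE x in leb. D x = 0" by simp
  have "AE x in leb. h x \<in> \<real>" using re by (simp add: real_valued_ae_def)
  with Dz have "AE x in leb. h x = complex_of_real (?H (norm x))"
    by eventually_elim (auto simp: D_def Reals_def)
  then show thesis using that[OF f] fg L2 unfolding g_def by blast
qed

section \<open>From radial derivatives back to energy functions\<close>

lemma pairing_eq_lin:
  assumes h: "AE x in leb. h x = complex_of_real (radial_prim f (norm x))" "h \<in> borel_measurable leb"
    and f: "sq_int f" and k: "k \<in> borel_measurable leb"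
  shows "pairing (\<lambda>x. of_real (k x)) h = lin k f"
proof -
  note [measurable] = h(2) k borel_measurable_radial_prim[OF f]
  have "(LINT x|leb. complex_of_real (k x) * h x) = (LINT x|leb. complex_of_real (k x * radial_prim f (norm x)))"
  proof (rule integral_cong_AE)
    show "AE x in leb. complex_of_real (k x) * h x = complex_of_real (k x * radial_prim f (norm x))"
      using h(1) by eventually_elim simp
  qed measurable
  then show ?thesis unfolding pairing_def lin_def complex_cnj_complex_of_real integral_complex_of_real by simp
qed

lemma potential_energy_eq:
  assumes h: "AE x in leb. h x = complex_of_real (radial_prim f (norm x))" "h \<in> borel_measurable leb"
    and f: "sq_int f" and V: "\<And>x. V x = - \<kappa> * W x"
  shows "potential_energy V h = - (\<kappa> * wform f f)"
proof -
  note [measurable] = h(2) borel_measurable_radial_prim[OF f]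
  have "(LINT x|leb. W x * (norm (h x))\<^sup>2) = (LINT x|leb. W x * (radial_prim f (norm x) * radial_prim f (norm x)))"
  proof (rule integral_cong_AE)
    show "AE x in leb. W x * (norm (h x))\<^sup>2 = W x * (radial_prim f (norm x) * radial_prim f (norm x))"
      using h(1) by eventually_elim (simp add: power2_eq_square)
  qed measurable
  then show ?thesis unfolding potential_energy_def V wform_def mult.assoc by simp
qed

text \<open>An inequality is enough because the gradient terms to be bounded below carry nonnegative
  coefficients. The region B may be larger than the preimage of A: the closed regions of the final
  statement overlap on a sphere, while the pieces of f do not.\<close>

lemma dirichlet_le_grad_energy:
  assumes f: "sq_int f" and fg: "\<And>x. \<bar>f x\<bar> \<le> norm (weak_gradient h x)" and g: "in_Lp 2 (weak_gradient h)"
    and A: "A \<in> sets borel" and B: "B \<in> sets borel" "\<And>x. norm x \<in> A \<Longrightarrow> x \<in> B"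
  shows "dirichlet (\<lambda>x. indicator A (norm x) * f x) (\<lambda>x. indicator A (norm x) * f x) \<le> grad_energy B h"
  unfolding dirichlet_def grad_energy_def set_lebesgue_integral_def
proof (rule integral_mono)
  show "integrable leb (\<lambda>x. indicator A (norm x) * f x * (indicator A (norm x) * f x))"
    using sq_int_restrict[OF f A] by (simp add: sq_int_def power2_eq_square)
  show "integrable leb (\<lambda>x. indicator B x *\<^sub>R (norm (weak_gradient h x))\<^sup>2)"
    using g B by (intro integrable_mult_indicator) (auto simp: in_Lp_def)
  fix x
  show "indicator A (norm x) * f x * (indicator A (norm x) * f x) \<le> indicator B x *\<^sub>R (norm (weak_gradient h x))\<^sup>2"
  proof (cases "norm x \<in> A")
    case True
    have "\<bar>f x\<bar>\<^sup>2 \<le> (norm (weak_gradient h x))\<^sup>2" by (rule power_mono[OF fg]) simp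
    then show ?thesis using True B(2)[OF True] by (simp add: power2_eq_square)
  qed simp
qed

lemma closed_norm_regions:
  "{x::real^6. norm x \<le> r} \<in> sets borel" "{x::real^6. norm x \<ge> r} \<in> sets borel"
  by (auto intro!: borel_closed closed_Collect_le continuous_intros)

text \<open>In the first inequality c \<delta> times the gradient energy is moved to the left before
  f is replaced by the full gradient, so that the comparison is made with the nonnegative factor 1 -
  c \<delta>.\<close>

lemma energy_coercivity:
  assumes k1: "cut_kernels k1 B" and k2: "cut_kernels k2 B" and \<kappa>: "1 \<le> \<kappa>" "\<kappa> \<le> 2" and c0: "c0 > 0" "C0 > 0"
    and coer: "eventually (\<lambda>R. \<forall>f. sq_int f \<longrightarrow> dirichlet f f - \<kappa> * wform f f \<ge>
      c0 / ln R * dirichlet f f - C0 * ((lin (k1 R) f)\<^sup>2 + (lin (k2 R) f)\<^sup>2)) at_top"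
    and c: "0 < c" "6 * c \<le> c0" and C: "2 * C0 \<le> C" and V: "\<And>x. V x = - \<kappa> * W x"
  defines "S \<equiv> \<lambda>R h. (pairing (\<lambda>x. of_real (k1 R x)) h)\<^sup>2 + (pairing (\<lambda>x. of_real (k2 R x)) h)\<^sup>2"
    and "\<delta> \<equiv> \<lambda>R. ln R powr (- (4/3))"
  shows "eventually (\<lambda>R. \<forall>h. h \<in> energy_space \<and> real_valued_ae h \<longrightarrow>
      schroedinger_form V h \<ge> c * \<delta> R * grad_energy UNIV h - C * S R h \<and>
      (\<forall>r1. r1 \<ge> inverse c * R * ln R powr (4/3) \<longrightarrow>
        (1 - 2 * c * \<delta> R) * grad_energy {x. norm x \<le> r1} h + c * \<delta> R * grad_energy {x. norm x \<ge> r1} h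
        + potential_energy V h \<ge> - C * S R h) \<and>
      (\<forall>r2. 0 < r2 \<and> r2 \<le> c * \<delta> R \<longrightarrow>
        (1 - 2 * c * \<delta> R) * grad_energy {x. norm x \<ge> r2} h + c * \<delta> R * grad_energy {x. norm x \<le> r2} h
        + potential_energy V h \<ge> - C * S R h)) at_top"
  using cut_coercivity[OF k1 k2 \<kappa> c0 coer c C] eventually_ge_at_top[of 2]
proof eventually_elim
  case (elim R)
  define d where "d = \<delta> R"
  note dR = d_def[unfolded \<delta>_def, symmetric]
  note E = elim(1)[unfolded dR]
  have d: "0 \<le> 1 - c * d" "0 \<le> 1 - 2 * c * d" "0 \<le> c * d"
    using E c by (auto simp: mult.assoc)
  have mono: "X \<le> a * G1 + b * G2 + - w"
    if "X \<le> a * E1 + b * E2 - w" "E1 \<le> G1" "E2 \<le> G2" "0 \<le> a" "0 \<le> b" for X a b E1 E2 G1 G2 w :: real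
    using mult_left_mono[OF that(2,4)] mult_left_mono[OF that(3,5)] that(1) by linarith
  show ?case
  proof (intro allI impI)
    fix h assume h: "h \<in> energy_space \<and> real_valued_ae h"
    then obtain f where f: "sq_int f" and hf: "AE x in leb. h x = complex_of_real (radial_prim f (norm x))"
      and fg: "\<And>x. \<bar>f x\<bar> \<le> norm (weak_gradient h x)" "in_Lp 2 (weak_gradient h)"
      using energy_space_profile by blast
    have hm: "h \<in> borel_measurable leb" using h by (simp add: energy_space_def Hdot1_def in_Lp_def)
    have km: "k1 R \<in> borel_measurable leb" "k2 R \<in> borel_measurable leb"
      using k1 k2 elim(2) by (auto simp: cut_kernels_def kernel_def)
    have S: "(lin (k1 R) f)\<^sup>2 + (lin (k2 R) f)\<^sup>2 = S R h"
      unfolding S_def pairing_eq_lin[OF hf hm f km(1)] pairing_eq_lin[OF hf hm f km(2)] ..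
    have pot: "potential_energy V h = - (\<kappa> * wform f f)" by (rule potential_energy_eq[OF hf hm f V])
    note le = dirichlet_le_grad_energy[OF f fg]
    show "schroedinger_form V h \<ge> c * \<delta> R * grad_energy UNIV h - C * S R h \<and>
      (\<forall>r1. r1 \<ge> inverse c * R * ln R powr (4/3) \<longrightarrow>
        (1 - 2 * c * \<delta> R) * grad_energy {x. norm x \<le> r1} h + c * \<delta> R * grad_energy {x. norm x \<ge> r1} h
        + potential_energy V h \<ge> - C * S R h) \<and>
      (\<forall>r2. 0 < r2 \<and> r2 \<le> c * \<delta> R \<longrightarrow>
        (1 - 2 * c * \<delta> R) * grad_energy {x. norm x \<ge> r2} h + c * \<delta> R * grad_energy {x. norm x \<le> r2} h
        + potential_energy V h \<ge> - C * S R h)"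
      unfolding d_def[symmetric] pot schroedinger_form_def
    proof (intro conjI allI impI)
      have "dirichlet f f \<le> grad_energy UNIV h" using le[of UNIV UNIV] by simp
      then have "(1 - c * d) * dirichlet f f \<le> (1 - c * d) * grad_energy UNIV h" by (rule mult_left_mono) (rule d)
      moreover have "(1 - c * d) * dirichlet f f - \<kappa> * wform f f \<ge> - (C * S R h)" unfolding S[symmetric] using E f by blast
      ultimately show "c * d * grad_energy UNIV h - C * S R h \<le> grad_energy UNIV h + - (\<kappa> * wform f f)"
        unfolding left_diff_distrib mult_1_left by linarith
    next
      fix r1 assume r1: "inverse c * R * ln R powr (4/3) \<le> r1"
      show "- C * S R h \<le> (1 - 2 * c * d) * grad_energy {x. norm x \<le> r1} h + c * d * grad_energy {x. norm x \<ge> r1} h + - (\<kappa> * wform f f)"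
        unfolding S[symmetric] mult_minus_left
      proof (rule mono[OF _ le[of "{..r1}"] le[of "{r1<..}"] d(2,3)])
        show "- (C * ((lin (k1 R) f)\<^sup>2 + (lin (k2 R) f)\<^sup>2)) \<le>
          (1 - 2 * c * d) * dirichlet (\<lambda>x. indicator {..r1} (norm x) * f x) (\<lambda>x. indicator {..r1} (norm x) * f x)
          + c * d * dirichlet (\<lambda>x. indicator {r1<..} (norm x) * f x) (\<lambda>x. indicator {r1<..} (norm x) * f x)
          - \<kappa> * wform f f"
          using E f r1 by blast
      qed (simp_all add: closed_norm_regions)
    next
      fix r2 assume r2: "0 < r2 \<and> r2 \<le> c * d"
      show "- C * S R h \<le> (1 - 2 * c * d) * grad_energy {x. norm x \<ge> r2} h + c * d * grad_energy {x. norm x \<le> r2} h + - (\<kappa> * wform f f)"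
        unfolding S[symmetric] mult_minus_left
      proof (rule mono[OF _ le[of "{r2..}"] le[of "{..<r2}"] d(2,3)])
        show "- (C * ((lin (k1 R) f)\<^sup>2 + (lin (k2 R) f)\<^sup>2)) \<le>
          (1 - 2 * c * d) * dirichlet (\<lambda>x. indicator {r2..} (norm x) * f x) (\<lambda>x. indicator {r2..} (norm x) * f x)
          + c * d * dirichlet (\<lambda>x. indicator {..<r2} (norm x) * f x) (\<lambda>x. indicator {..<r2} (norm x) * f x)
          - \<kappa> * wform f f"
          using E f r2 by blast
      qed (simp_all add: closed_norm_regions)
    qed
  qed
qed

theorem lemma2p5:
  fixes \<phi> Y1 Y2 :: "real^6 \<Rightarrow> real" and \<nu> :: real
  assumes "smooth \<phi>" and "radial \<phi>"
    and "\<And>x. norm x \<le> 1 \<Longrightarrow> \<phi> x = 1"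
    and "\<And>x. norm x \<ge> 2 \<Longrightarrow> \<phi> x = 0"
    and "schwartz Y1" and "radial Y1"
    and "schwartz Y2" and "radial Y2"
    and "\<nu> > 0"
    and "\<And>x. schroedinger Vplus Y1 x = - \<nu> * Y2 x"
    and "\<And>x. schroedinger Vminus Y2 x = \<nu> * Y1 x"
    and "L2norm Y1 = 1" and "L2norm Y2 = 1"
  shows "\<exists>c>0. \<exists>C>0. \<forall>\<^sub>F R :: real in at_top.
      (\<forall>h. h \<in> energy_space \<and> real_valued_ae h \<longrightarrow>
          schroedinger_form Vplus h \<ge> c * ln R powr (- (4/3)) * grad_energy UNIV h
            - C * ((pairing (\<lambda>x. of_real (rescale R \<phi> x * W x)) h)\<^sup>2 + (pairing (\<lambda>x. of_real (Y2 x)) h)\<^sup>2) \<and>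
          schroedinger_form Vminus h \<ge> c * ln R powr (- (4/3)) * grad_energy UNIV h
            - C * (pairing (\<lambda>x. of_real (rescale R \<phi> x * Lam W x)) h)\<^sup>2)
    \<and> (\<forall>r1. r1 \<ge> inverse c * R * ln R powr (4/3) \<longrightarrow>
        (\<forall>h. h \<in> energy_space \<and> real_valued_ae h \<longrightarrow>
          (1 - 2 * c * ln R powr (- (4/3))) * grad_energy {x. norm x \<le> r1} h
            + c * ln R powr (- (4/3)) * grad_energy {x. norm x \<ge> r1} h + potential_energy Vplus h
            \<ge> - C * ((pairing (\<lambda>x. of_real (rescale R \<phi> x * W x)) h)\<^sup>2 + (pairing (\<lambda>x. of_real (Y2 x)) h)\<^sup>2) \<and>
          (1 - 2 * c * ln R powr (- (4/3))) * grad_energy {x. norm x \<le> r1} h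
            + c * ln R powr (- (4/3)) * grad_energy {x. norm x \<ge> r1} h + potential_energy Vminus h
            \<ge> - C * (pairing (\<lambda>x. of_real (rescale R \<phi> x * Lam W x)) h)\<^sup>2))
    \<and> (\<forall>r2. 0 < r2 \<and> r2 \<le> c * ln R powr (- (4/3)) \<longrightarrow>
        (\<forall>h. h \<in> energy_space \<and> real_valued_ae h \<longrightarrow>
          (1 - 2 * c * ln R powr (- (4/3))) * grad_energy {x. norm x \<ge> r2} h
            + c * ln R powr (- (4/3)) * grad_energy {x. norm x \<le> r2} h + potential_energy Vplus h
            \<ge> - C * ((pairing (\<lambda>x. of_real (rescale R \<phi> x * W x)) h)\<^sup>2 + (pairing (\<lambda>x. of_real (Y2 x)) h)\<^sup>2) \<and>
          (1 - 2 * c * ln R powr (- (4/3))) * grad_energy {x. norm x \<ge> r2} h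
            + c * ln R powr (- (4/3)) * grad_energy {x. norm x \<le> r2} h + potential_energy Vminus h
            \<ge> - C * (pairing (\<lambda>x. of_real (rescale R \<phi> x * Lam W x)) h)\<^sup>2))"
proof -
  interpret eigenpair Y1 Y2 \<nu> by (rule eigenpair.intro) (fact assms)+
  let ?kW = "\<lambda>R x. rescale R \<phi> x * W x" and ?kL = "\<lambda>R x. rescale R \<phi> x * Lam W x"
  obtain B c0 C0 where c0: "c0 > 0" "C0 > 0" and k: "cut_kernels ?kW B" "cut_kernels ?kL B" "cut_kernels (\<lambda>R. Y2) B"
    and e1: "eventually (\<lambda>R. \<forall>f. sq_int f \<longrightarrow> dirichlet f f - 1 * wform f f \<ge>
      c0 / ln R * dirichlet f f - C0 * ((lin (?kL R) f)\<^sup>2 + (lin (\<lambda>x. 0) f)\<^sup>2)) at_top"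
    and e2: "eventually (\<lambda>R. \<forall>f. sq_int f \<longrightarrow> dirichlet f f - 2 * wform f f \<ge>
      c0 / ln R * dirichlet f f - C0 * ((lin (?kW R) f)\<^sup>2 + (lin Y2 f)\<^sup>2)) at_top"
    by (rule coercivity[OF assms(1,3,4)])
  have B0: "B \<ge> 0" using k(1) by (simp add: cut_kernels_def)
  \<comment> \<open>The factor 6 is the one demanded by \<open>cut_arith\<close>, and the factor 2
    in C comes from (x + y)^2 \<le> 2 x^2 + 2 y^2 for the pairings of the two pieces. Both forms
    share these constants.\<close>
  define c where "c = c0 / 6"
  define C where "C = 2 * C0"
  have cC: "c > 0" "C > 0" "6 * c \<le> c0" "2 * C0 \<le> C" using c0 by (auto simp: c_def C_def)
  have V: "Vminus x = - 1 * W x" "Vplus x = - 2 * W x" for x by (simp_all add: Vminus_def Vplus_def)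
  note minus = energy_coercivity[where ?k1.0 = ?kL and ?k2.0 = "\<lambda>R x. 0", OF k(2) cut_kernels_zero[OF B0] order_refl one_le_numeral c0 e1 cC(1,3,4) V(1)]
  note plus = energy_coercivity[where ?k1.0 = ?kW and ?k2.0 = "\<lambda>R. Y2", OF k(1,3) one_le_numeral order_refl c0 e2 cC(1,3,4) V(2)]
  have zero: "pairing (\<lambda>x. of_real 0) h = 0" for h by (simp add: pairing_def)
  note both = eventually_conj[OF plus minus[unfolded zero zero_power2 add_0_right]]
  show ?thesis
  proof (rule exI[of _ c], rule conjI[OF cC(1)], rule exI[of _ C], rule conjI[OF cC(2)],
      rule eventually_mono[OF both], intro conjI allI impI)
  qed blast+
qed

end
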